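(* Let $p\in(1,\infty)$ and $q,m\in(0,\infty)$. Let $u,w,v$ be weights such that the pair $(u,w)$ is admissible with respect to $(m,q)$. Let $$C=\sup_{h\in\mathfrak M_+}\frac{\left(\int_0^{\infty}\left(\int_t^\infty \left(\int_s^{\infty}h(y)\,dy\right)^m u(s)\,ds\right)^{\frac{q}{m}}w(t)\,dt\right)^{\frac{1}{q}}}{\left(\int_0^{\infty}h(t)^pv(t)\,dt\right)^{\frac{1}{p}}}.$$ (a) Let $1<p\le m<\infty$ and $p\le q<\infty$. Then $C\approx A_1$, where $$A_1=\sup_{t\in(0,\infty)}\left(\int_0^t w(s)\left(\int_s^t u(y)\,dy\right)^{\frac qm}ds\right)^{\frac1q}\left(\int_t^{\infty}v(s)^{1-p'}ds\right)^{\frac1{p'}}.$$ (b) Let $1<p\le m<\infty$ and $0<q<p$. Define $r=\frac{pq}{p-q}$. Then $C\approx A_2+A_3$, where $$A_2=\left(\int_0^{\infty}\left(\int_0^t w(s)\,ds\right)^{\frac rp}w(t)\sup_{z\in(t,\infty)}\left(\int_t^z u(y)\,dy\right)^{\frac rm}\left(\int_z^{\infty}v(y)^{1-p'}dy\right)^{\frac r{p'}}dt\right)^{\frac1r}$$ and $$A_3=\left(\int_0^{\infty}\left(\int_0^t w(s)\left(\int_s^t u(y)\,dy\right)^{\frac qm}ds\right)^{\frac rp}w(t)\sup_{z\in(t,\infty)}\left(\int_t^z u(y)\,dy\right)^{\frac qm}\left(\int_z^{\infty}v(y)^{1-p'}dy\right)^{\frac r{p'}}dt\right)^{\frac1r}.$$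 (c) Let $0<m<p<\infty$ and $1<p\le q$. Then $C\approx A_1+A_4\approx A_1+A_4^*$, where $A_1$ is given by the formula in (a), $$A_4=\sup_{t\in(0,\infty)}\left(\int_0^t w(s)\,ds\right)^{\frac1q}\left(\int_t^{\infty}\left(\int_t^s u(y)\,dy\right)^{\frac p{p-m}}\left(\int_s^{\infty}v(\tau)^{1-p'}d\tau\right)^{\frac{p(m-1)}{p-m}}v(s)^{1-p'}ds\right)^{\frac{p-m}{pm}}$$ and $$A_4^*=\sup_{t\in(0,\infty)}\left(\int_0^t w(s)\,ds\right)^{\frac1q}\left(\int_t^{\infty}\left(\int_t^s u(y)\,dy\right)^{\frac m{p-m}}u(s)\left(\int_s^{\infty}v(\tau)^{1-p'}d\tau\right)^{\frac{m(p-1)}{p-m}}ds\right)^{\frac{p-m}{pm}}.$$ If, moreover, $m\ge1$ or $\int_t^{\infty}v(s)^{1-p'}ds<\infty$ for every $t\in(0,\infty)$, then $A_4\approx A_4^*$. (d) Let $0<m<p<\infty$, $1<p$ and $0<q<p<\infty$. Define $r=\frac{pq}{p-q}$. Then $C\approx A_3+A_5\approx A_3+A_5^*$, where $A_3$ is given by the formula in (b), $$A_5=\left(\int_0^{\infty}\left(\int_0^t w(s)\,ds\right)^{\frac rp}w(t)\left(\int_t^{\infty}\left(\int_t^s u(y)\,dy\right)^{\frac p{p-m}}\left(\int_s^{\infty}v(\tau)^{1-p'}d\tau\right)^{\frac{p(m-1)}{p-m}}v(s)^{1-p'}ds\right)^{\frac{q(p-m)}{m(p-q)}}dt\right)^{\frac1r}$$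 and $$A_5^*=\left(\int_0^{\infty}\left(\int_0^t w(s)\,ds\right)^{\frac rp}w(t)\left(\int_t^{\infty}\left(\int_t^s u(y)\,dy\right)^{\frac m{p-m}}u(s)\left(\int_s^{\infty}v(\tau)^{1-p'}d\tau\right)^{\frac{m(p-1)}{p-m}}ds\right)^{\frac{q(p-m)}{m(p-q)}}dt\right)^{\frac1r}.$$ If, moreover, ($m\ge1$ and $q>1$) or $\int_t^{\infty}v(s)^{1-p'}ds<\infty$ for every $t\in(0,\infty)$, then $A_5\approx A_5^*$.
   Context: $\mathfrak M_+$ is the cone of all non-negative measurable functions on $(0,\infty)$. A weight is a measurable non-negative function on $(0,\infty)$. For $p\neq1$, $p'=\frac{p}{p-1}$. The pair of weights $(u,w)$ is admissible with respect to $(m,q)$ if the function $$\varphi(t)=\left(\int_0^{t}\left(\int_s^t u(y)\,dy\right)^{\frac{q}{m}}w(s)\,ds\right)^{\frac1q}$$ satisfies $0<\varphi(t)<\infty$ for every $t\in(0,\infty)$. $A\lesssim B$ means $A\le cB$ with a constant $c\in(0,\infty)$ that may depend only on the exponents $m,p,q$ (not on the weights); $A\approx B$ means $A\lesssim B$ and $B\lesssim A$. All quantities take values in $[0,\infty]$. Conventions: $0\cdot\infty=0$, $\frac00=0$, $a^0=1$ for all $a\in[0,\infty]$ (and, as usual, $0$ to a negative power is $\infty$, $\infty$ to a negative power is $0$). The number $C\in[0,\infty]$ is the optimal (least) constant in the inequality "numerator $\le C\cdot$ denominator" required for all $h\in\mathfrak M_+$. *)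

theory Defs
  imports "HOL-Analysis.Analysis"
begin

text \<open>
  All quantities live in \<^typ>\<open>ennreal\<close>, whose arithmetic already satisfies \<open>0 * \<infinity> = 0\<close>,
  \<open>0 / 0 = 0\<close>, \<open>\<infinity> / \<infinity> = 0\<close> and \<open>a / 0 = \<infinity>\<close> for \<open>a > 0\<close>.  Real powers on \<open>[0,\<infinity>]\<close> are not in the
  library; the following one has \<open>a\<^sup>0 = 1\<close> for all \<open>a\<close>, including \<open>0\<close> and \<open>\<infinity>\<close>.
\<close>

definition epowr :: "ennreal \<Rightarrow> real \<Rightarrow> ennreal" (infixr "epowr" 80) where
  "x epowr a =
     (if a = 0 then 1
      else if x = 0 then (if a > 0 then 0 else \<infinity>)
      else if x = \<infinity> then (if a > 0 then \<infinity> else 0)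
      else ennreal (enn2real x powr a))"

text \<open>
  The cone of non-negative (Lebesgue) measurable functions on \<open>(0,\<infinity>)\<close>, with values in \<open>[0,\<infinity>]\<close>.
  Functions have type \<^typ>\<open>real \<Rightarrow> ennreal\<close>, but their values outside \<open>(0,\<infinity>)\<close> are never used.
\<close>

definition Mplus :: "(real \<Rightarrow> ennreal) set" where
  "Mplus = borel_measurable (lebesgue_on {0<..})"

definition weight :: "(real \<Rightarrow> ennreal) \<Rightarrow> bool" where
  "weight f \<longleftrightarrow> f \<in> Mplus"

definition conj_exp :: "real \<Rightarrow> real" where
  "conj_exp p = p / (p - 1)"

definition integ :: "(real \<Rightarrow> ennreal) \<Rightarrow> real \<Rightarrow> real \<Rightarrow> ennreal" where
  "integ f a b = (\<integral>\<^sup>+x\<in>{a<..<b}. f x \<partial>lebesgue)"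

definition integ_tail :: "(real \<Rightarrow> ennreal) \<Rightarrow> real \<Rightarrow> ennreal" where
  "integ_tail f a = (\<integral>\<^sup>+x\<in>{a<..}. f x \<partial>lebesgue)"

definition admissible :: "real \<Rightarrow> real \<Rightarrow> (real \<Rightarrow> ennreal) \<Rightarrow> (real \<Rightarrow> ennreal) \<Rightarrow> bool" where
  "admissible m q u w \<longleftrightarrow>
     (\<forall>t>0. 0 < (integ (\<lambda>s. (integ u s t) epowr (q / m) * w s) 0 t) epowr (1 / q) \<and>
            (integ (\<lambda>s. (integ u s t) epowr (q / m) * w s) 0 t) epowr (1 / q) < \<infinity>)"

definition lhs_norm ::
  "real \<Rightarrow> real \<Rightarrow> (real \<Rightarrow> ennreal) \<Rightarrow> (real \<Rightarrow> ennreal) \<Rightarrow> (real \<Rightarrow> ennreal) \<Rightarrow> ennreal" where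
  "lhs_norm m q u w h =
     (integ_tail (\<lambda>t. (integ_tail (\<lambda>s. (integ_tail h s) epowr m * u s) t) epowr (q / m) * w t) 0)
       epowr (1 / q)"

definition rhs_norm :: "real \<Rightarrow> (real \<Rightarrow> ennreal) \<Rightarrow> (real \<Rightarrow> ennreal) \<Rightarrow> ennreal" where
  "rhs_norm p v h = (integ_tail (\<lambda>t. (h t) epowr p * v t) 0) epowr (1 / p)"

definition C_opt ::
  "real \<Rightarrow> real \<Rightarrow> real \<Rightarrow> (real \<Rightarrow> ennreal) \<Rightarrow> (real \<Rightarrow> ennreal) \<Rightarrow> (real \<Rightarrow> ennreal) \<Rightarrow> ennreal" where
  "C_opt p q m u w v = (SUP h\<in>Mplus. lhs_norm m q u w h / rhs_norm p v h)"

text \<open>The supremum of quotients is the optimal constant, degenerate denominators included.\<close>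

lemma C_opt_eq_Inf:
  "C_opt p q m u w v = Inf {c. \<forall>h\<in>Mplus. lhs_norm m q u w h \<le> c * rhs_norm p v h}"
proof (rule antisym)
  have quot: "a / b \<le> c" if "a \<le> c * b" for a b c :: ennreal
  proof (cases "b = 0 \<or> b = top")
    case True
    then show ?thesis using that by auto
  next
    case False
    then show ?thesis using that
      by (metis divide_right_mono_ennreal ennreal_mult_divide_eq)
  qed
  show "C_opt p q m u w v \<le> Inf {c. \<forall>h\<in>Mplus. lhs_norm m q u w h \<le> c * rhs_norm p v h}"
    unfolding C_opt_def by (intro Inf_greatest SUP_least) (auto intro: quot)
  have mult: "a \<le> c * b" if "a / b \<le> d" "d < c" for a b c d :: ennreal
  proof -
    have c: "a / b \<le> c" "c \<noteq> 0" using that by auto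
    consider "b = 0" | "b = top" | "b \<noteq> 0" "b \<noteq> top" by blast
    then show ?thesis
    proof cases
      case 1
      have "a = 0"
      proof (rule ccontr)
        assume "a \<noteq> 0"
        then have "a / b = top" using 1 by (simp add: ennreal_divide_zero)
        then show False using that by (simp add: top_unique)
      qed
      then show ?thesis by simp
    next
      case 2
      then show ?thesis using c by (simp add: ennreal_mult_top)
    next
      case 3
      have "a = a / b * b" using 3
        by (simp add: ennreal_divide_times ennreal_mult_divide_eq ennreal_divide_self less_top zero_less_iff_neq_zero)
      also have "\<dots> \<le> c * b" using c by (intro mult_right_mono) auto
      finally show ?thesis .
    qed
  qed
  show "Inf {c. \<forall>h\<in>Mplus. lhs_norm m q u w h \<le> c * rhs_norm p v h} \<le> C_opt p q m u w v"
  proof (rule dense_ge)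
    fix c assume "C_opt p q m u w v < c"
    then have "lhs_norm m q u w h \<le> c * rhs_norm p v h" if "h \<in> Mplus" for h
      using mult[OF SUP_upper[OF that]] unfolding C_opt_def by blast
    then show "Inf {c. \<forall>h\<in>Mplus. lhs_norm m q u w h \<le> c * rhs_norm p v h} \<le> c"
      by (intro Inf_lower) auto
  qed
qed

definition vdual :: "real \<Rightarrow> (real \<Rightarrow> ennreal) \<Rightarrow> real \<Rightarrow> ennreal" where
  "vdual p v s = (v s) epowr (1 - conj_exp p)"

definition A1 ::
  "real \<Rightarrow> real \<Rightarrow> real \<Rightarrow> (real \<Rightarrow> ennreal) \<Rightarrow> (real \<Rightarrow> ennreal) \<Rightarrow> (real \<Rightarrow> ennreal) \<Rightarrow> ennreal" where
  "A1 p q m u w v =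
     (SUP t\<in>{0<..}.
        (integ (\<lambda>s. w s * (integ u s t) epowr (q / m)) 0 t) epowr (1 / q) *
        (integ_tail (vdual p v) t) epowr (1 / conj_exp p))"

definition A2 ::
  "real \<Rightarrow> real \<Rightarrow> real \<Rightarrow> (real \<Rightarrow> ennreal) \<Rightarrow> (real \<Rightarrow> ennreal) \<Rightarrow> (real \<Rightarrow> ennreal) \<Rightarrow> ennreal" where
  "A2 p q m u w v =
     (let r = p * q / (p - q) in
      (integ_tail (\<lambda>t.
         (integ w 0 t) epowr (r / p) * w t *
         (SUP z\<in>{t<..}. (integ u t z) epowr (r / m) *
                        (integ_tail (vdual p v) z) epowr (r / conj_exp p))) 0) epowr (1 / r))"

definition A3 ::
  "real \<Rightarrow> real \<Rightarrow> real \<Rightarrow> (real \<Rightarrow> ennreal) \<Rightarrow> (real \<Rightarrow> ennreal) \<Rightarrow> (real \<Rightarrow> ennreal) \<Rightarrow> ennreal" where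
  "A3 p q m u w v =
     (let r = p * q / (p - q) in
      (integ_tail (\<lambda>t.
         (integ (\<lambda>s. w s * (integ u s t) epowr (q / m)) 0 t) epowr (r / p) * w t *
         (SUP z\<in>{t<..}. (integ u t z) epowr (q / m) *
                        (integ_tail (vdual p v) z) epowr (r / conj_exp p))) 0) epowr (1 / r))"

definition A4 ::
  "real \<Rightarrow> real \<Rightarrow> real \<Rightarrow> (real \<Rightarrow> ennreal) \<Rightarrow> (real \<Rightarrow> ennreal) \<Rightarrow> (real \<Rightarrow> ennreal) \<Rightarrow> ennreal" where
  "A4 p q m u w v =
     (SUP t\<in>{0<..}.
        (integ w 0 t) epowr (1 / q) *
        (integ_tail (\<lambda>s. (integ u t s) epowr (p / (p - m)) *
                         (integ_tail (vdual p v) s) epowr (p * (m - 1) / (p - m)) *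
                         vdual p v s) t) epowr ((p - m) / (p * m)))"

definition A4_star ::
  "real \<Rightarrow> real \<Rightarrow> real \<Rightarrow> (real \<Rightarrow> ennreal) \<Rightarrow> (real \<Rightarrow> ennreal) \<Rightarrow> (real \<Rightarrow> ennreal) \<Rightarrow> ennreal" where
  "A4_star p q m u w v =
     (SUP t\<in>{0<..}.
        (integ w 0 t) epowr (1 / q) *
        (integ_tail (\<lambda>s. (integ u t s) epowr (m / (p - m)) * u s *
                         (integ_tail (vdual p v) s) epowr (m * (p - 1) / (p - m))) t)
          epowr ((p - m) / (p * m)))"

definition A5 ::
  "real \<Rightarrow> real \<Rightarrow> real \<Rightarrow> (real \<Rightarrow> ennreal) \<Rightarrow> (real \<Rightarrow> ennreal) \<Rightarrow> (real \<Rightarrow> ennreal) \<Rightarrow> ennreal" where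
  "A5 p q m u w v =
     (let r = p * q / (p - q) in
      (integ_tail (\<lambda>t.
         (integ w 0 t) epowr (r / p) * w t *
         (integ_tail (\<lambda>s. (integ u t s) epowr (p / (p - m)) *
                          (integ_tail (vdual p v) s) epowr (p * (m - 1) / (p - m)) *
                          vdual p v s) t)
           epowr (q * (p - m) / (m * (p - q)))) 0) epowr (1 / r))"

definition A5_star ::
  "real \<Rightarrow> real \<Rightarrow> real \<Rightarrow> (real \<Rightarrow> ennreal) \<Rightarrow> (real \<Rightarrow> ennreal) \<Rightarrow> (real \<Rightarrow> ennreal) \<Rightarrow> ennreal" where
  "A5_star p q m u w v =
     (let r = p * q / (p - q) in
      (integ_tail (\<lambda>t.
         (integ w 0 t) epowr (r / p) * w t *
         (integ_tail (\<lambda>s. (integ u t s) epowr (m / (p - m)) * u s *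
                          (integ_tail (vdual p v) s) epowr (m * (p - 1) / (p - m))) t)
           epowr (q * (p - m) / (m * (p - q)))) 0) epowr (1 / r))"

definition weight_triples ::
  "real \<Rightarrow> real \<Rightarrow> ((real \<Rightarrow> ennreal) \<times> (real \<Rightarrow> ennreal) \<times> (real \<Rightarrow> ennreal)) set" where
  "weight_triples m q =
     {(u, w, v). weight u \<and> weight w \<and> weight v \<and> admissible m q u w}"

definition tail_finite :: "real \<Rightarrow> (real \<Rightarrow> ennreal) \<Rightarrow> bool" where
  "tail_finite p v \<longleftrightarrow> (\<forall>t>0. integ_tail (vdual p v) t < \<infinity>)"

text \<open>
  \<open>A \<lesssim> B\<close> with one constant for all weights in the class \<open>S\<close>: the constant is chosen after the
  exponents but before the weights.
\<close>

definition lesssim_on :: "'a set \<Rightarrow> ('a \<Rightarrow> ennreal) \<Rightarrow> ('a \<Rightarrow> ennreal) \<Rightarrow> bool" where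
  "lesssim_on S A B \<longleftrightarrow> (\<exists>c::real. 0 < c \<and> (\<forall>x\<in>S. A x \<le> ennreal c * B x))"

definition approx_on :: "'a set \<Rightarrow> ('a \<Rightarrow> ennreal) \<Rightarrow> ('a \<Rightarrow> ennreal) \<Rightarrow> bool" where
  "approx_on S A B \<longleftrightarrow> lesssim_on S A B \<and> lesssim_on S B A"

end

theory Submission
 imports Defs "HOL-Probability.Probability"
begin

text \<open>The weights are merely measurable and may take the values 0 and \<infinity>, so
  integration by parts is not at hand. Its substitute is the level inequality \<mu> {x. \<mu> {..x}
  \<le> t} \<le> t: by it the integral of \<mu> {..x}^e against \<mu> is comparable to (total
  mass)^(e + 1) for every e > -1, a range that covers all exponents that occur, m < 1 and q < 1
  included. Atomlessness serves mainly to let tails take prescribed values, so that nodes and dyadic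
  blocks exist. The outer measures of the Hardy inequalities may have atoms, hence the discrete
  Hardy inequality is the general one for a sum of point masses. Halving the mass of w makes sums
  over earlier cells harmless as long as their weights grow slower than 2^n; factors such as 3/2
  stay below this threshold. The bound of A3 by C is the delicate one: the points z of the supremum
  lie inside cells while the head function is controlled at nodes, so one test function has to serve
  two discrete measures. Absorbing S \<le> D S^\<theta> needs S < \<infinity>; truncations of s near
  0 or near \<infinity> provide it and are removed by monotone limits.\<close>

abbreviation borelfun :: "(real => ennreal) set" where
 "borelfun \<equiv> borel_measurable borel"

abbreviation powint :: "real => real measure => (real => ennreal) => ennreal" where
 "powint p s g \<equiv> \<integral>\<^sup>+y. g y epowr p \<partial>s"

declare [[coercion "emeasure :: 'a measure => 'a set => ennreal"]]

text \<open>
  The weights enter only through the atomless measures \<open>u dx\<close>, \<open>w dx\<close> and \<open>s = v^(1 - p') dx\<close>. Choose points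
  \<open>t n\<close> decreasing in \<open>n\<close> with \<open>w (0, t n) = 2^(-n) w (0, t 0)\<close>. Sums weighted by powers of \<open>w (0, t n)\<close> are
  dominated by their diagonal terms, so the inequality splits into Hardy inequalities for \<open>u\<close> and \<open>s\<close> on the cells
  \<open>(t (n + 1), t n]\<close>, whose norms have the form known from Maz'ya's theorem, and one discrete Hardy inequality for the values
  of the Copson integral at the nodes. Summing the local norms gives \<open>A2\<close> or \<open>A5_star\<close>, the discrete inequality gives \<open>A1\<close>
  or \<open>A3\<close>. The lower bounds come from test functions on the cells, combined by duality when \<open>q < p\<close>. If \<open>s\<close> has an infinite
  tail, then \<open>C\<close>, \<open>A1\<close> and \<open>A3\<close> are all infinite. The two forms of the local norms, hence \<open>A4\<close> and \<open>A4_star\<close>, are compared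
  through the dyadic level sets of \<open>u\<close> and \<open>s\<close>.
\<close>

section \<open>Real powers of extended non-negative reals\<close>

text \<open>All constants are asserted ahead of the measures, as \<exists>c<top. \<forall>... .
  Combined with \<open>goal_cases\<close> this rule opens such a fact while the goal, which has to
  supply a constant of its own, stays in place.\<close>

lemma ex_finiteE: "\<exists>c<top. P c ==> (\<And>c. c < (top::ennreal) ==> P c ==> R) ==> R"
 by blast

lemma epowr_0_right [simp]: "x epowr 0 = 1"
 by (simp add: epowr_def)

lemma epowr_1_right [simp]: "x epowr 1 = x"
 by (cases x) (auto simp: epowr_def)

lemma zero_epowr [simp]: "a > 0 ==> 0 epowr a = 0"
 by (simp add: epowr_def)

lemma top_epowr [simp]: "a > 0 ==> top epowr a = top"
 by (simp add: epowr_def)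

lemma one_epowr [simp]: "1 epowr a = 1"
 by (simp add: epowr_def)

lemma ennreal_epowr_pos: "x > 0 ==> ennreal x epowr a = ennreal (x powr a)"
 by (auto simp: epowr_def)

lemma ennreal_pos_cases [case_names zero real top]:
 assumes "x = 0 ==> P" "\<And>r. r > 0 ==> x = ennreal r ==> P" "x = top ==> P"
 shows P
 using assms by (cases x) (metis ennreal_0 less_eq_real_def)+

lemma epowr_mono: "a \<ge> 0 ==> x \<le> y ==> x epowr a \<le> y epowr a"
 by (cases x rule: ennreal_pos_cases; cases y rule: ennreal_pos_cases; cases "a = 0")
   (auto simp: ennreal_epowr_pos top_unique intro!: powr_mono2 ennreal_leI)

lemma epowr_antimono: "a \<le> 0 ==> x \<le> y ==> y epowr a \<le> x epowr a"
 by (cases x rule: ennreal_pos_cases; cases y rule: ennreal_pos_cases; cases "a = 0")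
   (auto simp: ennreal_epowr_pos top_unique epowr_def intro!: powr_mono2' ennreal_leI)

lemma epowr_mult: "a \<ge> 0 ==> (x * y) epowr a = x epowr a * y epowr a"
 by (cases x rule: ennreal_pos_cases; cases y rule: ennreal_pos_cases; cases "a = 0")
   (auto simp: ennreal_epowr_pos ennreal_mult[symmetric] powr_mult
    ennreal_mult_top ennreal_top_mult)

lemma epowr_add: "a \<ge> 0 ==> b \<ge> 0 ==> x epowr (a + b) = x epowr a * x epowr b"
 by (cases x rule: ennreal_pos_cases; cases "a = 0"; cases "b = 0")
   (auto simp: ennreal_epowr_pos ennreal_mult[symmetric] powr_add)

text \<open>For exponents of opposite sign the law breaks down at the two ends, where the product is
  0 * top = 0 while x^0 = 1.\<close>

lemma epowr_add': "x \<noteq> 0 ==> x \<noteq> top ==> x epowr (a + b) = x epowr a * x epowr b"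
 by (cases x rule: ennreal_pos_cases)
   (auto simp: ennreal_epowr_pos ennreal_mult[symmetric] powr_add)

text \<open>True for all signs: a negative exponent exchanges 0 and top, a second one exchanges them
  back, and exponent 0 gives 1 on both sides.\<close>

lemma epowr_epowr: "(x epowr a) epowr b = x epowr (a * b)"
 by (cases x rule: ennreal_pos_cases; cases "a = 0"; cases "b = 0")
   (auto simp: ennreal_epowr_pos powr_powr epowr_def zero_less_mult_iff mult_less_0_iff
    linorder_neq_iff split: if_splits)

lemma epowr_inverse: "a \<noteq> 0 ==> (x epowr a) epowr (1 / a) = x"
 by (simp add: epowr_epowr)

lemma epowr_inverse': "a \<noteq> 0 ==> (x epowr (1 / a)) epowr a = x"
 by (simp add: epowr_epowr)

lemma epowr_less_top: "a \<ge> 0 ==> x < top ==> x epowr a < top"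
 by (cases x rule: ennreal_pos_cases; cases "a = 0") (auto simp: ennreal_epowr_pos)

lemma epowr_eq_0_iff: "a > 0 ==> x epowr a = 0 \<longleftrightarrow> x = 0"
 by (cases x rule: ennreal_pos_cases) (auto simp: ennreal_epowr_pos)

lemma epowr_eq_top_iff: "a > 0 ==> x epowr a = top \<longleftrightarrow> x = top"
 by (cases x rule: ennreal_pos_cases) (auto simp: ennreal_epowr_pos)

lemma epowr_pos: "0 < x ==> a \<ge> 0 ==> 0 < x epowr a"
 by (cases "a = 0") (auto simp: zero_less_iff_neq_zero epowr_eq_0_iff)

lemma epowr_le_iff: "a > 0 ==> x epowr a \<le> y epowr a \<longleftrightarrow> x \<le> y"
proof
 assume "a > 0" and "x epowr a \<le> y epowr a"
 then have "(x epowr a) epowr (1 / a) \<le> (y epowr a) epowr (1 / a)"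
  by (intro epowr_mono[of "1 / a"]) auto
 then show "x \<le> y" using \<open>a > 0\<close> by (simp add: epowr_inverse)
qed (auto intro: epowr_mono)

lemma epowr_le_swap: "a > 0 ==> x epowr a \<le> y \<longleftrightarrow> x \<le> y epowr (1 / a)"
 using epowr_le_iff[of a x "y epowr (1 / a)"] by (simp add: epowr_inverse')

lemma epowr_SUP:
 assumes "a > 0" "I \<noteq> {}"
 shows "(SUP i\<in>I. f i) epowr a = (SUP i\<in>I. f i epowr a)"
proof (rule antisym)
 have "(SUP i\<in>I. f i) \<le> (SUP i\<in>I. f i epowr a) epowr (1 / a)"
 proof (rule SUP_least)
  fix i assume i: "i \<in> I"
  have "f i = (f i epowr a) epowr (1 / a)" using assms by (simp add: epowr_inverse)
  also have "\<dots> \<le> (SUP i\<in>I. f i epowr a) epowr (1 / a)"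
   using assms i by (intro epowr_mono SUP_upper) auto
  finally show "f i \<le> \<dots>" .
 qed
 then show "(SUP i\<in>I. f i) epowr a \<le> (SUP i\<in>I. f i epowr a)"
  using assms by (simp add: epowr_le_swap)
 show "(SUP i\<in>I. f i epowr a) \<le> (SUP i\<in>I. f i) epowr a"
  using assms by (intro SUP_least epowr_mono SUP_upper) auto
qed

text \<open>From x + y \<le> 2 max x y, which treats exponents below and above 1 alike.\<close>

lemma epowr_add_le:
 assumes "a \<ge> 0"
 shows "(x + y) epowr a \<le> 2 epowr a * (x epowr a + y epowr a)"
proof -
 have "x + y \<le> 2 * max x y"
  by (metis add_mono_thms_linordered_semiring(1) max.cobounded1 max.cobounded2 mult_2)
 then have "(x + y) epowr a \<le> (2 * max x y) epowr a" using assms by (rule epowr_mono[rotated])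
 also have "\<dots> = 2 epowr a * max x y epowr a" using assms by (rule epowr_mult)
 also have "max x y epowr a \<le> x epowr a + y epowr a"
  by (cases "x \<le> y") (auto simp: max_def)
 finally show ?thesis by (simp add: mult_left_mono)
qed

lemma numeral_epowr_less_top [simp]: "(numeral n :: ennreal) epowr a < top"
proof -
 have "(numeral n :: ennreal) = ennreal (numeral n)" by simp
 then show ?thesis by (metis ennreal_epowr_pos ennreal_less_top zero_less_numeral)
qed

lemma borel_measurable_epowr [measurable]:
 assumes [measurable]: "f \<in> borel_measurable M"
 shows "(\<lambda>x. f x epowr a) \<in> borel_measurable M"
 unfolding epowr_def by measurable

lemma mult_less_top_ennreal: "x < top ==> y < top ==> x * y < (top::ennreal)"
 by (simp add: ennreal_mult_less_top)

lemma add_less_top_ennreal: "x < top ==> y < top ==> x + y < (top::ennreal)"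
 by simp

section \<open>Level sets of monotone functions\<close>

lemma le_suminf_term: "f k \<le> (\<Sum>k. f k :: ennreal)"
 using sum_le_suminf[of f "{k}"] by simp

text \<open>A nonempty down set of reals is a closed half-line, an open half-line or the whole line.
  The points x n have to lie in Q because later bounds are known only for half-lines {..x} with x in
  Q.\<close>

lemma down_set_exhaustion:
 fixes Q :: "real set"
 assumes "\<forall>x\<in>Q. \<forall>y\<le>x. y \<in> Q" "Q \<noteq> {}"
 shows "\<exists>x::nat => real. incseq (\<lambda>n. {..x n}) \<and> Q = (\<Union>n. {..x n}) \<and> (\<forall>n. x n \<in> Q)"
proof (cases "bdd_above Q")
 case True
 let ?c = "Sup Q"
 show ?thesis
 proof (cases "?c \<in> Q")
  case c: True
  have "Q = {..?c}" using c assms(1) cSup_upper[OF _ True] by auto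
  then show ?thesis using c by (intro exI[of _ "\<lambda>_. ?c"]) (auto simp: incseq_def)
 next
  case c: False
  have "x < ?c" if "x \<in> Q" for x
   using cSup_upper[OF that True] c that by (metis less_eq_real_def)
  moreover have in_Q: "x \<in> Q" if "x < ?c" for x
   using that assms less_cSup_iff[OF assms(2) True, of x] less_imp_le by blast
  ultimately have Q: "Q = {..<?c}" by auto
  have inc: "incseq (\<lambda>n. {..?c - 1 / (real n + 1)})"
   by (auto simp: incseq_def intro!: frac_le dest: order.trans)
  have "Q = (\<Union>n::nat. {..?c - 1 / (real n + 1)})"
  proof safe
   fix x assume "x \<in> Q"
   then have "0 < ?c - x" using Q by auto
   then obtain n :: nat where "inverse (real (Suc n)) < ?c - x" using reals_Archimedean by blast
   then have "x \<le> ?c - 1 / (real n + 1)" by (simp add: inverse_eq_divide add.commute)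
   then show "x \<in> (\<Union>n::nat. {..?c - 1 / (real n + 1)})" by auto
  next
   fix x and n :: nat assume "x \<le> ?c - 1 / (real n + 1)"
   then have "x < ?c" by (smt (verit) divide_pos_pos of_nat_0_le_iff)
   then show "x \<in> Q" by (rule in_Q)
  qed
  then show ?thesis
   using inc by (intro exI[of _ "\<lambda>n. ?c - 1 / (real n + 1)"]) (auto intro!: in_Q)
 qed
next
 case False
 then have "x \<in> Q" for x using assms(1) by (metis bdd_above.I linear)
 then have "Q = UNIV" by auto
 moreover have "UNIV = (\<Union>n::nat. {..real n})" by (auto intro: real_arch_simple)
 ultimately show ?thesis by (intro exI[of _ real]) (auto simp: incseq_def)
qed

lemma down_set_borel:
 fixes Q :: "real set"
 assumes "\<forall>x\<in>Q. \<forall>y\<le>x. y \<in> Q"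
 shows "Q \<in> sets borel"
proof (cases "Q = {}")
 case False
 show ?thesis using down_set_exhaustion[OF assms False] by auto
qed auto

lemma emeasure_down_set_le:
 fixes Q :: "real set"
 assumes "sets \<nu> = sets borel" "\<forall>x\<in>Q. \<forall>y\<le>x. y \<in> Q"
  and "\<And>x. x \<in> Q ==> \<nu> {..x} \<le> R"
 shows "\<nu> Q \<le> R"
proof (cases "Q = {}")
 case False
 obtain x :: "nat => real" where
  x: "incseq (\<lambda>n. {..x n})" "Q = (\<Union>n. {..x n})" "\<And>n. x n \<in> Q"
  using down_set_exhaustion[OF assms(2) False] by blast
 have r: "range (\<lambda>n. {..x n}) \<subseteq> sets \<nu>" unfolding assms(1) by auto
 have "\<nu> (\<Union>n. {..x n}) = (SUP n. \<nu> {..x n})"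
  by (rule SUP_emeasure_incseq[symmetric, OF r x(1)])
 also have "\<dots> \<le> R" by (rule SUP_least) (use x(3) assms(3) in blast)
 finally show ?thesis by (simp only: x(2))
qed auto

lemma borel_measurable_mono_ennreal:
 fixes f :: "real => ennreal"
 assumes "mono f" shows "f \<in> borelfun"
proof (rule borel_measurableI_less)
 fix y
 have "{x. f x < y} \<in> sets borel"
  using assms by (intro down_set_borel) (auto dest: monoD intro: le_less_trans)
 then show "{x \<in> space borel. f x < y} \<in> sets borel" by simp
qed

lemma borel_measurable_antimono_ennreal:
 fixes f :: "real => ennreal"
 assumes "antimono f" shows "f \<in> borelfun"
proof -
 have [measurable]: "(\<lambda>x. f (- x)) \<in> borelfun"
  using assms by (intro borel_measurable_mono_ennreal) (auto simp: mono_def intro: antimonoD)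
 have "(\<lambda>x. f (- (- x))) \<in> borelfun"
  by measurable
 then show ?thesis by simp
qed

text \<open>The level set is a down set and every {..x} with x in it has measure at most t, so
  continuity from below gives the bound. For a finite atomless \<mu> equality holds up to the total
  mass; the inequality survives atoms, and point masses rely on that.\<close>

lemma emeasure_head_level:
 fixes \<mu> :: "real measure"
 assumes [simp]: "sets \<mu> = sets borel"
 shows "\<mu> {x. \<mu> {..x} \<le> t} \<le> t"
proof (rule emeasure_down_set_le)
 have "\<mu> {..y} \<le> \<mu> {..x}" if "y \<le> x" for x y
  using that by (intro emeasure_mono) auto
 then show "\<forall>x\<in>{x. \<mu> {..x} \<le> t}. \<forall>y\<le>x. y \<in> {x. \<mu> {..x} \<le> t}"
  by (auto intro: order.trans)
qed auto

text \<open>The reflection of x to -x turns tails into heads.\<close>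

lemma emeasure_tail_level:
 fixes \<mu> :: "real measure"
 assumes [simp]: "sets \<mu> = sets borel"
 shows "\<mu> {x. \<mu> {x..} \<le> t} \<le> t"
proof -
 define \<nu> where "\<nu> = distr \<mu> borel uminus"
 have sp: "space \<mu> = UNIV" using sets_eq_imp_space_eq[OF assms] by simp
 have m: "uminus \<in> measurable \<mu> borel"
  by (simp cong: measurable_cong_sets)
 have \<nu>: "\<nu> A = \<mu> (uminus -` A)" if "A \<in> sets borel" for A
  using that m by (simp add: \<nu>_def emeasure_distr sp)
 have e: "uminus -` {..x} = {-x::real..}" for x by auto
 have 1: "\<nu> {..x} = \<mu> {-x..}" for x by (simp add: \<nu> e)
 have "{x. \<nu> {..x} \<le> t} \<in> sets borel"
  unfolding 1 by (rule down_set_borel) (auto intro!: emeasure_mono elim!: order.trans[rotated])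
 then have "\<nu> {x. \<nu> {..x} \<le> t} = \<mu> {x. \<mu> {x..} \<le> t}"
  by (simp add: \<nu> 1)
 then show ?thesis using emeasure_head_level[of \<nu> t] by (simp add: \<nu>_def)
qed

lemma dyadic_level:
 fixes x M :: real
 assumes "0 < x" "x \<le> M"
 obtains k :: nat where "M / 2 ^ (k + 1) < x" "x \<le> M / 2 ^ k"
proof -
 obtain n where "M / x < 2 ^ n" using real_arch_pow[of 2 "M / x"] by auto
 then have "M / 2 ^ n < x" using assms by (simp add: field_simps)
 then have ex: "\<exists>k. M / 2 ^ k < x" by blast
 define k where "k = (LEAST k. M / 2 ^ k < x)"
 have k: "M / 2 ^ k < x" using LeastI_ex[OF ex] by (simp add: k_def)
 have "k \<noteq> 0" using k assms by (intro notI) auto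
 then obtain j where j: "k = j + 1" by (metis Suc_eq_plus1 not0_implies_Suc)
 have "x \<le> M / 2 ^ j"
  using not_less_Least[of j "\<lambda>k. M / 2 ^ k < x"] j by (simp add: k_def not_less)
 then show ?thesis using that k j by auto
qed

text \<open>For e \<ge> 0 the bound of F by the total mass M suffices. For -1 < e < 0 the integral
  is cut at the levels M / 2^k: on the k-th layer F^e is at most (M / 2^(k + 1))^e, and the layer
  has measure at most M / 2^k.\<close>

lemma power_level_upper:
 assumes e: "-1 < e"
 shows "\<exists>c<top. \<forall>(\<nu>::real measure) F. \<nu> (space \<nu>) < top --> F \<in> borel_measurable \<nu> -->
  (\<forall>x. F x \<le> \<nu> (space \<nu>)) --> (\<forall>t. \<nu> {x\<in>space \<nu>. F x \<le> t} \<le> t) -->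
  (\<integral>\<^sup>+x. F x epowr e \<partial>\<nu>) \<le> c * \<nu> (space \<nu>) epowr (e + 1)"
proof (cases "e \<ge> 0")
 case True
 show ?thesis
 proof (intro exI[of _ 1] conjI allI impI)
  fix \<nu> :: "real measure" and F :: "real => ennreal"
  assume F: "\<forall>x. F x \<le> \<nu> (space \<nu>)"
  have "(\<integral>\<^sup>+x. F x epowr e \<partial>\<nu>) \<le> (\<integral>\<^sup>+x. \<nu> (space \<nu>) epowr e \<partial>\<nu>)"
   using F True by (intro nn_integral_mono epowr_mono) auto
  also have "\<dots> = \<nu> (space \<nu>) epowr (e + 1)"
   using True by (simp add: epowr_add)
  finally show "(\<integral>\<^sup>+x. F x epowr e \<partial>\<nu>) \<le> 1 * \<nu> (space \<nu>) epowr (e + 1)" by simp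
 qed auto
next
 case False
 \<comment> \<open>Ratio of the series of (M / 2^(k + 1))^e * M / 2^k. It is below 1 exactly because
   e > -1.\<close>
 define q where "q = 2 powr (-(1 + e))"
 have q: "0 < q" "q < 1" using e by (auto simp: q_def powr_less_one)
 define c where "c = 2 powr (- e) / (1 - q)"
 show ?thesis
 proof (intro exI[of _ "ennreal c"] conjI allI impI)
  fix \<nu> :: "real measure" and F :: "real => ennreal"
  assume fin: "\<nu> (space \<nu>) < top" and [measurable]: "F \<in> borel_measurable \<nu>"
   and F: "\<forall>x. F x \<le> \<nu> (space \<nu>)" and lev: "\<forall>t. \<nu> {x\<in>space \<nu>. F x \<le> t} \<le> t"
  show "(\<integral>\<^sup>+x. F x epowr e \<partial>\<nu>) \<le> ennreal c * \<nu> (space \<nu>) epowr (e + 1)"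
  proof (cases "\<nu> (space \<nu>)" rule: ennreal_pos_cases)
   case zero
   then have "AE x in \<nu>. F x epowr e = 0" by (intro AE_I[of _ _ "space \<nu>"]) auto
   then have "(\<integral>\<^sup>+x. F x epowr e \<partial>\<nu>) = 0" by (simp add: nn_integral_0_iff_AE)
   then show ?thesis by simp
  next
   case (real M)
   \<comment> \<open>The zeros of F, where F^e is infinite, form a null set by the level bound at t
     = 0.\<close>
   have ae: "AE x in \<nu>. F x \<noteq> 0"
    using lev[rule_format, of 0] by (simp add: AE_iff_null null_sets_def)
   have pw: "F x epowr e \<le> (\<Sum>k. ennreal ((M / 2 ^ (k+1)) powr e) * indicator {x\<in>space \<nu>. F x \<le> ennreal (M / 2 ^ k)} x)"
    if x: "x \<in> space \<nu>" "F x \<noteq> 0" for x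
   proof -
    have "F x \<le> ennreal M" using F real by metis
    then obtain y where y: "F x = ennreal y" "y > 0" "y \<le> M"
     using x real by (cases "F x" rule: ennreal_pos_cases) (auto simp: top_unique)
    obtain k where k: "M / 2 ^ (k + 1) < y" "y \<le> M / 2 ^ k"
     using y dyadic_level by blast
    have "F x epowr e = ennreal (y powr e)" using y by (simp add: ennreal_epowr_pos)
    also have "\<dots> \<le> ennreal ((M / 2 ^ (k+1)) powr e)"
     using y k False real by (intro ennreal_leI powr_mono2') auto
    also have "\<dots> = ennreal ((M / 2 ^ (k+1)) powr e) * indicator {x\<in>space \<nu>. F x \<le> ennreal (M / 2 ^ k)} x"
     using x k y by (auto simp: ennreal_leI)
    also have "\<dots> \<le> (\<Sum>k. ennreal ((M / 2 ^ (k+1)) powr e) * indicator {x\<in>space \<nu>. F x \<le> ennreal (M / 2 ^ k)} x)"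
     by (rule le_suminf_term)
    finally show ?thesis .
   qed
   have "(\<integral>\<^sup>+x. F x epowr e \<partial>\<nu>) \<le> (\<integral>\<^sup>+x. (\<Sum>k. ennreal ((M / 2 ^ (k+1)) powr e) * indicator {x\<in>space \<nu>. F x \<le> ennreal (M / 2 ^ k)} x) \<partial>\<nu>)"
    using ae pw by (intro nn_integral_mono_AE) auto
   also have "\<dots> = (\<Sum>k. ennreal ((M / 2 ^ (k+1)) powr e) * \<nu> {x\<in>space \<nu>. F x \<le> ennreal (M / 2 ^ k)})"
    by (simp add: nn_integral_suminf nn_integral_cmult)
   also have "\<dots> \<le> (\<Sum>k. ennreal ((M / 2 ^ (k+1)) powr e) * ennreal (M / 2 ^ k))"
    using lev by (intro suminf_le mult_left_mono) auto
   also have "\<dots> = (\<Sum>k. ennreal (M powr (e + 1) * (2 powr (- e)) * q ^ k))"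
   proof (intro suminf_cong)
    fix k
    have "(M / 2 ^ (k+1)) powr e * (M / 2 ^ k) = M powr (e + 1) * (2 powr (- e)) * q ^ k"
    proof -
     have q': "q ^ k = 2 powr (- (1 + e) * real k)"
      by (simp add: q_def powr_powr flip: powr_realpow)
     have p: "(2::real) powr (- real j) = inverse (2 ^ j)" for j :: nat
      by (simp only: powr_minus powr_realpow zero_less_numeral)
     have "M / 2 ^ (k + 1) = M * 2 powr (- real (k + 1))" "M / 2 ^ k = M * 2 powr (- real k)"
      by (simp_all only: p divide_inverse)
     then have "(M / 2 ^ (k+1)) powr e * (M / 2 ^ k) =
       (M powr e * M) * (2 powr (- real (k + 1) * e) * 2 powr (- real k))"
      using powr_mult[of M "2 powr (- real (k + 1))" e] real
      by (simp only: powr_powr mult_ac)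
     also have "M powr e * M = M powr (e + 1)" using powr_add[of M e 1] real by simp
     also have "2 powr (- real (k + 1) * e) * 2 powr (- real k) = (2::real) powr (- e) * q ^ k"
      unfolding q' powr_add[symmetric] by (rule arg_cong[of _ _ "\<lambda>x. 2 powr x"]) (simp add: algebra_simps)
     finally show ?thesis by simp
    qed
    then show "ennreal ((M / 2 ^ (k+1)) powr e) * ennreal (M / 2 ^ k) = ennreal (M powr (e + 1) * (2 powr (- e)) * q ^ k)"
     using real by (metis ennreal_mult powr_ge_zero divide_nonneg_nonneg less_imp_le zero_le_numeral zero_le_power)
   qed
   also have "\<dots> = ennreal (\<Sum>k. M powr (e + 1) * (2 powr (- e)) * q ^ k)"
    using q by (intro suminf_ennreal2 summable_mult summable_geometric) simp_all
   also have "(\<Sum>k. M powr (e + 1) * (2 powr (- e)) * q ^ k) = c * M powr (e + 1)"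
    using q by (simp add: suminf_mult suminf_geometric c_def)
   also have "ennreal (c * M powr (e + 1)) = ennreal c * \<nu> (space \<nu>) epowr (e + 1)"
    using real q by (subst ennreal_mult) (auto simp: c_def ennreal_epowr_pos)
   finally show ?thesis .
  next
   case top then show ?thesis using fin by simp
  qed
 qed auto
qed

text \<open>For e \<le> 0 the bound F \<le> M suffices. For e > 0 the level bound at M / 2 leaves at
  least half of the mass on the set where F > M / 2, whence the constant 2^(e + 1).\<close>

lemma power_level_lower:
 assumes e: "-1 < e"
 shows "\<exists>c<top. \<forall>(\<nu>::real measure) F. \<nu> (space \<nu>) < top --> F \<in> borel_measurable \<nu> -->
  (\<forall>x. F x \<le> \<nu> (space \<nu>)) --> (\<forall>t. \<nu> {x\<in>space \<nu>. F x \<le> t} \<le> t) -->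
  \<nu> (space \<nu>) epowr (e + 1) \<le> c * (\<integral>\<^sup>+x. F x epowr e \<partial>\<nu>)"
proof (cases "e \<le> 0")
 case True
 show ?thesis
 proof (intro exI[of _ 1] conjI allI impI)
  fix \<nu> :: "real measure" and F :: "real => ennreal"
  assume F: "\<forall>x. F x \<le> \<nu> (space \<nu>)" and fin: "\<nu> (space \<nu>) < top"
  show "\<nu> (space \<nu>) epowr (e + 1) \<le> 1 * (\<integral>\<^sup>+x. F x epowr e \<partial>\<nu>)"
  proof (cases "\<nu> (space \<nu>) = 0")
   case False
   have "\<nu> (space \<nu>) epowr (e + 1) = \<nu> (space \<nu>) epowr e * \<nu> (space \<nu>)"
    using False fin by (simp add: epowr_add')
   also have "\<dots> = (\<integral>\<^sup>+x. \<nu> (space \<nu>) epowr e \<partial>\<nu>)" by simp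
   also have "\<dots> \<le> (\<integral>\<^sup>+x. F x epowr e \<partial>\<nu>)"
    using F True by (intro nn_integral_mono epowr_antimono) auto
   finally show ?thesis by simp
  qed (use e in auto)
 qed auto
next
 case False
 show ?thesis
 proof (intro exI[of _ "2 epowr (e + 1)"] conjI allI impI)
  fix \<nu> :: "real measure" and F :: "real => ennreal"
  assume fin: "\<nu> (space \<nu>) < top" and [measurable]: "F \<in> borel_measurable \<nu>"
   and F: "\<forall>x. F x \<le> \<nu> (space \<nu>)" and lev: "\<forall>t. \<nu> {x\<in>space \<nu>. F x \<le> t} \<le> t"
  define M where "M = \<nu> (space \<nu>)"
  obtain r where "r \<ge> 0" "M = ennreal r"
   using fin by (cases M) (auto simp: M_def)
  then have half: "M / 2 + M / 2 = M" and half_fin: "M / 2 < top"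
   using divide_ennreal[of r 2] by (simp_all flip: ennreal_plus)
  have "M \<le> \<nu> {x\<in>space \<nu>. F x \<le> M / 2} + \<nu> {x\<in>space \<nu>. \<not> F x \<le> M / 2}"
   unfolding M_def by (subst plus_emeasure) (auto intro!: emeasure_mono)
  also have "\<dots> \<le> M / 2 + \<nu> {x\<in>space \<nu>. \<not> F x \<le> M / 2}"
   using lev by (intro add_right_mono) auto
  finally have "M / 2 + M / 2 \<le> M / 2 + \<nu> {x\<in>space \<nu>. \<not> F x \<le> M / 2}" by (simp add: half)
  then have *: "M / 2 \<le> \<nu> {x\<in>space \<nu>. \<not> F x \<le> M / 2}" using half_fin by auto
  have "M = 2 * (M / 2)" by (simp add: half mult_2)
  then have "M epowr (e + 1) = (2 * (M / 2)) epowr (e + 1)" by simp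
  also have "\<dots> = 2 epowr (e + 1) * ((M / 2) epowr e * (M / 2))"
   using False by (simp add: epowr_mult epowr_add mult_ac)
  also have "\<dots> \<le> 2 epowr (e + 1) * ((M / 2) epowr e * \<nu> {x\<in>space \<nu>. \<not> F x \<le> M / 2})"
   using * by (intro mult_left_mono) auto
  also have "\<dots> = 2 epowr (e + 1) * (\<integral>\<^sup>+x. (M / 2) epowr e * indicator {x\<in>space \<nu>. \<not> F x \<le> M / 2} x \<partial>\<nu>)"
   by (subst nn_integral_cmult_indicator) auto
  also have "\<dots> \<le> 2 epowr (e + 1) * (\<integral>\<^sup>+x. F x epowr e \<partial>\<nu>)"
   using False by (intro mult_left_mono nn_integral_mono) (auto split: split_indicator intro!: epowr_mono)
  finally show "\<nu> (space \<nu>) epowr (e + 1) \<le> 2 epowr (e + 1) * (\<integral>\<^sup>+x. F x epowr e \<partial>\<nu>)"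
   by (simp add: M_def)
 qed auto
qed

section \<open>Diffuse measures on the line\<close>

definition restr :: "real measure => real set => real measure" where
 "restr \<mu> A = density \<mu> (indicator A)"

definition diffuse :: "real measure => bool" where
 "diffuse \<mu> \<longleftrightarrow> sets \<mu> = sets borel \<and> (\<forall>x. \<mu> {x} = 0)"

lemma diffuseD: "diffuse \<mu> ==> sets \<mu> = sets borel" "diffuse \<mu> ==> \<mu> {x} = 0"
 by (auto simp: diffuse_def)

lemma sets_restr [simp, measurable_cong]: "sets (restr \<mu> A) = sets \<mu>"
 by (simp add: restr_def)

lemma space_borel_like: "sets \<mu> = sets (borel :: real measure) ==> space \<mu> = UNIV"
 using sets_eq_imp_space_eq[of \<mu> borel] by simp

lemma measurable_borel_like:
 "sets \<mu> = sets (borel :: real measure) ==> f \<in> borelfun ==> f \<in> borel_measurable \<mu>"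
 by (simp cong: measurable_cong_sets)

lemma emeasure_restr:
 assumes "sets \<mu> = sets borel" "A \<in> sets borel" "B \<in> sets borel"
 shows "(restr \<mu> A) B = \<mu> (A \<inter> B)"
proof -
 have "(restr \<mu> A) B = (\<integral>\<^sup>+x. indicator A x * indicator B x \<partial>\<mu>)"
  unfolding restr_def using assms by (intro emeasure_density) auto
 also have "\<dots> = (\<integral>\<^sup>+x. indicator (A \<inter> B) x \<partial>\<mu>)"
  by (simp only: indicator_inter_arith)
 also have "\<dots> = \<mu> (A \<inter> B)" using assms by (intro nn_integral_indicator) auto
 finally show ?thesis .
qed

lemma nn_integral_restr:
 assumes "sets \<mu> = sets borel" "A \<in> sets borel" "f \<in> borelfun"
 shows "(\<integral>\<^sup>+x. f x \<partial>restr \<mu> A) = (\<integral>\<^sup>+x\<in>A. f x \<partial>\<mu>)"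
 unfolding restr_def using assms
 by (subst nn_integral_density) (auto intro!: measurable_borel_like simp: mult.commute)

lemma diffuse_restr: "diffuse \<mu> ==> A \<in> sets borel ==> diffuse (restr \<mu> A)"
proof -
 assume d: "diffuse \<mu>" and A: "A \<in> sets borel"
 note s = diffuseD(1)[OF d]
 have "(restr \<mu> A) {x} = 0" for x
 proof -
  have "\<mu> (A \<inter> {x}) \<le> \<mu> {x}" using s by (intro emeasure_mono) auto
  then show ?thesis using diffuseD(2)[OF d] emeasure_restr[OF s A, of "{x}"] by simp
 qed
 then show ?thesis using s by (simp add: diffuse_def)
qed

lemma measurable_tail: "sets \<mu> = sets borel ==> (\<lambda>x::real. \<mu> {x<..}) \<in> borelfun"
 by (rule borel_measurable_antimono_ennreal) (rule antimonoI, rule emeasure_mono, auto)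

lemma measurable_ctail: "sets \<mu> = sets borel ==> (\<lambda>x::real. \<mu> {x..}) \<in> borelfun"
 by (rule borel_measurable_antimono_ennreal) (rule antimonoI, rule emeasure_mono, auto)

lemma measurable_head: "sets \<mu> = sets borel ==> (\<lambda>x::real. \<mu> {..x}) \<in> borelfun"
 by (rule borel_measurable_mono_ennreal) (rule monoI, rule emeasure_mono, auto)

lemma measurable_Ioc: "sets \<mu> = sets borel ==> (\<lambda>x::real. \<mu> {a<..x}) \<in> borelfun"
 by (rule borel_measurable_mono_ennreal) (rule monoI, rule emeasure_mono, auto)

lemma measurable_Ioc': "sets \<mu> = sets borel ==> (\<lambda>x::real. \<mu> {x<..b}) \<in> borelfun"
 by (rule borel_measurable_antimono_ennreal) (rule antimonoI, rule emeasure_mono, auto)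

lemma diffuse_ctail: "diffuse \<mu> ==> \<mu> {x..} = \<mu> {x<..}"
proof -
 assume *: "diffuse \<mu>"
 have "{x} \<in> null_sets \<mu>" "{x<..} \<in> sets \<mu>" using diffuseD(1)[OF *] diffuseD(2)[OF *, of x] by auto
 then have "\<mu> ({x<..} \<union> {x}) = \<mu> {x<..}" by (rule emeasure_Un_null_set[rotated])
 moreover have "{x<..} \<union> {x} = {x..}" by auto
 ultimately show ?thesis by simp
qed

text \<open>This stands in for the primitive of F^e dF: a head or tail function of \<nu>, of which
  only the level bound is used, integrates to (total mass)^(e + 1) up to a constant.\<close>

lemma power_level:
 assumes e: "-1 < e"
 shows "\<exists>c<top. \<forall>(\<nu>::real measure) F. \<nu> (space \<nu>) < top --> F \<in> borel_measurable \<nu> -->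
  (\<forall>x. F x \<le> \<nu> (space \<nu>)) --> (\<forall>t. \<nu> {x\<in>space \<nu>. F x \<le> t} \<le> t) -->
  (\<integral>\<^sup>+x. F x epowr e \<partial>\<nu>) \<le> c * \<nu> (space \<nu>) epowr (e + 1) \<and>
  \<nu> (space \<nu>) epowr (e + 1) \<le> c * (\<integral>\<^sup>+x. F x epowr e \<partial>\<nu>)"
proof -
 show ?thesis
 proof (rule ex_finiteE[OF power_level_upper[OF e]], goal_cases)
 case (1 c1)
 note c1 = 1(1) 1(2)[rule_format (no_asm)]
 show ?thesis
 proof (rule ex_finiteE[OF power_level_lower[OF e]], goal_cases)
 case (1 c2)
 note c2 = 1(1) 1(2)[rule_format (no_asm)]
 have m: "c1 * X \<le> (c1 + c2) * X" "c2 * X \<le> (c1 + c2) * X" for X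
  by (auto intro!: mult_right_mono)
 show ?thesis
  by (intro exI[of _ "c1 + c2"] conjI allI impI)
    (use c1(1) c2(1) order.trans[OF c1(2) m(1)] order.trans[OF c2(2) m(2)] in auto)
 qed
 qed
qed

lemma head_power_gen:
 assumes e: "-1 < e"
 shows "\<exists>c<top. \<forall>(\<mu>::real measure) E. sets \<mu> = sets borel --> E \<in> sets borel --> \<mu> E < top -->
  (\<integral>\<^sup>+x\<in>E. \<mu> (E \<inter> {..x}) epowr e \<partial>\<mu>) \<le> c * \<mu> E epowr (e + 1) \<and>
  \<mu> E epowr (e + 1) \<le> c * (\<integral>\<^sup>+x\<in>E. \<mu> (E \<inter> {..x}) epowr e \<partial>\<mu>)"
proof -
 show ?thesis
 proof (rule ex_finiteE[OF power_level[OF e]], goal_cases)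
 case (1 c)
 note c = 1(1) 1(2)[rule_format (no_asm)]
 show ?thesis
 proof (intro exI[of _ c] conjI[OF c(1)] allI impI)
  fix \<mu> :: "real measure" and E
  assume \<mu> [simp, measurable_cong]: "sets \<mu> = sets borel" and E [measurable]: "E \<in> sets borel" and fin: "\<mu> E < top"
  let ?r = "restr \<mu> E"
  have sp: "space ?r = UNIV" by (rule space_borel_like) simp
  have em: "emeasure ?r B = \<mu> (E \<inter> B)" if "B \<in> sets borel" for B
   using that by (simp add: emeasure_restr)
  have [measurable]: "(\<lambda>x. \<mu> (E \<inter> {..x})) \<in> borelfun"
   by (rule borel_measurable_mono_ennreal) (rule monoI, rule emeasure_mono, auto)
  have lev: "emeasure ?r {x\<in>space ?r. \<mu> (E \<inter> {..x}) \<le> t} \<le> t" for t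
   using emeasure_head_level[of ?r t] by (simp add: sp em)
  have le: "\<mu> (E \<inter> {..x}) \<le> emeasure ?r (space ?r)" for x
   by (auto simp: em sp intro!: emeasure_mono)
  show "(\<integral>\<^sup>+x\<in>E. \<mu> (E \<inter> {..x}) epowr e \<partial>\<mu>) \<le> c * \<mu> E epowr (e + 1) \<and>
   \<mu> E epowr (e + 1) \<le> c * (\<integral>\<^sup>+x\<in>E. \<mu> (E \<inter> {..x}) epowr e \<partial>\<mu>)"
   using c(2)[of ?r "\<lambda>x. \<mu> (E \<inter> {..x})"] lev le fin
   by (simp add: sp em nn_integral_restr)
 qed
 qed
qed

lemma head_power:
 assumes e: "-1 < e"
 shows "\<exists>c<top. \<forall>\<mu> a b. diffuse \<mu> --> \<mu> {a<..b} < top -->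
  (\<integral>\<^sup>+x\<in>{a<..b}. \<mu> {a<..x} epowr e \<partial>\<mu>) \<le> c * \<mu> {a<..b} epowr (e + 1) \<and>
  \<mu> {a<..b} epowr (e + 1) \<le> c * (\<integral>\<^sup>+x\<in>{a<..b}. \<mu> {a<..x} epowr e \<partial>\<mu>)"
proof -
 show ?thesis
 proof (rule ex_finiteE[OF head_power_gen[OF e]], goal_cases)
 case (1 c)
 note c = 1(1) 1(2)[rule_format (no_asm)]
 have *: "{a<..b} \<inter> {..x} = {a<..x}" if "x \<in> {a<..b}" for a b x :: real using that by auto
 have "(\<integral>\<^sup>+x\<in>{a<..b}. \<mu> ({a<..b} \<inter> {..x}) epowr e \<partial>\<mu>) =
   (\<integral>\<^sup>+x\<in>{a<..b}. \<mu> {a<..x} epowr e \<partial>\<mu>)" for \<mu> and a b :: real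
  by (intro nn_integral_cong) (auto simp: * split: split_indicator)
 then show ?thesis using c(2)[OF diffuseD(1), of _ "{a<..b}" for a b] c(1) by (intro exI[of _ c]) auto
 qed
qed

text \<open>Diffuseness matters here: the level bound concerns closed tails, and an atom destroys it
  for the open tails {x<..}.\<close>

lemma tail_power:
 assumes e: "-1 < e"
 shows "\<exists>c<top. \<forall>\<mu> y. diffuse \<mu> --> \<mu> {y<..} < top -->
  (\<integral>\<^sup>+x\<in>{y<..}. \<mu> {x<..} epowr e \<partial>\<mu>) \<le> c * \<mu> {y<..} epowr (e + 1) \<and>
  \<mu> {y<..} epowr (e + 1) \<le> c * (\<integral>\<^sup>+x\<in>{y<..}. \<mu> {x<..} epowr e \<partial>\<mu>)"
proof -
 show ?thesis
 proof (rule ex_finiteE[OF power_level[OF e]], goal_cases)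
 case (1 c)
 note c = 1(1) 1(2)[rule_format (no_asm)]
 show ?thesis
 proof (intro exI[of _ c] conjI[OF c(1)] allI impI)
  fix \<mu> y assume d: "diffuse \<mu>" and fin: "\<mu> {y<..} < top"
  note [simp, measurable_cong] = diffuseD(1)[OF d]
  let ?r = "restr \<mu> {y<..}"
  have dr: "diffuse ?r" using d by (simp add: diffuse_restr)
  have sp: "space ?r = UNIV" by (rule space_borel_like) simp
  have em: "emeasure ?r B = \<mu> ({y<..} \<inter> B)" if "B \<in> sets borel" for B
   using that by (simp add: emeasure_restr)
  have [measurable]: "(\<lambda>x. emeasure ?r {x<..}) \<in> borelfun"
   by (rule measurable_tail) simp
  have lev: "emeasure ?r {x\<in>space ?r. emeasure ?r {x<..} \<le> t} \<le> t" for t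
   using emeasure_tail_level[of ?r t] by (simp add: sp diffuse_ctail[OF dr])
  have le: "emeasure ?r {x<..} \<le> emeasure ?r (space ?r)" for x
   by (auto simp: sp intro!: emeasure_mono)
  have eq: "(\<integral>\<^sup>+x. emeasure ?r {x<..} epowr e \<partial>?r) = (\<integral>\<^sup>+x\<in>{y<..}. \<mu> {x<..} epowr e \<partial>\<mu>)"
  proof -
   have "(\<integral>\<^sup>+x. emeasure ?r {x<..} epowr e \<partial>?r) = (\<integral>\<^sup>+x\<in>{y<..}. emeasure ?r {x<..} epowr e \<partial>\<mu>)"
    by (rule nn_integral_restr) auto
   also have "\<dots> = (\<integral>\<^sup>+x\<in>{y<..}. \<mu> {x<..} epowr e \<partial>\<mu>)"
   proof (intro nn_integral_cong)
    fix x
    have "{y<..} \<inter> {x<..} = {x<..}" if "y < x" using that by auto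
    then show "emeasure ?r {x<..} epowr e * indicator {y<..} x = \<mu> {x<..} epowr e * indicator {y<..} x"
     by (cases "y < x") (simp_all add: em)
   qed
   finally show ?thesis .
  qed
  show "(\<integral>\<^sup>+x\<in>{y<..}. \<mu> {x<..} epowr e \<partial>\<mu>) \<le> c * \<mu> {y<..} epowr (e + 1) \<and>
   \<mu> {y<..} epowr (e + 1) \<le> c * (\<integral>\<^sup>+x\<in>{y<..}. \<mu> {x<..} epowr e \<partial>\<mu>)"
  proof -
   have sp': "emeasure ?r (space ?r) = \<mu> {y<..}" by (simp add: sp em)
   have "(\<lambda>x. emeasure ?r {x<..}) \<in> borel_measurable ?r"
    by (rule measurable_borel_like) auto
   from c(2)[OF _ this allI[OF le] allI[OF lev]] fin
   show ?thesis unfolding eq sp' by blast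
  qed
 qed
 qed
qed

section \<open>Young and Hoelder inequalities with values in [0,\<infinity>], and the embedding of
  sequence spaces\<close>

lemma Young_ennreal:
 assumes "0 < \<theta>" "\<theta> < 1"
 shows "x epowr \<theta> * y epowr (1 - \<theta>) \<le> ennreal \<theta> * x + ennreal (1 - \<theta>) * y"
proof (cases x rule: ennreal_pos_cases; cases y rule: ennreal_pos_cases)
 fix a b assume a: "0 < a" "x = ennreal a" and b: "0 < b" "y = ennreal b"
 have "a powr \<theta> * b powr (1 - \<theta>) \<le> \<theta> * a + (1 - \<theta>) * b"
  using assms a b by (intro Youngs_inequality_0) auto
 then have "ennreal (a powr \<theta> * b powr (1 - \<theta>)) \<le> ennreal (\<theta> * a + (1 - \<theta>) * b)"
  by (rule ennreal_leI)
 also have "\<dots> = ennreal \<theta> * x + ennreal (1 - \<theta>) * y"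
  using assms a b by (simp add: ennreal_plus ennreal_mult)
 finally show ?thesis
  using a b by (simp add: ennreal_epowr_pos ennreal_mult)
qed (use assms in \<open>auto simp: ennreal_mult_top ennreal_top_mult\<close>)

lemma Hoelder_nn_integral:
 assumes \<theta>: "0 < \<theta>" "\<theta> < 1" and [measurable]: "f \<in> borel_measurable M" "g \<in> borel_measurable M"
 shows "(\<integral>\<^sup>+x. f x epowr \<theta> * g x epowr (1 - \<theta>) \<partial>M) \<le> (\<integral>\<^sup>+x. f x \<partial>M) epowr \<theta> * (\<integral>\<^sup>+x. g x \<partial>M) epowr (1 - \<theta>)"
proof -
 define F where "F = (\<integral>\<^sup>+x. f x \<partial>M)"
 define G where "G = (\<integral>\<^sup>+x. g x \<partial>M)"
 have z: "(\<integral>\<^sup>+x. f x epowr \<theta> * g x epowr (1 - \<theta>) \<partial>M) = 0" if "F = 0 \<or> G = 0"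
 proof -
  have "AE x in M. f x epowr \<theta> * g x epowr (1 - \<theta>) = 0"
  proof (cases "F = 0")
   case True
   then have "AE x in M. f x = 0" by (simp add: F_def nn_integral_0_iff_AE)
   then show ?thesis by eventually_elim (use \<theta> in auto)
  next
   case False
   then have "AE x in M. g x = 0" using that by (simp add: G_def nn_integral_0_iff_AE)
   then show ?thesis by eventually_elim (use \<theta> in auto)
  qed
  then show ?thesis by (simp add: nn_integral_0_iff_AE)
 qed
 \<comment> \<open>The order of the cases matters: if one integral is 0, the right side is 0 even
   when the other is infinite, so the left side must be seen to vanish before infinite values are
   discussed.\<close>
 consider "F = 0 \<or> G = 0" | "F \<noteq> 0" "G \<noteq> 0" "F = top \<or> G = top" | "F \<noteq> 0" "G \<noteq> 0" "F < top" "G < top"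
  by (metis less_top)
 then show ?thesis
 proof cases
  case 1 then show ?thesis using z by simp
 next
  case 2
  then have "F epowr \<theta> * G epowr (1 - \<theta>) = top"
   using \<theta> by (auto simp: ennreal_mult_eq_top_iff epowr_eq_0_iff)
  then show ?thesis by (simp add: F_def G_def)
 next
  case 3
  have F1: "F * (1 / F) = 1" "G * (1 / G) = 1"
   using 3 by (auto simp: ennreal_times_divide ennreal_divide_self less_top)
  have "(\<integral>\<^sup>+x. f x epowr \<theta> * g x epowr (1 - \<theta>) \<partial>M)
   = (\<integral>\<^sup>+x. (F epowr \<theta> * G epowr (1 - \<theta>)) * ((f x * (1 / F)) epowr \<theta> * (g x * (1 / G)) epowr (1 - \<theta>)) \<partial>M)"
  proof (intro nn_integral_cong)
   fix x
   have "(F epowr \<theta> * G epowr (1 - \<theta>)) * ((f x * (1 / F)) epowr \<theta> * (g x * (1 / G)) epowr (1 - \<theta>))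
    = (F * (1 / F)) epowr \<theta> * (G * (1 / G)) epowr (1 - \<theta>) * (f x epowr \<theta> * g x epowr (1 - \<theta>))"
    using \<theta> by (simp add: epowr_mult mult_ac)
   then show "f x epowr \<theta> * g x epowr (1 - \<theta>) =
     (F epowr \<theta> * G epowr (1 - \<theta>)) * ((f x * (1 / F)) epowr \<theta> * (g x * (1 / G)) epowr (1 - \<theta>))"
    by (simp only: F1 one_epowr mult_1)
  qed
  also have "\<dots> = (F epowr \<theta> * G epowr (1 - \<theta>)) * (\<integral>\<^sup>+x. (f x * (1 / F)) epowr \<theta> * (g x * (1 / G)) epowr (1 - \<theta>) \<partial>M)"
   by (rule nn_integral_cmult) measurable
  also have "\<dots> \<le> (F epowr \<theta> * G epowr (1 - \<theta>)) * (\<integral>\<^sup>+x. ennreal \<theta> * (f x * (1 / F)) + ennreal (1 - \<theta>) * (g x * (1 / G)) \<partial>M)"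
   using \<theta> by (intro mult_left_mono nn_integral_mono Young_ennreal) auto
  also have "(\<integral>\<^sup>+x. ennreal \<theta> * (f x * (1 / F)) + ennreal (1 - \<theta>) * (g x * (1 / G)) \<partial>M)
   = ennreal \<theta> * (F * (1 / F)) + ennreal (1 - \<theta>) * (G * (1 / G))"
   by (subst nn_integral_add) (auto simp: nn_integral_cmult nn_integral_multc F_def G_def)
  also have "\<dots> = 1" using \<theta> unfolding F1 by (simp flip: ennreal_plus)
  finally show ?thesis by (simp add: F_def G_def)
 qed
qed

lemma suminf_swap_ennreal: "(\<Sum>i. \<Sum>j. f i j :: ennreal) = (\<Sum>j. \<Sum>i. f i j)"
proof -
 have "(\<Sum>i. \<Sum>j. f i j) = (\<integral>\<^sup>+i. (\<Sum>j. f i j) \<partial>count_space UNIV)"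
  by (simp add: nn_integral_count_space_nat)
 also have "\<dots> = (\<Sum>j. \<integral>\<^sup>+i. f i j \<partial>count_space UNIV)"
  by (rule nn_integral_suminf) simp
 finally show ?thesis by (simp add: nn_integral_count_space_nat)
qed

lemma Hoelder_suminf:
 assumes \<theta>: "0 < \<theta>" "\<theta> < 1"
 shows "(\<Sum>n. f n epowr \<theta> * g n) \<le> (\<Sum>n. f n) epowr \<theta> * (\<Sum>n. g n epowr (1 / (1 - \<theta>))) epowr (1 - \<theta>)"
proof -
 have "(\<Sum>n. f n epowr \<theta> * g n) = (\<integral>\<^sup>+n. f n epowr \<theta> * (g n epowr (1 / (1 - \<theta>))) epowr (1 - \<theta>) \<partial>count_space UNIV)"
  using \<theta> by (simp add: nn_integral_count_space_nat epowr_epowr)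
 also have "\<dots> \<le> (\<integral>\<^sup>+n. f n \<partial>count_space UNIV) epowr \<theta> * (\<integral>\<^sup>+n. g n epowr (1 / (1 - \<theta>)) \<partial>count_space UNIV) epowr (1 - \<theta>)"
  using \<theta> by (intro Hoelder_nn_integral) auto
 finally show ?thesis by (simp add: nn_integral_count_space_nat)
qed

text \<open>The embedding of l^1 into l^\<theta>. It is how the relations p \<le> q and p \<le> m
  enter the upper bounds, with \<theta> = q / p or \<theta> = m / p.\<close>

lemma suminf_epowr_le:
 assumes "\<theta> \<ge> 1"
 shows "(\<Sum>n. f n epowr \<theta>) \<le> (\<Sum>n. f n) epowr \<theta>"
proof -
 define S where "S = (\<Sum>n. f n)"
 have "f n epowr \<theta> \<le> f n * S epowr (\<theta> - 1)" for n
 proof -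
  have "f n epowr \<theta> = f n * f n epowr (\<theta> - 1)"
   using assms epowr_add[of 1 "\<theta> - 1" "f n"] by simp
  also have "\<dots> \<le> f n * S epowr (\<theta> - 1)"
   using assms by (intro mult_left_mono epowr_mono) (auto simp: S_def le_suminf_term)
  finally show ?thesis .
 qed
 then have "(\<Sum>n. f n epowr \<theta>) \<le> (\<Sum>n. f n * S epowr (\<theta> - 1))"
  by (intro suminf_le) auto
 also have "\<dots> = S * S epowr (\<theta> - 1)" by (simp add: S_def)
 also have "\<dots> = S epowr \<theta>" using assms epowr_add[of 1 "\<theta> - 1" S] by simp
 finally show ?thesis by (simp add: S_def)
qed

section \<open>Weighted sums with geometric weights\<close>

text \<open>Division by S^\<theta>. The value S = top would satisfy the inequality for every D > 0,
  so each application first truncates its data to make S finite.\<close>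

lemma self_improve:
 fixes S D :: ennreal
 assumes "S < top" "S \<le> D * S epowr \<theta>" "0 < \<theta>" "\<theta> < 1"
 shows "S \<le> D epowr (1 / (1 - \<theta>))"
proof (cases "S = 0")
 case False
 have "S = S epowr ((1 - \<theta>) + \<theta>)" by simp
 also have "\<dots> = S epowr (1 - \<theta>) * S epowr \<theta>" using assms by (intro epowr_add) auto
 finally have "S epowr (1 - \<theta>) * S epowr \<theta> \<le> D * S epowr \<theta>" using assms(2) by simp
 moreover have "S epowr \<theta> \<noteq> 0" "S epowr \<theta> \<noteq> top"
  using False assms epowr_less_top[of \<theta> S] by (auto simp: epowr_eq_0_iff)
 ultimately have "S epowr (1 - \<theta>) \<le> D"
  by (metis ennreal_mult_le_mult_iff mult.commute)
 then show ?thesis using assms by (simp add: epowr_le_swap)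
qed auto

lemma suminf_le_if_partial:
 assumes "\<And>N. (\<Sum>n<N. f n) \<le> (X::ennreal)"
 shows "(\<Sum>n. f n) \<le> X"
 using assms by (intro suminf_le_const) auto

text \<open>The converse of Hoelder's inequality: a bound against all sequences x^q in l^(p / q)
  bounds c in the dual space, whose exponent is p / (p - q). It is used to combine test functions
  that live on different cells.\<close>

lemma suminf_duality:
 assumes qp: "0 < q" "q < p"
  and *: "\<And>x::nat => ennreal. (\<Sum>n. c n * x n epowr q) \<le> D * (\<Sum>n. x n epowr p) epowr (q / p)"
 shows "(\<Sum>n. c n epowr (p / (p - q))) \<le> D epowr (p / (p - q))"
proof (rule suminf_le_if_partial)
 fix N :: nat
 have pq: "1 / (1 - q / p) = p / (p - q)" using qp by (simp add: field_simps)
 show "(\<Sum>n<N. c n epowr (p / (p - q))) \<le> D epowr (p / (p - q))"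
 proof (cases "\<exists>n<N. c n = top")
  case True
  then obtain m where m: "c m = top" by blast
  \<comment> \<open>One infinite coefficient, tested with the unit sequence at its place, already
    forces D to be infinite.\<close>
  define l :: "nat => ennreal" where "l = (\<lambda>n. if n = m then 1 else 0)"
  have "(\<Sum>n. c n * l n epowr q) = (\<Sum>n\<in>{m}. c n * l n epowr q)"
   using qp by (intro suminf_finite) (auto simp: l_def)
  moreover have "(\<Sum>n. l n epowr p) = (\<Sum>n\<in>{m}. l n epowr p)"
   using qp by (intro suminf_finite) (auto simp: l_def)
  ultimately have "D = top" using *[of l] m by (simp add: l_def top_unique)
  then show ?thesis using qp by simp
 next
  case False
  \<comment> \<open>The extremal sequence: c n * l n^q and l n^p both equal c n^(p / (p - q)). The
    cut at N keeps the sum finite for \<open>self_improve\<close>.\<close>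
  define l where "l = (\<lambda>n. if n < N then c n epowr (1 / (p - q)) else 0)"
  define S where "S = (\<Sum>n<N. c n epowr (p / (p - q)))"
  have e: "1 + q / (p - q) = p / (p - q)" using qp by (simp add: field_simps)
  have "S = (\<Sum>n<N. c n * l n epowr q)"
   unfolding S_def
  proof (intro sum.cong refl)
   fix n assume "n \<in> {..<N}"
   then have "c n * l n epowr q = c n epowr 1 * c n epowr (q / (p - q))"
    by (simp add: l_def epowr_epowr)
   also have "\<dots> = c n epowr (1 + q / (p - q))" using qp by (intro epowr_add[symmetric]) auto
   finally show "c n epowr (p / (p - q)) = c n * l n epowr q" using e by simp
  qed
  also have "\<dots> = (\<Sum>n. c n * l n epowr q)"
   using qp by (intro suminf_finite[symmetric]) (auto simp: l_def)
  also have "\<dots> \<le> D * (\<Sum>n. l n epowr p) epowr (q / p)" by (rule *)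
  also have "(\<Sum>n. l n epowr p) = (\<Sum>n<N. l n epowr p)"
   using qp by (intro suminf_finite) (auto simp: l_def)
  also have "\<dots> = S"
   unfolding S_def by (intro sum.cong) (auto simp: l_def epowr_epowr)
  finally have "S \<le> D * S epowr (q / p)" .
  moreover have "S < top" using False qp by (auto simp: S_def less_top intro!: epowr_less_top)
  ultimately have "S \<le> D epowr (1 / (1 - q / p))" using qp by (intro self_improve) auto
  then show ?thesis by (simp only: pq S_def)
 qed
qed

lemma suminf_shift_ennreal: "(\<Sum>n. if j \<le> n then f (n - j) else 0) = (\<Sum>n. f n :: ennreal)"
proof (induction j)
 case (Suc j)
 have "(\<lambda>n. if Suc j \<le> Suc n then f (Suc n - Suc j) else 0) sums (\<Sum>n. f n)"
  using summable_sums[OF summableI, of "\<lambda>n. if j \<le> n then f (n - j) else 0"]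
  by (simp only: Suc.IH diff_Suc_Suc Suc_le_mono)
 from sums_Suc[of "\<lambda>n. if Suc j \<le> n then f (n - Suc j) else 0", OF this]
 show ?case by (simp add: sums_unique[symmetric])
qed simp

lemma sum_geometric_reverse_le:
 fixes \<rho> :: real
 assumes "0 \<le> \<rho>" "\<rho> < 1"
 shows "(\<Sum>j\<le>n. \<rho> ^ (n - j)) \<le> 1 / (1 - \<rho>)"
proof -
 have "(\<Sum>j\<le>n. \<rho> ^ (n - j)) = (\<Sum>j\<le>n. \<rho> ^ j)"
  using sum.nat_diff_reindex[of "\<lambda>j. \<rho> ^ j" "Suc n"] by (simp add: lessThan_Suc_atMost)
 also have "\<dots> \<le> (\<Sum>j. \<rho> ^ j)"
  using assms by (intro sum_le_suminf) auto
 also have "\<dots> = 1 / (1 - \<rho>)" using assms by (intro suminf_geometric) auto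
 finally show ?thesis .
qed

text \<open>Valid for a below and above 1. With \<eta> = \<theta>^(1 / a) > \<mu>, each single term
  \<eta>^(n - j) x j is at most S^(1 / a), where S is the sum on the right; the leftover ratio \<mu>
  / \<eta> < 1 sums to the constant.\<close>

lemma sum_epowr_geometric:
 fixes \<mu> \<theta> a :: real
 assumes "0 < \<mu>" "0 < a" "\<mu> powr a < \<theta>"
 shows "\<exists>c<top. \<forall>x n. (\<Sum>j\<le>n. ennreal (\<mu> ^ (n - j)) * x j) epowr a
  \<le> c * (\<Sum>j\<le>n. ennreal (\<theta> ^ (n - j)) * x j epowr a)"
proof -
 have \<theta>: "0 < \<theta>" using assms powr_gt_zero[of \<mu> a] by linarith
 define \<eta> where "\<eta> = \<theta> powr (1 / a)"
 have \<eta>: "0 < \<eta>" "\<eta> powr a = \<theta>" using \<theta> assms by (auto simp: \<eta>_def powr_powr)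
 have "\<mu> < \<eta>"
 proof (rule ccontr)
  assume "\<not> \<mu> < \<eta>"
  then have "\<eta> powr a \<le> \<mu> powr a" using assms \<eta>(1) by (intro powr_mono2) auto
  then show False using \<eta>(2) assms(3) by simp
 qed
 define \<rho> where "\<rho> = \<mu> / \<eta>"
 have \<rho>: "0 < \<rho>" "\<rho> < 1" using \<open>\<mu> < \<eta>\<close> assms \<eta> by (auto simp: \<rho>_def)
 have "(\<Sum>j\<le>n. ennreal (\<mu> ^ (n - j)) * x j) epowr a
   \<le> ennreal (1 / (1 - \<rho>)) epowr a * (\<Sum>j\<le>n. ennreal (\<theta> ^ (n - j)) * x j epowr a)" for x n
 proof -
  define S where "S = (\<Sum>j\<le>n. ennreal (\<theta> ^ (n - j)) * x j epowr a)"
  have trm: "ennreal (\<eta> ^ (n - j)) * x j \<le> S epowr (1 / a)" if "j \<le> n" for j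
  proof -
   have "(\<eta> ^ (n - j)) powr a = (\<eta> powr a) powr real (n - j)"
    unfolding powr_realpow[OF \<eta>(1), symmetric] powr_powr by (simp only: mult.commute)
   then have "(\<eta> ^ (n - j)) powr a = \<theta> ^ (n - j)"
    using \<theta> by (simp only: \<eta>(2) powr_realpow)
   then have "(ennreal (\<eta> ^ (n - j)) * x j) epowr a = ennreal (\<theta> ^ (n - j)) * x j epowr a"
    using \<eta> assms by (simp add: epowr_mult ennreal_epowr_pos)
   also have "\<dots> \<le> S" unfolding S_def using that by (intro member_le_sum) auto
   finally show ?thesis using assms by (simp add: epowr_le_swap)
  qed
  have "(\<Sum>j\<le>n. ennreal (\<mu> ^ (n - j)) * x j) \<le> (\<Sum>j\<le>n. ennreal (\<rho> ^ (n - j)) * S epowr (1 / a))"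
  proof (intro sum_mono)
   fix j assume "j \<in> {..n}"
   have "\<mu> ^ (n - j) = \<rho> ^ (n - j) * \<eta> ^ (n - j)"
    using \<eta> by (simp add: \<rho>_def flip: power_mult_distrib)
   then have "ennreal (\<mu> ^ (n - j)) * x j = ennreal (\<rho> ^ (n - j)) * (ennreal (\<eta> ^ (n - j)) * x j)"
    using \<rho> \<eta> by (simp add: ennreal_mult mult.assoc)
   also have "\<dots> \<le> ennreal (\<rho> ^ (n - j)) * S epowr (1 / a)"
    using trm \<open>j \<in> {..n}\<close> by (intro mult_left_mono) auto
   finally show "ennreal (\<mu> ^ (n - j)) * x j \<le> ennreal (\<rho> ^ (n - j)) * S epowr (1 / a)" .
  qed
  also have "\<dots> = ennreal (\<Sum>j\<le>n. \<rho> ^ (n - j)) * S epowr (1 / a)"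
   using \<rho> by (simp add: sum_ennreal flip: sum_distrib_right)
  also have "\<dots> \<le> ennreal (1 / (1 - \<rho>)) * S epowr (1 / a)"
   using \<rho> by (intro mult_right_mono ennreal_leI sum_geometric_reverse_le) auto
  finally have "(\<Sum>j\<le>n. ennreal (\<mu> ^ (n - j)) * x j) epowr a
    \<le> (ennreal (1 / (1 - \<rho>)) * S epowr (1 / a)) epowr a"
   using assms by (intro epowr_mono) auto
  also have "\<dots> = ennreal (1 / (1 - \<rho>)) epowr a * S"
   using assms by (simp add: epowr_mult epowr_inverse')
  finally show ?thesis by (simp add: S_def)
 qed
 moreover have "ennreal (1 / (1 - \<rho>)) epowr a < top" using assms by (intro epowr_less_top) auto
 ultimately show ?thesis by blast
qed

lemma suminf_geometric_ennreal:
 "0 \<le> \<rho> ==> \<rho> < 1 ==> (\<Sum>k. ennreal (\<rho> ^ k)) = ennreal (1 / (1 - \<rho>))"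
 by (subst suminf_ennreal2) (auto simp: suminf_geometric)

text \<open>After the exchange of the sums, \<omega> n \<le> lam^(n - j) \<omega> j turns the sum
  over n into a geometric series of ratio lam * \<theta>.\<close>

lemma suminf_geometric_convolution:
 fixes lam \<theta> :: real and \<omega> y :: "nat => ennreal"
 assumes "0 < lam" "0 < \<theta>" "lam * \<theta> < 1" and dec: "\<And>n. \<omega> (Suc n) \<le> ennreal lam * \<omega> n"
 shows "(\<Sum>n. \<omega> n * (\<Sum>j\<le>n. ennreal (\<theta> ^ (n - j)) * y j)) \<le> ennreal (1 / (1 - lam * \<theta>)) * (\<Sum>n. \<omega> n * y n)"
proof -
 have decay: "\<omega> (j + k) \<le> ennreal (lam ^ k) * \<omega> j" for j k
 proof (induction k)
  case (Suc k)
  have "\<omega> (j + Suc k) \<le> ennreal lam * \<omega> (j + k)" using dec by simp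
  also have "\<dots> \<le> ennreal lam * (ennreal (lam ^ k) * \<omega> j)" by (intro mult_left_mono Suc) auto
  finally show ?case using assms by (simp add: ennreal_mult mult.assoc)
 qed simp
 have "(\<Sum>n. \<omega> n * (\<Sum>j\<le>n. ennreal (\<theta> ^ (n - j)) * y j))
   = (\<Sum>n. \<Sum>j. if j \<le> n then \<omega> n * (ennreal (\<theta> ^ (n - j)) * y j) else 0)"
 proof (intro suminf_cong)
  fix n
  have "(\<Sum>j. if j \<le> n then \<omega> n * (ennreal (\<theta> ^ (n - j)) * y j) else 0)
    = (\<Sum>j\<le>n. if j \<le> n then \<omega> n * (ennreal (\<theta> ^ (n - j)) * y j) else 0)"
   by (intro suminf_finite) auto
  then show "\<omega> n * (\<Sum>j\<le>n. ennreal (\<theta> ^ (n - j)) * y j)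
    = (\<Sum>j. if j \<le> n then \<omega> n * (ennreal (\<theta> ^ (n - j)) * y j) else 0)"
   by (simp add: sum_distrib_left)
 qed
 also have "\<dots> = (\<Sum>j. \<Sum>n. if j \<le> n then \<omega> n * (ennreal (\<theta> ^ (n - j)) * y j) else 0)"
  by (rule suminf_swap_ennreal)
 also have "\<dots> \<le> (\<Sum>j. \<Sum>n. if j \<le> n then ennreal ((lam * \<theta>) ^ (n - j)) * (\<omega> j * y j) else 0)"
 proof (intro suminf_le summableI)
  fix j n :: nat
  show "(if j \<le> n then \<omega> n * (ennreal (\<theta> ^ (n - j)) * y j) else 0)
    \<le> (if j \<le> n then ennreal ((lam * \<theta>) ^ (n - j)) * (\<omega> j * y j) else 0)"
  proof (cases "j \<le> n")
   case True
   then have "\<omega> n \<le> ennreal (lam ^ (n - j)) * \<omega> j" using decay[of j "n - j"] by simp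
   then have "\<omega> n * (ennreal (\<theta> ^ (n - j)) * y j) \<le> ennreal (lam ^ (n - j)) * \<omega> j * (ennreal (\<theta> ^ (n - j)) * y j)"
    by (rule mult_right_mono) simp
   also have "\<dots> = ennreal ((lam * \<theta>) ^ (n - j)) * (\<omega> j * y j)"
    using assms by (simp add: power_mult_distrib ennreal_mult mult_ac)
   finally show ?thesis using True by simp
  qed simp
 qed
 also have "\<dots> = (\<Sum>j. \<Sum>k. ennreal ((lam * \<theta>) ^ k) * (\<omega> j * y j))"
  by (intro suminf_cong suminf_shift_ennreal)
 also have "\<dots> = (\<Sum>j. ennreal (1 / (1 - lam * \<theta>)) * (\<omega> j * y j))"
  using assms by (intro suminf_cong) (simp only: ennreal_suminf_multc suminf_geometric_ennreal mult_nonneg_nonneg less_imp_le)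
 finally show ?thesis by simp
qed

lemma suminf_geometric_epowr:
 fixes lam \<mu> a :: real
 assumes "0 < lam" "0 < \<mu>" "0 < a" "lam * \<mu> powr a < 1"
 shows "\<exists>c<top. \<forall>\<omega> x. (\<forall>n. \<omega> (Suc n) \<le> ennreal lam * \<omega> n) -->
  (\<Sum>n. \<omega> n * (\<Sum>j\<le>n. ennreal (\<mu> ^ (n - j)) * x j) epowr a) \<le> c * (\<Sum>n. \<omega> n * x n epowr a)"
proof -
 \<comment> \<open>Passing the power inside the sum costs a little growth, from \<mu>^a to \<theta>;
   the gap below 1 / lam leaves room for it.\<close>
 obtain \<theta> where \<theta>: "\<mu> powr a < \<theta>" "\<theta> < 1 / lam"
  using dense[of "\<mu> powr a" "1 / lam"] assms by (auto simp: field_simps)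
 have "0 < \<theta>" using \<theta> assms powr_gt_zero[of \<mu> a] by linarith
 have l\<theta>: "lam * \<theta> < 1" using \<theta> assms by (simp add: field_simps)
 show ?thesis
 proof (rule ex_finiteE[OF sum_epowr_geometric[OF assms(2,3) \<theta>(1)]], goal_cases)
 case (1 c)
 note c = 1(1) 1(2)[rule_format (no_asm)]
 show ?thesis
 proof (intro exI[of _ "c * ennreal (1 / (1 - lam * \<theta>))"] conjI allI impI)
  show "c * ennreal (1 / (1 - lam * \<theta>)) < top" using c by (simp add: ennreal_mult_less_top)
  fix \<omega> x :: "nat => ennreal" assume dec: "\<forall>n. \<omega> (Suc n) \<le> ennreal lam * \<omega> n"
  have "(\<Sum>n. \<omega> n * (\<Sum>j\<le>n. ennreal (\<mu> ^ (n - j)) * x j) epowr a)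
    \<le> (\<Sum>n. c * (\<omega> n * (\<Sum>j\<le>n. ennreal (\<theta> ^ (n - j)) * x j epowr a)))"
  proof (intro suminf_le summableI)
   fix n
   have "\<omega> n * (\<Sum>j\<le>n. ennreal (\<mu> ^ (n - j)) * x j) epowr a
     \<le> \<omega> n * (c * (\<Sum>j\<le>n. ennreal (\<theta> ^ (n - j)) * x j epowr a))"
    by (intro mult_left_mono c(2)) simp
   then show "\<omega> n * (\<Sum>j\<le>n. ennreal (\<mu> ^ (n - j)) * x j) epowr a
     \<le> c * (\<omega> n * (\<Sum>j\<le>n. ennreal (\<theta> ^ (n - j)) * x j epowr a))"
    by (simp only: mult.left_commute)
  qed
  also have "\<dots> \<le> c * (ennreal (1 / (1 - lam * \<theta>)) * (\<Sum>n. \<omega> n * x n epowr a))"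
   unfolding ennreal_suminf_cmult using dec
   by (intro mult_left_mono suminf_geometric_convolution assms \<open>0 < \<theta>\<close> l\<theta>) auto
  finally show "(\<Sum>n. \<omega> n * (\<Sum>j\<le>n. ennreal (\<mu> ^ (n - j)) * x j) epowr a)
    \<le> c * ennreal (1 / (1 - lam * \<theta>)) * (\<Sum>n. \<omega> n * x n epowr a)"
   by (simp add: mult.assoc)
 qed
 qed
qed

text \<open>The distribution function of an atomless finite measure is continuous and runs from 0 to
  M, so the intermediate value theorem applies. Nodes of the grid and blocks of the Hardy inequality
  both come from here.\<close>

lemma diffuse_tail_point:
 assumes d: "diffuse \<nu>" and M: "\<nu> UNIV = ennreal M" and c: "0 < c" "c < M"
 shows "\<exists>x. \<nu> {x<..} = ennreal c"
proof -
 note s = diffuseD(1)[OF d]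
 have sp: "space \<nu> = UNIV" using s by (rule space_borel_like)
 interpret finite_borel_measure \<nu>
  by (intro finite_borel_measure.intro finite_measureI)
   (simp_all add: M sp s finite_borel_measure_axioms_def)
 have cont: "continuous_on UNIV (cdf \<nu>)"
  using diffuseD(2)[OF d] by (intro continuous_at_imp_continuous_on ballI) (simp add: isCont_cdf measure_def)
 have mM: "measure \<nu> (space \<nu>) = M" using M c sp by (simp add: measure_def)
 have "eventually (\<lambda>x. cdf \<nu> x < M - c) at_bot"
  using cdf_lim_at_bot c by (intro order_tendstoD) auto
 then obtain a where a: "cdf \<nu> a < M - c" by (metis eventually_at_bot_linorder order_refl)
 have "eventually (\<lambda>x. M - c < cdf \<nu> x) at_top"
  using cdf_lim_at_top c mM by (intro order_tendstoD[where y = M]) auto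
 then obtain b where b: "M - c < cdf \<nu> b" by (metis eventually_at_top_linorder order_refl)
 have "a \<le> b" using a b cdf_nondecreasing[of b a] by (cases "a \<le> b") auto
 then obtain x where x: "cdf \<nu> x = M - c"
  using IVT'[of "cdf \<nu>" a "M - c" b] a b cont by (auto intro: continuous_on_subset)
 have "{x<..} = space \<nu> - {..x}" by (auto simp: sp)
 then have "measure \<nu> {x<..} = M - cdf \<nu> x"
  using s mM by (simp only: cdf_def) (subst finite_measure_compl, auto)
 then have "measure \<nu> {x<..} = c" using x by simp
 then show ?thesis by (metis emeasure_eq_measure)
qed

section \<open>Hardy inequalities\<close>

text \<open>The dual Hardy operator, normalised by h = g v^(1 - p'): then h dx = g ds, and the
  weighted norm of h becomes the plain L^p(s) norm of g.\<close>

definition copson :: "real measure => (real => ennreal) => real => ennreal" where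
 "copson s g x = (\<integral>\<^sup>+y\<in>{x<..}. g y \<partial>s)"

lemma copson_density:
 assumes "sets s = sets borel" "g \<in> borelfun"
 shows "copson s g x = (density s g) {x<..}"
 unfolding copson_def using assms
 by (subst emeasure_density) (auto intro: measurable_borel_like)

lemma copson_antimono: "x \<le> y ==> copson s g y \<le> copson s g x"
 unfolding copson_def by (intro nn_integral_mono) (auto split: split_indicator)

lemma measurable_copson: "copson s g \<in> borelfun"
 by (rule borel_measurable_antimono_ennreal) (rule antimonoI, rule copson_antimono)

lemma diffuse_density:
 assumes d: "diffuse s" and g: "g \<in> borelfun"
 shows "diffuse (density s g)"
proof -
 note s = diffuseD(1)[OF d]
 have g': "g \<in> borel_measurable s" using s g by (rule measurable_borel_like)
 have "(density s g) {x} = 0" for x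
 proof -
  have "{x} \<in> null_sets s" using s diffuseD(2)[OF d, of x] by auto
  then have "AE y in s. y \<notin> {x}" by (rule AE_not_in)
  then have "AE y in s. g y * indicator {x} y = 0" by eventually_elim auto
  then have "(\<integral>\<^sup>+y. g y * indicator {x} y \<partial>s) = 0"
   using g' s by (subst nn_integral_0_iff_AE) auto
  then show ?thesis using g' s by (subst emeasure_density) auto
 qed
 then show ?thesis using s by (simp add: diffuse_def)
qed

lemma copson_split:
 assumes s: "sets s = sets borel" and g: "g \<in> borelfun" and "x \<le> y"
 shows "copson s g x = (\<integral>\<^sup>+z\<in>{x<..y}. g z \<partial>s) + copson s g y"
proof -
 have g': "g \<in> borel_measurable s" using s g by (rule measurable_borel_like)
 have "(density s g) {x<..y} + (density s g) {y<..} = (density s g) ({x<..y} \<union> {y<..})"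
  using s by (intro plus_emeasure) auto
 moreover have "{x<..y} \<union> {y<..} = {x<..}" using \<open>x \<le> y\<close> by auto
 moreover have "(density s g) {x<..y} = (\<integral>\<^sup>+z\<in>{x<..y}. g z \<partial>s)"
  using s g' by (intro emeasure_density) auto
 ultimately show ?thesis by (simp add: copson_density[OF s g])
qed

lemma Hoelder_set:
 fixes s :: "real measure"
 assumes s: "sets s = sets borel" and g: "g \<in> borelfun" and E: "E \<in> sets borel" and p: "1 < p"
 shows "(\<integral>\<^sup>+y\<in>E. g y \<partial>s) \<le> (\<integral>\<^sup>+y\<in>E. g y epowr p \<partial>s) epowr (1 / p) * s E epowr ((p - 1) / p)"
proof -
 have g': "g \<in> borel_measurable (restr s E)" by (rule measurable_borel_like[OF _ g]) (simp add: s)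
 have "(\<integral>\<^sup>+y. (g y epowr p) epowr (1 / p) * 1 epowr (1 - 1 / p) \<partial>restr s E)
  \<le> (\<integral>\<^sup>+y. g y epowr p \<partial>restr s E) epowr (1 / p) * (\<integral>\<^sup>+y. 1 \<partial>restr s E) epowr (1 - 1 / p)"
  using p g' by (intro Hoelder_nn_integral) auto
 moreover have "(\<integral>\<^sup>+y. (g y epowr p) epowr (1 / p) * 1 epowr (1 - 1 / p) \<partial>restr s E) = (\<integral>\<^sup>+y\<in>E. g y \<partial>s)"
  using p s g E by (simp add: epowr_inverse nn_integral_restr)
 moreover have "(\<integral>\<^sup>+y. g y epowr p \<partial>restr s E) = (\<integral>\<^sup>+y\<in>E. g y epowr p \<partial>s)"
  using s g E by (intro nn_integral_restr) auto
 moreover have "(\<integral>\<^sup>+y. 1 \<partial>restr s E) = s E"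
  using s E by (simp add: emeasure_restr space_borel_like)
 moreover have "1 - 1 / p = (p - 1) / p" using p by (simp add: field_simps)
 ultimately show ?thesis by simp
qed

lemma disjoint_family_Ioc:
 fixes z :: "nat => real"
 assumes "\<And>k. z k \<le> z (Suc k)"
 shows "disjoint_family (\<lambda>k. {z k<..z (Suc k)})"
proof -
 have m: "z i \<le> z j" if "i \<le> j" for i j using lift_Suc_mono_le[of z, OF assms that] .
 have "{z i<..z (Suc i)} \<inter> {z j<..z (Suc j)} = {}" if "i < j" for i j
  using m[of "Suc i" j] that by auto
 then show ?thesis unfolding disjoint_family_on_def by (metis Int_commute linorder_neqE_nat)
qed

text \<open>The blocking argument common to both ranges of q. E k is the set where the Copson
  integral lies between M / 2^(k + 1) and M / 2^k, y k the point where it equals M / 2^(k + 1), and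
  N k the p-th power norm of g over the block from y k to y (k + 1). Hoelder on the block bounds the
  integral on E k. Nothing is asked of \<mu> beyond the Borel sets, so it may be discrete.\<close>

lemma Hardy_blocks:
 assumes q: "0 < q" and p: "1 < p" and \<mu>: "sets \<mu> = sets borel" and d: "diffuse s"
  and g: "g \<in> borelfun" and M: "copson s g a = ennreal M" "0 < M"
 shows "\<exists>(E::nat => real set) y N. (\<forall>k. E k \<in> sets borel) \<and> disjoint_family E \<and> (\<forall>k. E k \<subseteq> {a..y k}) \<and>
  (\<Sum>k. N k) \<le> (\<integral>\<^sup>+y\<in>{a<..}. g y epowr p \<partial>s) \<and>
  (\<integral>\<^sup>+x\<in>{a..}. copson s g x epowr q \<partial>\<mu>) \<le>
   4 epowr q * (\<Sum>k. N k epowr (q / p) * (s {y k<..} epowr (q * (p - 1) / p) * \<mu> (E k)))"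
proof -
 note s = diffuseD(1)[OF d]
 \<comment> \<open>Atomless because s is; its tail function, the Copson integral cut at a, therefore
   takes every dyadic fraction of M.\<close>
 define \<nu> where "\<nu> = restr (density s g) {a<..}"
 have dn: "diffuse \<nu>" unfolding \<nu>_def by (intro diffuse_restr diffuse_density d g) auto
 have \<nu>: "\<nu> {x<..} = copson s g (max a x)" for x
 proof -
  have "{a<..} \<inter> {x<..} = {max a x<..}" by auto
  then show ?thesis using s g unfolding \<nu>_def
   by (subst emeasure_restr) (auto simp: copson_density)
 qed
 have "\<nu> UNIV = (density s g) ({a<..} \<inter> UNIV)"
  unfolding \<nu>_def using s by (intro emeasure_restr) auto
 then have \<nu>M: "\<nu> UNIV = ennreal M" using M s g by (simp add: copson_density)
 have "\<exists>x. \<nu> {x<..} = ennreal (M / 2 ^ (k + 1))" for k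
 proof (rule diffuse_tail_point[OF dn \<nu>M])
  have "1 < (2::real) ^ (k + 1)" by (rule one_less_power) auto
  then show "M / 2 ^ (k + 1) < M" using M by (simp add: field_simps del: power_Suc)
 qed (use M in auto)
 then obtain z where z: "\<And>k. \<nu> {z k<..} = ennreal (M / 2 ^ (k + 1))" by metis
 have lt: "M / 2 ^ (k + 1) < M" for k
 proof -
  have "1 < (2::real) ^ (k + 1)" by (rule one_less_power) auto
  then show "M / 2 ^ (k + 1) < M" using M by (simp add: field_simps del: power_Suc)
 qed
 have za: "a < z k" for k
 proof (rule ccontr)
  assume "\<not> a < z k"
  then have "ennreal M = ennreal (M / 2 ^ (k + 1))" using z[of k] \<nu>[of "z k"] M(1) by (simp add: max_def)
  then show False using lt[of k] M(2) by (simp add: ennreal_inj del: power_Suc)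
 qed
 have Hz: "copson s g (z k) = ennreal (M / 2 ^ (k + 1))" for k
  using z[of k] \<nu>[of "z k"] za[of k] by (simp add: max_def del: power_Suc)
 have mono: "z k \<le> z (Suc k)" for k
 proof (rule ccontr)
  assume "\<not> z k \<le> z (Suc k)"
  then have "copson s g (z k) \<le> copson s g (z (Suc k))" by (intro copson_antimono) auto
  then show False unfolding Hz using M(2) by (simp add: ennreal_le_iff field_simps)
 qed
 define N where "N = (\<lambda>k. \<integral>\<^sup>+y\<in>{z k<..z (Suc k)}. g y epowr p \<partial>s)"
 define E where "E = (\<lambda>k. {x. a \<le> x \<and> ennreal (M / 2 ^ (k + 1)) < copson s g x \<and> copson s g x \<le> ennreal (M / 2 ^ k)})"
 note mc [measurable] = measurable_copson[of s g]
 have E1: "E k \<in> sets borel" for k unfolding E_def by measurable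
 have E2: "E k \<subseteq> {a..z k}" for k
 proof
  fix x assume x: "x \<in> E k"
  have "\<not> z k < x"
  proof
   assume "z k < x"
   then have "copson s g x \<le> ennreal (M / 2 ^ (k + 1))" unfolding Hz[symmetric] by (intro copson_antimono) auto
   then show False using x by (auto simp: E_def)
  qed
  then show "x \<in> {a..z k}" using x by (auto simp: E_def)
 qed
 have E3: "disjoint_family E"
 proof -
  have "E i \<inter> E j = {}" if "i < j" for i j
  proof -
   have "(2::real) ^ (i + 1) \<le> 2 ^ j" using that by (intro power_increasing) auto
   then have "M / 2 ^ j \<le> M / 2 ^ (i + 1)" using M by (intro divide_left_mono) auto
   then have "ennreal (M / 2 ^ j) \<le> ennreal (M / 2 ^ (i + 1))" by (rule ennreal_leI)
   then show ?thesis unfolding E_def by (auto simp del: power_Suc)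
  qed
  then show ?thesis unfolding disjoint_family_on_def by (metis Int_commute linorder_neqE_nat)
 qed
 have N1: "(\<Sum>k. N k) \<le> (\<integral>\<^sup>+y\<in>{a<..}. g y epowr p \<partial>s)"
 proof -
  have "(\<Sum>k. N k) = (\<integral>\<^sup>+y\<in>(\<Union>k. {z k<..z (Suc k)}). g y epowr p \<partial>s)"
   unfolding N_def using s g
   by (intro nn_integral_disjoint_family[symmetric] disjoint_family_Ioc mono
     borel_measurable_epowr measurable_borel_like[OF s g]) auto
  also have "\<dots> \<le> (\<integral>\<^sup>+y\<in>{a<..}. g y epowr p \<partial>s)"
   using za by (intro nn_integral_mono) (auto split: split_indicator dest: less_trans)
  finally show ?thesis .
 qed
 \<comment> \<open>Across the block the Copson integral falls from M / 2^(k + 1) to M / 2^(k + 2),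
   so the block contributes M / 2^(k + 2), a quarter of the bound M / 2^k valid on E k. Hence the
   factor 4.\<close>
 have block: "ennreal (M / 2 ^ k) \<le> 4 * (N k epowr (1 / p) * s {z k<..} epowr ((p - 1) / p))" for k
 proof -
  let ?b = "\<integral>\<^sup>+y\<in>{z k<..z (Suc k)}. g y \<partial>s"
  let ?m = "ennreal (M / 2 ^ (k + 2))"
  have "ennreal (M / 2 ^ (k + 1)) = ?b + ?m"
   using copson_split[OF s g mono[of k]] unfolding Hz by (simp add: add.commute)
  moreover have "ennreal (M / 2 ^ (k + 1)) = ?m + ?m"
   using M by (subst ennreal_plus[symmetric]) (auto simp: field_simps)
  ultimately have "?m + ?m = ?m + ?b" by (simp only: add.commute)
  then have b: "?m = ?b" by (simp add: ennreal_add_left_cancel)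
  have "ennreal (M / 2 ^ k) = ennreal (4 * (M / 2 ^ (k + 2)))" by (simp add: field_simps)
  also have "\<dots> = 4 * ?m" using M by (subst ennreal_mult) auto
  also have "\<dots> = 4 * ?b" by (simp only: b)
  also have "\<dots> \<le> 4 * (N k epowr (1 / p) * s {z k<..z (Suc k)} epowr ((p - 1) / p))"
   unfolding N_def by (intro mult_left_mono Hoelder_set s g p) auto
  also have "\<dots> \<le> 4 * (N k epowr (1 / p) * s {z k<..} epowr ((p - 1) / p))"
   using p s by (intro mult_left_mono epowr_mono emeasure_mono) auto
  finally show ?thesis .
 qed
 let ?t = "\<lambda>k. 4 epowr q * (N k epowr (q / p) * s {z k<..} epowr (q * (p - 1) / p))"
 have pw: "copson s g x epowr q * indicator {a..} x \<le> (\<Sum>k. ?t k * indicator (E k) x)" for x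
 proof (cases "a \<le> x \<and> copson s g x \<noteq> 0")
  case True
  have "copson s g x \<le> ennreal M" unfolding M(1)[symmetric] using True by (intro copson_antimono) auto
  then obtain y where y: "copson s g x = ennreal y" "0 < y" "y \<le> M"
   using True M(2) by (cases "copson s g x" rule: ennreal_pos_cases) (auto simp: top_unique)
  then obtain k where k: "M / 2 ^ (k + 1) < y" "y \<le> M / 2 ^ k" using dyadic_level by blast
  have xE: "x \<in> E k" using True y k M(2) unfolding E_def by (auto simp: ennreal_less_iff intro!: ennreal_leI)
  have "copson s g x epowr q \<le> ennreal (M / 2 ^ k) epowr q"
   using xE q by (intro epowr_mono) (auto simp: E_def)
  also have "\<dots> \<le> (4 * (N k epowr (1 / p) * s {z k<..} epowr ((p - 1) / p))) epowr q"
   using q by (intro epowr_mono block) auto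
  also have "\<dots> = ?t k"
   using q by (simp add: epowr_mult epowr_epowr mult.commute)
  also have "\<dots> = ?t k * indicator (E k) x" using xE by simp
  also have "\<dots> \<le> (\<Sum>k. ?t k * indicator (E k) x)" by (rule le_suminf_term)
  finally show ?thesis using True by simp
 qed (use q in auto)
 have "(\<integral>\<^sup>+x\<in>{a..}. copson s g x epowr q \<partial>\<mu>) \<le> (\<integral>\<^sup>+x. (\<Sum>k. ?t k * indicator (E k) x) \<partial>\<mu>)"
  using pw by (intro nn_integral_mono) auto
 also have "\<dots> = (\<Sum>k. ?t k * \<mu> (E k))"
  using E1 \<mu> by (subst nn_integral_suminf) (auto simp: nn_integral_cmult_indicator)
 also have "\<dots> = 4 epowr q * (\<Sum>k. N k epowr (q / p) * (s {z k<..} epowr (q * (p - 1) / p) * \<mu> (E k)))"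
  by (simp only: mult.assoc ennreal_suminf_cmult)
 finally show ?thesis using E1 E2 E3 N1 by blast
qed

text \<open>As E k lies in {a..y k}, every coefficient in \<open>Hardy_blocks\<close> is at most B;
  the powers N k^(q / p) are then summed by the embedding for q / p \<ge> 1.\<close>

lemma Hardy_upper_le:
 assumes q: "0 < q" and p: "1 < p" "p \<le> q" and \<mu>: "sets \<mu> = sets borel" and d: "diffuse s"
  and g: "g \<in> borelfun" and fin: "s {a<..} < top"
  and N: "(\<integral>\<^sup>+y\<in>{a<..}. g y epowr p \<partial>s) < top"
  and B: "\<And>x. a \<le> x ==> \<mu> {a..x} * s {x<..} epowr (q * (p - 1) / p) \<le> B"
 shows "(\<integral>\<^sup>+x\<in>{a..}. copson s g x epowr q \<partial>\<mu>) \<le> 4 epowr q * (B * (\<integral>\<^sup>+y\<in>{a<..}. g y epowr p \<partial>s) epowr (q / p))"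
proof -
 note s = diffuseD(1)[OF d]
 let ?N = "\<integral>\<^sup>+y\<in>{a<..}. g y epowr p \<partial>s"
 \<comment> \<open>Finite tail of s and finite norm of g make the value at a finite, so there is a
   top level M from which to count the dyadic levels.\<close>
 have "copson s g a \<le> ?N epowr (1 / p) * s {a<..} epowr ((p - 1) / p)"
  unfolding copson_def using s g p by (intro Hoelder_set) auto
 also have "\<dots> < top" using N fin p by (intro mult_less_top_ennreal epowr_less_top) auto
 finally have ca: "copson s g a < top" .
 show ?thesis
 proof (cases "copson s g a" rule: ennreal_pos_cases)
  case zero
  have "copson s g x epowr q * indicator {a..} x = 0" for x
   using copson_antimono[of a x s g] zero q by (auto split: split_indicator)
  then have "(\<integral>\<^sup>+x\<in>{a..}. copson s g x epowr q \<partial>\<mu>) = (\<integral>\<^sup>+x. 0 \<partial>\<mu>)"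
   by (rule nn_integral_cong)
  then show ?thesis by simp
 next
  case (real M)
  obtain E :: "nat => real set" and y N where "(\<forall>k. E k \<in> sets borel) \<and> disjoint_family E \<and> (\<forall>k. E k \<subseteq> {a..y k}) \<and>
   (\<Sum>k. N k) \<le> ?N \<and> (\<integral>\<^sup>+x\<in>{a..}. copson s g x epowr q \<partial>\<mu>) \<le>
    4 epowr q * (\<Sum>k. N k epowr (q / p) * (s {y k<..} epowr (q * (p - 1) / p) * \<mu> (E k)))"
   using Hardy_blocks[OF q p(1) \<mu> d g real(2,1)] by (elim exE) (rule that)
  then have E: "\<And>k. E k \<in> sets borel" "disjoint_family E" "\<And>k. E k \<subseteq> {a..y k}"
   and N: "(\<Sum>k. N k) \<le> ?N"
   and le: "(\<integral>\<^sup>+x\<in>{a..}. copson s g x epowr q \<partial>\<mu>) \<le>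
    4 epowr q * (\<Sum>k. N k epowr (q / p) * (s {y k<..} epowr (q * (p - 1) / p) * \<mu> (E k)))"
   by (simp_all only: simp_thms)
  have *: "s {y k<..} epowr (q * (p - 1) / p) * \<mu> (E k) \<le> B" for k
  proof (cases "a \<le> y k")
   case True
   have "\<mu> (E k) \<le> \<mu> {a..y k}" using E(3) \<mu> by (intro emeasure_mono) auto
   then have "\<mu> (E k) * s {y k<..} epowr (q * (p - 1) / p)
     \<le> \<mu> {a..y k} * s {y k<..} epowr (q * (p - 1) / p)"
    by (rule mult_right_mono) simp
   also have "\<dots> \<le> B" by (rule B[OF True])
   finally show ?thesis by (simp only: mult.commute)
  next
   case False
   then have "E k = {}" using E(3)[of k] by auto
   then show ?thesis by simp
  qed
  have "(\<Sum>k. N k epowr (q / p) * (s {y k<..} epowr (q * (p - 1) / p) * \<mu> (E k)))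
    \<le> (\<Sum>k. N k epowr (q / p) * B)"
   by (intro suminf_le summableI mult_left_mono *) simp
  also have "\<dots> = B * (\<Sum>k. N k epowr (q / p))" by (simp add: mult.commute)
  also have "\<dots> \<le> B * (\<Sum>k. N k) epowr (q / p)"
   using p q by (intro mult_left_mono suminf_epowr_le) auto
  also have "\<dots> \<le> B * ?N epowr (q / p)"
   using p q N by (intro mult_left_mono epowr_mono) auto
  finally show ?thesis by (intro order.trans[OF le] mult_left_mono) auto
 next
  case top then show ?thesis using ca by simp
 qed
qed

text \<open>Hoelder with \<theta> = q / p separates the N k from the coefficients G k. The power
  \<mu> (E k)^(p / (p - q)) that appears is turned back into an integral over E k by
  \<open>head_power_gen\<close>, and these integrals add up because the E k are disjoint.\<close>

lemma Hardy_upper_lt: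
 assumes q: "0 < q" and p: "1 < p" "q < p"
 shows "\<exists>c<top. \<forall>\<mu> s g a. sets \<mu> = sets borel --> diffuse s --> g \<in> borelfun -->
  s {a<..} < top --> (\<integral>\<^sup>+y\<in>{a<..}. g y epowr p \<partial>s) < top --> (\<forall>x. \<mu> {a..x} < top) -->
  (\<integral>\<^sup>+x\<in>{a..}. copson s g x epowr q \<partial>\<mu>) \<le> c * ((\<integral>\<^sup>+y\<in>{a<..}. g y epowr p \<partial>s) epowr (q / p) *
   (\<integral>\<^sup>+x\<in>{a..}. \<mu> {a..x} epowr (q / (p - q)) * s {x<..} epowr (q * (p - 1) / (p - q)) \<partial>\<mu>) epowr ((p - q) / p))"
proof -
 have "0 < q / (p - q)" using q p by simp
 then have e: "-1 < q / (p - q)" by linarith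
 show ?thesis
 proof (rule ex_finiteE[OF head_power_gen[OF e]], goal_cases)
 case (1 c0)
 note c0 = 1(1) and hp = 1(2)[rule_format (no_asm)]
 have ex: "q / (p - q) + 1 = p / (p - q)" "1 / (1 - q / p) = p / (p - q)" "1 - q / p = (p - q) / p"
  "q * (p - 1) / p * (p / (p - q)) = q * (p - 1) / (p - q)"
  using p q by (auto simp: field_simps)
 show ?thesis
 proof (intro exI[of _ "4 epowr q * c0 epowr ((p - q) / p)"] conjI allI impI)
  show "4 epowr q * c0 epowr ((p - q) / p) < top"
   using c0 p by (intro mult_less_top_ennreal epowr_less_top[OF _ c0]) auto
  fix \<mu> s g a
  assume \<mu>: "sets \<mu> = sets borel" and d: "diffuse s" and g: "g \<in> borelfun"
   and fin: "s {a<..} < top" and N: "(\<integral>\<^sup>+y\<in>{a<..}. g y epowr p \<partial>s) < top"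
   and \<mu>fin: "\<forall>x. \<mu> {a..x} < top"
  note s = diffuseD(1)[OF d]
  let ?N = "\<integral>\<^sup>+y\<in>{a<..}. g y epowr p \<partial>s"
  let ?f = "\<lambda>x. \<mu> {a..x} epowr (q / (p - q)) * s {x<..} epowr (q * (p - 1) / (p - q))"
  let ?A = "\<integral>\<^sup>+x\<in>{a..}. ?f x \<partial>\<mu>"
  have "copson s g a \<le> ?N epowr (1 / p) * s {a<..} epowr ((p - 1) / p)"
   unfolding copson_def using s g p by (intro Hoelder_set) auto
  also have "\<dots> < top" using N fin p by (intro mult_less_top_ennreal epowr_less_top) auto
  finally have ca: "copson s g a < top" .
  have mf: "?f \<in> borelfun"
  proof -
   have "(\<lambda>x. \<mu> {a..x}) \<in> borelfun"
    by (rule borel_measurable_mono_ennreal) (rule monoI, rule emeasure_mono, auto simp: \<mu>)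
   then show ?thesis using measurable_tail[OF s] by measurable
  qed
  show "(\<integral>\<^sup>+x\<in>{a..}. copson s g x epowr q \<partial>\<mu>) \<le>
   4 epowr q * c0 epowr ((p - q) / p) * (?N epowr (q / p) * ?A epowr ((p - q) / p))"
  proof (cases "copson s g a" rule: ennreal_pos_cases)
   case zero
   have "copson s g x epowr q * indicator {a..} x = 0" for x
    using copson_antimono[of a x s g] zero q by (auto split: split_indicator)
   then have "(\<integral>\<^sup>+x\<in>{a..}. copson s g x epowr q \<partial>\<mu>) = (\<integral>\<^sup>+x. 0 \<partial>\<mu>)"
   by (rule nn_integral_cong)
  then show ?thesis by simp
  next
   case (real M)
   obtain E :: "nat => real set" and y N where "(\<forall>k. E k \<in> sets borel) \<and> disjoint_family E \<and> (\<forall>k. E k \<subseteq> {a..y k}) \<and>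
   (\<Sum>k. N k) \<le> ?N \<and> (\<integral>\<^sup>+x\<in>{a..}. copson s g x epowr q \<partial>\<mu>) \<le>
    4 epowr q * (\<Sum>k. N k epowr (q / p) * (s {y k<..} epowr (q * (p - 1) / p) * \<mu> (E k)))"
   using Hardy_blocks[OF q p(1) \<mu> d g real(2,1)] by (elim exE) (rule that)
  then have E: "\<And>k. E k \<in> sets borel" "disjoint_family E" "\<And>k. E k \<subseteq> {a..y k}"
   and N: "(\<Sum>k. N k) \<le> ?N"
   and le: "(\<integral>\<^sup>+x\<in>{a..}. copson s g x epowr q \<partial>\<mu>) \<le>
    4 epowr q * (\<Sum>k. N k epowr (q / p) * (s {y k<..} epowr (q * (p - 1) / p) * \<mu> (E k)))"
   by (simp_all only: simp_thms)
   define G where "G = (\<lambda>k. s {y k<..} epowr (q * (p - 1) / p) * \<mu> (E k))"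
   have G: "G k epowr (p / (p - q)) \<le> c0 * (\<integral>\<^sup>+x\<in>E k. ?f x \<partial>\<mu>)" for k
   proof -
    let ?V = "s {y k<..} epowr (q * (p - 1) / (p - q))"
    have mu: "\<mu> (E k) < top"
     using emeasure_mono[OF E(3)[of k], of \<mu>] \<mu> \<mu>fin by (auto intro: le_less_trans)
    have mh: "(\<lambda>x. \<mu> (E k \<inter> {..x})) \<in> borelfun"
     by (rule borel_measurable_mono_ennreal) (rule monoI, rule emeasure_mono, auto simp: \<mu> E(1))
    have mi: "(\<lambda>x. \<mu> (E k \<inter> {..x}) epowr (q / (p - q)) * indicator (E k) x) \<in> borel_measurable \<mu>"
     by (rule measurable_borel_like[OF \<mu>]) (use mh E(1)[of k] in measurable)
    have "G k epowr (p / (p - q)) = ?V * \<mu> (E k) epowr (q / (p - q) + 1)"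
     unfolding G_def using p q by (simp add: epowr_mult epowr_epowr ex)
    also have "\<dots> \<le> ?V * (c0 * (\<integral>\<^sup>+x\<in>E k. \<mu> (E k \<inter> {..x}) epowr (q / (p - q)) \<partial>\<mu>))"
     by (intro mult_left_mono hp[THEN conjunct2] \<mu> E mu) simp
    also have "\<dots> = c0 * (\<integral>\<^sup>+x. ?V * (\<mu> (E k \<inter> {..x}) epowr (q / (p - q)) * indicator (E k) x) \<partial>\<mu>)"
     by (subst nn_integral_cmult[OF mi]) (simp only: mult.left_commute)
    also have "\<dots> \<le> c0 * (\<integral>\<^sup>+x\<in>E k. ?f x \<partial>\<mu>)"
    proof (intro mult_left_mono nn_integral_mono)
     fix x
     show "?V * (\<mu> (E k \<inter> {..x}) epowr (q / (p - q)) * indicator (E k) x) \<le> ?f x * indicator (E k) x"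
     proof (cases "x \<in> E k")
      case True
      have 1: "\<mu> (E k \<inter> {..x}) \<le> \<mu> {a..x}"
       using E(3)[of k] \<mu> by (intro emeasure_mono) auto
      have 2: "s {y k<..} \<le> s {x<..}"
       using E(3)[of k] True s by (intro emeasure_mono) auto
      have "?V * \<mu> (E k \<inter> {..x}) epowr (q / (p - q)) \<le>
        s {x<..} epowr (q * (p - 1) / (p - q)) * \<mu> {a..x} epowr (q / (p - q))"
       using p q 1 2 by (intro mult_mono epowr_mono) auto
      then show ?thesis using True by (simp add: mult.commute)
     qed simp
    qed simp
    finally show ?thesis .
   qed
   have "(\<Sum>k. N k epowr (q / p) * G k) \<le> (\<Sum>k. N k) epowr (q / p) * (\<Sum>k. G k epowr (1 / (1 - q / p))) epowr (1 - q / p)"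
    using p q by (intro Hoelder_suminf) auto
   also have "\<dots> \<le> ?N epowr (q / p) * (c0 * ?A) epowr ((p - q) / p)"
    unfolding ex(2) unfolding ex(3)
   proof (intro mult_mono epowr_mono N)
    have "(\<Sum>k. G k epowr (p / (p - q))) \<le> (\<Sum>k. c0 * (\<integral>\<^sup>+x\<in>E k. ?f x \<partial>\<mu>))"
     by (intro suminf_le summableI G)
    also have "\<dots> = c0 * (\<integral>\<^sup>+x\<in>(\<Union>k. E k). ?f x \<partial>\<mu>)"
     unfolding ennreal_suminf_cmult using E \<mu>
     by (subst nn_integral_disjoint_family[OF measurable_borel_like[OF \<mu> mf]]) auto
    also have "\<dots> \<le> c0 * ?A"
    proof (rule mult_left_mono[OF nn_integral_mono])
     have "(\<Union>k. E k) \<subseteq> {a..}"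
     proof
      fix x assume "x \<in> (\<Union>k. E k)"
      then obtain k where "x \<in> E k" by blast
      then show "x \<in> {a..}" using E(3)[of k] by auto
     qed
     then have *: "indicator (\<Union>k. E k) x \<le> (indicator {a..} x :: ennreal)" for x
      by (auto split: split_indicator)
     fix x show "?f x * indicator (\<Union>k. E k) x \<le> ?f x * indicator {a..} x"
      by (intro mult_left_mono *) simp
    qed simp
    finally show "(\<Sum>k. G k epowr (p / (p - q))) \<le> c0 * ?A" .
   qed (use p q in auto)
   also have "\<dots> = c0 epowr ((p - q) / p) * (?N epowr (q / p) * ?A epowr ((p - q) / p))"
    using p by (simp add: epowr_mult mult.left_commute)
   finally have "4 epowr q * (\<Sum>k. N k epowr (q / p) * G k)
     \<le> 4 epowr q * (c0 epowr ((p - q) / p) * (?N epowr (q / p) * ?A epowr ((p - q) / p)))"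
    by (rule mult_left_mono) simp
   then show ?thesis using le unfolding G_def by (simp only: mult.assoc)
  next
   case top then show ?thesis using ca by simp
  qed
 qed
 qed
qed

lemma nn_integral_diffuse_ctail:
 assumes d: "diffuse s" and f: "f \<in> borelfun"
 shows "(\<integral>\<^sup>+x\<in>{y..}. f x \<partial>s) = (\<integral>\<^sup>+x\<in>{y<..}. f x \<partial>s)"
proof -
 have "{y} \<in> null_sets s" using diffuseD(1)[OF d] diffuseD(2)[OF d, of y] by auto
 then have "AE x in s. x \<notin> {y}" by (rule AE_not_in)
 then have "AE x in s. f x * indicator {y..} x = f x * indicator {y<..} x"
  by eventually_elim (auto split: split_indicator)
 then show ?thesis by (rule nn_integral_cong_AE)
qed

lemma sigma_finite_heads:
 assumes u: "sets u = sets borel" and fin: "\<And>x::real. u {..x} < top"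
 shows "sigma_finite_measure u"
proof
 have "\<Union>(range (\<lambda>n::nat. {..real n})) = space u"
  using space_borel_like[OF u] real_arch_simple by auto
 moreover have "emeasure u a \<noteq> \<infinity>" if "a \<in> range (\<lambda>n::nat. {..real n})" for a
  using that fin by (auto simp: less_top)
 ultimately show "\<exists>A. countable A \<and> A \<subseteq> sets u \<and> \<Union> A = space u \<and> (\<forall>a\<in>A. emeasure u a \<noteq> \<infinity>)"
  using u by (intro exI[of _ "range (\<lambda>n::nat. {..real n})"]) auto
qed

lemma nn_integral_triangle_swap:
 assumes u: "sets u = sets borel" and s: "sets s = sets borel"
  and "sigma_finite_measure u" "sigma_finite_measure s"
  and f: "f \<in> borelfun" and h: "h \<in> borelfun"
 shows "(\<integral>\<^sup>+x. h x * (\<integral>\<^sup>+y\<in>{..x}. f y \<partial>u) \<partial>s) = (\<integral>\<^sup>+y. f y * (\<integral>\<^sup>+x\<in>{y::real..}. h x \<partial>s) \<partial>u)"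
proof -
 interpret pair_sigma_finite s u using assms by (intro pair_sigma_finite.intro)
 note [measurable_cong] = u s
 note [measurable] = f h
 have f': "f \<in> borel_measurable u" and h': "h \<in> borel_measurable s"
  by (rule measurable_borel_like[OF u f], rule measurable_borel_like[OF s h])
 have "(\<integral>\<^sup>+x. h x * (\<integral>\<^sup>+y\<in>{..x}. f y \<partial>u) \<partial>s) = (\<integral>\<^sup>+x. (\<integral>\<^sup>+y. (if y \<le> x then h x * f y else 0) \<partial>u) \<partial>s)"
 proof (intro nn_integral_cong)
  fix x
  have m: "(\<lambda>y. f y * indicator {..x} y) \<in> borel_measurable u"
   by (rule measurable_borel_like[OF u]) measurable
  have "(\<integral>\<^sup>+y. (if y \<le> x then h x * f y else 0) \<partial>u) = (\<integral>\<^sup>+y. h x * (f y * indicator {..x} y) \<partial>u)"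
   by (intro nn_integral_cong) auto
  then show "h x * (\<integral>\<^sup>+y\<in>{..x}. f y \<partial>u) = (\<integral>\<^sup>+y. (if y \<le> x then h x * f y else 0) \<partial>u)"
   by (simp add: nn_integral_cmult[OF m])
 qed
 also have "\<dots> = (\<integral>\<^sup>+y. (\<integral>\<^sup>+x. (if y \<le> x then h x * f y else 0) \<partial>s) \<partial>u)"
 proof (rule Fubini'[symmetric])
  show "(\<lambda>(x, y). if y \<le> x then h x * f y else 0) \<in> borel_measurable (s \<Otimes>\<^sub>M u)"
   by measurable
 qed
 also have "\<dots> = (\<integral>\<^sup>+y. f y * (\<integral>\<^sup>+x\<in>{y..}. h x \<partial>s) \<partial>u)"
 proof (intro nn_integral_cong)
  fix y
  have m: "(\<lambda>x. h x * indicator {y..} x) \<in> borel_measurable s"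
   by (rule measurable_borel_like[OF s]) measurable
  have "(\<integral>\<^sup>+x. (if y \<le> x then h x * f y else 0) \<partial>s) = (\<integral>\<^sup>+x. f y * (h x * indicator {y..} x) \<partial>s)"
   by (intro nn_integral_cong) (auto simp: mult.commute)
  then show "(\<integral>\<^sup>+x. (if y \<le> x then h x * f y else 0) \<partial>s) = f y * (\<integral>\<^sup>+x\<in>{y..}. h x \<partial>s)"
   by (simp add: nn_integral_cmult[OF m])
 qed
 finally show ?thesis .
qed

section \<open>Local inequalities of Maz'ya type\<close>

text \<open>The inner integrals of \<open>A4\<close> and \<open>A4_star\<close>, in terms of the measures \<open>u dx\<close> and \<open>s = v^(1 - p') dx\<close>.\<close>

definition Xs :: "real => real => real measure => real measure => real => ennreal" where
 "Xs m p u s t = (\<integral>\<^sup>+x\<in>{t<..}. u {t<..x} epowr (p / (p - m)) * s {x<..} epowr (p * (m - 1) / (p - m)) \<partial>s)"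

definition Xu :: "real => real => real measure => real measure => real => ennreal" where
 "Xu m p u s t = (\<integral>\<^sup>+x\<in>{t<..}. u {t<..x} epowr (m / (p - m)) * s {x<..} epowr (m * (p - 1) / (p - m)) \<partial>u)"

text \<open>Both sides are compared with one double integral over the triangle t < y \<le> x.
  Integrating first in y raises the exponent of the u-mass by one and gives the form over s;
  integrating first in x does the same for the tail of s and gives the form over u.\<close>

lemma Xs_Xu_equiv:
 assumes m: "0 < m" "m < p" and p: "1 < p"
 shows "\<exists>c<top. \<forall>u s t. diffuse u --> diffuse s --> (\<forall>x. u {t<..x} < top) --> s {t<..} < top -->
  Xs m p u s t \<le> c * Xu m p u s t \<and> Xu m p u s t \<le> c * Xs m p u s t"
proof -
 define a where "a = m / (p - m)"
 define e where "e = p * (m - 1) / (p - m)"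
 have a: "0 < a" "-1 < a" using m by (auto simp: a_def intro: less_trans[of _ 0])
 have a1: "a + 1 = p / (p - m)" using m by (simp add: a_def field_simps)
 have e1: "e + 1 = m * (p - 1) / (p - m)" using m by (simp add: e_def field_simps)
 \<comment> \<open>The exponent e is negative for m < 1 but still exceeds -1, since p > 1 and m >
   0.\<close>
 have "0 < e + 1" unfolding e1 using m p by simp
 then have e: "-1 < e" by simp
 show ?thesis
 proof (rule ex_finiteE[OF head_power[OF a(2)]], goal_cases)
 case (1 c1)
 note c1 = 1(1) and h = 1(2)[rule_format (no_asm)]
 show ?thesis
 proof (rule ex_finiteE[OF tail_power[OF e]], goal_cases)
 case (1 c2)
 note c2 = 1(1) and tl = 1(2)[rule_format (no_asm)]
 show ?thesis
 proof (intro exI[of _ "c1 * c2"] conjI allI impI)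
  show "c1 * c2 < top" using c1 c2 by (rule mult_less_top_ennreal)
  fix u s t assume du: "diffuse u" and ds: "diffuse s"
   and ufin: "\<forall>x. u {t<..x} < top" and sfin: "s {t<..} < top"
  note u = diffuseD(1)[OF du] and s = diffuseD(1)[OF ds]
  define u' where "u' = restr u {t<..}"
  define s' where "s' = restr s {t<..}"
  have u': "sets u' = sets borel" and s': "sets s' = sets borel" by (simp_all add: u'_def s'_def u s)
  have "u' {..x} < top" for x
  proof -
   have "{t<..} \<inter> {..x} = {t<..x}" by auto
   then show ?thesis using ufin u by (simp add: u'_def emeasure_restr)
  qed
  then have su: "sigma_finite_measure u'" by (rule sigma_finite_heads[OF u'])
  have "s' {..x} < top" for x
   unfolding s'_def using sfin s
   by (subst emeasure_restr) (auto intro: le_less_trans[OF emeasure_mono[of _ "{t<..}"]])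
  then have ss: "sigma_finite_measure s'" by (rule sigma_finite_heads[OF s'])
  have [measurable]: "(\<lambda>x. u {t<..x}) \<in> borelfun"
   "(\<lambda>x. s {x<..}) \<in> borelfun"
   by (rule measurable_Ioc[OF u], rule measurable_tail[OF s])
  let ?U = "\<lambda>x. u {t<..x}" and ?V = "\<lambda>x. s {x<..}"
  let ?I = "\<lambda>x. \<integral>\<^sup>+y\<in>{..x}. ?U y epowr a \<partial>u'" and ?J = "\<lambda>y. \<integral>\<^sup>+x\<in>{y..}. ?V x epowr e \<partial>s'"
  \<comment> \<open>The double integral of u(t,y]^a times s(x,\<infinity>)^e over y \<le> x; here a
    + 1 and e + 1 are the remaining exponents of \<open>Xs\<close> and \<open>Xu\<close>.\<close>
  define Z where "Z = (\<integral>\<^sup>+x. ?V x epowr e * ?I x \<partial>s')"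
  have Z2: "Z = (\<integral>\<^sup>+y. ?U y epowr a * ?J y \<partial>u')"
   unfolding Z_def by (rule nn_integral_triangle_swap[OF u' s' su ss]) measurable
  have I: "?I x = (\<integral>\<^sup>+y\<in>{t<..x}. ?U y epowr a \<partial>u)" for x
   unfolding u'_def using u
   by (subst nn_integral_restr) (auto intro!: nn_integral_cong split: split_indicator)
  have J: "?J y = (\<integral>\<^sup>+x\<in>{y<..}. ?V x epowr e \<partial>s)" if "t < y" for y
  proof -
   have "?J y = (\<integral>\<^sup>+x\<in>{y..}. ?V x epowr e \<partial>s)"
    unfolding s'_def using s that
    by (subst nn_integral_restr) (auto intro!: nn_integral_cong split: split_indicator)
   also have "\<dots> = (\<integral>\<^sup>+x\<in>{y<..}. ?V x epowr e \<partial>s)"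
    by (rule nn_integral_diffuse_ctail[OF ds]) measurable
   finally show ?thesis .
  qed
  have mI: "?I \<in> borelfun"
   by (rule borel_measurable_mono_ennreal)
     (rule monoI, rule nn_integral_mono, auto split: split_indicator)
  have mJ: "?J \<in> borelfun"
   by (rule borel_measurable_antimono_ennreal)
     (rule antimonoI, rule nn_integral_mono, auto split: split_indicator)
  have mVe: "(\<lambda>x. ?V x epowr e) \<in> borelfun" and mUa: "(\<lambda>x. ?U x epowr a) \<in> borelfun"
   by measurable
  have mVI: "(\<lambda>x. ?V x epowr e * ?I x) \<in> borelfun" by (rule borel_measurable_times_ennreal[OF mVe mI])
  have mUJ: "(\<lambda>x. ?U x epowr a * ?J x) \<in> borelfun" by (rule borel_measurable_times_ennreal[OF mUa mJ])
  have mi: "indicator {t<..} \<in> borel_measurable (borel :: real measure)" for t :: real by measurable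
  have Z1: "Z = (\<integral>\<^sup>+x\<in>{t<..}. ?V x epowr e * ?I x \<partial>s)"
   unfolding Z_def s'_def by (rule nn_integral_restr[OF s _ mVI]) simp
  have Z3: "Z = (\<integral>\<^sup>+y\<in>{t<..}. ?U y epowr a * ?J y \<partial>u)"
   unfolding Z2 u'_def by (rule nn_integral_restr[OF u _ mUJ]) simp
  have mU: "(\<lambda>x. ?V x epowr e * ?I x * indicator {t<..} x) \<in> borel_measurable s"
   by (rule measurable_borel_like[OF s borel_measurable_times_ennreal[OF mVI mi]])
  have mV: "(\<lambda>x. ?U x epowr (p / (p - m)) * ?V x epowr e * indicator {t<..} x) \<in> borel_measurable s"
   by (rule measurable_borel_like[OF s]) measurable
  have mW: "(\<lambda>y. ?U y epowr a * ?J y * indicator {t<..} y) \<in> borel_measurable u"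
   by (rule measurable_borel_like[OF u borel_measurable_times_ennreal[OF mUJ mi]])
  have mX: "(\<lambda>y. ?U y epowr a * ?V y epowr (m * (p - 1) / (p - m)) * indicator {t<..} y) \<in> borel_measurable u"
   by (rule measurable_borel_like[OF u]) measurable
  have Xs: "Xs m p u s t = (\<integral>\<^sup>+x\<in>{t<..}. ?U x epowr (p / (p - m)) * ?V x epowr e \<partial>s)"
   by (simp add: Xs_def e_def)
  have Xu: "Xu m p u s t = (\<integral>\<^sup>+y\<in>{t<..}. ?U y epowr a * ?V y epowr (m * (p - 1) / (p - m)) \<partial>u)"
   by (simp add: Xu_def a_def)
  have A1: "Xs m p u s t \<le> c1 * Z"
  proof -
   have "Xs m p u s t \<le> (\<integral>\<^sup>+x. c1 * (?V x epowr e * ?I x * indicator {t<..} x) \<partial>s)"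
    unfolding Xs
   proof (intro nn_integral_mono)
    fix x
    have "?U x epowr (p / (p - m)) * ?V x epowr e \<le> (c1 * ?I x) * ?V x epowr e"
     using h[OF du ufin[rule_format, of x], THEN conjunct2] unfolding I a1 by (rule mult_right_mono) simp
    also have "\<dots> = c1 * (?V x epowr e * ?I x)" by (simp only: mult_ac)
    finally show "?U x epowr (p / (p - m)) * ?V x epowr e * indicator {t<..} x
     \<le> c1 * (?V x epowr e * ?I x * indicator {t<..} x)"
     by (auto split: split_indicator)
   qed
   also have "\<dots> = c1 * Z" unfolding Z1 by (rule nn_integral_cmult[OF mU])
   finally show ?thesis .
  qed
  have A2: "Z \<le> c1 * Xs m p u s t"
  proof -
   have "Z \<le> (\<integral>\<^sup>+x. c1 * (?U x epowr (p / (p - m)) * ?V x epowr e * indicator {t<..} x) \<partial>s)"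
    unfolding Z1
   proof (intro nn_integral_mono)
    fix x
    have "?V x epowr e * ?I x \<le> ?V x epowr e * (c1 * ?U x epowr (p / (p - m)))"
     using h[OF du ufin[rule_format, of x], THEN conjunct1] unfolding I a1 by (rule mult_left_mono) simp
    also have "\<dots> = c1 * (?U x epowr (p / (p - m)) * ?V x epowr e)" by (simp only: mult_ac)
    finally show "?V x epowr e * ?I x * indicator {t<..} x
     \<le> c1 * (?U x epowr (p / (p - m)) * ?V x epowr e * indicator {t<..} x)"
     by (auto split: split_indicator)
   qed
   also have "\<dots> = c1 * Xs m p u s t" unfolding Xs by (rule nn_integral_cmult[OF mV])
   finally show ?thesis .
  qed
  have yf: "?V y < top" if "t < y" for y
   using that s sfin by (intro le_less_trans[OF emeasure_mono[of _ "{t<..}"] sfin]) auto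
  have B1: "Z \<le> c2 * Xu m p u s t"
  proof -
   have "Z \<le> (\<integral>\<^sup>+y. c2 * (?U y epowr a * ?V y epowr (m * (p - 1) / (p - m)) * indicator {t<..} y) \<partial>u)"
    unfolding Z3
   proof (intro nn_integral_mono)
    fix y
    show "?U y epowr a * ?J y * indicator {t<..} y
     \<le> c2 * (?U y epowr a * ?V y epowr (m * (p - 1) / (p - m)) * indicator {t<..} y)"
    proof (cases "t < y")
     case True
     have "?U y epowr a * ?J y \<le> ?U y epowr a * (c2 * ?V y epowr (m * (p - 1) / (p - m)))"
      using tl[OF ds yf[OF True], THEN conjunct1] unfolding J[OF True] e1 by (rule mult_left_mono) simp
     then show ?thesis using True by (simp add: mult_ac)
    qed simp
   qed
   also have "\<dots> = c2 * Xu m p u s t" unfolding Xu by (rule nn_integral_cmult[OF mX])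
   finally show ?thesis .
  qed
  have B2: "Xu m p u s t \<le> c2 * Z"
  proof -
   have "Xu m p u s t \<le> (\<integral>\<^sup>+y. c2 * (?U y epowr a * ?J y * indicator {t<..} y) \<partial>u)"
    unfolding Xu
   proof (intro nn_integral_mono)
    fix y
    show "?U y epowr a * ?V y epowr (m * (p - 1) / (p - m)) * indicator {t<..} y
     \<le> c2 * (?U y epowr a * ?J y * indicator {t<..} y)"
    proof (cases "t < y")
     case True
     have "?U y epowr a * ?V y epowr (m * (p - 1) / (p - m)) \<le> ?U y epowr a * (c2 * ?J y)"
      using tl[OF ds yf[OF True], THEN conjunct2] unfolding J[OF True] e1 by (rule mult_left_mono) simp
     then show ?thesis using True by (simp add: mult_ac)
    qed simp
   qed
   also have "\<dots> = c2 * Z" unfolding Z3 by (rule nn_integral_cmult[OF mW])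
   finally show ?thesis .
  qed
  have "c1 * Z \<le> c1 * (c2 * Xu m p u s t)" by (intro mult_left_mono B1) simp
  then have "Xs m p u s t \<le> c1 * (c2 * Xu m p u s t)" using A1 by (rule order.trans[rotated])
  then show "Xs m p u s t \<le> c1 * c2 * Xu m p u s t" by (simp only: mult.assoc)
  have "c2 * Z \<le> c2 * (c1 * Xs m p u s t)" by (intro mult_left_mono A2) simp
  then have "Xu m p u s t \<le> c2 * (c1 * Xs m p u s t)" using B2 by (rule order.trans[rotated])
  then show "Xu m p u s t \<le> c1 * c2 * Xs m p u s t" by (simp only: mult_ac)
 qed
 qed
 qed
qed

text \<open>This is the sharpness of the Hardy inequality with exponents m < p. The hypothesis that
  s vanishes beyond some M keeps the normalising integral finite; bounded cells satisfy it, and for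
  half-lines it is removed by \<open>Xu_SUP\<close>.\<close>

lemma Mazya_test_function:
 assumes m: "0 < m" "m < p" and p: "1 < p"
 shows "\<exists>c<top. \<forall>u s t M. diffuse u --> diffuse s --> (\<forall>x. u {t<..x} < top) --> s {t<..} < top -->
  s {M<..} = 0 --> (\<exists>g\<in>borel_measurable borel. (\<integral>\<^sup>+x\<in>{t<..}. g x epowr p \<partial>s) \<le> 1 \<and>
   Xu m p u s t epowr ((p - m) / p) \<le> c * (\<integral>\<^sup>+x\<in>{t<..}. copson s g x epowr m \<partial>u))"
proof -
 define k where "k = (m - 1) / (p - m)"
 have k1: "k + 1 = (p - 1) / (p - m)" using m by (simp add: k_def field_simps)
 have "0 < k + 1" unfolding k1 using m p by simp
 then have k: "-1 < k" by simp
 have "0 < m * (p - 1) / (p - m)" using m p by simp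
 moreover have "m * (p - 1) / (p - m) = p * (m - 1) / (p - m) + 1" using m by (simp add: field_simps)
 ultimately have e: "-1 < p * (m - 1) / (p - m)" by linarith
 show ?thesis
 proof (rule ex_finiteE[OF tail_power[OF k]], goal_cases)
 case (1 c1)
 note c1 = 1(1) and tl = 1(2)[rule_format (no_asm)]
 show ?thesis
 proof (rule ex_finiteE[OF tail_power[OF e]], goal_cases)
 case (1 c3)
 note c3 = 1(1) and tl3 = 1(2)[rule_format (no_asm)]
 show ?thesis
 proof (rule ex_finiteE[OF Xs_Xu_equiv[OF m p]], goal_cases)
 case (1 c2)
 note c2 = 1(1) and X = 1(2)[rule_format (no_asm)]
 show ?thesis
 proof (intro exI[of _ "c2 epowr (m / p) * c1 epowr m"] conjI allI impI)
  show "c2 epowr (m / p) * c1 epowr m < top"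
   using m p by (intro mult_less_top_ennreal epowr_less_top c1 c2) auto
  fix u s t M assume du: "diffuse u" and ds: "diffuse s"
   and ufin: "\<forall>x. u {t<..x} < top" and sfin: "s {t<..} < top" and M: "s {M<..} = 0"
  note u = diffuseD(1)[OF du] and s = diffuseD(1)[OF ds]
  let ?U = "\<lambda>x. u {t<..x}" and ?V = "\<lambda>x. s {x<..}"
  have [measurable]: "?U \<in> borelfun" "?V \<in> borelfun"
   by (rule measurable_Ioc[OF u], rule measurable_tail[OF s])
  define X where "X = Xs m p u s t"
  have X1: "X \<le> c2 * Xu m p u s t" "Xu m p u s t \<le> c2 * X" using X[OF du ds ufin sfin] by (auto simp: X_def)
  \<comment> \<open>As s carries no mass beyond M, the u-factor is bounded by its value at M, and
    \<open>tail_power\<close> integrates the rest.\<close>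
  have Xfin: "X < top"
  proof -
   have ae: "AE x in s. x \<notin> {M<..}" using M s by (intro AE_not_in) auto
   have "X \<le> (\<integral>\<^sup>+x. ?U M epowr (p / (p - m)) * (?V x epowr (p * (m - 1) / (p - m)) * indicator {t<..} x) \<partial>s)"
    unfolding X_def Xs_def
   proof (rule nn_integral_mono_AE, use ae in eventually_elim)
    fix x assume "x \<notin> {M<..}"
    then have "?U x \<le> ?U M" using u by (intro emeasure_mono) auto
    then have "?U x epowr (p / (p - m)) \<le> ?U M epowr (p / (p - m))" using m by (intro epowr_mono) auto
    then have "?U x epowr (p / (p - m)) * (?V x epowr (p * (m - 1) / (p - m)) * indicator {t<..} x)
     \<le> ?U M epowr (p / (p - m)) * (?V x epowr (p * (m - 1) / (p - m)) * indicator {t<..} x)"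
     by (rule mult_right_mono) simp
    then show "?U x epowr (p / (p - m)) * ?V x epowr (p * (m - 1) / (p - m)) * indicator {t<..} x
     \<le> ?U M epowr (p / (p - m)) * (?V x epowr (p * (m - 1) / (p - m)) * indicator {t<..} x)"
     by (simp only: mult.assoc)
   qed
   also have "\<dots> = ?U M epowr (p / (p - m)) * (\<integral>\<^sup>+x\<in>{t<..}. ?V x epowr (p * (m - 1) / (p - m)) \<partial>s)"
    by (rule nn_integral_cmult, rule measurable_borel_like[OF s]) measurable
   also have "\<dots> \<le> ?U M epowr (p / (p - m)) * (c3 * ?V t epowr (p * (m - 1) / (p - m) + 1))"
    by (intro mult_left_mono tl3[OF ds sfin, THEN conjunct1]) simp
   also have "\<dots> < top" using m p ufin sfin c3 e by (intro mult_less_top_ennreal epowr_less_top) auto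
   finally show ?thesis .
  qed
  show "\<exists>g\<in>borel_measurable borel. (\<integral>\<^sup>+x\<in>{t<..}. g x epowr p \<partial>s) \<le> 1 \<and>
   Xu m p u s t epowr ((p - m) / p) \<le> c2 epowr (m / p) * c1 epowr m * (\<integral>\<^sup>+x\<in>{t<..}. copson s g x epowr m \<partial>u)"
  proof (cases "X = 0")
   case True
   then have "Xu m p u s t = 0" using X1 by simp
   then show ?thesis using m p by (intro bexI[of _ "\<lambda>_. 0"]) auto
  next
   case False
   \<comment> \<open>The p-th power of g is the integrand of \<open>Xs\<close> divided by X, so the
     norm is 1. The exponent k = (m - 1) / (p - m) satisfies (k + 1) m = m (p - 1) / (p - m), the
     exponent of the tail in \<open>Xu\<close>.\<close>
   define g where "g = (\<lambda>x. X epowr (- (1 / p)) * (?U x epowr (1 / (p - m)) * ?V x epowr k))"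
   have g [measurable]: "g \<in> borelfun" unfolding g_def by measurable
   have Xm: "X epowr (- 1) * X = 1"
    using epowr_add'[of X "-1" 1] False Xfin by simp
   have "(\<integral>\<^sup>+x\<in>{t<..}. g x epowr p \<partial>s) = (\<integral>\<^sup>+x. X epowr (- 1) *
     (?U x epowr (p / (p - m)) * ?V x epowr (p * (m - 1) / (p - m)) * indicator {t<..} x) \<partial>s)"
    using m p by (intro nn_integral_cong) (simp add: g_def epowr_mult epowr_epowr k_def mult_ac)
   also have "\<dots> = X epowr (- 1) * X"
    unfolding X_def Xs_def by (rule nn_integral_cmult, rule measurable_borel_like[OF s]) measurable
   finally have N: "(\<integral>\<^sup>+x\<in>{t<..}. g x epowr p \<partial>s) \<le> 1" using Xm by simp
   \<comment> \<open>The u-factor increases, hence may be replaced by its value at the left end x of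
     the Copson integral; what remains is an integral of a power of the tail of s.\<close>
   have cg: "X epowr (- (1 / p)) * (?U x epowr (1 / (p - m)) * ?V x epowr (k + 1)) \<le> c1 * copson s g x" if "t < x" for x
   proof -
    have mk: "(\<lambda>y. ?V y epowr k * indicator {x<..} y) \<in> borel_measurable s"
     by (rule measurable_borel_like[OF s]) measurable
    have fx: "?V x < top" using that s by (intro le_less_trans[OF emeasure_mono sfin]) auto
    have "X epowr (- (1 / p)) * (?U x epowr (1 / (p - m)) * ?V x epowr (k + 1))
     \<le> X epowr (- (1 / p)) * (?U x epowr (1 / (p - m)) * (c1 * (\<integral>\<^sup>+y\<in>{x<..}. ?V y epowr k \<partial>s)))"
     by (intro mult_left_mono tl[OF ds fx, THEN conjunct2]) simp_all
    also have "\<dots> = c1 * (X epowr (- (1 / p)) * ?U x epowr (1 / (p - m)) * (\<integral>\<^sup>+y\<in>{x<..}. ?V y epowr k \<partial>s))"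
     by (simp only: mult_ac)
    also have "\<dots> = c1 * (\<integral>\<^sup>+y. X epowr (- (1 / p)) * ?U x epowr (1 / (p - m)) * (?V y epowr k * indicator {x<..} y) \<partial>s)"
     by (simp only: nn_integral_cmult[OF mk])
    also have "\<dots> \<le> c1 * copson s g x"
     unfolding copson_def
    proof (rule mult_left_mono[OF nn_integral_mono])
     fix y
     show "X epowr (- (1 / p)) * ?U x epowr (1 / (p - m)) * (?V y epowr k * indicator {x<..} y) \<le> g y * indicator {x<..} y"
     proof (cases "x < y")
      case True
      have "?U x epowr (1 / (p - m)) \<le> ?U y epowr (1 / (p - m))"
       using True m u by (intro epowr_mono emeasure_mono) auto
      then have "X epowr (- (1 / p)) * (?U x epowr (1 / (p - m)) * ?V y epowr k)
       \<le> X epowr (- (1 / p)) * (?U y epowr (1 / (p - m)) * ?V y epowr k)"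
       by (intro mult_left_mono mult_right_mono) auto
      then show ?thesis using True by (simp add: g_def mult.assoc)
     qed simp
    qed simp
    finally show ?thesis .
   qed
   have mX: "(\<lambda>x. ?U x epowr (m / (p - m)) * ?V x epowr (m * (p - 1) / (p - m)) * indicator {t<..} x) \<in> borel_measurable u"
    by (rule measurable_borel_like[OF u]) measurable
   have mc: "(\<lambda>x. copson s g x epowr m * indicator {t<..} x) \<in> borel_measurable u"
    by (rule measurable_borel_like[OF u]) (use measurable_copson[of s g] in measurable)
   have "X epowr (- (m / p)) * Xu m p u s t = (\<integral>\<^sup>+x. X epowr (- (m / p)) *
     (?U x epowr (m / (p - m)) * ?V x epowr (m * (p - 1) / (p - m)) * indicator {t<..} x) \<partial>u)"
    unfolding Xu_def by (rule nn_integral_cmult[symmetric, OF mX])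
   also have "\<dots> \<le> (\<integral>\<^sup>+x. c1 epowr m * (copson s g x epowr m * indicator {t<..} x) \<partial>u)"
   proof (intro nn_integral_mono)
    fix x
    show "X epowr (- (m / p)) * (?U x epowr (m / (p - m)) * ?V x epowr (m * (p - 1) / (p - m)) * indicator {t<..} x)
     \<le> c1 epowr m * (copson s g x epowr m * indicator {t<..} x)"
    proof (cases "t < x")
     case True
     have "(X epowr (- (1 / p)) * (?U x epowr (1 / (p - m)) * ?V x epowr (k + 1))) epowr m \<le> (c1 * copson s g x) epowr m"
      using cg[OF True] m by (intro epowr_mono) auto
     moreover have "(k + 1) * m = m * (p - 1) / (p - m)" unfolding k1 by (simp add: mult.commute)
     ultimately show ?thesis using True m by (simp add: epowr_mult epowr_epowr mult.assoc)
    qed simp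
   qed
   also have "\<dots> = c1 epowr m * (\<integral>\<^sup>+x\<in>{t<..}. copson s g x epowr m \<partial>u)"
    by (rule nn_integral_cmult[OF mc])
   finally have main: "X epowr (- (m / p)) * Xu m p u s t \<le> c1 epowr m * (\<integral>\<^sup>+x\<in>{t<..}. copson s g x epowr m \<partial>u)" .
   let ?Y = "Xu m p u s t"
   have Y: "?Y \<noteq> 0" "?Y \<noteq> top"
   proof -
    show "?Y \<noteq> 0" using X1(1) False by auto
    have "c2 * X < top" using c2 Xfin by (rule mult_less_top_ennreal)
    then show "?Y \<noteq> top" using X1(2) by auto
   qed
   have "?Y epowr ((p - m) / p) = ?Y epowr (- (m / p)) * ?Y"
    using epowr_add'[OF Y, of "- (m / p)" 1] p by (simp add: field_simps)
   also have "\<dots> \<le> (c2 epowr (m / p) * X epowr (- (m / p))) * ?Y"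
   proof (intro mult_right_mono)
    have X0: "X \<noteq> 0" "X \<noteq> top" using False Xfin by auto
    have mp: "0 < m / p" using m p by simp
    have "X epowr (m / p) \<le> (c2 * ?Y) epowr (m / p)" using X1(1) mp by (intro epowr_mono) auto
    also have "\<dots> = c2 epowr (m / p) * ?Y epowr (m / p)" using mp by (intro epowr_mult) auto
    finally have "X epowr (- (m / p)) * X epowr (m / p) * ?Y epowr (- (m / p))
     \<le> X epowr (- (m / p)) * (c2 epowr (m / p) * ?Y epowr (m / p)) * ?Y epowr (- (m / p))"
     by (intro mult_right_mono mult_left_mono) auto
    moreover have "X epowr (- (m / p)) * X epowr (m / p) = 1" using epowr_add'[OF X0, of "- (m / p)" "m / p"] by simp
    moreover have "X epowr (- (m / p)) * (c2 epowr (m / p) * ?Y epowr (m / p)) * ?Y epowr (- (m / p))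
     = c2 epowr (m / p) * X epowr (- (m / p)) * (?Y epowr (- (m / p)) * ?Y epowr (m / p))" by (simp only: mult_ac)
    moreover have "?Y epowr (- (m / p)) * ?Y epowr (m / p) = 1" using epowr_add'[OF Y, of "- (m / p)" "m / p"] by simp
    ultimately show "?Y epowr (- (m / p)) \<le> c2 epowr (m / p) * X epowr (- (m / p))" by simp
   qed simp
   also have "\<dots> = c2 epowr (m / p) * (X epowr (- (m / p)) * ?Y)" by (simp only: mult.assoc)
   also have "\<dots> \<le> c2 epowr (m / p) * (c1 epowr m * (\<integral>\<^sup>+x\<in>{t<..}. copson s g x epowr m \<partial>u))"
    by (intro mult_left_mono main) simp
   finally have "?Y epowr ((p - m) / p) \<le> c2 epowr (m / p) * c1 epowr m * (\<integral>\<^sup>+x\<in>{t<..}. copson s g x epowr m \<partial>u)"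
    by (simp only: mult.assoc)
   then show ?thesis using N g by blast
  qed
 qed
 qed
 qed
 qed
qed

section \<open>Test functions for the case of a small outer exponent\<close>

lemma copson_restr:
 assumes s: "sets s = sets borel" and A: "A \<in> sets borel" and g: "g \<in> borelfun"
 shows "copson (restr s A) g x = copson s (\<lambda>y. g y * indicator A y) x"
proof -
 have [measurable]: "g \<in> borelfun" by (rule g)
 have "copson (restr s A) g x = (\<integral>\<^sup>+y. g y * indicator {x<..} y * indicator A y \<partial>s)"
  unfolding copson_def by (rule nn_integral_restr[OF s A]) measurable
 also have "\<dots> = copson s (\<lambda>y. g y * indicator A y) x"
  unfolding copson_def by (intro nn_integral_cong) (auto split: split_indicator)
 finally show ?thesis .
qed

lemma nn_integral_epowr_restr:
 assumes s: "sets s = sets borel" and A: "A \<in> sets borel" and g: "g \<in> borelfun" and p: "0 < p"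
 shows "(\<integral>\<^sup>+y. g y epowr p \<partial>restr s A) = (\<integral>\<^sup>+y. (g y * indicator A y) epowr p \<partial>s)"
proof -
 have [measurable]: "g \<in> borelfun" by (rule g)
 have "(\<integral>\<^sup>+y. g y epowr p \<partial>restr s A) = (\<integral>\<^sup>+y. g y epowr p * indicator A y \<partial>s)"
  by (rule nn_integral_restr[OF s A]) measurable
 also have "\<dots> = (\<integral>\<^sup>+y. (g y * indicator A y) epowr p \<partial>s)"
  using p by (intro nn_integral_cong) (auto split: split_indicator)
 finally show ?thesis .
qed

text \<open>One function g whose norm is controlled by the integral against \<mu> while its Copson
  integral dominates the integrand at every point. The pointwise form is what allows a second outer
  measure in \<open>lower_dual\<close>.\<close>

lemma lower_test_function:
 assumes q: "0 < q" and p: "1 < p" "q < p"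
 shows "\<exists>c<top. \<forall>s \<mu>. diffuse s --> s UNIV < top --> sets \<mu> = sets borel --> \<mu> UNIV < top -->
  (\<exists>g\<in>borel_measurable borel.
   (powint p s g) \<le> c * (\<integral>\<^sup>+z. \<mu> {..z} epowr (q / (p - q)) * s {z<..} epowr (q * (p - 1) / (p - q)) \<partial>\<mu>) \<and>
   (\<forall>z. \<mu> {..z} epowr (q / (p - q)) * s {z<..} epowr (q * (p - 1) / (p - q)) \<le> c * copson s g z epowr q))"
proof -
 define a where "a = q / (p - q)"
 define e where "e = p * (q - 1) / (p - q)"
 define k where "k = (q - 1) / (p - q)"
 define \<kappa> where "\<kappa> = q * (p - 1) / (p - q)"
 have a0: "0 < a" using q p by (simp add: a_def)
 have a: "-1 < a" using a0 by linarith
 have a1: "a + 1 = p / (p - q)" using p by (simp add: a_def field_simps)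
 have e1: "e + 1 = \<kappa>" using p by (simp add: e_def \<kappa>_def field_simps)
 have \<kappa>0: "0 < \<kappa>" using q p by (simp add: \<kappa>_def)
 have e: "-1 < e" using e1 \<kappa>0 by linarith
 have k1: "k + 1 = (p - 1) / (p - q)" using p by (simp add: k_def field_simps)
 have "0 < (p - 1) / (p - q)" using p by simp
 then have k: "-1 < k" using k1 by linarith
 show ?thesis
 proof (rule ex_finiteE[OF head_power_gen[OF a]], goal_cases)
 case (1 c1)
 note c1 = 1(1) and hp = 1(2)[rule_format (no_asm)]
 show ?thesis
 proof (rule ex_finiteE[OF tail_power[OF e]], goal_cases)
 case (1 c2)
 note c2 = 1(1) and tl = 1(2)[rule_format (no_asm)]
 show ?thesis
 proof (rule ex_finiteE[OF tail_power[OF k]], goal_cases)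
 case (1 c3)
 note c3 = 1(1) and tl3 = 1(2)[rule_format (no_asm)]
 show ?thesis
  unfolding a_def[symmetric] \<kappa>_def[symmetric]
 proof (intro exI[of _ "c1 * c2 + c3 epowr q"] conjI allI impI)
  show "c1 * c2 + c3 epowr q < top"
   using q by (intro add_less_top_ennreal mult_less_top_ennreal epowr_less_top c1 c2 c3) auto
  fix s \<mu> :: "real measure"
  assume ds: "diffuse s" and sfin: "s UNIV < top" and \<mu>: "sets \<mu> = sets borel" and \<mu>fin: "\<mu> UNIV < top"
  note s = diffuseD(1)[OF ds]
  have sf: "s {y<..} < top" for y
   using s by (intro le_less_trans[OF emeasure_mono sfin]) auto
  have mf: "\<mu> {..y} < top" for y
   using \<mu> by (intro le_less_trans[OF emeasure_mono \<mu>fin]) auto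
  have sf': "s {..y} < top" for y
   using s by (intro le_less_trans[OF emeasure_mono sfin]) auto
  let ?B = "\<lambda>x. \<mu> {..x}" and ?V = "\<lambda>x. s {x<..}"
  have [measurable]: "?B \<in> borelfun" "?V \<in> borelfun"
   by (rule measurable_head[OF \<mu>], rule measurable_tail[OF s])
  define D2 where "D2 = (\<integral>\<^sup>+z. ?B z epowr a * ?V z epowr \<kappa> \<partial>\<mu>)"
  \<comment> \<open>Chosen so that g^p is the head to the power a + 1 times the tail to the power e.
    The former is again an integral of the head to the power a, and the exchange of the two
    integrals leads back to the integral that defines D2.\<close>
  define g where "g = (\<lambda>x. ?B x epowr (1 / (p - q)) * ?V x epowr k)"
  have g: "g \<in> borelfun" unfolding g_def by measurable
  have ms: "(\<lambda>x. ?V x epowr e * (\<integral>\<^sup>+z\<in>{..x}. ?B z epowr a \<partial>\<mu>)) \<in> borel_measurable s"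
  proof (rule measurable_borel_like[OF s], rule borel_measurable_times_ennreal)
   show "(\<lambda>x. \<integral>\<^sup>+z\<in>{..x}. ?B z epowr a \<partial>\<mu>) \<in> borelfun"
    by (rule borel_measurable_mono_ennreal) (rule monoI, rule nn_integral_mono, auto split: split_indicator)
  qed measurable
  have m\<mu>: "(\<lambda>z. ?B z epowr a * ?V z epowr \<kappa>) \<in> borel_measurable \<mu>"
   by (rule measurable_borel_like[OF \<mu>]) measurable
  have "(powint p s g) \<le> (\<integral>\<^sup>+x. c1 * (?V x epowr e * (\<integral>\<^sup>+z\<in>{..x}. ?B z epowr a \<partial>\<mu>)) \<partial>s)"
  proof (intro nn_integral_mono)
   fix x
   have eq: "(\<integral>\<^sup>+z\<in>{..x}. \<mu> ({..x} \<inter> {..z}) epowr a \<partial>\<mu>) = (\<integral>\<^sup>+z\<in>{..x}. ?B z epowr a \<partial>\<mu>)"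
   proof (intro nn_integral_cong)
    fix z
    have "{..x} \<inter> {..z} = {..z}" if "z \<le> x" using that by auto
    then show "\<mu> ({..x} \<inter> {..z}) epowr a * indicator {..x} z = ?B z epowr a * indicator {..x} z"
     by (cases "z \<le> x") simp_all
   qed
   have "?B x epowr (a + 1) \<le> c1 * (\<integral>\<^sup>+z\<in>{..x}. ?B z epowr a \<partial>\<mu>)"
    using hp[OF \<mu> _ mf[of x], THEN conjunct2] unfolding eq by simp
   then have "?B x epowr (a + 1) * ?V x epowr e \<le> c1 * (\<integral>\<^sup>+z\<in>{..x}. ?B z epowr a \<partial>\<mu>) * ?V x epowr e"
    by (rule mult_right_mono) simp
   moreover have "g x epowr p = ?B x epowr (a + 1) * ?V x epowr e"
    using p by (simp add: g_def epowr_mult epowr_epowr a1 e_def k_def mult.commute)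
   ultimately show "g x epowr p \<le> c1 * (?V x epowr e * (\<integral>\<^sup>+z\<in>{..x}. ?B z epowr a \<partial>\<mu>))"
    by (simp only: mult_ac)
  qed
  also have "\<dots> = c1 * (\<integral>\<^sup>+x. ?V x epowr e * (\<integral>\<^sup>+z\<in>{..x}. ?B z epowr a \<partial>\<mu>) \<partial>s)"
   by (rule nn_integral_cmult[OF ms])
  also have "(\<integral>\<^sup>+x. ?V x epowr e * (\<integral>\<^sup>+z\<in>{..x}. ?B z epowr a \<partial>\<mu>) \<partial>s)
    = (\<integral>\<^sup>+z. ?B z epowr a * (\<integral>\<^sup>+x\<in>{z..}. ?V x epowr e \<partial>s) \<partial>\<mu>)"
   by (rule nn_integral_triangle_swap[OF \<mu> s sigma_finite_heads[OF \<mu> mf] sigma_finite_heads[OF s sf']]) measurable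
  also have "\<dots> \<le> (\<integral>\<^sup>+z. c2 * (?B z epowr a * ?V z epowr \<kappa>) \<partial>\<mu>)"
  proof (intro nn_integral_mono)
   fix z
   have "(\<integral>\<^sup>+x\<in>{z..}. ?V x epowr e \<partial>s) = (\<integral>\<^sup>+x\<in>{z<..}. ?V x epowr e \<partial>s)"
    by (rule nn_integral_diffuse_ctail[OF ds]) measurable
   also have "\<dots> \<le> c2 * ?V z epowr \<kappa>"
    using tl[OF ds sf, THEN conjunct1, of z] unfolding e1 .
   finally have "?B z epowr a * (\<integral>\<^sup>+x\<in>{z..}. ?V x epowr e \<partial>s) \<le> ?B z epowr a * (c2 * ?V z epowr \<kappa>)"
    by (rule mult_left_mono) simp
   then show "?B z epowr a * (\<integral>\<^sup>+x\<in>{z..}. ?V x epowr e \<partial>s) \<le> c2 * (?B z epowr a * ?V z epowr \<kappa>)"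
    by (simp only: mult_ac)
  qed
  also have "\<dots> = c2 * D2" unfolding D2_def by (rule nn_integral_cmult[OF m\<mu>])
  finally have N: "(powint p s g) \<le> c1 * c2 * D2" by (simp add: mult_left_mono mult.assoc)
  have cg: "?B z epowr a * ?V z epowr \<kappa> \<le> c3 epowr q * copson s g z epowr q" for z
  proof -
   have mk: "(\<lambda>x. ?V x epowr k * indicator {z<..} x) \<in> borel_measurable s"
    by (rule measurable_borel_like[OF s]) measurable
   have "?B z epowr (1 / (p - q)) * ?V z epowr (k + 1) \<le> ?B z epowr (1 / (p - q)) * (c3 * (\<integral>\<^sup>+x\<in>{z<..}. ?V x epowr k \<partial>s))"
    by (intro mult_left_mono tl3[OF ds sf, THEN conjunct2]) simp
   also have "\<dots> = c3 * (\<integral>\<^sup>+x. ?B z epowr (1 / (p - q)) * (?V x epowr k * indicator {z<..} x) \<partial>s)"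
    unfolding nn_integral_cmult[OF mk] by (simp only: mult.left_commute)
   also have "\<dots> \<le> c3 * copson s g z"
    unfolding copson_def
   proof (rule mult_left_mono[OF nn_integral_mono])
    fix x
    show "?B z epowr (1 / (p - q)) * (?V x epowr k * indicator {z<..} x) \<le> g x * indicator {z<..} x"
    proof (cases "z < x")
     case True
     have "?B z epowr (1 / (p - q)) \<le> ?B x epowr (1 / (p - q))"
      using True p \<mu> by (intro epowr_mono emeasure_mono) auto
     then have "?B z epowr (1 / (p - q)) * ?V x epowr k \<le> ?B x epowr (1 / (p - q)) * ?V x epowr k"
      by (rule mult_right_mono) simp
     then show ?thesis using True by (simp add: g_def)
    qed simp
   qed simp
   finally have "(?B z epowr (1 / (p - q)) * ?V z epowr (k + 1)) epowr q \<le> (c3 * copson s g z) epowr q"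
    using q by (intro epowr_mono) auto
   moreover have "(?B z epowr (1 / (p - q)) * ?V z epowr (k + 1)) epowr q = ?B z epowr a * ?V z epowr \<kappa>"
    using q by (simp add: epowr_mult epowr_epowr a_def k1 \<kappa>_def mult.commute)
   ultimately show ?thesis using q by (simp add: epowr_mult)
  qed
  have c: "c1 * c2 * X \<le> (c1 * c2 + c3 epowr q) * X" "c3 epowr q * X \<le> (c1 * c2 + c3 epowr q) * X" for X
   by (auto intro!: mult_right_mono)
  show "\<exists>g\<in>borel_measurable borel.
   (powint p s g) \<le> (c1 * c2 + c3 epowr q) * (\<integral>\<^sup>+z. ?B z epowr a * ?V z epowr \<kappa> \<partial>\<mu>) \<and>
   (\<forall>z. ?B z epowr a * ?V z epowr \<kappa> \<le> (c1 * c2 + c3 epowr q) * copson s g z epowr q)"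
   by (intro bexI[OF _ g] conjI allI order.trans[OF N[unfolded D2_def] c(1)] order.trans[OF cg c(2)])
 qed
 qed
 qed
 qed
qed

lemma nn_integral_pos_limit:
 assumes \<mu>: "sets \<mu> = sets borel" and f: "f \<in> borelfun"
  and R: "\<And>\<tau>::real. 0 < \<tau> ==> (\<integral>\<^sup>+z\<in>{\<tau><..}. f z \<partial>\<mu>) \<le> R"
 shows "(\<integral>\<^sup>+z\<in>{0<..}. f z \<partial>\<mu>) \<le> R"
proof -
 have f': "f \<in> borel_measurable \<mu>" by (rule measurable_borel_like[OF \<mu> f])
 have e: "(density \<mu> f) {\<tau><..} = (\<integral>\<^sup>+z\<in>{\<tau><..}. f z \<partial>\<mu>)" for \<tau>
  using f' \<mu> by (intro emeasure_density) auto
 have U: "{0<..} = (\<Union>n::nat. {1 / (real n + 1)<..})"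
 proof (intro set_eqI iffI)
  fix x :: real assume "x \<in> {0<..}"
  then obtain n :: nat where "inverse (real (Suc n)) < x" using reals_Archimedean by auto
  then show "x \<in> (\<Union>n::nat. {1 / (real n + 1)<..})" by (auto simp: inverse_eq_divide add.commute)
 next
  fix x :: real assume "x \<in> (\<Union>n::nat. {1 / (real n + 1)<..})"
  then obtain n :: nat where "1 / (real n + 1) < x" by auto
  moreover have "0 < 1 / (real n + 1)" by simp
  ultimately show "x \<in> {0<..}" by (metis greaterThan_iff less_trans)
 qed
 have inc: "incseq (\<lambda>n::nat. {1 / (real n + 1)<..})"
 proof (rule incseq_SucI, rule subsetI)
  fix n :: nat and x :: real assume "x \<in> {1 / (real n + 1)<..}"
  moreover have "1 / (real (Suc n) + 1) \<le> 1 / (real n + 1)" by (intro frac_le) auto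
  ultimately show "x \<in> {1 / (real (Suc n) + 1)<..}" by auto
 qed
 have ran: "range (\<lambda>n::nat. {1 / (real n + 1)<..}) \<subseteq> sets (density \<mu> f)"
  unfolding sets_density \<mu> by auto
 have "(density \<mu> f) {0<..} = (SUP n::nat. (density \<mu> f) {1 / (real n + 1)<..})"
  unfolding U by (rule SUP_emeasure_incseq[symmetric, OF ran inc])
 also have "\<dots> \<le> R" unfolding e by (intro SUP_least R) simp
 finally show ?thesis unfolding e .
qed

text \<open>The heads are those of \<mu>, the integration is against \<mu>'. Tested on \<mu>, the
  function of \<open>lower_test_function\<close> gives D2 \<le> C D D2^(q / p) and thereby bounds
  D2; tested on \<mu>', it bounds the mixed integral by C D D2^(q / p). The case \<mu> = \<mu>'
  yields A2, the mixed case yields A3.\<close>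

lemma lower_dual:
 assumes q: "0 < q" and p: "1 < p" "q < p"
 shows "\<exists>c<top. \<forall>s \<mu> \<mu>' D. diffuse s --> (\<forall>\<tau>>0. s {\<tau><..} < top) -->
  sets \<mu> = sets borel --> sets \<mu>' = sets borel --> \<mu> UNIV < top -->
  (\<forall>g\<in>borel_measurable borel. (\<integral>\<^sup>+z. copson s g z epowr q \<partial>\<mu>) \<le> D * powint p s g epowr (q / p)) -->
  (\<forall>g\<in>borel_measurable borel. (\<integral>\<^sup>+z. copson s g z epowr q \<partial>\<mu>') \<le> D * powint p s g epowr (q / p)) -->
  (\<integral>\<^sup>+z\<in>{0<..}. \<mu> {..z} epowr (q / (p - q)) * s {z<..} epowr (q * (p - 1) / (p - q)) \<partial>\<mu>')
   \<le> c * D epowr (p / (p - q))"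
proof -
 define a where "a = q / (p - q)"
 define \<kappa> where "\<kappa> = q * (p - 1) / (p - q)"
 have a0: "0 < a" using q p by (simp add: a_def)
 have a1: "1 + q / (p - q) = p / (p - q)" "p / (p - q) * (q / p) = q / (p - q)" "1 / (1 - q / p) = p / (p - q)"
  using q p by (auto simp: field_simps)
 have \<kappa>0: "0 < \<kappa>" using q p by (simp add: \<kappa>_def)
 show ?thesis
 proof (rule ex_finiteE[OF lower_test_function[OF q p, folded a_def, folded \<kappa>_def]], goal_cases)
 case (1 c)
 note c = 1(1) and tf = 1(2)[rule_format (no_asm)]
 define C where "C = c * c epowr (q / p)"
 have C: "C < top" unfolding C_def using q p by (intro mult_less_top_ennreal epowr_less_top c) auto
 show ?thesis
  unfolding a_def[symmetric] \<kappa>_def[symmetric]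
 proof (intro exI[of _ "C epowr (p / (p - q))"] conjI allI impI)
  show "C epowr (p / (p - q)) < top" using p by (intro epowr_less_top C) auto
  fix s \<mu> \<mu>' :: "real measure" and D
  assume ds: "diffuse s" and sfin: "\<forall>\<tau>>0. s {\<tau><..} < top"
   and \<mu>: "sets \<mu> = sets borel" and \<mu>': "sets \<mu>' = sets borel" and \<mu>fin: "\<mu> UNIV < top"
   and D: "\<forall>g\<in>borel_measurable borel. (\<integral>\<^sup>+z. copson s g z epowr q \<partial>\<mu>) \<le> D * powint p s g epowr (q / p)"
   and D': "\<forall>g\<in>borel_measurable borel. (\<integral>\<^sup>+z. copson s g z epowr q \<partial>\<mu>') \<le> D * powint p s g epowr (q / p)"
  note s = diffuseD(1)[OF ds]
  let ?B = "\<lambda>x. \<mu> {..x}" and ?V = "\<lambda>x. s {x<..}"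
  have [measurable]: "?B \<in> borelfun" "?V \<in> borelfun"
   by (rule measurable_head[OF \<mu>], rule measurable_tail[OF s])
  show "(\<integral>\<^sup>+z\<in>{0<..}. ?B z epowr a * ?V z epowr \<kappa> \<partial>\<mu>') \<le> C epowr (p / (p - q)) * D epowr (p / (p - q))"
  proof (rule nn_integral_pos_limit[OF \<mu>'])
   show "(\<lambda>z. ?B z epowr a * ?V z epowr \<kappa>) \<in> borelfun" by measurable
   fix \<tau> :: real assume \<tau>: "0 < \<tau>"
   \<comment> \<open>The mass of s near 0 may be infinite, and D2 must be finite to be absorbed; so
     s is cut at \<tau> > 0, with constants that do not depend on \<tau>.\<close>
   define s' where "s' = restr s {\<tau><..}"
   let ?V' = "\<lambda>x. s' {x<..}"
   have ds': "diffuse s'" unfolding s'_def by (rule diffuse_restr[OF ds]) simp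
   have s'f: "s' UNIV < top" using sfin \<tau> s by (simp add: s'_def emeasure_restr)
   obtain g where g: "g \<in> borelfun"
    and g1: "(\<integral>\<^sup>+x. g x epowr p \<partial>s') \<le> c * (\<integral>\<^sup>+z. ?B z epowr a * ?V' z epowr \<kappa> \<partial>\<mu>)"
    and g2: "\<And>z. ?B z epowr a * ?V' z epowr \<kappa> \<le> c * copson s' g z epowr q"
    using tf[OF ds' s'f \<mu> \<mu>fin] by blast
   define D2 where "D2 = (\<integral>\<^sup>+z. ?B z epowr a * ?V' z epowr \<kappa> \<partial>\<mu>)"
   let ?g = "\<lambda>y. g y * indicator {\<tau><..} y"
   have g' [measurable]: "?g \<in> borelfun" using g by measurable
   have cop: "copson s' g z = copson s ?g z" for z
    unfolding s'_def by (rule copson_restr[OF s _ g]) simp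
   have Ng: "(powint p s ?g) \<le> c * D2"
    using g1 p unfolding s'_def D2_def by (subst (asm) nn_integral_epowr_restr[OF s _ g]) auto
   have mc: "(\<lambda>z. copson s ?g z epowr q) \<in> borelfun"
    using measurable_copson[of s ?g] by measurable
   have est: "(\<integral>\<^sup>+z. ?B z epowr a * ?V' z epowr \<kappa> \<partial>\<nu>) \<le> C * D * D2 epowr (q / p)"
    if \<nu>: "sets \<nu> = sets borel" and D\<nu>: "\<forall>g\<in>borel_measurable borel. (\<integral>\<^sup>+z. copson s g z epowr q \<partial>\<nu>) \<le> D * powint p s g epowr (q / p)" for \<nu>
   proof -
    have "(\<integral>\<^sup>+z. ?B z epowr a * ?V' z epowr \<kappa> \<partial>\<nu>) \<le> (\<integral>\<^sup>+z. c * copson s ?g z epowr q \<partial>\<nu>)"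
     using g2 unfolding cop by (rule nn_integral_mono)
    also have "\<dots> = c * (\<integral>\<^sup>+z. copson s ?g z epowr q \<partial>\<nu>)"
     by (rule nn_integral_cmult[OF measurable_borel_like[OF \<nu> mc]])
    also have "\<dots> \<le> c * (D * (c * D2) epowr (q / p))"
     using q p by (intro mult_left_mono order.trans[OF D\<nu>[rule_format, OF g']] epowr_mono Ng) auto
    also have "\<dots> = C * D * D2 epowr (q / p)"
     using q p by (simp add: C_def epowr_mult mult_ac)
    finally show ?thesis .
   qed
   \<comment> \<open>Both factors of the integrand are bounded by total masses, and \<mu> is
     finite.\<close>
   have D2fin: "D2 < top"
   proof -
    have "D2 \<le> (\<integral>\<^sup>+z. \<mu> UNIV epowr a * s' UNIV epowr \<kappa> \<partial>\<mu>)"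
     unfolding D2_def using a0 \<kappa>0 \<mu> diffuseD(1)[OF ds']
     by (intro nn_integral_mono mult_mono epowr_mono emeasure_mono) auto
    also have "\<dots> = \<mu> UNIV epowr a * s' UNIV epowr \<kappa> * \<mu> UNIV"
     using space_borel_like[OF \<mu>] by simp
    also have "\<dots> < top"
     using a0 \<kappa>0 by (intro mult_less_top_ennreal epowr_less_top \<mu>fin s'f) auto
    finally show ?thesis .
   qed
   have "D2 \<le> C * D * D2 epowr (q / p)" using est[OF \<mu> D] unfolding D2_def .
   then have "D2 \<le> (C * D) epowr (1 / (1 - q / p))"
    using q p by (intro self_improve[OF D2fin]) auto
   then have D2: "D2 \<le> (C * D) epowr (p / (p - q))" unfolding a1(3) .
   have "(\<integral>\<^sup>+z\<in>{\<tau><..}. ?B z epowr a * ?V z epowr \<kappa> \<partial>\<mu>') \<le> (\<integral>\<^sup>+z. ?B z epowr a * ?V' z epowr \<kappa> \<partial>\<mu>')"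
   proof (intro nn_integral_mono)
    fix z
    have "?V' z = ?V z" if "\<tau> < z"
    proof -
     have "{\<tau><..} \<inter> {z<..} = {z<..}" using that by auto
     then show ?thesis unfolding s'_def by (subst emeasure_restr[OF s]) auto
    qed
    then show "?B z epowr a * ?V z epowr \<kappa> * indicator {\<tau><..} z \<le> ?B z epowr a * ?V' z epowr \<kappa>"
     by (cases "\<tau> < z") auto
   qed
   also have "\<dots> \<le> C * D * D2 epowr (q / p)" by (rule est[OF \<mu>' D'])
   also have "\<dots> \<le> C * D * ((C * D) epowr (p / (p - q))) epowr (q / p)"
    using q p by (intro mult_left_mono epowr_mono D2) auto
   also have "\<dots> = (C * D) epowr 1 * (C * D) epowr (q / (p - q))"
    by (simp only: epowr_epowr a1 epowr_1_right)
   also have "\<dots> = (C * D) epowr (1 + q / (p - q))"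
    using q p by (intro epowr_add[symmetric]) auto
   also have "\<dots> = C epowr (p / (p - q)) * D epowr (p / (p - q))"
    unfolding a1 using p q by (intro epowr_mult) auto
   finally show "(\<integral>\<^sup>+z\<in>{\<tau><..}. ?B z epowr a * ?V z epowr \<kappa> \<partial>\<mu>') \<le> C epowr (p / (p - q)) * D epowr (p / (p - q))" .
  qed
 qed
 qed
qed

text \<open>The sum of the point masses b n at y n, written as a push-forward of a weighted counting
  measure so that integrals become series. Discrete Hardy inequalities are then instances of those
  for Borel measures.\<close>

definition point_masses :: "(nat => ennreal) => (nat => real) => real measure" where
 "point_masses b y = distr (density (count_space UNIV) b) borel y"

lemma sets_point_masses [simp]: "sets (point_masses b y) = sets borel"
 by (simp add: point_masses_def)

lemma nn_integral_point_masses: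
 assumes "f \<in> borelfun"
 shows "(\<integral>\<^sup>+x. f x \<partial>point_masses b y) = (\<Sum>n. b n * f (y n))"
 unfolding point_masses_def using assms
 by (simp add: nn_integral_distr nn_integral_density nn_integral_count_space_nat)

lemma emeasure_point_masses:
 assumes "A \<in> sets borel"
 shows "(point_masses b y) A = (\<Sum>n. b n * indicator A (y n))"
proof -
 have "(point_masses b y) A = (\<integral>\<^sup>+x. indicator A x \<partial>point_masses b y)"
  using assms by (intro nn_integral_indicator[symmetric]) simp
 also have "\<dots> = (\<Sum>n. b n * indicator A (y n))"
  using assms by (intro nn_integral_point_masses) simp
 finally show ?thesis .
qed

section \<open>Discretisation\<close>

text \<open>
 With \<open>a = q / m\<close> and the measures \<open>u dx\<close>, \<open>w dx\<close>, \<open>s = v^(1 - p') dx\<close>, the function \<open>Phi\<close> is the \<open>q\<close>-th power of the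
 fundamental function \<open>\<phi>\<close>, and \<open>iterK\<close> is the inner integral of the inequality for the density \<open>g\<close> of \<open>h dx\<close> with respect to \<open>s\<close>.
\<close>

definition Phi :: "real => real measure => real measure => real => ennreal" where
 "Phi a u w x = (\<integral>\<^sup>+y\<in>{..x}. u {y<..x} epowr a \<partial>w)"

text \<open>The inner supremum shared by A2 and A3. The exponents are independent parameters because
  A2 has r / m on the u-mass where A3 has q / m.\<close>

definition Usup :: "real => real => real measure => real measure => real => ennreal" where
 "Usup b k u s x = (SUP z\<in>{x<..}. u {x<..z} epowr b * s {z<..} epowr k)"

definition iterK :: "real => real measure => real measure => (real => ennreal) => real => ennreal" where
 "iterK m u s g x = (\<integral>\<^sup>+y\<in>{x<..}. copson s g y epowr m \<partial>u)"

text \<open>With a = q / m, e = r / p and k = r / p' the first integral is the r-th power of A3; the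
  second is that of A2 when in addition b = r / m.\<close>

abbreviation Phi_Usup_int :: "real => real => real => real measure => real measure => real measure => ennreal" where
 "Phi_Usup_int a e k u w s \<equiv> \<integral>\<^sup>+x. Phi a u w x epowr e * Usup a k u s x \<partial>w"

abbreviation head_Usup_int :: "real => real => real => real measure => real measure => real measure => ennreal" where
 "head_Usup_int b e k u w s \<equiv> \<integral>\<^sup>+x. w {..x} epowr e * Usup b k u s x \<partial>w"

abbreviation iterK_int :: "real => real => real measure => real measure => real measure => (real => ennreal) => ennreal" where
 "iterK_int a m u w s g \<equiv> \<integral>\<^sup>+x. iterK m u s g x epowr a \<partial>w"

abbreviation iterK_int_upto :: "real => real => real => real measure => real measure => real measure => (real => ennreal) => ennreal" where
 "iterK_int_upto b a m u w s g \<equiv> \<integral>\<^sup>+x\<in>{..b}. iterK m u s g x epowr a \<partial>w"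

text \<open>Cell 0 is the whole half-line beyond the largest node, so that {t n<..} is the union of
  the cells 0 to n. The cells with larger index approach 0.\<close>

definition grid_cell :: "(nat => real) => nat => real set" where
 "grid_cell t n = (case n of 0 => {t 0<..} | Suc k => {t (Suc k)<..t k})"

lemma grid_cell_simps [simp]: "grid_cell t 0 = {t 0<..}" "grid_cell t (Suc k) = {t (Suc k)<..t k}"
 by (simp_all add: grid_cell_def)

lemma grid_cell_borel [simp, measurable]: "grid_cell t n \<in> sets borel"
 by (cases n) auto

lemma grid_cell_subset: "grid_cell t n \<subseteq> {t n<..}"
 by (cases n) auto

lemma iterK_antimono: "x \<le> y ==> iterK m u s g y \<le> iterK m u s g x"
 unfolding iterK_def by (intro nn_integral_mono) (auto split: split_indicator)

lemma Phi_mono: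
 assumes "sets u = sets borel" "0 \<le> a" "x \<le> y" shows "Phi a u w x \<le> Phi a u w y"
 unfolding Phi_def
proof (intro nn_integral_mono)
 fix z
 have "u {z<..x} epowr a \<le> u {z<..y} epowr a"
  using assms by (intro epowr_mono emeasure_mono) auto
 then show "u {z<..x} epowr a * indicator {..x} z \<le> u {z<..y} epowr a * indicator {..y} z"
  using assms(3) by (auto split: split_indicator)
qed

lemma suminf_Suc_ennreal: "(\<Sum>n. f n :: ennreal) = f 0 + (\<Sum>n. f (Suc n))"
proof -
 have "(\<lambda>n. f (Suc n)) sums (\<Sum>n. f (Suc n))" by (rule summable_sums[OF summableI])
 from sums_Suc[OF this] show ?thesis by (simp add: sums_unique[symmetric] add.commute)
qed

lemma suminf_add_ennreal: "(\<Sum>n. f n + g n :: ennreal) = (\<Sum>n. f n) + (\<Sum>n. g n)"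
 by (rule suminf_add[symmetric]) auto

text \<open>The finiteness of Phi is half of admissibility, and w {..0} = 0 places the mass of w on
  (0,\<infinity>). The nodes are fixed by mass and not by length: this makes the ratio 1/2 in all
  geometric sums the same for every w.\<close>

locale copson_grid =
 fixes u w s :: "real measure" and a :: real and t :: "nat => real"
 assumes du: "diffuse u" and dw: "diffuse w" and ds: "diffuse s" and a0: "0 < a"
  and ufin: "\<And>x y. 0 < x ==> emeasure u {x<..y} < top"
  and sfin: "\<And>x. 0 < x ==> emeasure s {x<..} < top"
  and w0: "emeasure w {..0} = 0"
  and Phifin: "\<And>x. 0 < x ==> Phi a u w x < top"
  and t_pos: "\<And>n. 0 < t n" and t_dec: "\<And>n. t (Suc n) < t n" and t_lim: "\<And>x. 0 < x ==> \<exists>n. t n < x"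
  and W0: "emeasure w {..t 0} < top" and Whalf: "\<And>n. emeasure w {..t n} = 2 * emeasure w {..t (Suc n)}"
begin

lemmas u = diffuseD(1)[OF du] and w = diffuseD(1)[OF dw] and s = diffuseD(1)[OF ds]

abbreviation W :: "nat => ennreal" where "W n \<equiv> w {..t n}"

lemma t_antimono: "i \<le> j ==> t j \<le> t i"
 using lift_Suc_antimono_le[of t i j] t_dec by (simp add: less_imp_le)

lemma t_less_iff: "t j < t i \<longleftrightarrow> i < j"
proof
 assume "i < j"
 then have "t j \<le> t (Suc i)" by (intro t_antimono) auto
 then show "t j < t i" using t_dec[of i] by simp
next
 assume "t j < t i"
 then show "i < j" using t_antimono[of j i] by (cases "i < j") auto
qed

lemma Wfin: "W n < top"
 using t_antimono[of 0 n] w by (intro le_less_trans[OF emeasure_mono W0]) auto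

lemma W_Suc_half: "W (Suc n) = ennreal (1 / 2) * W n"
proof -
 have "ennreal (1 / 2) * (2 * W (Suc n)) = (ennreal (1 / 2) * ennreal 2) * W (Suc n)"
  by (simp add: mult.assoc)
 also have "ennreal (1 / 2) * ennreal 2 = 1" by (subst ennreal_mult[symmetric]) auto
 finally show ?thesis using Whalf[of n] by simp
qed

text \<open>Half of the mass below a node lies in the adjacent cell and half below it. Hence a sum
  over nodes weighted by W is interchangeable with an integral over cells, up to shifts of the
  index.\<close>

lemma w_cell: "w (grid_cell t (Suc n)) = W (Suc n)"
proof -
 have "{..t (Suc n)} \<union> {t (Suc n)<..t n} = {..t n}" using t_dec[of n] by auto
 moreover have "W (Suc n) + w {t (Suc n)<..t n} = w ({..t (Suc n)} \<union> {t (Suc n)<..t n})"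
  using w by (intro plus_emeasure) auto
 ultimately have "W (Suc n) + w {t (Suc n)<..t n} = W (Suc n) + W (Suc n)"
  using Whalf[of n] by (simp add: mult_2)
 then show ?thesis using Wfin[of "Suc n"] by (auto simp: ennreal_add_left_cancel)
qed

lemma tail_sum:
 assumes \<mu>: "sets \<mu> = sets borel" and f: "f \<in> borelfun"
 shows "(\<integral>\<^sup>+x\<in>{t n<..}. f x \<partial>\<mu>) = (\<Sum>j\<le>n. \<integral>\<^sup>+x\<in>grid_cell t j. f x \<partial>\<mu>)"
proof (induction n)
 case (Suc n)
 have f': "f \<in> borel_measurable \<mu>" by (rule measurable_borel_like[OF \<mu> f])
 have U: "{t (Suc n)<..} = {t n<..} \<union> {t (Suc n)<..t n}" using t_dec[of n] by auto
 have "(\<integral>\<^sup>+x\<in>{t (Suc n)<..}. f x \<partial>\<mu>) = (\<integral>\<^sup>+x\<in>{t n<..}. f x \<partial>\<mu>) + (\<integral>\<^sup>+x\<in>{t (Suc n)<..t n}. f x \<partial>\<mu>)"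
  unfolding U using \<mu> f' by (intro nn_integral_disjoint_pair) auto
 then show ?case using Suc by simp
qed simp

lemma disjoint_cells: "disjoint_family (grid_cell t)"
proof -
 have "grid_cell t i \<inter> grid_cell t j = {}" if ij: "i < j" for i j
 proof -
  obtain k where k: "j = Suc k" "i \<le> k" using ij by (cases j) auto
  then show ?thesis using grid_cell_subset[of t i] t_antimono[of i k] by auto
 qed
 then show ?thesis unfolding disjoint_family_on_def by (metis Int_commute linorder_neqE_nat)
qed

lemma disjoint_cells_Suc: "disjoint_family (\<lambda>n. grid_cell t (Suc n))"
 using disjoint_cells unfolding disjoint_family_on_def by (metis UNIV_I Suc_inject)

lemma cell_cover:
 assumes "0 < x" "x \<le> t 0" shows "\<exists>n. x \<in> grid_cell t (Suc n)"
proof -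
 define n where "n = (LEAST n. t n < x)"
 have n: "t n < x" unfolding n_def using t_lim[OF assms(1)] by (rule LeastI_ex)
 have "n \<noteq> 0" using n assms by (intro notI) auto
 then obtain k where k: "n = Suc k" by (cases n) auto
 have "\<not> t k < x" using not_less_Least[of k "\<lambda>n. t n < x"] k by (simp add: n_def)
 then show ?thesis using n k by (intro exI[of _ k]) auto
qed

lemma sum_cells:
 fixes F :: "nat => ennreal"
 assumes "x \<in> grid_cell t (Suc k)"
 shows "(\<Sum>n. F n * indicator (grid_cell t (Suc n)) x) = F k"
proof -
 have "x \<notin> grid_cell t (Suc n)" if "n \<noteq> k" for n
  using disjoint_family_onD[OF disjoint_cells_Suc _ _ that] assms by auto
 then have "(\<Sum>n. F n * indicator (grid_cell t (Suc n)) x) = (\<Sum>n\<in>{k}. F n * indicator (grid_cell t (Suc n)) x)"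
  by (intro suminf_finite) (auto simp del: grid_cell_simps)
 then show ?thesis using assms by (simp del: grid_cell_simps)
qed

lemma integral_cells:
 fixes F :: "nat => ennreal"
 shows "(\<integral>\<^sup>+x. (\<Sum>n. F n * indicator (grid_cell t (Suc n)) x) \<partial>w) = (\<Sum>n. W (Suc n) * F n)"
proof -
 have m: "(\<lambda>x. F n * indicator (grid_cell t (Suc n)) x) \<in> borel_measurable w" for n
  by (rule measurable_borel_like[OF w]) measurable
 have "(\<integral>\<^sup>+x. (\<Sum>n. F n * indicator (grid_cell t (Suc n)) x) \<partial>w)
   = (\<Sum>n. \<integral>\<^sup>+x. F n * indicator (grid_cell t (Suc n)) x \<partial>w)"
  by (rule nn_integral_suminf[OF m])
 also have "\<dots> = (\<Sum>n. W (Suc n) * F n)"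
 proof (intro suminf_cong)
  fix n
  have "grid_cell t (Suc n) \<in> sets w" unfolding w by (rule grid_cell_borel)
  then show "(\<integral>\<^sup>+x. F n * indicator (grid_cell t (Suc n)) x \<partial>w) = W (Suc n) * F n"
   unfolding w_cell[symmetric] by (simp only: nn_integral_cmult_indicator mult.commute)
 qed
 finally show ?thesis .
qed

lemma upper_sum:
 assumes "\<And>n x. x \<in> grid_cell t (Suc n) ==> f x \<le> F n"
 shows "(\<integral>\<^sup>+x\<in>{..t 0}. f x \<partial>w) \<le> (\<Sum>n. W (Suc n) * F n)"
 unfolding integral_cells[symmetric]
proof (rule nn_integral_mono_AE)
 have "{..0} \<in> null_sets w" using w w0 by auto
 then have "AE x in w. x \<notin> {..0}" by (rule AE_not_in)
 then show "AE x in w. f x * indicator {..t 0} x \<le> (\<Sum>n. F n * indicator (grid_cell t (Suc n)) x)"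
 proof eventually_elim
  fix x :: real assume "x \<notin> {..0}"
  show "f x * indicator {..t 0} x \<le> (\<Sum>n. F n * indicator (grid_cell t (Suc n)) x)"
  proof (cases "x \<le> t 0")
   case True
   then obtain k where k: "x \<in> grid_cell t (Suc k)" using cell_cover[of x] \<open>x \<notin> {..0}\<close> by auto
   show ?thesis unfolding sum_cells[OF k] using assms[OF k] True by simp
  qed simp
 qed
qed

lemma lower_sum:
 assumes "\<And>n x. x \<in> grid_cell t (Suc n) ==> F n \<le> f x"
 shows "(\<Sum>n. W (Suc n) * F n) \<le> (\<integral>\<^sup>+x\<in>{..t 0}. f x \<partial>w)"
 unfolding integral_cells[symmetric]
proof (rule nn_integral_mono)
 fix x
 show "(\<Sum>n. F n * indicator (grid_cell t (Suc n)) x) \<le> f x * indicator {..t 0} x"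
 proof (cases "\<exists>k. x \<in> grid_cell t (Suc k)")
  case True
  then obtain k where k: "x \<in> grid_cell t (Suc k)" by blast
  then have "x \<le> t 0" using t_antimono[of 0 k] by auto
  then show ?thesis unfolding sum_cells[OF k] using assms[OF k] by simp
 next
  case False
  then have "(\<Sum>n. F n * indicator (grid_cell t (Suc n)) x) = 0" by simp
  then show ?thesis by simp
 qed
qed

text \<open>For terms that refer to nodes j steps above the cell of integration: the gap leaves room
  to compare suprema and heads at x with quantities at those nodes.\<close>

lemma lower_sum_shift:
 assumes "\<And>n x. x \<in> grid_cell t (Suc (n + j)) ==> F n \<le> f x"
 shows "(\<Sum>n. W (Suc (n + j)) * F n) \<le> (\<integral>\<^sup>+x\<in>{..t 0}. f x \<partial>w)"
proof -
 have "(\<Sum>n. W (Suc n) * (if j \<le> n then F (n - j) else 0)) \<le> (\<integral>\<^sup>+x\<in>{..t 0}. f x \<partial>w)"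
 proof (rule lower_sum)
  fix n x assume "x \<in> grid_cell t (Suc n)"
  then show "(if j \<le> n then F (n - j) else 0) \<le> f x" using assms[of x "n - j"] by simp
 qed
 moreover have "(\<Sum>n. W (Suc n) * (if j \<le> n then F (n - j) else 0))
   = (\<Sum>n. if j \<le> n then W (Suc ((n - j) + j)) * F (n - j) else 0)"
  by (intro suminf_cong) auto
 ultimately show ?thesis unfolding suminf_shift_ennreal[of j "\<lambda>n. W (Suc (n + j)) * F n"] by simp
qed

lemma copson_cell:
 assumes g: "g \<in> borelfun" and x: "x \<in> grid_cell t (Suc k)"
 shows "copson s g x = copson (restr s (grid_cell t (Suc k))) g x + copson s g (t k)"
proof -
 have "copson (restr s (grid_cell t (Suc k))) g x = copson s (\<lambda>y. g y * indicator (grid_cell t (Suc k)) y) x"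
  by (rule copson_restr[OF s grid_cell_borel g])
 also have "\<dots> = (\<integral>\<^sup>+y\<in>{x<..t k}. g y \<partial>s)"
  unfolding copson_def using x by (intro nn_integral_cong) (auto split: split_indicator)
 finally show ?thesis using copson_split[OF s g, of x "t k"] x by simp
qed

lemma copson_cell0:
 assumes g: "g \<in> borelfun" and x: "x \<in> grid_cell t 0"
 shows "copson s g x = copson (restr s (grid_cell t 0)) g x"
proof -
 have "copson (restr s (grid_cell t 0)) g x = copson s (\<lambda>y. g y * indicator (grid_cell t 0) y) x"
  by (rule copson_restr[OF s grid_cell_borel g])
 also have "\<dots> = copson s g x"
  unfolding copson_def using x by (intro nn_integral_cong) (auto split: split_indicator)
 finally show ?thesis by simp
qed

text \<open>An m-th power: over one cell, the Copson integral formed with the part of s in the same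
  cell only. What lies to the right of the cell contributes a constant on it and is treated
  apart.\<close>

definition local_norm :: "real => (real => ennreal) => nat => ennreal" where
 "local_norm m g n = (\<integral>\<^sup>+x\<in>grid_cell t n. copson (restr s (grid_cell t n)) g x epowr m \<partial>u)"

lemma cell_iterK_0:
 assumes g: "g \<in> borelfun"
 shows "(\<integral>\<^sup>+x\<in>grid_cell t 0. copson s g x epowr m \<partial>u) = local_norm m g 0"
 unfolding local_norm_def
proof (intro nn_integral_cong)
 fix x
 show "copson s g x epowr m * indicator (grid_cell t 0) x
   = copson (restr s (grid_cell t 0)) g x epowr m * indicator (grid_cell t 0) x"
  using copson_cell0[OF g, of x] by (cases "x \<in> grid_cell t 0") simp_all
qed

lemma cell_iterK_Suc:
 assumes g: "g \<in> borelfun" and m: "0 < m"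
 shows "(\<integral>\<^sup>+x\<in>grid_cell t (Suc k). copson s g x epowr m \<partial>u) \<le>
  2 epowr m * (local_norm m g (Suc k) + u (grid_cell t (Suc k)) * copson s g (t k) epowr m)"
proof -
 let ?J = "grid_cell t (Suc k)" and ?c = "copson (restr s (grid_cell t (Suc k))) g" and ?H = "copson s g (t k)"
 have [measurable]: "?c \<in> borelfun" by (rule measurable_copson)
 have m1: "(\<lambda>x. ?c x epowr m * indicator ?J x) \<in> borel_measurable u"
  by (rule measurable_borel_like[OF u]) measurable
 have m2: "(\<lambda>x. ?H epowr m * indicator ?J x) \<in> borel_measurable u"
  by (rule measurable_borel_like[OF u]) measurable
 have m3: "(\<lambda>x. ?c x epowr m * indicator ?J x + ?H epowr m * indicator ?J x) \<in> borel_measurable u"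
  by (rule measurable_borel_like[OF u]) measurable
 have Jb: "?J \<in> sets u" unfolding u by (rule grid_cell_borel)
 have "(\<integral>\<^sup>+x\<in>?J. copson s g x epowr m \<partial>u)
   \<le> (\<integral>\<^sup>+x. 2 epowr m * (?c x epowr m * indicator ?J x + ?H epowr m * indicator ?J x) \<partial>u)"
 proof (intro nn_integral_mono)
  fix x
  show "copson s g x epowr m * indicator ?J x \<le> 2 epowr m * (?c x epowr m * indicator ?J x + ?H epowr m * indicator ?J x)"
  proof (cases "x \<in> ?J")
   case True
   have "copson s g x epowr m \<le> 2 epowr m * (?c x epowr m + ?H epowr m)"
    unfolding copson_cell[OF g True] using m by (intro epowr_add_le) auto
   then show ?thesis using True by simp
  qed simp
 qed
 also have "\<dots> = 2 epowr m * (local_norm m g (Suc k) + u ?J * ?H epowr m)"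
  unfolding nn_integral_cmult[OF m3] nn_integral_add[OF m1 m2] nn_integral_cmult_indicator[OF Jb] local_norm_def
  by (simp only: mult.commute)
 finally show ?thesis .
qed

end

text \<open>At a node the inner integral is a sum over the cells to the right, and the decay of W
  reduces the weighted sum to its diagonal. On a single cell the Copson integral is its local part
  plus its value at the upper node; the two resulting series are the local and the discrete problem.
  Cell 0 has no upper node and only a local part.\<close>

lemma grid_reduction:
 assumes a: "0 < a" and m: "0 < m"
 shows "\<exists>c<top. \<forall>u w s t g. copson_grid u w s a t --> g \<in> borelfun -->
  iterK_int_upto (t 0) a m u w s g \<le> c *
   ((\<Sum>n. w {..t n} * copson_grid.local_norm u s t m g n epowr a) +
    (\<Sum>n. w {..t (Suc n)} * u (grid_cell t (Suc n)) epowr a * copson s g (t n) epowr (a * m)))"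
proof -
 \<comment> \<open>The inner sums carry no weights, \<mu> = 1, so the condition of
   \<open>suminf_geometric_epowr\<close> reads 1/2 < 1 whatever the exponent a is.\<close>
 obtain c where c: "c < top" and geo: "\<And>\<omega> x. (\<forall>n. \<omega> (Suc n) \<le> ennreal (1/2) * \<omega> n) ==>
  (\<Sum>n. \<omega> n * (\<Sum>j\<le>n. ennreal (1 ^ (n - j)) * x j) epowr a) \<le> c * (\<Sum>n. \<omega> n * x n epowr a)"
 proof -
  have "\<exists>c<top. \<forall>\<omega> x. (\<forall>n. \<omega> (Suc n) \<le> ennreal (1/2) * \<omega> n) -->
   (\<Sum>n. \<omega> n * (\<Sum>j\<le>n. ennreal (1 ^ (n - j)) * x j) epowr a) \<le> c * (\<Sum>n. \<omega> n * x n epowr a)"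
   by (rule suminf_geometric_epowr) (use a in simp_all)
  then show ?thesis using that by blast
 qed
 define C where "C = (2 epowr m) epowr a * 2 epowr a + 1"
 have C: "C < top" unfolding C_def using a m by (intro add_less_top_ennreal mult_less_top_ennreal epowr_less_top) auto
 show ?thesis
 proof (intro exI[of _ "c * C"] conjI allI impI)
  show "c * C < top" by (rule mult_less_top_ennreal[OF c C])
  fix u w s t and g :: "real => ennreal"
  assume "copson_grid u w s a t" and g: "g \<in> borelfun"
  then interpret copson_grid u w s a t by simp
  define \<kappa> where "\<kappa> = (\<lambda>j. \<integral>\<^sup>+x\<in>grid_cell t j. copson s g x epowr m \<partial>u)"
  let ?F2 = "\<lambda>n. W (Suc n) * u (grid_cell t (Suc n)) epowr a * copson s g (t n) epowr (a * m)"
  have mc: "(\<lambda>x. copson s g x epowr m) \<in> borelfun"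
   by (rule borel_measurable_epowr[OF measurable_copson])
  have K: "iterK m u s g (t n) = (\<Sum>j\<le>n. ennreal (1 ^ (n - j)) * \<kappa> j)" for n
   unfolding iterK_def \<kappa>_def tail_sum[OF u mc] by simp
  have "iterK_int_upto (t 0) a m u w s g \<le> (\<Sum>n. W (Suc n) * iterK m u s g (t (Suc n)) epowr a)"
   using a by (intro upper_sum epowr_mono iterK_antimono) auto
  also have "\<dots> \<le> (\<Sum>n. W n * iterK m u s g (t n) epowr a)"
   unfolding suminf_Suc_ennreal[of "\<lambda>n. W n * iterK m u s g (t n) epowr a"] by simp
  also have "\<dots> \<le> c * (\<Sum>n. W n * \<kappa> n epowr a)"
   unfolding K using W_Suc_half by (intro geo allI) simp
  also have "\<dots> \<le> c * (C * ((\<Sum>n. W n * local_norm m g n epowr a) + (\<Sum>n. ?F2 n)))"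
  proof (rule mult_left_mono)
   let ?L = "\<lambda>n. W n * local_norm m g n epowr a"
   have 0: "W 0 * \<kappa> 0 epowr a \<le> C * ?L 0"
   proof -
    have "W 0 * \<kappa> 0 epowr a = ?L 0" unfolding \<kappa>_def cell_iterK_0[OF g] ..
    also have "\<dots> = 1 * ?L 0" by simp
    also have "\<dots> \<le> C * ?L 0" by (rule mult_right_mono) (simp_all add: C_def)
    finally show ?thesis .
   qed
   have Sk: "W (Suc k) * \<kappa> (Suc k) epowr a \<le> C * (?L (Suc k) + ?F2 k)" for k
   proof -
    let ?l = "local_norm m g (Suc k)" and ?r = "u (grid_cell t (Suc k)) * copson s g (t k) epowr m"
    have "\<kappa> (Suc k) epowr a \<le> (2 epowr m * (?l + ?r)) epowr a"
     unfolding \<kappa>_def using a by (intro epowr_mono cell_iterK_Suc g m) auto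
    also have "\<dots> = (2 epowr m) epowr a * (?l + ?r) epowr a" using a by (intro epowr_mult) auto
    also have "\<dots> \<le> (2 epowr m) epowr a * (2 epowr a * (?l epowr a + ?r epowr a))"
     using a by (intro mult_left_mono epowr_add_le) auto
    also have "\<dots> = (2 epowr m) epowr a * 2 epowr a * (?l epowr a + ?r epowr a)" by (simp only: mult.assoc)
    also have "\<dots> \<le> C * (?l epowr a + ?r epowr a)" by (rule mult_right_mono) (simp_all add: C_def)
    finally have "W (Suc k) * \<kappa> (Suc k) epowr a \<le> W (Suc k) * (C * (?l epowr a + ?r epowr a))"
     by (rule mult_left_mono) simp
    also have "?r epowr a = u (grid_cell t (Suc k)) epowr a * copson s g (t k) epowr (a * m)"
     using a by (simp add: epowr_mult epowr_epowr mult.commute)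
    finally show ?thesis by (simp only: distrib_left mult_ac)
   qed
   have "(\<Sum>n. W n * \<kappa> n epowr a) = W 0 * \<kappa> 0 epowr a + (\<Sum>k. W (Suc k) * \<kappa> (Suc k) epowr a)"
    by (rule suminf_Suc_ennreal)
   also have "\<dots> \<le> C * ?L 0 + (\<Sum>k. C * (?L (Suc k) + ?F2 k))"
    by (intro add_mono 0 suminf_le summableI Sk)
   also have "\<dots> = C * (?L 0 + (\<Sum>k. ?L (Suc k)) + (\<Sum>k. ?F2 k))"
    unfolding ennreal_suminf_cmult suminf_add_ennreal by (simp only: distrib_left add.assoc)
   also have "?L 0 + (\<Sum>k. ?L (Suc k)) = (\<Sum>n. ?L n)"
    by (rule suminf_Suc_ennreal[symmetric])
   finally show "(\<Sum>n. W n * \<kappa> n epowr a) \<le> C * ((\<Sum>n. ?L n) + (\<Sum>n. ?F2 n))" .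
  qed simp
  finally show "iterK_int_upto (t 0) a m u w s g \<le> c * C *
   ((\<Sum>n. W n * local_norm m g n epowr a) + (\<Sum>n. ?F2 n))" by (simp only: mult.assoc)
 qed
qed

text \<open>Nodes are points where w {..x} takes the values M / 2^n. They tend to 0 because every
  head has positive mass and so exceeds some M / 2^n.\<close>

lemma grid_exists:
 assumes "diffuse u" and dw: "diffuse w" and "diffuse s" and "0 < a"
  and "\<And>x y. 0 < x ==> u {x<..y} < top" and "\<And>x. 0 < x ==> s {x<..} < top"
  and w0: "w {..0} = 0" and "\<And>x. 0 < x ==> Phi a u w x < top"
  and wpos: "\<And>x. 0 < x ==> 0 < w {..x}" and T: "0 < T" "w {..T} < top"
 shows "\<exists>t. t 0 = T \<and> copson_grid u w s a t"
proof -
 note w = diffuseD(1)[OF dw]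
 obtain M where M: "w {..T} = ennreal M" "0 < M"
  using wpos[OF T(1)] T(2) by (cases "w {..T}" rule: ennreal_pos_cases) auto
 define \<nu> where "\<nu> = restr w {..T}"
 have dn: "diffuse \<nu>" unfolding \<nu>_def by (rule diffuse_restr[OF dw]) simp
 have nM: "\<nu> UNIV = ennreal M" using M w by (simp add: \<nu>_def emeasure_restr)
 have ex: "\<exists>x. w {..x} = ennreal (M / 2 ^ n)" for n
 proof (cases "n = 0")
  case True
  then show ?thesis using M by (intro exI[of _ T]) simp
 next
  case False
  then have "1 < (2::real) ^ n" by (intro one_less_power) auto
  then have lt: "M / 2 ^ n < M" using M by (simp add: field_simps)
  obtain x where x: "\<nu> {x<..} = ennreal (M - M / 2 ^ n)"
   using diffuse_tail_point[OF dn nM, of "M - M / 2 ^ n"] lt M by auto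
  have e: "\<nu> {x<..} = w ({..T} \<inter> {x<..})"
   unfolding \<nu>_def by (rule emeasure_restr[OF w]) auto
  have "x < T"
  proof (rule ccontr)
   assume "\<not> x < T"
   then have "{..T} \<inter> {x<..} = {}" by auto
   then show False using x e lt by simp
  qed
  have "w {..x} + w ({..T} \<inter> {x<..}) = w ({..x} \<union> ({..T} \<inter> {x<..}))"
   using w by (intro plus_emeasure) auto
  moreover have "{..x} \<union> ({..T} \<inter> {x<..}) = {..T}" using \<open>x < T\<close> by auto
  ultimately have "w {..x} + ennreal (M - M / 2 ^ n) = ennreal (M / 2 ^ n) + ennreal (M - M / 2 ^ n)"
   using x e M lt by (simp flip: ennreal_plus)
  then have "w {..x} = ennreal (M / 2 ^ n)"
   by (simp add: add.commute[of _ "ennreal (M - M / 2 ^ n)"] ennreal_add_left_cancel)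
  then show ?thesis by blast
 qed
 \<comment> \<open>The value M may be attained at other points than T, so the first node is
   prescribed and only the later ones are chosen.\<close>
 define t where "t = (\<lambda>n. if n = 0 then T else (SOME x. w {..x} = ennreal (M / 2 ^ n)))"
 have t: "w {..t n} = ennreal (M / 2 ^ n)" for n
  using someI_ex[OF ex[of n]] M by (cases "n = 0") (simp_all add: t_def)
 have "copson_grid u w s a t"
 proof (rule copson_grid.intro)
  fix n
  show "0 < t n"
  proof (rule ccontr)
   assume "\<not> 0 < t n"
   then have "w {..t n} \<le> w {..0}" using w by (intro emeasure_mono) auto
   then show False using t[of n] w0 M by simp
  qed
  show "t (Suc n) < t n"
  proof (rule ccontr)
   assume "\<not> t (Suc n) < t n"
   then have "w {..t n} \<le> w {..t (Suc n)}" using w by (intro emeasure_mono) auto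
   then show False unfolding t using M by (simp add: field_simps)
  qed
  have "2 * ennreal (M / 2 ^ Suc n) = ennreal (2 * (M / 2 ^ Suc n))" using M by (subst ennreal_mult) auto
  then show "w {..t n} = 2 * w {..t (Suc n)}" unfolding t by (simp add: field_simps)
 next
  fix x :: real assume x: "0 < x"
  show "\<exists>n. t n < x"
  proof (rule ccontr)
   assume "\<nexists>n. t n < x"
   then have le: "w {..x} \<le> ennreal (M / 2 ^ n)" for n
    unfolding t[symmetric] using w by (intro emeasure_mono) (auto simp: not_less)
   have "w {..x} < top" using le[of 0] by (rule le_less_trans) simp
   then obtain r where r: "w {..x} = ennreal r" "0 < r"
    using wpos[OF x] by (cases "w {..x}" rule: ennreal_pos_cases) auto
   obtain n where "M / r < 2 ^ n" using real_arch_pow[of 2 "M / r"] by auto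
   then have "M / 2 ^ n < r" using r by (simp add: field_simps)
   then show False using le[of n] r M by (simp add: ennreal_le_iff)
  qed
 qed (use assms T in \<open>auto simp: t_def\<close>)
 then show ?thesis by (intro exI[of _ t]) (simp add: t_def)
qed

section \<open>Monotonicity of the inner functionals, and summation of the local norms\<close>

lemma Usup_antimono:
 assumes u: "sets u = sets borel" and b: "0 \<le> b" and xy: "x \<le> y"
 shows "Usup b k u s y \<le> Usup b k u s x"
 unfolding Usup_def
proof (rule SUP_mono)
 fix z assume z: "z \<in> {y<..}"
 have "u {y<..z} epowr b \<le> u {x<..z} epowr b"
  using u b xy by (intro epowr_mono emeasure_mono) auto
 then have "u {y<..z} epowr b * s {z<..} epowr k \<le> u {x<..z} epowr b * s {z<..} epowr k"
  by (rule mult_right_mono) simp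
 then show "\<exists>z'\<in>{x<..}. u {y<..z} epowr b * s {z<..} epowr k \<le> u {x<..z'} epowr b * s {z'<..} epowr k"
  using z xy by (intro bexI[of _ z]) auto
qed

lemma Usup_upper: "x < z ==> emeasure u {x<..z} epowr b * emeasure s {z<..} epowr k \<le> Usup b k u s x"
 unfolding Usup_def by (rule SUP_upper) simp

lemma Usup_epowr:
 assumes "0 < b'" "0 \<le> b"
 shows "Usup b k u s x epowr b' = Usup (b * b') (k * b') u s x"
 unfolding Usup_def using assms
 by (subst epowr_SUP) (auto simp: epowr_mult epowr_epowr intro!: exI[of _ "x + 1"])

lemma Xu_antimono:
 assumes u: "sets u = sets borel" and m: "0 < m" "m < p" and xy: "x \<le> y"
 shows "Xu m p u s y \<le> Xu m p u s x"
 unfolding Xu_def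
proof (intro nn_integral_mono)
 fix z
 have "u {y<..z} epowr (m / (p - m)) \<le> u {x<..z} epowr (m / (p - m))"
  using u m xy by (intro epowr_mono emeasure_mono) auto
 then have "u {y<..z} epowr (m / (p - m)) * s {z<..} epowr (m * (p - 1) / (p - m))
   \<le> u {x<..z} epowr (m / (p - m)) * s {z<..} epowr (m * (p - 1) / (p - m))"
  by (rule mult_right_mono) simp
 then show "u {y<..z} epowr (m / (p - m)) * s {z<..} epowr (m * (p - 1) / (p - m)) * indicator {y<..} z
   \<le> u {x<..z} epowr (m / (p - m)) * s {z<..} epowr (m * (p - 1) / (p - m)) * indicator {x<..} z"
  using xy by (auto split: split_indicator)
qed

lemma suminf_local_le:
 assumes a: "0 < a" and m: "0 < m" and p: "0 < p" "p \<le> a * m"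
  and L: "\<And>n. L n \<le> c * (N n epowr (m / p) * B n)" and A: "\<And>n. W n * B n epowr a \<le> A"
 shows "(\<Sum>n. W n * L n epowr a) \<le> c epowr a * (A * (\<Sum>n. N n) epowr (a * m / p))"
proof -
 have "(\<Sum>n. W n * L n epowr a) \<le> (\<Sum>n. c epowr a * A * N n epowr (a * m / p))"
 proof (intro suminf_le summableI)
  fix n
  have "W n * L n epowr a \<le> W n * (c * (N n epowr (m / p) * B n)) epowr a"
   using a by (intro mult_left_mono epowr_mono L) auto
  also have "\<dots> = c epowr a * N n epowr (a * m / p) * (W n * B n epowr a)"
   using a by (simp add: epowr_mult epowr_epowr mult_ac)
  also have "\<dots> \<le> c epowr a * N n epowr (a * m / p) * A"
   by (intro mult_left_mono A) simp
  finally show "W n * L n epowr a \<le> c epowr a * A * N n epowr (a * m / p)" by (simp only: mult_ac)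
 qed
 also have "\<dots> = c epowr a * A * (\<Sum>n. N n epowr (a * m / p))" by (rule ennreal_suminf_cmult)
 also have "\<dots> \<le> c epowr a * A * (\<Sum>n. N n) epowr (a * m / p)"
  using p by (intro mult_left_mono suminf_epowr_le) auto
 finally show ?thesis by (simp only: mult.assoc)
qed

lemma suminf_local_lt:
 assumes a: "0 < a" and m: "0 < m" and p: "a * m < p"
  and L: "\<And>n. L n \<le> c * (N n epowr (m / p) * B n)"
 shows "(\<Sum>n. W n * L n epowr a) \<le> c epowr a * ((\<Sum>n. N n) epowr (a * m / p) *
   (\<Sum>n. (W n * B n epowr a) epowr (p / (p - a * m))) epowr ((p - a * m) / p))"
proof -
 have am: "0 < a * m" using a m by simp
 have ex: "1 / (1 - a * m / p) = p / (p - a * m)" "1 - a * m / p = (p - a * m) / p"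
  using am p by (auto simp: field_simps)
 have "(\<Sum>n. W n * L n epowr a) \<le> (\<Sum>n. c epowr a * (N n epowr (a * m / p) * (W n * B n epowr a)))"
 proof (intro suminf_le summableI)
  fix n
  have "W n * L n epowr a \<le> W n * (c * (N n epowr (m / p) * B n)) epowr a"
   using a by (intro mult_left_mono epowr_mono L) auto
  also have "\<dots> = c epowr a * (N n epowr (a * m / p) * (W n * B n epowr a))"
   using a by (simp add: epowr_mult epowr_epowr mult_ac)
  finally show "W n * L n epowr a \<le> c epowr a * (N n epowr (a * m / p) * (W n * B n epowr a))" .
 qed
 also have "\<dots> = c epowr a * (\<Sum>n. N n epowr (a * m / p) * (W n * B n epowr a))" by (rule ennreal_suminf_cmult)
 also have "\<dots> \<le> c epowr a * ((\<Sum>n. N n) epowr (a * m / p) *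
   (\<Sum>n. (W n * B n epowr a) epowr (1 / (1 - a * m / p))) epowr (1 - a * m / p))"
  using am p by (intro mult_left_mono Hoelder_suminf) auto
 finally show ?thesis unfolding ex(1) unfolding ex(2) .
qed

context copson_grid
begin

lemma cell_norm_sum:
 assumes g: "g \<in> borelfun" and p: "0 < p"
 shows "(\<Sum>n. \<integral>\<^sup>+y\<in>grid_cell t n. g y epowr p \<partial>s) \<le> (powint p s g)"
proof -
 have g': "(\<lambda>y. g y epowr p) \<in> borel_measurable s"
  by (rule borel_measurable_epowr[OF measurable_borel_like[OF s g]])
 have cs: "grid_cell t n \<in> sets s" for n unfolding s by (rule grid_cell_borel)
 have "(\<Sum>n. \<integral>\<^sup>+y\<in>grid_cell t n. g y epowr p \<partial>s) = (\<integral>\<^sup>+y\<in>(\<Union>n. grid_cell t n). g y epowr p \<partial>s)"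
  by (rule nn_integral_disjoint_family[OF g' cs disjoint_cells, symmetric])
 also have "\<dots> \<le> (powint p s g)"
  by (intro nn_integral_mono) (auto split: split_indicator)
 finally show ?thesis .
qed

lemma restr_cell:
 assumes "\<mu> = u \<or> \<mu> = s"
 shows "sets (restr \<mu> (grid_cell t n)) = sets borel"
  "A \<in> sets borel ==> (restr \<mu> (grid_cell t n)) A = \<mu> (grid_cell t n \<inter> A)"
  "f \<in> borelfun ==> (\<integral>\<^sup>+x. f x \<partial>restr \<mu> (grid_cell t n)) = (\<integral>\<^sup>+x\<in>grid_cell t n. f x \<partial>\<mu>)"
proof -
 have \<mu>: "sets \<mu> = sets borel" using assms u s by auto
 show "sets (restr \<mu> (grid_cell t n)) = sets borel" using \<mu> by simp
 show "A \<in> sets borel ==> (restr \<mu> (grid_cell t n)) A = \<mu> (grid_cell t n \<inter> A)"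
  by (rule emeasure_restr[OF \<mu> grid_cell_borel])
 show "f \<in> borelfun ==> (\<integral>\<^sup>+x. f x \<partial>restr \<mu> (grid_cell t n)) = (\<integral>\<^sup>+x\<in>grid_cell t n. f x \<partial>\<mu>)"
  by (rule nn_integral_restr[OF \<mu> grid_cell_borel])
qed

lemma local_norm_restr:
 "local_norm m g n = (\<integral>\<^sup>+x\<in>{t n..}. copson (restr s (grid_cell t n)) g x epowr m \<partial>restr u (grid_cell t n))"
proof -
 have mc [measurable]: "copson (restr s (grid_cell t n)) g \<in> borelfun" by (rule measurable_copson)
 have "(\<integral>\<^sup>+x\<in>{t n..}. copson (restr s (grid_cell t n)) g x epowr m \<partial>restr u (grid_cell t n))
   = (\<integral>\<^sup>+x\<in>grid_cell t n. copson (restr s (grid_cell t n)) g x epowr m * indicator {t n..} x \<partial>u)"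
  by (rule restr_cell(3)) (simp, measurable)
 also have "\<dots> = local_norm m g n"
  unfolding local_norm_def
 proof (intro nn_integral_cong)
  fix x
  have "t n \<le> x" if "x \<in> grid_cell t n" using grid_cell_subset[of t n] that by auto
  then show "copson (restr s (grid_cell t n)) g x epowr m * indicator {t n..} x * indicator (grid_cell t n) x
    = copson (restr s (grid_cell t n)) g x epowr m * indicator (grid_cell t n) x"
   by (cases "x \<in> grid_cell t n") auto
 qed
 finally show ?thesis by simp
qed

lemma cell_norm_restr:
 assumes g: "g \<in> borelfun"
 shows "(\<integral>\<^sup>+y\<in>{t n<..}. g y epowr p \<partial>restr s (grid_cell t n)) = (\<integral>\<^sup>+y\<in>grid_cell t n. g y epowr p \<partial>s)"
proof -
 have [measurable]: "g \<in> borelfun" by (rule g)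
 have "(\<integral>\<^sup>+y\<in>{t n<..}. g y epowr p \<partial>restr s (grid_cell t n)) = (\<integral>\<^sup>+y\<in>grid_cell t n. g y epowr p * indicator {t n<..} y \<partial>s)"
  by (rule restr_cell(3)) (simp, measurable)
 also have "\<dots> = (\<integral>\<^sup>+y\<in>grid_cell t n. g y epowr p \<partial>s)"
  using grid_cell_subset[of t n] by (intro nn_integral_cong) (auto split: split_indicator)
 finally show ?thesis .
qed

lemma restr_u_le: "(restr u (grid_cell t n)) {t n..x} \<le> u {t n<..x}"
proof -
 have "grid_cell t n \<inter> {t n..x} \<subseteq> {t n<..x}" using grid_cell_subset[of t n] by auto
 then show ?thesis using u by (subst restr_cell(2)) (auto intro: emeasure_mono)
qed

lemma restr_s_le: "(restr s (grid_cell t n)) {x<..} \<le> s {x<..}"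
 using s by (subst restr_cell(2)) (auto intro: emeasure_mono)

lemma cell_norm_fin:
 assumes "(powint p s g) < top"
 shows "(\<integral>\<^sup>+y\<in>grid_cell t n. g y epowr p \<partial>s) < top"
 by (rule le_less_trans[OF nn_integral_mono assms]) (auto split: split_indicator)

text \<open>The local operator is the Copson operator between the restrictions to the cell.
  Replacing the restricted masses by the full ones loses nothing essential and brings the supremum
  to the form in which it enters A1 and A2.\<close>

lemma local_norm_le:
 assumes m: "0 < m" and p: "1 < p" "p \<le> m" and g: "g \<in> borelfun" and N: "(powint p s g) < top"
 shows "local_norm m g n \<le> 4 epowr m * ((\<integral>\<^sup>+y\<in>grid_cell t n. g y epowr p \<partial>s) epowr (m / p) * Usup 1 (m * (p - 1) / p) u s (t n))"
proof -
 have "local_norm m g n \<le> 4 epowr m * (Usup 1 (m * (p - 1) / p) u s (t n) *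
  (\<integral>\<^sup>+y\<in>{t n<..}. g y epowr p \<partial>restr s (grid_cell t n)) epowr (m / p))"
  unfolding local_norm_restr
 proof (rule Hardy_upper_le[OF m p])
  show "sets (restr u (grid_cell t n)) = sets borel" by (rule restr_cell(1)) simp
  show "diffuse (restr s (grid_cell t n))" by (rule diffuse_restr[OF ds grid_cell_borel])
  show "g \<in> borelfun" by (rule g)
  show "(restr s (grid_cell t n)) {t n<..} < top"
   by (rule le_less_trans[OF restr_s_le sfin[OF t_pos]])
  show "(\<integral>\<^sup>+y\<in>{t n<..}. g y epowr p \<partial>restr s (grid_cell t n)) < top"
   unfolding cell_norm_restr[OF g] by (rule cell_norm_fin[OF N])
  fix x assume "t n \<le> x"
  show "(restr u (grid_cell t n)) {t n..x} * (restr s (grid_cell t n)) {x<..} epowr (m * (p - 1) / p)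
    \<le> Usup 1 (m * (p - 1) / p) u s (t n)"
  proof (cases "t n < x")
   case True
   have "(restr u (grid_cell t n)) {t n..x} * (restr s (grid_cell t n)) {x<..} epowr (m * (p - 1) / p)
     \<le> u {t n<..x} * s {x<..} epowr (m * (p - 1) / p)"
    using m p by (intro mult_mono epowr_mono restr_u_le restr_s_le) auto
   also have "\<dots> \<le> Usup 1 (m * (p - 1) / p) u s (t n)"
    using Usup_upper[OF True, of u 1 s "m * (p - 1) / p"] by simp
   finally show ?thesis .
  next
   case False
   then have "u {t n<..x} = 0" by simp
   then have "(restr u (grid_cell t n)) {t n..x} = 0" using restr_u_le[of n x] by simp
   then show ?thesis by simp
  qed
 qed
 then show ?thesis unfolding cell_norm_restr[OF g] by (simp only: mult_ac)
qed

end

lemma local_norm_lt: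
 assumes m: "0 < m" "m < p" and p: "1 < p"
 shows "\<exists>c<top. \<forall>u w s a t g n. copson_grid u w s a t --> g \<in> borelfun --> (powint p s g) < top -->
  copson_grid.local_norm u s t m g n \<le> c * ((\<integral>\<^sup>+y\<in>grid_cell t n. g y epowr p \<partial>s) epowr (m / p) * Xu m p u s (t n) epowr ((p - m) / p))"
proof -
 show ?thesis
 proof (rule ex_finiteE[OF Hardy_upper_lt[OF m(1) p m(2)]], goal_cases)
 case (1 c)
 note c = 1(1) and H = 1(2)[rule_format (no_asm)]
 show ?thesis
 proof (intro exI[of _ c] conjI[OF c] allI impI)
  fix u w s a t n and g :: "real => ennreal"
  assume "copson_grid u w s a t" and g: "g \<in> borelfun" and N: "(powint p s g) < top"
  then interpret copson_grid u w s a t by simp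
  let ?u = "restr u (grid_cell t n)" and ?s = "restr s (grid_cell t n)"
  let ?f = "\<lambda>x. emeasure ?u {t n..x} epowr (m / (p - m)) * emeasure ?s {x<..} epowr (m * (p - 1) / (p - m))"
  let ?N = "\<integral>\<^sup>+y\<in>grid_cell t n. g y epowr p \<partial>s"
  have ru: "sets ?u = sets borel" and rs: "sets ?s = sets borel" by (rule restr_cell(1), simp)+
  have fin: "emeasure ?u {t n..x} < top" for x
   by (rule le_less_trans[OF restr_u_le ufin[OF t_pos]])
  have mf: "?f \<in> borelfun"
  proof -
   have "(\<lambda>x. emeasure ?u {t n..x}) \<in> borelfun"
    by (rule borel_measurable_mono_ennreal) (rule monoI, rule emeasure_mono, auto simp: ru u)
   then show ?thesis using measurable_tail[OF rs] by measurable
  qed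
  have "local_norm m g n \<le> c * (?N epowr (m / p) * (\<integral>\<^sup>+x\<in>{t n..}. ?f x \<partial>?u) epowr ((p - m) / p))"
   unfolding local_norm_restr cell_norm_restr[OF g, symmetric]
  proof (rule H[OF ru diffuse_restr[OF ds grid_cell_borel] g])
   show "emeasure ?s {t n<..} < top"
    by (rule le_less_trans[OF restr_s_le sfin[OF t_pos]])
   show "(\<integral>\<^sup>+y\<in>{t n<..}. g y epowr p \<partial>?s) < top"
    unfolding cell_norm_restr[OF g] by (rule cell_norm_fin[OF N])
  qed (use fin in blast)
  also have "\<dots> \<le> c * (?N epowr (m / p) * Xu m p u s (t n) epowr ((p - m) / p))"
  proof (intro mult_left_mono epowr_mono)
   have "(\<integral>\<^sup>+x\<in>{t n..}. ?f x \<partial>?u) = (\<integral>\<^sup>+x\<in>grid_cell t n. ?f x * indicator {t n..} x \<partial>u)"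
    by (rule restr_cell(3)) (simp, use mf in measurable)
   also have "\<dots> \<le> Xu m p u s (t n)"
    unfolding Xu_def
   proof (intro nn_integral_mono)
    fix x
    have "?f x \<le> u {t n<..x} epowr (m / (p - m)) * s {x<..} epowr (m * (p - 1) / (p - m))"
     using m p by (intro mult_mono epowr_mono restr_u_le restr_s_le) auto
    moreover have "indicator {t n..} x * indicator (grid_cell t n) x \<le> (indicator {t n<..} x :: ennreal)"
     using grid_cell_subset[of t n] by (auto split: split_indicator)
    ultimately have "?f x * (indicator {t n..} x * indicator (grid_cell t n) x) \<le>
      u {t n<..x} epowr (m / (p - m)) * s {x<..} epowr (m * (p - 1) / (p - m)) * indicator {t n<..} x"
     by (rule mult_mono) auto
    then show "?f x * indicator {t n..} x * indicator (grid_cell t n) x \<le>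
      u {t n<..x} epowr (m / (p - m)) * s {x<..} epowr (m * (p - 1) / (p - m)) * indicator {t n<..} x"
     by (simp only: mult.assoc)
   qed
   finally show "(\<integral>\<^sup>+x\<in>{t n..}. ?f x \<partial>?u) \<le> Xu m p u s (t n)" .
  qed (use m p in auto)
  finally show "local_norm m g n \<le> c * (?N epowr (m / p) * Xu m p u s (t n) epowr ((p - m) / p))" .
 qed
 qed
qed

section \<open>The discrete Hardy inequality at the nodes\<close>

context copson_grid
begin

text \<open>The coefficient of copson(t n)^q in the second series of \<open>grid_reduction\<close>,
  read as a mass placed at t n.\<close>

definition bmass :: "nat => ennreal" where
 "bmass n = W (Suc n) * u (grid_cell t (Suc n)) epowr a"

definition beta :: "real measure" where "beta = point_masses bmass t"

lemma sets_beta: "sets beta = sets borel"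
 by (simp add: beta_def)

lemma beta_head: "beta {..x} = (\<Sum>n. bmass n * indicator {..x} (t n))"
 unfolding beta_def by (rule emeasure_point_masses) simp

text \<open>The mass at t k involves the u-mass of the cell just below t k. If y lies one cell
  further down, that cell is contained in {y<..x} as soon as t k \<le> x; shifting w by one cell
  accounts for the factor 2.\<close>

lemma beta_head_le: "beta {..x} \<le> 2 * Phi a u w x"
proof -
 define F where "F = (\<lambda>n. u (grid_cell t n) epowr a * indicator {..x} (t (n - 1)))"
 have "(\<Sum>n. W (Suc n) * (if 1 \<le> n then F n else 0)) \<le> (\<integral>\<^sup>+y\<in>{..t 0}. (u {y<..x} epowr a * indicator {..x} y) \<partial>w)"
 proof (rule lower_sum)
  fix n y assume y: "y \<in> grid_cell t (Suc n)"
  show "(if 1 \<le> n then F n else 0) \<le> u {y<..x} epowr a * indicator {..x} y"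
  proof (cases "1 \<le> n \<and> t (n - 1) \<le> x")
   case True
   then obtain k where k: "n = Suc k" by (cases n) auto
   have y1: "y \<le> t (Suc k)" "t k \<le> x" using y True k by auto
   then have yx: "y \<le> x" using t_dec[of k] by linarith
   have sub: "{t (Suc k)<..t k} \<subseteq> {y<..x}" using y1 by auto
   have "u (grid_cell t n) \<le> u {y<..x}"
    unfolding k grid_cell_simps by (rule emeasure_mono[OF sub]) (simp add: u)
   then have "u (grid_cell t n) epowr a \<le> u {y<..x} epowr a"
    using a0 by (intro epowr_mono) auto
   then show ?thesis using True yx by (simp add: F_def)
  qed (auto simp: F_def)
 qed
 also have "\<dots> \<le> Phi a u w x" unfolding Phi_def by (intro nn_integral_mono) (auto split: split_indicator)
 finally have le: "(\<Sum>n. W (Suc n) * (if 1 \<le> n then F n else 0)) \<le> Phi a u w x" .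
 have "beta {..x} = (\<Sum>n. 2 * (W (Suc (Suc n)) * F (Suc n)))"
  unfolding beta_head
 proof (intro suminf_cong)
  fix n
  show "bmass n * indicator {..x} (t n) = 2 * (W (Suc (Suc n)) * F (Suc n))"
   unfolding bmass_def F_def diff_Suc_1 Whalf[of "Suc n"] by (simp only: mult.assoc)
 qed
 also have "\<dots> = 2 * (\<Sum>n. W (Suc (Suc n)) * F (Suc n))" by (rule ennreal_suminf_cmult)
 also have "(\<Sum>n. W (Suc (Suc n)) * F (Suc n)) = (\<Sum>n. W (Suc n) * (if 1 \<le> n then F n else 0))"
  using suminf_Suc_ennreal[of "\<lambda>n. W (Suc n) * (if 1 \<le> n then F n else 0)"] by simp
 also have "2 * \<dots> \<le> 2 * Phi a u w x" by (rule mult_left_mono[OF le]) simp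
 finally show ?thesis .
qed

lemma beta_fin: "beta {..x} < top"
proof -
 have "beta {..x} \<le> beta {..max x 1}" using sets_beta by (intro emeasure_mono) auto
 also have "\<dots> \<le> 2 * Phi a u w (max x 1)" by (rule beta_head_le)
 also have "\<dots> < top" by (intro mult_less_top_ennreal Phifin) auto
 finally show ?thesis .
qed

text \<open>The tails of s are finite only away from 0, so the Hardy inequality is applied on {t
  M..} with a bound independent of M, which then covers all partial sums.\<close>

lemma beta_sum_le:
 assumes "\<And>M. (\<integral>\<^sup>+x\<in>{t M..}. f x \<partial>beta) \<le> X" and f: "f \<in> borelfun"
 shows "(\<Sum>n. bmass n * f (t n)) \<le> X"
proof (rule suminf_le_if_partial)
 fix M
 have "(\<Sum>n<M. bmass n * f (t n)) = (\<Sum>n<M. bmass n * (f (t n) * indicator {t M..} (t n)))"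
  by (intro sum.cong) (auto simp: t_antimono)
 also have "\<dots> \<le> (\<Sum>n. bmass n * (f (t n) * indicator {t M..} (t n)))"
  by (rule sum_le_suminf) auto
 also have "\<dots> = (\<integral>\<^sup>+x\<in>{t M..}. f x \<partial>beta)"
  unfolding beta_def by (intro nn_integral_point_masses[symmetric] borel_measurable_times_ennreal f borel_measurable_indicator) simp
 also have "\<dots> \<le> X" by (rule assms(1))
 finally show "(\<Sum>n<M. bmass n * f (t n)) \<le> X" .
qed

lemma norm_tail_le: "(\<integral>\<^sup>+y\<in>{x<..}. g y epowr p \<partial>s) \<le> (powint p s g)"
 by (rule nn_integral_mono) (auto split: split_indicator)

lemma nonlocal_le:
 assumes q: "0 < q" and p: "1 < p" "p \<le> q" and g: "g \<in> borelfun" and N: "(powint p s g) < top"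
  and A: "\<And>x. 0 < x ==> Phi a u w x * s {x<..} epowr (q * (p - 1) / p) \<le> A"
 shows "(\<Sum>n. bmass n * copson s g (t n) epowr q) \<le> 4 epowr q * (2 * A * powint p s g epowr (q / p))"
proof (rule beta_sum_le)
 show "(\<lambda>x. copson s g x epowr q) \<in> borelfun"
  by (rule borel_measurable_epowr[OF measurable_copson])
 fix M
 have "(\<integral>\<^sup>+x\<in>{t M..}. copson s g x epowr q \<partial>beta)
   \<le> 4 epowr q * (2 * A * (\<integral>\<^sup>+y\<in>{t M<..}. g y epowr p \<partial>s) epowr (q / p))"
 proof (rule Hardy_upper_le[OF q p sets_beta ds g sfin[OF t_pos] le_less_trans[OF norm_tail_le N]])
  fix x assume "t M \<le> x"
  then have x: "0 < x" using t_pos[of M] by linarith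
  have "beta {t M..x} \<le> beta {..x}" using sets_beta by (intro emeasure_mono) auto
  also have "\<dots> \<le> 2 * Phi a u w x" by (rule beta_head_le)
  finally have "beta {t M..x} * s {x<..} epowr (q * (p - 1) / p) \<le> 2 * Phi a u w x * s {x<..} epowr (q * (p - 1) / p)"
   by (rule mult_right_mono) simp
  also have "\<dots> \<le> 2 * A" unfolding mult.assoc by (intro mult_left_mono A[OF x]) simp
  finally show "beta {t M..x} * s {x<..} epowr (q * (p - 1) / p) \<le> 2 * A" .
 qed
 also have "\<dots> \<le> 4 epowr q * (2 * A * powint p s g epowr (q / p))"
  using q p by (intro mult_left_mono epowr_mono norm_tail_le) auto
 finally show "(\<integral>\<^sup>+x\<in>{t M..}. copson s g x epowr q \<partial>beta) \<le> \<dots>" .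
qed

text \<open>The two topmost atoms are split off to leave two cells of room between t n and the point
  at which the remaining head is compared with Phi.\<close>

lemma beta_head_split:
 "beta {..t n} \<le> bmass n + bmass (Suc n) + beta {..t (Suc (Suc n))}"
proof -
 have "beta {..t n} \<le> (\<Sum>j. bmass j * (if j = n then 1 else 0) + bmass j * (if j = Suc n then 1 else 0)
   + bmass j * indicator {..t (Suc (Suc n))} (t j))"
  unfolding beta_head
 proof (intro suminf_le summableI)
  fix j
  consider "j < n" | "j = n" | "j = Suc n" | "Suc (Suc n) \<le> j" by linarith
  then show "bmass j * indicator {..t n} (t j) \<le> bmass j * (if j = n then 1 else 0) + bmass j * (if j = Suc n then 1 else 0)
   + bmass j * indicator {..t (Suc (Suc n))} (t j)"
  proof cases
   case 1
   then have "\<not> t j \<le> t n" using t_less_iff[of n j] by auto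
   then show ?thesis by simp
  next
   case 4
   then have "t j \<le> t (Suc (Suc n))" by (rule t_antimono)
   then have "bmass j * indicator {..t n} (t j) \<le> bmass j * indicator {..t (Suc (Suc n))} (t j)"
    by (auto intro!: mult_left_mono split: split_indicator)
   then show ?thesis by (rule order.trans) simp
  qed (auto split: split_indicator)
 qed
 also have "\<dots> = (\<Sum>j. bmass j * (if j = n then 1 else 0)) + (\<Sum>j. bmass j * (if j = Suc n then 1 else 0))
   + beta {..t (Suc (Suc n))}"
  unfolding suminf_add_ennreal beta_head ..
 also have "(\<Sum>j. bmass j * (if j = n then 1 else 0)) = (\<Sum>j\<in>{n}. bmass j * (if j = n then 1 else 0))"
  by (rule suminf_finite) auto
 also have "(\<Sum>j. bmass j * (if j = Suc n then 1 else 0)) = (\<Sum>j\<in>{Suc n}. bmass j * (if j = Suc n then 1 else 0))"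
  by (rule suminf_finite) auto
 finally show ?thesis by simp
qed

end

context copson_grid
begin

lemma head_le_Phi:
 assumes "x \<le> z" shows "w {..x} * u {x<..z} epowr a \<le> Phi a u w z"
proof -
 have hs: "{..x} \<in> sets w" unfolding w by simp
 have "w {..x} * u {x<..z} epowr a = (\<integral>\<^sup>+y. u {x<..z} epowr a * indicator {..x} y \<partial>w)"
  unfolding nn_integral_cmult_indicator[OF hs] by (rule mult.commute)
 also have "\<dots> \<le> Phi a u w z"
  unfolding Phi_def
 proof (intro nn_integral_mono)
  fix y
  show "u {x<..z} epowr a * indicator {..x} y \<le> u {y<..z} epowr a * indicator {..z} y"
  proof (cases "y \<le> x")
   case True
   have "u {x<..z} epowr a \<le> u {y<..z} epowr a"
    using True u a0 by (intro epowr_mono emeasure_mono) auto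
   then show ?thesis using True assms by simp
  qed simp
 qed
 finally show ?thesis .
qed

text \<open>The remaining head is at most 2 Phi(t (n + 2)); for x in the cell between t (n + 2) and
  t (n + 1) this is below 2 Phi(x), and the u-mass of the next cell enters the supremum at x with z
  = t n: this part gives A3. The two atoms together with \<open>bmass n\<close> form a power e + 1
  of w-mass times u-mass; integrated over the cell below t (n + 2) it gives A2.\<close>

lemma nonlocal_sum_lt:
 assumes e: "0 \<le> e" and \<kappa>: "0 \<le> \<kappa>"
 shows "(\<Sum>n. bmass n * (beta {..t n} epowr e * s {t n<..} epowr \<kappa>)) \<le>
  (2 epowr e * (2 epowr e * 2 + 2 epowr e * (4 * 4 epowr e))) *
  (Phi_Usup_int a e \<kappa> u w s +
   head_Usup_int (a * (e + 1)) e \<kappa> u w s)"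
proof -
 let ?A3 = "\<integral>\<^sup>+x. Phi a u w x epowr e * Usup a \<kappa> u s x \<partial>w"
 let ?A2 = "\<integral>\<^sup>+x. w {..x} epowr e * Usup (a * (e + 1)) \<kappa> u s x \<partial>w"
 let ?V = "\<lambda>n. s {t n<..} epowr \<kappa>"
 define G1 where "G1 = (\<lambda>n. Phi a u w (t (Suc (Suc n))) epowr e * (u (grid_cell t (Suc n)) epowr a * ?V n))"
 define G2 where "G2 = (\<lambda>n. W (Suc (Suc (Suc n))) epowr e * (u {t (Suc (Suc n))<..t n} epowr (a * (e + 1)) * ?V n))"
 have t2: "t (Suc (Suc n)) < t n" for n using t_less_iff by simp
 have S1: "(\<Sum>n. W (Suc (Suc n)) * G1 n) \<le> ?A3"
 proof -
  have "(\<Sum>n. W (Suc (n + 1)) * G1 n) \<le> (\<integral>\<^sup>+x\<in>{..t 0}. Phi a u w x epowr e * Usup a \<kappa> u s x \<partial>w)"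
  proof (rule lower_sum_shift)
   fix n x assume "x \<in> grid_cell t (Suc (n + 1))"
   then have x: "t (Suc (Suc n)) < x" "x \<le> t (Suc n)" by auto
   then have xn: "x < t n" using t_dec[of n] by linarith
   have 1: "Phi a u w (t (Suc (Suc n))) epowr e \<le> Phi a u w x epowr e"
    using x e a0 by (intro epowr_mono Phi_mono[OF u]) auto
   have "u (grid_cell t (Suc n)) \<le> u {x<..t n}"
    using x u by (intro emeasure_mono) auto
   then have "u (grid_cell t (Suc n)) epowr a * ?V n \<le> u {x<..t n} epowr a * ?V n"
    using a0 by (intro mult_right_mono epowr_mono) auto
   also have "\<dots> \<le> Usup a \<kappa> u s x" by (rule Usup_upper[OF xn])
   finally show "G1 n \<le> Phi a u w x epowr e * Usup a \<kappa> u s x"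
    unfolding G1_def by (intro mult_mono 1) auto
  qed
  also have "\<dots> \<le> ?A3" by (rule nn_integral_mono) (auto split: split_indicator)
  finally show ?thesis by simp
 qed
 have S2: "(\<Sum>n. W (Suc (Suc (Suc n))) * G2 n) \<le> ?A2"
 proof -
  have "(\<Sum>n. W (Suc (n + 2)) * G2 n) \<le> (\<integral>\<^sup>+x\<in>{..t 0}. w {..x} epowr e * Usup (a * (e + 1)) \<kappa> u s x \<partial>w)"
  proof (rule lower_sum_shift)
   fix n x assume "x \<in> grid_cell t (Suc (n + 2))"
   then have x: "t (Suc (Suc (Suc n))) < x" "x \<le> t (Suc (Suc n))" by auto
   then have xn: "x < t n" using t2[of n] by linarith
   have 1: "W (Suc (Suc (Suc n))) epowr e \<le> w {..x} epowr e"
    using x e w by (intro epowr_mono emeasure_mono) auto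
   have "u {t (Suc (Suc n))<..t n} \<le> u {x<..t n}"
    using x u by (intro emeasure_mono) auto
   then have "u {t (Suc (Suc n))<..t n} epowr (a * (e + 1)) * ?V n \<le> u {x<..t n} epowr (a * (e + 1)) * ?V n"
    using a0 e by (intro mult_right_mono epowr_mono) auto
   also have "\<dots> \<le> Usup (a * (e + 1)) \<kappa> u s x" by (rule Usup_upper[OF xn])
   finally show "G2 n \<le> w {..x} epowr e * Usup (a * (e + 1)) \<kappa> u s x"
    unfolding G2_def by (intro mult_mono 1) auto
  qed
  also have "\<dots> \<le> ?A2" by (rule nn_integral_mono) (auto split: split_indicator)
  finally show ?thesis by (simp add: numeral_2_eq_2)
 qed
 \<comment> \<open>Two halvings of the mass.\<close>
 have W4: "W (Suc n) = 4 * W (Suc (Suc (Suc n)))" for n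
  using Whalf[of "Suc n"] Whalf[of "Suc (Suc n)"] by (simp add: mult.assoc[symmetric])
 have main: "bmass n * (beta {..t n} epowr e * ?V n) \<le>
   2 epowr e * (2 epowr e * 2) * (W (Suc (Suc n)) * G1 n) +
   2 epowr e * (2 epowr e * (4 * 4 epowr e)) * (W (Suc (Suc (Suc n))) * G2 n)" for n
 proof -
  let ?u2 = "u {t (Suc (Suc n))<..t n}"
  have ua: "u (grid_cell t (Suc n)) epowr a \<le> ?u2 epowr a"
   using u a0 t_dec[of "Suc n"] by (intro epowr_mono emeasure_mono) auto
  have ub: "u (grid_cell t (Suc (Suc n))) epowr a \<le> ?u2 epowr a"
   using u a0 t_dec[of n] by (intro epowr_mono emeasure_mono) auto
  have b1: "bmass n \<le> W (Suc n) * ?u2 epowr a" unfolding bmass_def by (intro mult_left_mono ua) simp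
  have "W (Suc (Suc n)) \<le> W (Suc n)" using w t_dec[of "Suc n"] by (intro emeasure_mono) auto
  then have b2: "bmass (Suc n) \<le> W (Suc n) * ?u2 epowr a" unfolding bmass_def by (intro mult_mono ub) auto
  have b12: "bmass n + bmass (Suc n) \<le> 2 * (W (Suc n) * ?u2 epowr a)"
   using add_mono[OF b1 b2] by (simp add: mult_2)
  have "beta {..t n} epowr e \<le>
    ((bmass n + bmass (Suc n)) + beta {..t (Suc (Suc n))}) epowr e"
   using e by (intro epowr_mono beta_head_split) auto
  also have "\<dots> \<le> 2 epowr e * ((bmass n + bmass (Suc n)) epowr e + beta {..t (Suc (Suc n))} epowr e)"
   by (rule epowr_add_le[OF e])
  also have "\<dots> \<le> 2 epowr e * ((2 * (W (Suc n) * ?u2 epowr a)) epowr e + (2 * Phi a u w (t (Suc (Suc n)))) epowr e)"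
   using e by (intro mult_left_mono add_mono epowr_mono b12 beta_head_le) auto
  also have "\<dots> = 2 epowr e * (2 epowr e * Phi a u w (t (Suc (Suc n))) epowr e + 2 epowr e * (W (Suc n) * ?u2 epowr a) epowr e)"
   using e by (simp add: epowr_mult add.commute)
  finally have "bmass n * (beta {..t n} epowr e * ?V n) \<le> bmass n *
    (2 epowr e * (2 epowr e * Phi a u w (t (Suc (Suc n))) epowr e + 2 epowr e * (W (Suc n) * ?u2 epowr a) epowr e) * ?V n)"
   by (intro mult_left_mono mult_right_mono) auto
  also have "\<dots> = 2 epowr e * 2 epowr e * (bmass n * (Phi a u w (t (Suc (Suc n))) epowr e * ?V n)) +
    2 epowr e * 2 epowr e * (bmass n * (W (Suc n) * ?u2 epowr a) epowr e * ?V n)"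
   by (simp only: distrib_left distrib_right mult_ac)
  also have "\<dots> \<le> 2 epowr e * 2 epowr e * (bmass n * (Phi a u w (t (Suc (Suc n))) epowr e * ?V n)) +
    2 epowr e * 2 epowr e * ((W (Suc n) * ?u2 epowr a) * (W (Suc n) * ?u2 epowr a) epowr e * ?V n)"
   by (intro add_left_mono mult_left_mono mult_right_mono b1) auto
  also have "bmass n * (Phi a u w (t (Suc (Suc n))) epowr e * ?V n) = 2 * (W (Suc (Suc n)) * G1 n)"
   unfolding bmass_def G1_def Whalf[of "Suc n"] by (simp only: mult_ac)
  also have "(W (Suc n) * ?u2 epowr a) * (W (Suc n) * ?u2 epowr a) epowr e * ?V n =
    (4 * 4 epowr e) * (W (Suc (Suc (Suc n))) * G2 n)"
  proof -
   have "?u2 epowr a * ?u2 epowr (a * e) = ?u2 epowr (a * (e + 1))"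
    using a0 e epowr_add[of a "a * e" ?u2] by (simp add: distrib_left add.commute)
   moreover have "(W (Suc n) * ?u2 epowr a) epowr e = W (Suc n) epowr e * ?u2 epowr (a * e)"
    using e by (simp add: epowr_mult epowr_epowr)
   ultimately have "(W (Suc n) * ?u2 epowr a) * (W (Suc n) * ?u2 epowr a) epowr e * ?V n
     = W (Suc n) * W (Suc n) epowr e * (?u2 epowr (a * (e + 1)) * ?V n)"
    by (simp only: mult_ac flip: \<open>?u2 epowr a * ?u2 epowr (a * e) = ?u2 epowr (a * (e + 1))\<close>)
   also have "W (Suc n) epowr e = 4 epowr e * W (Suc (Suc (Suc n))) epowr e"
    unfolding W4[of n] using e by (simp add: epowr_mult)
   finally show ?thesis unfolding W4[of n] G2_def by (simp only: mult_ac)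
  qed
  finally show ?thesis by (simp only: mult_ac)
 qed
 have "(\<Sum>n. bmass n * (beta {..t n} epowr e * ?V n)) \<le>
   (\<Sum>n. 2 epowr e * (2 epowr e * 2) * (W (Suc (Suc n)) * G1 n) +
   2 epowr e * (2 epowr e * (4 * 4 epowr e)) * (W (Suc (Suc (Suc n))) * G2 n))"
  by (intro suminf_le summableI main)
 also have "\<dots> = 2 epowr e * (2 epowr e * 2) * (\<Sum>n. W (Suc (Suc n)) * G1 n) +
   2 epowr e * (2 epowr e * (4 * 4 epowr e)) * (\<Sum>n. W (Suc (Suc (Suc n))) * G2 n)"
  unfolding suminf_add_ennreal ennreal_suminf_cmult ..
 also have "\<dots> \<le> 2 epowr e * (2 epowr e * 2) * (?A3 + ?A2) + 2 epowr e * (2 epowr e * (4 * 4 epowr e)) * (?A3 + ?A2)"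
  by (intro add_mono mult_left_mono order.trans[OF S1] order.trans[OF S2]) auto
 also have "\<dots> = (2 epowr e * (2 epowr e * 2 + 2 epowr e * (4 * 4 epowr e))) * (?A3 + ?A2)"
  by (simp only: distrib_left[symmetric] distrib_right[symmetric])
 finally show ?thesis .
qed

end

lemma nonlocal_lt:
 assumes q: "0 < q" and p: "1 < p" "q < p"
 shows "\<exists>c<top. \<forall>u w s a t g. copson_grid u w s a t --> g \<in> borelfun --> (powint p s g) < top -->
  (\<Sum>n. copson_grid.bmass u w a t n * copson s g (t n) epowr q) \<le> c * (powint p s g epowr (q / p) *
   (Phi_Usup_int a (q / (p - q)) (q * (p - 1) / (p - q)) u w s +
    head_Usup_int (a * (p / (p - q))) (q / (p - q)) (q * (p - 1) / (p - q)) u w s) epowr ((p - q) / p))"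
proof -
 define e where "e = q / (p - q)"
 define \<kappa> where "\<kappa> = q * (p - 1) / (p - q)"
 have e0: "0 \<le> e" "0 \<le> \<kappa>" using q p by (auto simp: e_def \<kappa>_def)
 have e1: "p / (p - q) = e + 1" using p by (simp add: e_def field_simps)
 show ?thesis
 proof (rule ex_finiteE[OF Hardy_upper_lt[OF q p, folded e_def, folded \<kappa>_def]], goal_cases)
 case (1 c)
 note c = 1(1) and H = 1(2)[rule_format (no_asm)]
 define C where "C = 2 epowr e * (2 epowr e * 2 + 2 epowr e * (4 * 4 epowr e))"
 have C: "C < top" unfolding C_def by (intro add_less_top_ennreal mult_less_top_ennreal) auto
 show ?thesis
  unfolding e_def[symmetric] \<kappa>_def[symmetric] e1
 proof (intro exI[of _ "c * C epowr ((p - q) / p)"] conjI allI impI)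
  show "c * C epowr ((p - q) / p) < top" using p by (intro mult_less_top_ennreal epowr_less_top c C) auto
  fix u w s a t and g :: "real => ennreal"
  assume "copson_grid u w s a t" and g: "g \<in> borelfun" and N: "(powint p s g) < top"
  then interpret copson_grid u w s a t by simp
  let ?N = "\<integral>\<^sup>+y. g y epowr p \<partial>s"
  let ?R = "Phi_Usup_int a e \<kappa> u w s + head_Usup_int (a * (e + 1)) e \<kappa> u w s"
  show "(\<Sum>n. bmass n * copson s g (t n) epowr q) \<le> c * C epowr ((p - q) / p) * (?N epowr (q / p) * ?R epowr ((p - q) / p))"
  proof (rule beta_sum_le)
   show "(\<lambda>x. copson s g x epowr q) \<in> borelfun"
    by (rule borel_measurable_epowr[OF measurable_copson])
   fix M
   have fin: "beta {t M..x} < top" for x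
    using sets_beta by (intro le_less_trans[OF emeasure_mono beta_fin[of x]]) auto
   have mb: "(\<lambda>x. beta {..x} epowr e * s {x<..} epowr \<kappa>) \<in> borelfun"
    using measurable_head[OF sets_beta] measurable_tail[OF s] by measurable
   have "(\<integral>\<^sup>+x\<in>{t M..}. beta {t M..x} epowr e * s {x<..} epowr \<kappa> \<partial>beta)
     \<le> (\<integral>\<^sup>+x. beta {..x} epowr e * s {x<..} epowr \<kappa> \<partial>beta)"
   proof (intro nn_integral_mono)
    fix x
    have "beta {t M..x} \<le> beta {..x}" using sets_beta by (intro emeasure_mono) auto
    then have "beta {t M..x} epowr e * s {x<..} epowr \<kappa> \<le> beta {..x} epowr e * s {x<..} epowr \<kappa>"
     using e0 by (intro mult_right_mono epowr_mono) auto
    then show "beta {t M..x} epowr e * s {x<..} epowr \<kappa> * indicator {t M..} x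
      \<le> beta {..x} epowr e * s {x<..} epowr \<kappa>"
     by (auto split: split_indicator)
   qed
   also have "\<dots> = (\<Sum>n. bmass n * (beta {..t n} epowr e * s {t n<..} epowr \<kappa>))"
    using nn_integral_point_masses[OF mb, of bmass t] unfolding beta_def[symmetric] .
   also have "\<dots> \<le> C * ?R" unfolding C_def by (rule nonlocal_sum_lt[OF e0])
   finally have le: "(\<integral>\<^sup>+x\<in>{t M..}. beta {t M..x} epowr e * s {x<..} epowr \<kappa> \<partial>beta) \<le> C * ?R" .
   have "(\<integral>\<^sup>+x\<in>{t M..}. copson s g x epowr q \<partial>beta) \<le> c * ((\<integral>\<^sup>+y\<in>{t M<..}. g y epowr p \<partial>s) epowr (q / p) *
     (\<integral>\<^sup>+x\<in>{t M..}. beta {t M..x} epowr e * s {x<..} epowr \<kappa> \<partial>beta) epowr ((p - q) / p))"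
    using fin by (intro H sets_beta ds g sfin[OF t_pos] le_less_trans[OF norm_tail_le N]) auto
   also have "\<dots> \<le> c * (?N epowr (q / p) * (C * ?R) epowr ((p - q) / p))"
    using q p by (intro mult_left_mono mult_mono epowr_mono norm_tail_le le) auto
   also have "\<dots> = c * C epowr ((p - q) / p) * (?N epowr (q / p) * ?R epowr ((p - q) / p))"
    using p by (simp add: epowr_mult mult_ac)
   finally show "(\<integral>\<^sup>+x\<in>{t M..}. copson s g x epowr q \<partial>beta) \<le> \<dots>" .
  qed
 qed
 qed
qed

section \<open>From grids to the half-line: the same data without nodes and without finite heads of
  w\<close>

locale copson_setting =
 fixes u w s :: "real measure" and a :: real
 assumes du: "diffuse u" and dw: "diffuse w" and ds: "diffuse s" and a0: "0 < a"
  and ufin: "\<And>x y. 0 < x ==> emeasure u {x<..y} < top"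
  and sfin: "\<And>x. 0 < x ==> emeasure s {x<..} < top"
  and w0: "emeasure w {..0} = 0"
  and Phifin: "\<And>x. 0 < x ==> Phi a u w x < top"
  and Phipos: "\<And>x. 0 < x ==> 0 < Phi a u w x"
begin

lemmas u = diffuseD(1)[OF du] and w = diffuseD(1)[OF dw] and s = diffuseD(1)[OF ds]

lemma wpos: assumes "0 < x" shows "0 < w {..x}"
proof (rule ccontr)
 assume "\<not> 0 < w {..x}"
 then have "{..x} \<in> null_sets w" using w by (auto simp: zero_less_iff_neq_zero)
 then have "AE y in w. y \<notin> {..x}" by (rule AE_not_in)
 then have "AE y in w. u {y<..x} epowr a * indicator {..x} y = 0" by eventually_elim auto
 then have "Phi a u w x = (\<integral>\<^sup>+y. 0 \<partial>w)" unfolding Phi_def by (rule nn_integral_cong_AE)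
 then show False using Phipos[OF assms] by simp
qed

lemma grid: assumes "0 < T" "w {..T} < top" shows "\<exists>t. t 0 = T \<and> copson_grid u w s a t"
 by (rule grid_exists[OF du dw ds a0 ufin sfin w0 Phifin wpos assms])

text \<open>For z \<ge> x, Phi(z) is at least w {..x} times u(x,z]^a, and it is finite.\<close>

lemma head_infinite:
 assumes x: "0 < x" and inf: "w {..x} = top"
 shows "u {x<..} = 0"
proof -
 have z: "u {x<..z} = 0" if "x \<le> z" for z
 proof (rule ccontr)
  assume "u {x<..z} \<noteq> 0"
  then have "0 < u {x<..z} epowr a" using a0 by (intro epowr_pos) (auto simp: zero_less_iff_neq_zero)
  then have "w {..x} * u {x<..z} epowr a = top" using inf by (simp add: ennreal_top_mult)
  moreover have "w {..x} * u {x<..z} epowr a \<le> Phi a u w z"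
  proof -
   have hs: "{..x} \<in> sets w" unfolding w by simp
   have "w {..x} * u {x<..z} epowr a = (\<integral>\<^sup>+y. u {x<..z} epowr a * indicator {..x} y \<partial>w)"
    unfolding nn_integral_cmult_indicator[OF hs] by (rule mult.commute)
   also have "\<dots> \<le> Phi a u w z"
    unfolding Phi_def
   proof (intro nn_integral_mono)
    fix y
    show "u {x<..z} epowr a * indicator {..x} y \<le> u {y<..z} epowr a * indicator {..z} y"
    proof (cases "y \<le> x")
     case True
     have "u {x<..z} epowr a \<le> u {y<..z} epowr a"
      using True u a0 by (intro epowr_mono emeasure_mono) auto
     then show ?thesis using True that by simp
    qed simp
   qed
   finally show ?thesis .
  qed
  ultimately have "Phi a u w z = top" by (simp add: top_unique)
  then show False using Phifin[of z] x that by simp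
 qed
 have "{x<..} = (\<Union>n::nat. {x<..x + real n})"
 proof (intro set_eqI iffI)
  fix y assume "y \<in> {x<..}"
  moreover obtain n :: nat where "y - x \<le> real n" using real_arch_simple by blast
  ultimately show "y \<in> (\<Union>n::nat. {x<..x + real n})" by (auto intro!: exI[of _ n])
 qed auto
 moreover have "{x<..x + real n} \<in> null_sets u" for n :: nat using z[of "x + real n"] u by auto
 ultimately have "{x<..} \<in> null_sets u" by (simp only:) (rule null_sets_UN, auto)
 then show ?thesis by auto
qed

text \<open>A grid exists below every x with w {..x} finite. These x form a down set, exhausted from
  below; at the other positive points u has no mass to the right, so f vanishes there.\<close>

lemma integral_le_by_grids:
 assumes f: "f \<in> borelfun"
  and grid_le: "\<And>t. copson_grid u w s a t ==> (\<integral>\<^sup>+x\<in>{..t 0}. f x \<partial>w) \<le> R"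
  and f0: "\<And>x. 0 < x ==> u {x<..} = 0 ==> f x = 0"
 shows "(\<integral>\<^sup>+x. f x \<partial>w) \<le> R"
proof -
 define Q where "Q = {x. x \<le> 0 \<or> w {..x} < top}"
 have f': "f \<in> borel_measurable w" by (rule measurable_borel_like[OF w f])
 have dens: "(density w f) B = (\<integral>\<^sup>+x\<in>B. f x \<partial>w)" if "B \<in> sets borel" for B
  using that w by (intro emeasure_density[OF f']) auto
 have down: "\<forall>x\<in>Q. \<forall>y\<le>x. y \<in> Q"
 proof (intro ballI allI impI)
  fix x y assume x: "x \<in> Q" and "y \<le> x"
  show "y \<in> Q"
  proof (cases "x \<le> 0")
   case False
   then have "w {..x} < top" using x by (auto simp: Q_def)
   moreover have "w {..y} \<le> w {..x}" using \<open>y \<le> x\<close> w by (intro emeasure_mono) auto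
   ultimately show ?thesis by (auto simp: Q_def)
  qed (use \<open>y \<le> x\<close> in \<open>auto simp: Q_def\<close>)
 qed
 have null: "AE x in w. x \<notin> {..0}" using w w0 by (intro AE_not_in) auto
 have "(density w f) Q \<le> R"
 proof (rule emeasure_down_set_le[OF _ down])
  show "sets (density w f) = sets borel" using w by simp
  fix x assume x: "x \<in> Q"
  show "(density w f) {..x} \<le> R"
  proof (cases "0 < x")
   case True
   then obtain t where "t 0 = x" "copson_grid u w s a t" using grid[of x] x by (auto simp: Q_def)
   then show ?thesis using grid_le[of t] by (simp add: dens)
  next
   case False
   have "(\<integral>\<^sup>+y\<in>{..x}. f y \<partial>w) = (\<integral>\<^sup>+y. 0 \<partial>w)"
    by (rule nn_integral_cong_AE, use null in eventually_elim) (use False in auto)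
   then show ?thesis by (simp add: dens)
  qed
 qed
 moreover have "(density w f) Q = (\<integral>\<^sup>+x\<in>Q. f x \<partial>w)" by (rule dens[OF down_set_borel[OF down]])
 moreover have "(\<integral>\<^sup>+x\<in>Q. f x \<partial>w) = (\<integral>\<^sup>+x. f x \<partial>w)"
 proof (intro nn_integral_cong)
  fix x
  show "f x * indicator Q x = f x"
  proof (cases "x \<in> Q")
   case False
   then have "0 < x" "w {..x} = top" by (auto simp: Q_def less_top[symmetric])
   then have "f x = 0" by (intro f0 head_infinite)
   then show ?thesis by simp
  qed simp
 qed
 ultimately show ?thesis by simp
qed

lemma iterK_zero: assumes "u {x<..} = 0" shows "iterK m u s g x = 0"
proof -
 have "{x<..} \<in> null_sets u" using assms u by auto
 then have "AE y in u. y \<notin> {x<..}" by (rule AE_not_in)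
 then have "AE y in u. copson s g y epowr m * indicator {x<..} y = 0" by eventually_elim auto
 then have "iterK m u s g x = (\<integral>\<^sup>+y. 0 \<partial>u)" unfolding iterK_def by (rule nn_integral_cong_AE)
 then show ?thesis by simp
qed

lemma measurable_iterK: "iterK m u s g \<in> borelfun"
 by (rule borel_measurable_antimono_ennreal) (rule antimonoI, rule iterK_antimono)

end

section \<open>Upper bounds\<close>

lemma (in copson_grid) bmass_series:
 "(\<Sum>n. W (Suc n) * u (grid_cell t (Suc n)) epowr a * h n) = (\<Sum>n. bmass n * h n)"
 by (simp only: bmass_def)

text \<open>\<open>B n\<close> is the norm of the Hardy operator on the \<open>n\<close>-th cell.\<close>

lemma grid_upper_le:
 assumes a: "0 < a" and m: "0 < m" and p: "1 < p" "p \<le> a * m" and c1: "c1 < top"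
 shows "\<exists>c<top. \<forall>u w s t g A B. copson_grid u w s a t --> g \<in> borelfun --> (powint p s g) < top -->
  (\<forall>x>0. Phi a u w x * s {x<..} epowr (a * m * (p - 1) / p) \<le> A) -->
  (\<forall>n. copson_grid.local_norm u s t m g n \<le> c1 * ((\<integral>\<^sup>+y\<in>grid_cell t n. g y epowr p \<partial>s) epowr (m / p) * B n)) -->
  (\<forall>n. w {..t n} * B n epowr a \<le> A) -->
  iterK_int_upto (t 0) a m u w s g \<le> c * (A * powint p s g epowr (a * m / p))"
proof -
 show ?thesis
 proof (rule ex_finiteE[OF grid_reduction[OF a m]], goal_cases)
 case (1 c)
 note c = 1(1) and red = 1(2)[rule_format (no_asm)]
 have am: "0 < a * m" using a m by simp
 show ?thesis
 proof (intro exI[of _ "c * (c1 epowr a + 4 epowr (a * m) * 2)"] conjI allI impI)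
  show "c * (c1 epowr a + 4 epowr (a * m) * 2) < top"
   using a am by (intro mult_less_top_ennreal add_less_top_ennreal epowr_less_top c c1) auto
  fix u w s t and g :: "real => ennreal" and A B
  assume G: "copson_grid u w s a t" and g: "g \<in> borelfun" and N: "(powint p s g) < top"
   and A: "\<forall>x>0. Phi a u w x * s {x<..} epowr (a * m * (p - 1) / p) \<le> A"
   and L: "\<forall>n. copson_grid.local_norm u s t m g n \<le> c1 * ((\<integral>\<^sup>+y\<in>grid_cell t n. g y epowr p \<partial>s) epowr (m / p) * B n)"
   and WB: "\<forall>n. w {..t n} * B n epowr a \<le> A"
  interpret copson_grid u w s a t by (rule G)
  let ?N = "\<integral>\<^sup>+y. g y epowr p \<partial>s"
  have p0: "0 < p" using p by simp
  have 1: "(\<Sum>n. W n * local_norm m g n epowr a) \<le> c1 epowr a * (A * ?N epowr (a * m / p))"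
  proof -
   have "(\<Sum>n. W n * local_norm m g n epowr a) \<le> c1 epowr a * (A * (\<Sum>n. \<integral>\<^sup>+y\<in>grid_cell t n. g y epowr p \<partial>s) epowr (a * m / p))"
    using L WB by (intro suminf_local_le[OF a m p0 p(2)]) auto
   also have "\<dots> \<le> c1 epowr a * (A * ?N epowr (a * m / p))"
    using am p0 by (intro mult_left_mono epowr_mono cell_norm_sum g) auto
   finally show ?thesis .
  qed
  have 2: "(\<Sum>n. bmass n * copson s g (t n) epowr (a * m)) \<le> 4 epowr (a * m) * (2 * A * ?N epowr (a * m / p))"
   using A by (intro nonlocal_le am p g N) auto
  have "iterK_int_upto (t 0) a m u w s g \<le>
    c * (c1 epowr a * (A * ?N epowr (a * m / p)) + 4 epowr (a * m) * (2 * A * ?N epowr (a * m / p)))"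
   by (rule order.trans[OF red[OF G g]], unfold bmass_series) (intro mult_left_mono add_mono 1 2, simp)
  also have "\<dots> = c * (c1 epowr a + 4 epowr (a * m) * 2) * (A * ?N epowr (a * m / p))"
   by (simp only: distrib_left distrib_right mult_ac)
  finally show "iterK_int_upto (t 0) a m u w s g \<le> c * (c1 epowr a + 4 epowr (a * m) * 2) * (A * ?N epowr (a * m / p))" .
 qed
 qed
qed

text \<open>Now the local bound is given by a decreasing function B. Since B(t n) is at most B(x) on
  the cell below t n and the w-masses agree up to a factor, the series of (W n B(t n)^a)^(p / (p - a
  m)) is at most a constant times the integral bounded by A.\<close>

lemma grid_upper_lt:
 assumes a: "0 < a" and m: "0 < m" and p: "1 < p" "a * m < p" and c1: "c1 < top"
 shows "\<exists>c<top. \<forall>u w s t g A B. copson_grid u w s a t --> g \<in> borelfun --> (powint p s g) < top -->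
  Phi_Usup_int a (a * m / (p - a * m)) (a * m * (p - 1) / (p - a * m)) u w s +
  head_Usup_int (a * (p / (p - a * m))) (a * m / (p - a * m)) (a * m * (p - 1) / (p - a * m)) u w s \<le> A -->
  (\<forall>n. copson_grid.local_norm u s t m g n \<le> c1 * ((\<integral>\<^sup>+y\<in>grid_cell t n. g y epowr p \<partial>s) epowr (m / p) * B (t n))) -->
  antimono B --> (\<integral>\<^sup>+x. w {..x} epowr (a * m / (p - a * m)) * B x epowr (a * (p / (p - a * m))) \<partial>w) \<le> A -->
  iterK_int_upto (t 0) a m u w s g \<le> c * (A epowr ((p - a * m) / p) * powint p s g epowr (a * m / p))"
proof -
 define q where "q = a * m"
 have q: "0 < q" "q < p" using a m p by (auto simp: q_def)
 define e where "e = q / (p - q)"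
 have e: "0 \<le> e" using q by (simp add: e_def)
 have e1: "p / (p - q) = e + 1" using q by (simp add: e_def field_simps)
 have th: "0 < (p - q) / p" using q by simp
 show ?thesis
 proof (rule ex_finiteE[OF grid_reduction[OF a m]], goal_cases)
 case (1 c)
 note c = 1(1) and red = 1(2)[rule_format (no_asm)]
 show ?thesis
 proof (rule ex_finiteE[OF nonlocal_lt[OF q(1) p(1) q(2)]], goal_cases)
 case (1 c2)
 note c2 = 1(1) and nl = 1(2)[rule_format (no_asm)]
 define C where "C = c1 epowr a * (2 * 2 epowr e) epowr ((p - q) / p) + c2"
 have C: "C < top" unfolding C_def
  using a th e by (intro add_less_top_ennreal mult_less_top_ennreal epowr_less_top c1 c2) auto
 show ?thesis
  unfolding q_def[symmetric]
 proof (intro exI[of _ "c * C"] conjI allI impI)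
  show "c * C < top" by (rule mult_less_top_ennreal[OF c C])
  fix u w s t and g :: "real => ennreal" and A and B :: "real => ennreal"
  assume G: "copson_grid u w s a t" and g: "g \<in> borelfun" and N: "(powint p s g) < top"
   and A: "Phi_Usup_int a (q / (p - q)) (q * (p - 1) / (p - q)) u w s +
    head_Usup_int (a * (p / (p - q))) (q / (p - q)) (q * (p - 1) / (p - q)) u w s \<le> A"
   and L: "\<forall>n. copson_grid.local_norm u s t m g n \<le> c1 * ((\<integral>\<^sup>+y\<in>grid_cell t n. g y epowr p \<partial>s) epowr (m / p) * B (t n))"
   and B: "antimono B" and AB: "(\<integral>\<^sup>+x. w {..x} epowr (q / (p - q)) * B x epowr (a * (p / (p - q))) \<partial>w) \<le> A"
  interpret copson_grid u w s a t by (rule G)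
  let ?N = "\<integral>\<^sup>+y. g y epowr p \<partial>s"
  have S: "(\<Sum>n. (W n * B (t n) epowr a) epowr (p / (p - q))) \<le> 2 * 2 epowr e * A"
  proof -
   define F where "F = (\<lambda>n. W (Suc n) epowr e * B (t n) epowr (a * (e + 1)))"
   have "(\<Sum>n. (W n * B (t n) epowr a) epowr (p / (p - q))) = (\<Sum>n. 2 * 2 epowr e * (W (Suc n) * F n))"
   proof (intro suminf_cong)
    fix n
    have "(W n * B (t n) epowr a) epowr (e + 1) = W n epowr (e + 1) * B (t n) epowr (a * (e + 1))"
     using e by (simp add: epowr_mult epowr_epowr)
    also have "W n epowr (e + 1) = W n epowr e * W n" using e by (simp add: epowr_add)
    also have "W n epowr e = 2 epowr e * W (Suc n) epowr e"
     unfolding Whalf[of n] using e by (intro epowr_mult) auto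
    finally have "(W n * B (t n) epowr a) epowr (e + 1) = 2 epowr e * W (Suc n) epowr e * W n * B (t n) epowr (a * (e + 1))" .
    also have "\<dots> = 2 * 2 epowr e * (W (Suc n) * F n)"
     unfolding F_def Whalf[of n] by (simp only: mult_ac)
    finally show "(W n * B (t n) epowr a) epowr (p / (p - q)) = 2 * 2 epowr e * (W (Suc n) * F n)"
     unfolding e1 .
   qed
   also have "\<dots> = 2 * 2 epowr e * (\<Sum>n. W (Suc n) * F n)" by (rule ennreal_suminf_cmult)
   also have "(\<Sum>n. W (Suc n) * F n) \<le> (\<integral>\<^sup>+x\<in>{..t 0}. (w {..x} epowr e * B x epowr (a * (e + 1))) \<partial>w)"
   proof (rule lower_sum)
    fix n x assume "x \<in> grid_cell t (Suc n)"
    then have x: "t (Suc n) < x" "x \<le> t n" by auto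
    have "W (Suc n) epowr e \<le> w {..x} epowr e" using x w e by (intro epowr_mono emeasure_mono) auto
    moreover have "B (t n) epowr (a * (e + 1)) \<le> B x epowr (a * (e + 1))"
     using x e a by (intro epowr_mono antimonoD[OF B]) auto
    ultimately show "F n \<le> w {..x} epowr e * B x epowr (a * (e + 1))"
     unfolding F_def by (rule mult_mono) auto
   qed
   also have "\<dots> \<le> (\<integral>\<^sup>+x. w {..x} epowr e * B x epowr (a * (e + 1)) \<partial>w)"
    by (rule nn_integral_mono) (auto split: split_indicator)
   also have "\<dots> \<le> A" using AB unfolding e1 e_def[symmetric] .
   finally show ?thesis by (simp add: mult_left_mono)
  qed
  have 1: "(\<Sum>n. W n * local_norm m g n epowr a) \<le>
    c1 epowr a * (2 * 2 epowr e) epowr ((p - q) / p) * (A epowr ((p - q) / p) * ?N epowr (q / p))"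
  proof -
   have "(\<Sum>n. W n * local_norm m g n epowr a) \<le> c1 epowr a * ((\<Sum>n. \<integral>\<^sup>+y\<in>grid_cell t n. g y epowr p \<partial>s) epowr (q / p) *
     (\<Sum>n. (W n * B (t n) epowr a) epowr (p / (p - q))) epowr ((p - q) / p))"
    unfolding q_def using L by (intro suminf_local_lt[OF a m p(2)]) auto
   also have "\<dots> \<le> c1 epowr a * (?N epowr (q / p) * (2 * 2 epowr e * A) epowr ((p - q) / p))"
    using q p th by (intro mult_left_mono mult_mono epowr_mono cell_norm_sum g S) auto
   also have "\<dots> = c1 epowr a * (2 * 2 epowr e) epowr ((p - q) / p) * (A epowr ((p - q) / p) * ?N epowr (q / p))"
    unfolding epowr_mult[OF less_imp_le[OF th], of "2 * 2 epowr e" A] by (simp only: mult_ac)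
   finally show ?thesis .
  qed
  have 2: "(\<Sum>n. bmass n * copson s g (t n) epowr q) \<le> c2 * (A epowr ((p - q) / p) * ?N epowr (q / p))"
  proof (rule order.trans[OF nl[OF G g N]])
   show "c2 * (?N epowr (q / p) *
    (Phi_Usup_int a (q / (p - q)) (q * (p - 1) / (p - q)) u w s +
    head_Usup_int (a * (p / (p - q))) (q / (p - q)) (q * (p - 1) / (p - q)) u w s) epowr ((p - q) / p))
    \<le> c2 * (A epowr ((p - q) / p) * ?N epowr (q / p))"
    unfolding mult.commute[of "?N epowr (q / p)"]
    using th by (intro mult_left_mono mult_right_mono epowr_mono A) auto
  qed
  have "iterK_int_upto (t 0) a m u w s g \<le>
    c * (c1 epowr a * (2 * 2 epowr e) epowr ((p - q) / p) * (A epowr ((p - q) / p) * ?N epowr (q / p)) +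
     c2 * (A epowr ((p - q) / p) * ?N epowr (q / p)))"
   by (rule order.trans[OF red[OF G g]], unfold bmass_series q_def[symmetric]) (intro mult_left_mono add_mono 1 2, simp)
  also have "\<dots> = c * C * (A epowr ((p - q) / p) * ?N epowr (q / p))"
   unfolding C_def by (simp only: distrib_right[symmetric] mult.assoc[symmetric])
  finally show "iterK_int_upto (t 0) a m u w s g \<le> c * C * (A epowr ((p - q) / p) * ?N epowr (q / p))" .
 qed
 qed
 qed
qed

context copson_setting
begin

lemma iterK_integral_le:
 assumes "0 < m" and "\<And>t. copson_grid u w s a t ==> iterK_int_upto (t 0) a m u w s g \<le> R"
 shows "iterK_int a m u w s g \<le> R"
proof (rule integral_le_by_grids)
 show "(\<lambda>x. iterK m u s g x epowr a) \<in> borelfun"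
  by (rule borel_measurable_epowr[OF measurable_iterK])
 show "iterK m u s g x epowr a = 0" if "u {x<..} = 0" for x
  using iterK_zero[OF that] a0 by simp
qed (rule assms(2))

end

text \<open>The local term costs nothing new when p \<le> m: W n times the a-th power of the local
  supremum is a supremum of W n u(t n,z]^a times a power of the tail of s, and by
  \<open>head_le_Phi\<close> this is dominated by the expression in A1.\<close>

lemma upper_a:
 assumes a: "0 < a" and m: "0 < m" and p: "1 < p" "p \<le> a * m" "p \<le> m"
 shows "\<exists>c<top. \<forall>u w s g A. copson_setting u w s a --> g \<in> borelfun --> (powint p s g) < top -->
  (\<forall>x>0. Phi a u w x * s {x<..} epowr (a * m * (p - 1) / p) \<le> A) -->
  iterK_int a m u w s g \<le> c * (A * powint p s g epowr (a * m / p))"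
proof -
 have c1: "4 epowr m < (top::ennreal)" by simp
 show ?thesis
 proof (rule ex_finiteE[OF grid_upper_le[OF a m p(1,2) c1]], goal_cases)
 case (1 c)
 note c = 1(1) and U = 1(2)[rule_format (no_asm)]
 show ?thesis
 proof (intro exI[of _ c] conjI[OF c] allI impI)
  fix u w s A and g :: "real => ennreal"
  assume S: "copson_setting u w s a" and g: "g \<in> borelfun" and N: "(powint p s g) < top"
   and A: "\<forall>x>0. Phi a u w x * s {x<..} epowr (a * m * (p - 1) / p) \<le> A"
  interpret copson_setting u w s a by (rule S)
  show "iterK_int a m u w s g \<le> c * (A * powint p s g epowr (a * m / p))"
  proof (rule iterK_integral_le[OF m])
   fix t assume G: "copson_grid u w s a t"
   interpret copson_grid u w s a t by (rule G)
   show "iterK_int_upto (t 0) a m u w s g \<le> c * (A * powint p s g epowr (a * m / p))"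
   proof (rule U[OF G g N A, of "\<lambda>n. Usup 1 (m * (p - 1) / p) u s (t n)"])
    show "\<forall>n. local_norm m g n \<le> 4 epowr m * ((\<integral>\<^sup>+y\<in>grid_cell t n. g y epowr p \<partial>s) epowr (m / p) * Usup 1 (m * (p - 1) / p) u s (t n))"
     by (intro allI local_norm_le m p g N)
    show "\<forall>n. W n * Usup 1 (m * (p - 1) / p) u s (t n) epowr a \<le> A"
    proof
     fix n
     have "Usup 1 (m * (p - 1) / p) u s (t n) epowr a = Usup a (a * m * (p - 1) / p) u s (t n)"
      using a by (simp add: Usup_epowr mult_ac)
     then have "W n * Usup 1 (m * (p - 1) / p) u s (t n) epowr a =
       (SUP z\<in>{t n<..}. W n * (u {t n<..z} epowr a * s {z<..} epowr (a * m * (p - 1) / p)))"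
      by (simp only: Usup_def SUP_mult_left_ennreal)
     also have "\<dots> \<le> A"
     proof (rule SUP_least)
      fix z assume z: "z \<in> {t n<..}"
      have "W n * u {t n<..z} epowr a * s {z<..} epowr (a * m * (p - 1) / p)
        \<le> Phi a u w z * s {z<..} epowr (a * m * (p - 1) / p)"
       using z by (intro mult_right_mono head_le_Phi) auto
      also have "\<dots> \<le> A" using A z t_pos[of n] by auto
      finally show "W n * (u {t n<..z} epowr a * s {z<..} epowr (a * m * (p - 1) / p)) \<le> A"
       by (simp only: mult.assoc)
     qed
     finally show "W n * Usup 1 (m * (p - 1) / p) u s (t n) epowr a \<le> A" .
    qed
   qed
  qed
 qed
 qed
qed

text \<open>The power a p / (p - a m) of the local supremum is exactly the supremum in A2, so the
  local series is controlled by A2 and the discrete one by A3 and A2.\<close>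

lemma upper_b:
 assumes a: "0 < a" and m: "0 < m" and p: "1 < p" "a * m < p" "p \<le> m"
 shows "\<exists>c<top. \<forall>u w s g. copson_setting u w s a --> g \<in> borelfun --> (powint p s g) < top -->
  iterK_int a m u w s g \<le> c * (
   (Phi_Usup_int a (a * m / (p - a * m)) (a * m * (p - 1) / (p - a * m)) u w s +
  head_Usup_int (a * (p / (p - a * m))) (a * m / (p - a * m)) (a * m * (p - 1) / (p - a * m)) u w s) epowr ((p - a * m) / p)
   * powint p s g epowr (a * m / p))"
proof -
 have c1: "4 epowr m < (top::ennreal)" by simp
 define B where "B = (\<lambda>u s. Usup 1 (m * (p - 1) / p) u s)"
 show ?thesis
 proof (rule ex_forward[OF grid_upper_lt[OF a m p(1,2) c1]], elim conjE, intro conjI allI impI)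
  fix c u w s and g :: "real => ennreal"
  assume U: "\<forall>u w s t g A B. copson_grid u w s a t --> g \<in> borelfun --> (powint p s g) < top -->
  Phi_Usup_int a (a * m / (p - a * m)) (a * m * (p - 1) / (p - a * m)) u w s +
  head_Usup_int (a * (p / (p - a * m))) (a * m / (p - a * m)) (a * m * (p - 1) / (p - a * m)) u w s \<le> A -->
  (\<forall>n. copson_grid.local_norm u s t m g n \<le> 4 epowr m * ((\<integral>\<^sup>+y\<in>grid_cell t n. g y epowr p \<partial>s) epowr (m / p) * B (t n))) -->
  antimono B --> (\<integral>\<^sup>+x. w {..x} epowr (a * m / (p - a * m)) * B x epowr (a * (p / (p - a * m))) \<partial>w) \<le> A -->
  iterK_int_upto (t 0) a m u w s g \<le> c * (A epowr ((p - a * m) / p) * powint p s g epowr (a * m / p))"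
  assume S: "copson_setting u w s a" and g: "g \<in> borelfun" and N: "(powint p s g) < top"
  interpret copson_setting u w s a by (rule S)
  have am: "0 < a * (p / (p - a * m))" using a p by simp
  have Be: "B u s x epowr (a * (p / (p - a * m))) = Usup (a * (p / (p - a * m))) (a * m * (p - 1) / (p - a * m)) u s x" for x
  proof -
   have "m * (p - 1) / p * (a * (p / (p - a * m))) = a * m * (p - 1) / (p - a * m)"
    using p by (simp add: field_simps)
   then show ?thesis unfolding B_def Usup_epowr[OF am zero_le_one] by (simp only: mult_1)
  qed
  show "iterK_int a m u w s g \<le> c * (
   (Phi_Usup_int a (a * m / (p - a * m)) (a * m * (p - 1) / (p - a * m)) u w s +
  head_Usup_int (a * (p / (p - a * m))) (a * m / (p - a * m)) (a * m * (p - 1) / (p - a * m)) u w s) epowr ((p - a * m) / p)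
   * powint p s g epowr (a * m / p))"
  proof (rule iterK_integral_le[OF m])
   fix t assume G: "copson_grid u w s a t"
   interpret copson_grid u w s a t by (rule G)
   show "iterK_int_upto (t 0) a m u w s g \<le> c * (
   (Phi_Usup_int a (a * m / (p - a * m)) (a * m * (p - 1) / (p - a * m)) u w s +
  head_Usup_int (a * (p / (p - a * m))) (a * m / (p - a * m)) (a * m * (p - 1) / (p - a * m)) u w s) epowr ((p - a * m) / p)
   * powint p s g epowr (a * m / p))"
   proof (rule U[rule_format, OF G g N order_refl, of "B u s"])
    show "local_norm m g n \<le> 4 epowr m * ((\<integral>\<^sup>+y\<in>grid_cell t n. g y epowr p \<partial>s) epowr (m / p) * B u s (t n))" for n
     unfolding B_def by (intro local_norm_le m p g N)
    show "antimono (B u s)" unfolding B_def by (rule antimonoI, rule Usup_antimono[OF u]) auto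
    show "(\<integral>\<^sup>+x. w {..x} epowr (a * m / (p - a * m)) * B u s x epowr (a * (p / (p - a * m))) \<partial>w) \<le>
     Phi_Usup_int a (a * m / (p - a * m)) (a * m * (p - 1) / (p - a * m)) u w s +
     head_Usup_int (a * (p / (p - a * m))) (a * m / (p - a * m)) (a * m * (p - 1) / (p - a * m)) u w s"
     unfolding Be by simp
   qed
  qed
 qed
qed

lemma upper_c:
 assumes a: "0 < a" and m: "0 < m" "m < p" and p: "1 < p" "p \<le> a * m"
 shows "\<exists>c<top. \<forall>u w s g A. copson_setting u w s a --> g \<in> borelfun --> (powint p s g) < top -->
  (\<forall>x>0. Phi a u w x * s {x<..} epowr (a * m * (p - 1) / p) \<le> A) -->
  (\<forall>x>0. w {..x} * Xu m p u s x epowr (a * (p - m) / p) \<le> A) -->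
  iterK_int a m u w s g \<le> c * (A * powint p s g epowr (a * m / p))"
proof -
 show ?thesis
 proof (rule ex_finiteE[OF local_norm_lt[OF m p(1)]], goal_cases)
 case (1 c1)
 note c1 = 1(1) and loc = 1(2)[rule_format (no_asm)]
 show ?thesis
 proof (rule ex_finiteE[OF grid_upper_le[OF a m(1) p c1]], goal_cases)
 case (1 c)
 note c = 1(1) and U = 1(2)[rule_format (no_asm)]
 show ?thesis
 proof (intro exI[of _ c] conjI[OF c] allI impI)
  fix u w s A and g :: "real => ennreal"
  assume S: "copson_setting u w s a" and g: "g \<in> borelfun" and N: "(powint p s g) < top"
   and A: "\<forall>x>0. Phi a u w x * s {x<..} epowr (a * m * (p - 1) / p) \<le> A"
   and A4: "\<forall>x>0. w {..x} * Xu m p u s x epowr (a * (p - m) / p) \<le> A"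
  interpret copson_setting u w s a by (rule S)
  show "iterK_int a m u w s g \<le> c * (A * powint p s g epowr (a * m / p))"
  proof (rule iterK_integral_le[OF m(1)])
   fix t assume G: "copson_grid u w s a t"
   interpret copson_grid u w s a t by (rule G)
   have "(Xu m p u s (t n) epowr ((p - m) / p)) epowr a = Xu m p u s (t n) epowr (a * (p - m) / p)" for n
    by (simp add: epowr_epowr mult.commute)
   then show "iterK_int_upto (t 0) a m u w s g \<le> c * (A * powint p s g epowr (a * m / p))"
    using loc[OF G g N] A4 t_pos by (intro U[OF G g N A, of "\<lambda>n. Xu m p u s (t n) epowr ((p - m) / p)"]) auto
  qed
 qed
 qed
 qed
qed

text \<open>In u(x,z]^(p / (p - m)) one power is written as an integral over (x,z], where the tail
  of s is at least its value at z. This absorbs A2 into A5_star when m < p and is why A2 is absent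
  from that case.\<close>

lemma Usup_le_Xu:
 assumes m: "0 < m" "m < p" and p: "1 < p" and \<gamma>: "0 < \<gamma>"
 shows "\<exists>c<top. \<forall>u s x. diffuse u --> sets s = sets borel --> (\<forall>z. u {x<..z} < top) -->
  Usup (p / (p - m) * \<gamma>) (m * (p - 1) / (p - m) * \<gamma>) u s x \<le> c * Xu m p u s x epowr \<gamma>"
proof -
 define a where "a = m / (p - m)"
 have a: "-1 < a" using m by (auto simp: a_def intro: less_trans[of _ 0])
 have a1: "a + 1 = p / (p - m)" using m by (simp add: a_def field_simps)
 show ?thesis
 proof (rule ex_finiteE[OF head_power[OF a]], goal_cases)
 case (1 c1)
 note c1 = 1(1) and h = 1(2)[rule_format (no_asm)]
 show ?thesis
 proof (intro exI[of _ "c1 epowr \<gamma>"] conjI allI impI)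
  show "c1 epowr \<gamma> < top" using \<gamma> by (intro epowr_less_top c1) auto
  fix u s :: "real measure" and x assume du: "diffuse u" and s: "sets s = sets borel" and fin: "\<forall>z. u {x<..z} < top"
  note u = diffuseD(1)[OF du]
  show "Usup (p / (p - m) * \<gamma>) (m * (p - 1) / (p - m) * \<gamma>) u s x \<le> c1 epowr \<gamma> * Xu m p u s x epowr \<gamma>"
   unfolding Usup_def
  proof (rule SUP_least)
   fix z
   let ?k = "m * (p - 1) / (p - m)"
   have k: "0 \<le> ?k" using m p by simp
   have mu: "(\<lambda>y. u {x<..y} epowr a * indicator {x<..z} y) \<in> borel_measurable u"
    by (rule measurable_borel_like[OF u]) (use measurable_Ioc[OF u, of x] in measurable)
   have "u {x<..z} epowr (p / (p - m)) * s {z<..} epowr ?k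
     \<le> c1 * (\<integral>\<^sup>+y\<in>{x<..z}. u {x<..y} epowr a \<partial>u) * s {z<..} epowr ?k"
    using h[OF du fin[rule_format, of z], THEN conjunct2] unfolding a1 by (rule mult_right_mono) simp
   also have "\<dots> = c1 * (\<integral>\<^sup>+y. s {z<..} epowr ?k * (u {x<..y} epowr a * indicator {x<..z} y) \<partial>u)"
    unfolding nn_integral_cmult[OF mu] by (simp only: mult_ac)
   also have "\<dots> \<le> c1 * Xu m p u s x"
    unfolding Xu_def a_def[symmetric]
   proof (rule mult_left_mono[OF nn_integral_mono])
    fix y
    show "s {z<..} epowr ?k * (u {x<..y} epowr a * indicator {x<..z} y) \<le>
     u {x<..y} epowr a * s {y<..} epowr ?k * indicator {x<..} y"
    proof (cases "x < y \<and> y \<le> z")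
     case True
     have "s {z<..} epowr ?k \<le> s {y<..} epowr ?k"
      using True s k by (intro epowr_mono emeasure_mono) auto
     then have "s {z<..} epowr ?k * u {x<..y} epowr a \<le> s {y<..} epowr ?k * u {x<..y} epowr a"
      by (rule mult_right_mono) simp
     then show ?thesis using True by (simp add: mult.commute)
    qed (auto split: split_indicator)
   qed simp
   finally have "(u {x<..z} epowr (p / (p - m)) * s {z<..} epowr ?k) epowr \<gamma> \<le> (c1 * Xu m p u s x) epowr \<gamma>"
    using \<gamma> by (intro epowr_mono) auto
   then show "u {x<..z} epowr (p / (p - m) * \<gamma>) * s {z<..} epowr (?k * \<gamma>) \<le> c1 epowr \<gamma> * Xu m p u s x epowr \<gamma>"
    using \<gamma> by (simp only: epowr_mult[OF less_imp_le] epowr_epowr)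
  qed
 qed
 qed
qed

section \<open>Lower bounds\<close>

text \<open>In each place a point is chosen where f is at least half of the supremum. The suprema
  are finite because a single term, completed by arbitrary admissible points, is already bounded by
  X.\<close>

lemma suminf_SUP_choice:
 fixes f :: "nat => 'b => ennreal"
 assumes ne: "\<And>n. Z n \<noteq> {}"
  and le: "\<And>z. (\<And>n. z n \<in> Z n) ==> (\<Sum>n. f n (z n)) \<le> X"
 shows "(\<Sum>n. SUP z\<in>Z n. f n z) \<le> 2 * X"
proof (cases "X = top")
 case False
 define S where "S = (\<lambda>n. SUP z\<in>Z n. f n z)"
 define z0 where "z0 = (\<lambda>n. SOME z. z \<in> Z n)"
 have z0: "z0 n \<in> Z n" for n unfolding z0_def using ne[of n] by (simp add: some_in_eq)
 have fX: "f n z \<le> X" if "z \<in> Z n" for n z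
 proof -
  have "f n z = f n ((z0(n := z)) n)" by simp
  also have "\<dots> \<le> (\<Sum>k. f k ((z0(n := z)) k))" by (rule le_suminf_term)
  also have "\<dots> \<le> X" using z0 that by (intro le) auto
  finally show ?thesis .
 qed
 have Sfin: "S n < top" for n
 proof -
  have "S n \<le> X" unfolding S_def using fX by (intro SUP_least) auto
  then show ?thesis using False by (auto simp: less_top top_unique)
 qed
 have "\<exists>z\<in>Z n. S n \<le> 2 * f n z" for n
 proof (cases "S n" rule: ennreal_pos_cases)
  case zero
  then show ?thesis using z0[of n] by (intro bexI[of _ "z0 n"]) auto
 next
  case (real r)
  then have "ennreal (r / 2) < S n" by (simp add: ennreal_less_iff)
  then obtain z where z: "z \<in> Z n" "ennreal (r / 2) < f n z" unfolding S_def by (auto simp: less_SUP_iff)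
  have "S n = 2 * ennreal (r / 2)"
  proof -
   have "2 * ennreal (r / 2) = ennreal (2 * (r / 2))" using real by (subst ennreal_mult) auto
   then show ?thesis using real by simp
  qed
  also have "\<dots> \<le> 2 * f n z" using z(2) by (intro mult_left_mono less_imp_le) auto
  finally show ?thesis using z(1) by blast
 next
  case top then show ?thesis using Sfin[of n] by simp
 qed
 then obtain z where z: "\<And>n. z n \<in> Z n" "\<And>n. S n \<le> 2 * f n (z n)" by metis
 have "(\<Sum>n. S n) \<le> (\<Sum>n. 2 * f n (z n))" by (intro suminf_le summableI z(2))
 also have "\<dots> = 2 * (\<Sum>n. f n (z n))" by (rule ennreal_suminf_cmult)
 also have "\<dots> \<le> 2 * X" using z(1) by (intro mult_left_mono le) auto
 finally show ?thesis by (simp only: S_def)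
qed (simp add: ennreal_mult_top)

text \<open>The inequality in terms of the density g, raised to the power q = a m; accordingly D is
  the q-th power of a constant.\<close>

definition Cineq :: "real => real => real => real measure => real measure => real measure => ennreal => bool" where
 "Cineq a m p u w s D \<longleftrightarrow> (\<forall>g\<in>borel_measurable borel.
   iterK_int a m u w s g \<le> D * powint p s g epowr (a * m / p))"

context copson_grid
begin

lemma iterK_ge:
 assumes m: "0 < m" and "x \<le> z"
 shows "u {x<..z} * copson s g z epowr m \<le> iterK m u s g x"
proof -
 have zs: "{x<..z} \<in> sets u" unfolding u by simp
 have "u {x<..z} * copson s g z epowr m = (\<integral>\<^sup>+y. copson s g z epowr m * indicator {x<..z} y \<partial>u)"
  unfolding nn_integral_cmult_indicator[OF zs] by (rule mult.commute)
 also have "\<dots> \<le> iterK m u s g x"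
  unfolding iterK_def
 proof (intro nn_integral_mono)
  fix y
  show "copson s g z epowr m * indicator {x<..z} y \<le> copson s g y epowr m * indicator {x<..} y"
   using m copson_antimono[of y z s g] by (auto split: split_indicator intro!: epowr_mono)
 qed
 finally show ?thesis .
qed

lemma iterK_sum_le: "0 \<le> a ==> (\<Sum>n. W (Suc n) * iterK m u s g (t n) epowr a) \<le> iterK_int a m u w s g"
proof -
 have "(\<Sum>n. W (Suc n) * iterK m u s g (t n) epowr a) \<le> iterK_int_upto (t 0) a m u w s g"
  using a0 by (intro lower_sum epowr_mono iterK_antimono) auto
 also have "\<dots> \<le> iterK_int a m u w s g" by (rule nn_integral_mono) (auto split: split_indicator)
 finally show ?thesis .
qed

text \<open>The counterpart of \<open>bmass\<close> with freely chosen points z n in the cells,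
  needed because the suprema in A2 and A3 run over points inside cells.\<close>

definition zmass :: "(nat => real) => nat => ennreal" where
 "zmass z n = W n * u {t n<..z n} epowr a"

text \<open>The inner integral at t n is at least u(t n,z n] times copson(z n)^m, so the full
  inequality implies a discrete Hardy inequality for these masses. The factor 2 is the ratio of W n
  to W (n + 1).\<close>

lemma zmass_dual:
 assumes m: "0 < m" and C: "Cineq a m p u w s D" and g: "g \<in> borelfun" and z: "\<And>n. z n \<in> grid_cell t n"
 shows "(\<integral>\<^sup>+x. copson s g x epowr (a * m) \<partial>point_masses (zmass z) z) \<le> 2 * D * powint p s g epowr (a * m / p)"
proof -
 have mc: "(\<lambda>x. copson s g x epowr (a * m)) \<in> borelfun"
  by (rule borel_measurable_epowr[OF measurable_copson])
 have "(\<integral>\<^sup>+x. copson s g x epowr (a * m) \<partial>point_masses (zmass z) z) = (\<Sum>n. zmass z n * copson s g (z n) epowr (a * m))"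
  by (rule nn_integral_point_masses[OF mc])
 also have "\<dots> \<le> (\<Sum>n. 2 * (W (Suc n) * iterK m u s g (t n) epowr a))"
 proof (intro suminf_le summableI)
  fix n
  have "t n \<le> z n" using z[of n] grid_cell_subset[of t n] by auto
  then have "(u {t n<..z n} * copson s g (z n) epowr m) epowr a \<le> iterK m u s g (t n) epowr a"
   using a0 by (intro epowr_mono iterK_ge m) auto
  then have "W n * (u {t n<..z n} * copson s g (z n) epowr m) epowr a \<le> W n * iterK m u s g (t n) epowr a"
   by (rule mult_left_mono) simp
  moreover have "zmass z n * copson s g (z n) epowr (a * m) = W n * (u {t n<..z n} * copson s g (z n) epowr m) epowr a"
   using a0 by (simp add: zmass_def epowr_mult epowr_epowr mult_ac)
  ultimately show "zmass z n * copson s g (z n) epowr (a * m) \<le> 2 * (W (Suc n) * iterK m u s g (t n) epowr a)"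
   unfolding Whalf[of n] by (simp only: mult.assoc)
 qed
 also have "\<dots> = 2 * (\<Sum>n. W (Suc n) * iterK m u s g (t n) epowr a)" by (rule ennreal_suminf_cmult)
 also have "\<dots> \<le> 2 * (D * powint p s g epowr (a * m / p))"
  using C g a0 by (intro mult_left_mono order.trans[OF iterK_sum_le]) (auto simp: Cineq_def)
 finally show ?thesis by (simp only: mult.assoc)
qed

lemma beta_dual:
 assumes m: "0 < m" and C: "Cineq a m p u w s D" and g: "g \<in> borelfun"
 shows "(\<integral>\<^sup>+x. copson s g x epowr (a * m) \<partial>beta) \<le> 2 * D * powint p s g epowr (a * m / p)"
proof -
 have mc: "(\<lambda>x. copson s g x epowr (a * m)) \<in> borelfun"
  by (rule borel_measurable_epowr[OF measurable_copson])
 \<comment> \<open>The right endpoint of cell n + 1 is t n, and with it \<open>zmass\<close> becomes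
   \<open>bmass n\<close>. Cell 0 has no right endpoint; any point of it will do, as its term is
   only added.\<close>
 let ?z = "\<lambda>n. case n of 0 => t 0 + 1 | Suc k => t k"
 have z: "?z n \<in> grid_cell t n" for n using t_dec by (cases n) auto
 have "(\<integral>\<^sup>+x. copson s g x epowr (a * m) \<partial>beta) = (\<Sum>n. bmass n * copson s g (t n) epowr (a * m))"
  unfolding beta_def by (rule nn_integral_point_masses[OF mc])
 also have "\<dots> = (\<Sum>n. zmass ?z (Suc n) * copson s g (?z (Suc n)) epowr (a * m))"
  by (simp add: zmass_def bmass_def)
 also have "\<dots> \<le> (\<Sum>n. zmass ?z n * copson s g (?z n) epowr (a * m))"
  unfolding suminf_Suc_ennreal[of "\<lambda>n. zmass ?z n * copson s g (?z n) epowr (a * m)"] by simp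
 also have "\<dots> = (\<integral>\<^sup>+x. copson s g x epowr (a * m) \<partial>point_masses (zmass ?z) ?z)"
  by (rule nn_integral_point_masses[OF mc, symmetric])
 also have "\<dots> \<le> 2 * D * powint p s g epowr (a * m / p)"
  by (rule zmass_dual[OF m C g z])
 finally show ?thesis .
qed

lemma beta_UNIV: "beta UNIV < top"
proof -
 have "beta UNIV = beta {..t 0}"
  unfolding beta_def by (simp add: emeasure_point_masses t_antimono)
 then show ?thesis using beta_fin by simp
qed

lemma zmass_UNIV:
 assumes z: "\<And>n. z n \<in> grid_cell t n"
 shows "(point_masses (zmass z) z) UNIV < top"
proof -
 have le: "zmass z (Suc n) \<le> bmass n" for n
 proof -
  have "{t (Suc n)<..z (Suc n)} \<subseteq> grid_cell t (Suc n)" using z[of "Suc n"] by auto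
  then have "u {t (Suc n)<..z (Suc n)} \<le> u (grid_cell t (Suc n))"
   using u by (intro emeasure_mono) auto
  then show ?thesis unfolding zmass_def bmass_def using a0 by (intro mult_left_mono epowr_mono) auto
 qed
 have "(point_masses (zmass z) z) UNIV = (\<Sum>n. zmass z n)"
  by (simp add: emeasure_point_masses)
 also have "\<dots> = zmass z 0 + (\<Sum>n. zmass z (Suc n))" by (rule suminf_Suc_ennreal)
 also have "\<dots> \<le> zmass z 0 + (\<Sum>n. bmass n)" by (intro add_left_mono suminf_le summableI le)
 also have "(\<Sum>n. bmass n) = beta UNIV" by (simp add: beta_def emeasure_point_masses)
 also have "zmass z 0 + beta UNIV < top"
  unfolding zmass_def using a0 by (intro add_less_top_ennreal beta_UNIV mult_less_top_ennreal Wfin epowr_less_top ufin[OF t_pos]) auto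
 finally show ?thesis .
qed

lemma zmass_le_head: "zmass z n \<le> (point_masses (zmass z) z) {..z n}"
proof -
 have "zmass z n = zmass z n * indicator {..z n} (z n)" by simp
 also have "\<dots> \<le> (\<Sum>k. zmass z k * indicator {..z n} (z k))" by (rule le_suminf_term)
 also have "\<dots> = (point_masses (zmass z) z) {..z n}" by (rule emeasure_point_masses[symmetric]) simp
 finally show ?thesis .
qed

text \<open>The supremum of \<open>Usup\<close> at t n with z confined to the n-th cell, so that
  choices in different cells are independent.\<close>

definition cellsup :: "real => real => nat => ennreal" where
 "cellsup b k n = (SUP z\<in>grid_cell t n. u {t n<..z} epowr b * s {z<..} epowr k)"

lemma cell_nonempty: "grid_cell t n \<noteq> {}"
 using t_dec by (cases n) auto

lemma tail_decomp: "u {t n<..z} = (\<Sum>j\<le>n. u (grid_cell t j \<inter> {..z}))"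
proof -
 have m: "(indicator {..z} :: real => ennreal) \<in> borelfun" by simp
 have e: "(\<integral>\<^sup>+x\<in>A. indicator {..z} x \<partial>u) = u (A \<inter> {..z})" if "A \<in> sets borel" for A
 proof -
  have "(\<integral>\<^sup>+x\<in>A. indicator {..z} x \<partial>u) = (\<integral>\<^sup>+x. indicator (A \<inter> {..z}) x \<partial>u)"
   by (intro nn_integral_cong) (auto split: split_indicator)
  also have "\<dots> = u (A \<inter> {..z})" using that u by (intro nn_integral_indicator) auto
  finally show ?thesis .
 qed
 have "{t n<..} \<inter> {..z} = {t n<..z}" by auto
 then show ?thesis using tail_sum[OF u m, of n] e by simp
qed

text \<open>If z lies beyond the cell, the right endpoint is the better choice: the part of u in the
  cell is the same and the tail of s is larger.\<close>

lemma cell_part_le: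
 assumes b: "0 < b" and k: "0 \<le> k"
 shows "u (grid_cell t j \<inter> {..z}) epowr b * s {z<..} epowr k \<le> cellsup b k j"
proof -
 have up: "u {t j<..y} epowr b * s {y<..} epowr k \<le> cellsup b k j" if "y \<in> grid_cell t j" for y
  unfolding cellsup_def using that by (rule SUP_upper)
 consider "z \<le> t j" | "z \<in> grid_cell t j" | i where "j = Suc i" "t i < z"
  by (cases j) fastforce+
 then show ?thesis
 proof cases
  case 1
  then have e: "grid_cell t j \<inter> {..z} = {}" using grid_cell_subset[of t j] by auto
  show ?thesis unfolding e using b by simp
 next
  case 2
  have e: "grid_cell t j \<inter> {..z} = {t j<..z}" using 2 by (cases j) auto
  show ?thesis unfolding e by (rule up[OF 2])
 next
  case 3
  have e: "grid_cell t j \<inter> {..z} = {t j<..t i}" using 3 by auto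
  have "s {z<..} epowr k \<le> s {t i<..} epowr k"
   using 3 s k by (intro epowr_mono emeasure_mono) auto
  then have "u {t j<..t i} epowr b * s {z<..} epowr k \<le> u {t j<..t i} epowr b * s {t i<..} epowr k"
   by (rule mult_left_mono) simp
  also have "\<dots> \<le> cellsup b k j" using 3 t_dec[of i] by (intro up) auto
  finally show ?thesis unfolding e .
 qed
qed

text \<open>Passage from a node t' to a point x of the cell above it: the discrete head function
  controls Phi at nodes only.\<close>

lemma Phi_step:
 assumes "t' \<le> x"
 shows "Phi a u w x \<le> 2 epowr a * (Phi a u w t' + w {..x} * u {t'<..x} epowr a)"
proof -
 let ?c = "u {t'<..x} epowr a"
 have xs: "{..x} \<in> sets w" unfolding w by simp
 have m1: "(\<lambda>y. u {y<..t'} epowr a * indicator {..t'} y) \<in> borel_measurable w"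
  by (rule measurable_borel_like[OF w]) (use measurable_Ioc'[OF u, of t'] in measurable)
 have m2: "(\<lambda>y. ?c * indicator {..x} y) \<in> borel_measurable w"
  by (rule measurable_borel_like[OF w]) measurable
 have m3: "(\<lambda>y. u {y<..t'} epowr a * indicator {..t'} y + ?c * indicator {..x} y) \<in> borel_measurable w"
  by (rule borel_measurable_add[OF m1 m2])
 have "Phi a u w x \<le> (\<integral>\<^sup>+y. 2 epowr a * (u {y<..t'} epowr a * indicator {..t'} y + ?c * indicator {..x} y) \<partial>w)"
  unfolding Phi_def
 proof (intro nn_integral_mono)
  fix y
  show "u {y<..x} epowr a * indicator {..x} y \<le>
    2 epowr a * (u {y<..t'} epowr a * indicator {..t'} y + ?c * indicator {..x} y)"
  proof (cases "y \<le> t'")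
   case True
   have "u {y<..t'} + u {t'<..x} = u ({y<..t'} \<union> {t'<..x})"
    using u by (intro plus_emeasure) auto
   moreover have "{y<..t'} \<union> {t'<..x} = {y<..x}" using True assms by auto
   ultimately have e: "u {y<..x} = u {y<..t'} + u {t'<..x}" by simp
   show ?thesis unfolding e using True assms a0 by (simp add: epowr_add_le)
  next
   case False
   show ?thesis
   proof (cases "y \<le> x")
    case True
    have "u {y<..x} epowr a \<le> ?c" using False u a0 by (intro epowr_mono emeasure_mono) auto
    also have "\<dots> = 1 epowr a * ?c" by simp
    also have "\<dots> \<le> 2 epowr a * ?c" using a0 by (intro mult_right_mono epowr_mono) auto
    finally show ?thesis using True False by simp
   qed simp
  qed
 qed
 also have "\<dots> = 2 epowr a * (Phi a u w t' + w {..x} * ?c)"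
  unfolding nn_integral_cmult[OF m3] nn_integral_add[OF m1 m2] nn_integral_cmult_indicator[OF xs] Phi_def
  by (simp only: mult.commute)
 finally show ?thesis .
qed

lemma cells_between: "u {t (Suc (n + k))<..t n} = (\<Sum>j\<le>k. u (grid_cell t (Suc (n + j))))"
proof (induction k)
 case (Suc k)
 have "u {t (Suc (n + k))<..t n} + u {t (Suc (Suc (n + k)))<..t (Suc (n + k))}
   = u ({t (Suc (n + k))<..t n} \<union> {t (Suc (Suc (n + k)))<..t (Suc (n + k))})"
  using u by (intro plus_emeasure) auto
 moreover have "{t (Suc (n + k))<..t n} \<union> {t (Suc (Suc (n + k)))<..t (Suc (n + k))} = {t (Suc (n + Suc k))<..t n}"
  using t_dec[of "Suc (n + k)"] t_antimono[of n "Suc (n + k)"] by auto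
 ultimately show ?case using Suc by simp
qed simp

lemma beta_head_shift: "beta {..t n} = (\<Sum>k. bmass (n + k))"
proof -
 have "beta {..t n} = (\<Sum>j. if n \<le> j then bmass (n + (j - n)) else 0)"
  unfolding beta_head
 proof (intro suminf_cong)
  fix j
  show "bmass j * indicator {..t n} (t j) = (if n \<le> j then bmass (n + (j - n)) else 0)"
   using t_antimono[of n j] t_less_iff[of n j] by (auto split: split_indicator)
 qed
 also have "\<dots> = (\<Sum>k. bmass (n + k))" by (rule suminf_shift_ennreal)
 finally show ?thesis .
qed

lemma Phi_le_cells: "Phi a u w (t n) \<le> (\<Sum>k. W (Suc (n + k)) * (\<Sum>j\<le>k. u (grid_cell t (Suc (n + j)))) epowr a)"
proof -
 let ?F = "\<lambda>k. (\<Sum>j\<le>k. u (grid_cell t (Suc (n + j)))) epowr a"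
 have "Phi a u w (t n) = (\<integral>\<^sup>+y\<in>{..t 0}. (u {y<..t n} epowr a * indicator {..t n} y) \<partial>w)"
  unfolding Phi_def using t_antimono[of 0 n] by (intro nn_integral_cong) (auto split: split_indicator)
 also have "\<dots> \<le> (\<Sum>k. W (Suc k) * (if n \<le> k then ?F (k - n) else 0))"
 proof (rule upper_sum)
  fix k y assume y: "y \<in> grid_cell t (Suc k)"
  show "u {y<..t n} epowr a * indicator {..t n} y \<le> (if n \<le> k then ?F (k - n) else 0)"
  proof (cases "n \<le> k")
   case True
   have "u {y<..t n} \<le> u {t (Suc (n + (k - n)))<..t n}"
    using y True u by (intro emeasure_mono) auto
   then have "u {y<..t n} epowr a \<le> ?F (k - n)"
    unfolding cells_between using a0 by (intro epowr_mono) auto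
   then show ?thesis using True by (auto split: split_indicator)
  next
   case False
   then have "t n \<le> t (Suc k)" by (intro t_antimono) auto
   then have "\<not> y \<le> t n" using y by auto
   then show ?thesis by simp
  qed
 qed
 also have "\<dots> = (\<Sum>k. if n \<le> k then W (Suc (n + (k - n))) * ?F (k - n) else 0)"
  by (intro suminf_cong) auto
 also have "\<dots> = (\<Sum>k. W (Suc (n + k)) * ?F k)"
  by (rule suminf_shift_ennreal[of n "\<lambda>k. W (Suc (n + k)) * ?F k"])
 finally show ?thesis .
qed

end

text \<open>The converse of \<open>beta_head_le\<close>, at the nodes: Phi(t n) is a W-weighted sum
  of a-th powers of u-masses of runs of cells, and such a sum is dominated by its diagonal, the head
  of \<open>beta\<close>.\<close>

lemma Phi_le_beta:
 assumes a: "0 < a"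
 shows "\<exists>c<top. \<forall>u w s t n. copson_grid u w s a t --> Phi a u w (t n) \<le> c * (copson_grid.beta u w a t) {..t n}"
proof -
 have "\<exists>c<top. \<forall>\<omega> x. (\<forall>n. \<omega> (Suc n) \<le> ennreal (1/2) * \<omega> n) -->
   (\<Sum>n. \<omega> n * (\<Sum>j\<le>n. ennreal (1 ^ (n - j)) * x j) epowr a) \<le> c * (\<Sum>n. \<omega> n * x n epowr a)"
  by (rule suminf_geometric_epowr) (use a in simp_all)
 then obtain c where c: "c < top" and geo: "\<And>\<omega> x. (\<forall>n. \<omega> (Suc n) \<le> ennreal (1/2) * \<omega> n) ==>
   (\<Sum>n. \<omega> n * (\<Sum>j\<le>n. ennreal (1 ^ (n - j)) * x j) epowr a) \<le> c * (\<Sum>n. \<omega> n * x n epowr a)" by blast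
 show ?thesis
 proof (intro exI[of _ c] conjI[OF c] allI impI)
  fix u w s t n assume "copson_grid u w s a t"
  then interpret copson_grid u w s a t .
  have half: "\<forall>k. W (Suc (n + Suc k)) \<le> ennreal (1/2) * W (Suc (n + k))"
   using W_Suc_half[of "Suc (n + _)"] by simp
  have "Phi a u w (t n) \<le> (\<Sum>k. W (Suc (n + k)) * (\<Sum>j\<le>k. ennreal (1 ^ (k - j)) * u (grid_cell t (Suc (n + j)))) epowr a)"
   using Phi_le_cells[of n] by simp
  also have "\<dots> \<le> c * (\<Sum>k. W (Suc (n + k)) * u (grid_cell t (Suc (n + k))) epowr a)"
   by (rule geo[OF half])
  also have "\<dots> = c * beta {..t n}" by (simp only: beta_head_shift bmass_def)
  finally show "Phi a u w (t n) \<le> c * beta {..t n}" .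
 qed
qed

text \<open>The u-mass up to z is split over the cells and each piece estimated by
  \<open>cell_part_le\<close>.\<close>

lemma Usup_le_cells:
 assumes b: "0 < b" and k: "0 \<le> k"
 shows "\<exists>c<top. \<forall>u w s a t n. copson_grid u w s a t -->
  Usup b k u s (t n) \<le> c * (\<Sum>j\<le>n. ennreal ((3/2) ^ (n - j)) * copson_grid.cellsup u s t b k j)"
proof -
 \<comment> \<open>Any growth factor strictly between 1 and 2 would serve: above 1 to move the power
   inside the sum, below 2 to be beaten by the decay 1/2 of W afterwards.\<close>
 have "\<exists>c<top. \<forall>x n. (\<Sum>j\<le>n. ennreal (1 ^ (n - j)) * x j) epowr b
  \<le> c * (\<Sum>j\<le>n. ennreal ((3/2) ^ (n - j)) * x j epowr b)"
  by (rule sum_epowr_geometric) (use b in simp_all)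
 then obtain c where c: "c < top" and geo: "\<And>x n. (\<Sum>j\<le>n. ennreal (1 ^ (n - j)) * x j) epowr b
  \<le> c * (\<Sum>j\<le>n. ennreal ((3/2) ^ (n - j)) * x j epowr b)" by blast
 show ?thesis
 proof (intro exI[of _ c] conjI[OF c] allI impI)
  fix u w s a t n assume "copson_grid u w s a t"
  then interpret copson_grid u w s a t .
  show "Usup b k u s (t n) \<le> c * (\<Sum>j\<le>n. ennreal ((3/2) ^ (n - j)) * cellsup b k j)"
   unfolding Usup_def
  proof (rule SUP_least)
   fix z
   have "u {t n<..z} epowr b * s {z<..} epowr k \<le>
     c * (\<Sum>j\<le>n. ennreal ((3/2) ^ (n - j)) * u (grid_cell t j \<inter> {..z}) epowr b) * s {z<..} epowr k"
    using geo[where n = n and x = "\<lambda>j. u (grid_cell t j \<inter> {..z})"] unfolding tail_decomp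
    by (intro mult_right_mono) auto
   also have "\<dots> = c * (\<Sum>j\<le>n. ennreal ((3/2) ^ (n - j)) * (u (grid_cell t j \<inter> {..z}) epowr b * s {z<..} epowr k))"
    by (simp only: sum_distrib_right mult.assoc)
   also have "\<dots> \<le> c * (\<Sum>j\<le>n. ennreal ((3/2) ^ (n - j)) * cellsup b k j)"
    by (intro mult_left_mono sum_mono cell_part_le b k) auto
   finally show "u {t n<..z} epowr b * s {z<..} epowr k \<le> c * (\<Sum>j\<le>n. ennreal ((3/2) ^ (n - j)) * cellsup b k j)" .
  qed
 qed
qed

text \<open>Near-optimal points z n are fixed in all cells at once, and \<open>lower_dual\<close> is
  applied to the point masses there. The first sum takes heads and integration from the same point
  masses, the second takes the heads of \<open>beta\<close>.\<close>

lemma cellsup_sums: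
 assumes a: "0 < a" and m: "0 < m" and p: "1 < p" "a * m < p"
 shows "\<exists>c<top. \<forall>u w s t D. copson_grid u w s a t --> Cineq a m p u w s D -->
  (\<Sum>n. w {..t n} epowr (a * m / (p - a * m) + 1) *
   copson_grid.cellsup u s t (a * (a * m / (p - a * m) + 1)) (a * m * (p - 1) / (p - a * m)) n) \<le> c * D epowr (p / (p - a * m)) \<and>
  (\<Sum>n. w {..t n} * ((copson_grid.beta u w a t) {..t n} epowr (a * m / (p - a * m)) *
   copson_grid.cellsup u s t a (a * m * (p - 1) / (p - a * m)) n)) \<le> c * D epowr (p / (p - a * m))"
proof -
 define q where "q = a * m"
 have q: "0 < q" "q < p" using a m p by (auto simp: q_def)
 define e where "e = q / (p - q)"
 define \<kappa> where "\<kappa> = q * (p - 1) / (p - q)"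
 have e: "0 \<le> e" "0 \<le> \<kappa>" using q p by (auto simp: e_def \<kappa>_def)
 show ?thesis
 proof (rule ex_finiteE[OF lower_dual[OF q(1) p(1) q(2), folded e_def, folded \<kappa>_def]], goal_cases)
 case (1 c)
 note c = 1(1) and LD = 1(2)[rule_format (no_asm)]
 let ?C = "2 * (c * 2 epowr (p / (p - q)))"
 show ?thesis
  unfolding q_def[symmetric] unfolding e_def[symmetric] \<kappa>_def[symmetric]
 proof (intro exI[of _ ?C] conjI allI impI)
  show "?C < top" by (intro mult_less_top_ennreal c) auto
  fix u w s t D assume G: "copson_grid u w s a t" and CI: "Cineq a m p u w s D"
  interpret copson_grid u w s a t by (rule G)
  have sf: "\<forall>\<tau>>0. s {\<tau><..} < top" using sfin by blast
  have D2: "c * (2 * D) epowr (p / (p - q)) = c * 2 epowr (p / (p - q)) * D epowr (p / (p - q))"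
   using q by (simp add: epowr_mult mult.assoc)
  have zd: "\<forall>g\<in>borel_measurable borel. (\<integral>\<^sup>+x. copson s g x epowr q \<partial>point_masses (zmass z) z) \<le> 2 * D * powint p s g epowr (q / p)"
   if "\<And>n. z n \<in> grid_cell t n" for z
   using zmass_dual[OF m CI _ that] unfolding q_def[symmetric] by blast
  have bd: "\<forall>g\<in>borel_measurable borel. (\<integral>\<^sup>+x. copson s g x epowr q \<partial>beta) \<le> 2 * D * powint p s g epowr (q / p)"
   using beta_dual[OF m CI] unfolding q_def[symmetric] by blast
  have red: "(\<Sum>n. zmass z n * (f (z n))) \<le> c * 2 epowr (p / (p - q)) * D epowr (p / (p - q))"
   if z: "\<And>n. z n \<in> grid_cell t n" and f: "f \<in> borelfun"
    and le: "(\<integral>\<^sup>+x\<in>{0<..}. f x \<partial>point_masses (zmass z) z) \<le> c * (2 * D) epowr (p / (p - q))" for z f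
  proof -
   have zp: "0 < z n" for n using z[of n] grid_cell_subset[of t n] t_pos[of n] by auto
   have mf: "(\<lambda>x. f x * indicator {0<..} x) \<in> borelfun" using f by measurable
   have "(\<Sum>n. zmass z n * f (z n)) = (\<Sum>n. zmass z n * (f (z n) * indicator {0<..} (z n)))"
    using zp by simp
   also have "\<dots> = (\<integral>\<^sup>+x\<in>{0<..}. f x \<partial>point_masses (zmass z) z)"
    by (rule nn_integral_point_masses[OF mf, symmetric])
   finally show ?thesis using le unfolding D2 by simp
  qed
  have "(\<Sum>n. SUP z\<in>grid_cell t n. W n epowr (e + 1) * (u {t n<..z} epowr (a * (e + 1)) * s {z<..} epowr \<kappa>))
    \<le> 2 * (c * 2 epowr (p / (p - q)) * D epowr (p / (p - q)))"
  proof (rule suminf_SUP_choice[OF cell_nonempty])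
   fix z assume z: "\<And>n. z n \<in> grid_cell t n"
   let ?P = "point_masses (zmass z) z"
   have "(\<Sum>n. W n epowr (e + 1) * (u {t n<..z n} epowr (a * (e + 1)) * s {z n<..} epowr \<kappa>))
     \<le> (\<Sum>n. zmass z n * (emeasure ?P {..z n} epowr e * s {z n<..} epowr \<kappa>))"
   proof (intro suminf_le summableI)
    fix n
    have "W n epowr (e + 1) * (u {t n<..z n} epowr (a * (e + 1)) * s {z n<..} epowr \<kappa>)
      = zmass z n epowr (e + 1) * s {z n<..} epowr \<kappa>"
     using e by (simp add: zmass_def epowr_mult epowr_epowr mult.assoc)
    also have "zmass z n epowr (e + 1) = zmass z n * zmass z n epowr e"
     using e by (simp add: epowr_add mult.commute)
    \<comment> \<open>Each mass is at most the head up to its own point, so a power of the mass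
      becomes a head factor as in \<open>lower_dual\<close>.\<close>
    also have "zmass z n * zmass z n epowr e * s {z n<..} epowr \<kappa> \<le> zmass z n * emeasure ?P {..z n} epowr e * s {z n<..} epowr \<kappa>"
     using e by (intro mult_right_mono mult_left_mono epowr_mono zmass_le_head) auto
    finally show "W n epowr (e + 1) * (u {t n<..z n} epowr (a * (e + 1)) * s {z n<..} epowr \<kappa>)
      \<le> zmass z n * (emeasure ?P {..z n} epowr e * s {z n<..} epowr \<kappa>)" by (simp only: mult.assoc)
   qed
   also have "\<dots> \<le> c * 2 epowr (p / (p - q)) * D epowr (p / (p - q))"
   proof (rule red[OF z])
    show "(\<lambda>x. emeasure ?P {..x} epowr e * s {x<..} epowr \<kappa>) \<in> borelfun"
     using measurable_head[of ?P] measurable_tail[OF s] by measurable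
    show "(\<integral>\<^sup>+x\<in>{0<..}. emeasure ?P {..x} epowr e * s {x<..} epowr \<kappa> \<partial>?P) \<le> c * (2 * D) epowr (p / (p - q))"
     by (rule LD[OF ds sf _ _ zmass_UNIV[OF z] zd[OF z] zd[OF z]]) simp_all
   qed
   finally show "(\<Sum>n. W n epowr (e + 1) * (u {t n<..z n} epowr (a * (e + 1)) * s {z n<..} epowr \<kappa>))
     \<le> c * 2 epowr (p / (p - q)) * D epowr (p / (p - q))" .
  qed
  then show "(\<Sum>n. W n epowr (e + 1) * cellsup (a * (e + 1)) \<kappa> n) \<le> ?C * D epowr (p / (p - q))"
   unfolding cellsup_def by (simp only: SUP_mult_left_ennreal mult.assoc)
  have "(\<Sum>n. SUP z\<in>grid_cell t n. W n * beta {..t n} epowr e * (u {t n<..z} epowr a * s {z<..} epowr \<kappa>))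
    \<le> 2 * (c * 2 epowr (p / (p - q)) * D epowr (p / (p - q)))"
  proof (rule suminf_SUP_choice[OF cell_nonempty])
   fix z assume z: "\<And>n. z n \<in> grid_cell t n"
   let ?P = "point_masses (zmass z) z"
   have "(\<Sum>n. W n * beta {..t n} epowr e * (u {t n<..z n} epowr a * s {z n<..} epowr \<kappa>))
     \<le> (\<Sum>n. zmass z n * (beta {..z n} epowr e * s {z n<..} epowr \<kappa>))"
   proof (intro suminf_le summableI)
    fix n
    have "t n \<le> z n" using z[of n] grid_cell_subset[of t n] by auto
    then have "beta {..t n} epowr e \<le> beta {..z n} epowr e"
     using e sets_beta by (intro epowr_mono emeasure_mono) auto
    then have "zmass z n * (beta {..t n} epowr e * s {z n<..} epowr \<kappa>)
      \<le> zmass z n * (beta {..z n} epowr e * s {z n<..} epowr \<kappa>)"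
     by (intro mult_left_mono mult_right_mono) auto
    then show "W n * beta {..t n} epowr e * (u {t n<..z n} epowr a * s {z n<..} epowr \<kappa>)
      \<le> zmass z n * (beta {..z n} epowr e * s {z n<..} epowr \<kappa>)"
     by (simp only: zmass_def mult_ac)
   qed
   also have "\<dots> \<le> c * 2 epowr (p / (p - q)) * D epowr (p / (p - q))"
   proof (rule red[OF z])
    show "(\<lambda>x. beta {..x} epowr e * s {x<..} epowr \<kappa>) \<in> borelfun"
     using measurable_head[OF sets_beta] measurable_tail[OF s] by measurable
    show "(\<integral>\<^sup>+x\<in>{0<..}. beta {..x} epowr e * s {x<..} epowr \<kappa> \<partial>?P) \<le> c * (2 * D) epowr (p / (p - q))"
     by (rule LD[OF ds sf sets_beta _ beta_UNIV bd zd[OF z]]) simp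
   qed
   finally show "(\<Sum>n. W n * beta {..t n} epowr e * (u {t n<..z n} epowr a * s {z n<..} epowr \<kappa>))
     \<le> c * 2 epowr (p / (p - q)) * D epowr (p / (p - q))" .
  qed
  then show "(\<Sum>n. W n * (beta {..t n} epowr e * cellsup a \<kappa> n)) \<le> ?C * D epowr (p / (p - q))"
   unfolding cellsup_def by (simp only: SUP_mult_left_ennreal mult.assoc)
 qed
 qed
qed

section \<open>Lower bounds by A1 and A4_star from single test functions\<close>

lemma lower_A1:
 assumes a: "0 < a" and m: "0 < m" and p: "1 < p" and S: "copson_setting u w s a" and C: "Cineq a m p u w s D" and x: "0 < x"
 shows "Phi a u w x * s {x<..} epowr (a * m * (p - 1) / p) \<le> D"
proof -
 interpret copson_setting u w s a by (rule S)
 have am: "0 < a * m" using a m by simp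
 let ?V = "s {x<..}"
 \<comment> \<open>In terms of h this is v^(1 - p') on (x,\<infinity>). Its Copson integral is
   constant left of x and its norm is a power of the same tail, which is finite and can be divided
   out.\<close>
 let ?g = "indicator {x<..} :: real => ennreal"
 have g: "?g \<in> borelfun" by simp
 have xs: "{x<..} \<in> sets s" unfolding s by simp
 have cop: "copson s ?g z = ?V" if "z \<le> x" for z
 proof -
  have "copson s ?g z = (\<integral>\<^sup>+y. indicator {x<..} y \<partial>s)"
   unfolding copson_def using that by (intro nn_integral_cong) (auto split: split_indicator)
  then show ?thesis using xs by simp
 qed
 have N: "(powint p s ?g) = ?V"
 proof -
  have "(powint p s ?g) = (\<integral>\<^sup>+y. indicator {x<..} y \<partial>s)"
   using p by (intro nn_integral_cong) (auto split: split_indicator)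
  then show ?thesis using xs by simp
 qed
 have K: "u {y<..x} * ?V epowr m \<le> iterK m u s ?g y" for y
 proof -
  have ys: "{y<..x} \<in> sets u" unfolding u by simp
  have "u {y<..x} * ?V epowr m = (\<integral>\<^sup>+z. ?V epowr m * indicator {y<..x} z \<partial>u)"
   unfolding nn_integral_cmult_indicator[OF ys] by (rule mult.commute)
  also have "\<dots> \<le> iterK m u s ?g y"
   unfolding iterK_def using cop by (intro nn_integral_mono) (auto split: split_indicator)
  finally show ?thesis .
 qed
 have mP: "(\<lambda>y. u {y<..x} epowr a * indicator {..x} y) \<in> borel_measurable w"
  by (rule measurable_borel_like[OF w]) (use measurable_Ioc'[OF u, of x] in measurable)
 have "Phi a u w x * ?V epowr (a * m) = (\<integral>\<^sup>+y. ?V epowr (a * m) * (u {y<..x} epowr a * indicator {..x} y) \<partial>w)"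
  unfolding Phi_def nn_integral_cmult[OF mP] by (rule mult.commute)
 also have "\<dots> \<le> (\<integral>\<^sup>+y. iterK m u s ?g y epowr a \<partial>w)"
 proof (intro nn_integral_mono)
  fix y
  have "(u {y<..x} * ?V epowr m) epowr a \<le> iterK m u s ?g y epowr a"
   using a by (intro epowr_mono K) auto
  then show "?V epowr (a * m) * (u {y<..x} epowr a * indicator {..x} y) \<le> iterK m u s ?g y epowr a"
   using a by (auto simp: epowr_mult epowr_epowr mult_ac split: split_indicator)
 qed
 also have "\<dots> \<le> D * ?V epowr (a * m / p)"
  using C g N unfolding Cineq_def by metis
 finally have le: "Phi a u w x * ?V epowr (a * m) \<le> D * ?V epowr (a * m / p)" .
 show ?thesis
 proof (cases "?V = 0")
  case True
  have "0 < a * m * (p - 1) / p" using am p by simp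
  then show ?thesis using True by simp
 next
  case False
  let ?X = "?V epowr (a * m / p)"
  have X: "?X \<noteq> 0" "?X \<noteq> top"
   using False am p epowr_less_top[OF _ sfin[OF x], of "a * m / p"] by (auto simp: epowr_eq_0_iff)
  have "a * m = a * m * (p - 1) / p + a * m / p" using p by (simp add: field_simps)
  then have "?V epowr (a * m) = ?V epowr (a * m * (p - 1) / p + a * m / p)" by simp
  also have "\<dots> = ?V epowr (a * m * (p - 1) / p) * ?X" using am p by (intro epowr_add) auto
  finally have "?X * (Phi a u w x * ?V epowr (a * m * (p - 1) / p)) \<le> ?X * D"
   using le by (simp only: mult_ac)
  then show ?thesis using X by (metis ennreal_mult_le_mult_iff)
 qed
qed

text \<open>Monotone convergence in M; it removes the truncation required by
  \<open>Mazya_test_function\<close>.\<close>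

lemma Xu_SUP:
 assumes u: "sets u = sets borel" and s: "sets s = sets borel" and m: "0 < m" "m < p" and p: "1 < p"
  and le: "\<And>M. Xu m p u (restr s {x<..M}) x \<le> R"
 shows "Xu m p u s x \<le> R"
proof -
 let ?U = "\<lambda>y. u {x<..y} epowr (m / (p - m))" and ?k = "m * (p - 1) / (p - m)"
 have k: "0 < ?k" using m p by simp
 have eq: "(restr s {x<..M}) {y<..} = s {y<..M}" if "x < y" for y M
 proof -
  have "{x<..M} \<inter> {y<..} = {y<..M}" using that by auto
  then show ?thesis by (subst emeasure_restr[OF s]) auto
 qed
 have "Xu m p u s x = (\<integral>\<^sup>+y. (SUP n::nat. ?U y * s {y<..real n} epowr ?k * indicator {x<..} y) \<partial>u)"
  unfolding Xu_def
 proof (intro nn_integral_cong)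
  fix y
  have ran: "range (\<lambda>n::nat. {y<..real n}) \<subseteq> sets s" unfolding s by auto
  have inc: "incseq (\<lambda>n::nat. {y<..real n})" by (auto simp: incseq_def)
  have "(\<Union>n::nat. {y<..real n}) = {y<..}"
  proof (intro set_eqI iffI)
   fix z assume "z \<in> {y<..}"
   moreover obtain n :: nat where "z \<le> real n" using real_arch_simple by blast
   ultimately show "z \<in> (\<Union>n::nat. {y<..real n})" by (auto intro!: exI[of _ n])
  qed auto
  then have "s {y<..} = (SUP n::nat. s {y<..real n})"
   using SUP_emeasure_incseq[OF ran inc] by simp
  then have "s {y<..} epowr ?k = (SUP n::nat. s {y<..real n} epowr ?k)"
   using k by (simp add: epowr_SUP)
  then show "?U y * s {y<..} epowr ?k * indicator {x<..} y = (SUP n::nat. ?U y * s {y<..real n} epowr ?k * indicator {x<..} y)"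
   by (simp only: SUP_mult_left_ennreal[symmetric] SUP_mult_right_ennreal[symmetric])
 qed
 also have "\<dots> = (SUP n::nat. \<integral>\<^sup>+y\<in>{x<..}. (?U y * s {y<..real n} epowr ?k) \<partial>u)"
 proof (rule nn_integral_monotone_convergence_SUP)
  show "incseq (\<lambda>(n::nat) y. ?U y * s {y<..real n} epowr ?k * indicator {x<..} y)"
   using k s by (intro incseq_SucI le_funI mult_right_mono mult_left_mono epowr_mono emeasure_mono) auto
  show "(\<lambda>y. ?U y * s {y<..real n} epowr ?k * indicator {x<..} y) \<in> borel_measurable u" for n :: nat
   by (rule measurable_borel_like[OF u])
     (use measurable_Ioc[OF u, of x] measurable_Ioc'[OF s, of "real n"] in measurable)
 qed
 also have "\<dots> \<le> R"
 proof (rule SUP_least)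
  fix n :: nat
  have "(\<integral>\<^sup>+y\<in>{x<..}. (?U y * s {y<..real n} epowr ?k) \<partial>u) = Xu m p u (restr s {x<..real n}) x"
   unfolding Xu_def by (intro nn_integral_cong) (auto simp: eq split: split_indicator)
  then show "(\<integral>\<^sup>+y\<in>{x<..}. (?U y * s {y<..real n} epowr ?k) \<partial>u) \<le> R" using le by simp
 qed
 finally show ?thesis .
qed

text \<open>Left of x the inner integral is at least its value at x, which brings in the factor w
  {..x}; at x the Maz'ya test function for s cut to (x,M] is used.\<close>

lemma lower_A4:
 assumes a: "0 < a" and m: "0 < m" "m < p" and p: "1 < p"
 shows "\<exists>c<top. \<forall>u w s D x. copson_setting u w s a --> Cineq a m p u w s D --> 0 < x -->
  w {..x} * Xu m p u s x epowr (a * (p - m) / p) \<le> c * D"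
proof -
 show ?thesis
 proof (rule ex_finiteE[OF Mazya_test_function[OF m p]], goal_cases)
 case (1 c)
 note c = 1(1) and MT = 1(2)[rule_format (no_asm)]
 have th: "0 < a * (p - m) / p" using a m p by simp
 show ?thesis
 proof (intro exI[of _ "c epowr a"] conjI allI impI)
  show "c epowr a < top" using a by (intro epowr_less_top c) auto
  fix u w s D and x :: real assume S: "copson_setting u w s a" and C: "Cineq a m p u w s D" and x: "0 < x"
  interpret copson_setting u w s a by (rule S)
  have main: "w {..x} * Xu m p u (restr s {x<..M}) x epowr (a * (p - m) / p) \<le> c epowr a * D" for M
  proof -
   let ?s = "restr s {x<..M}"
   have ds': "diffuse ?s" by (rule diffuse_restr[OF ds]) simp
   have es: "emeasure ?s B = s ({x<..M} \<inter> B)" if "B \<in> sets borel" for B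
    using that by (intro emeasure_restr[OF s]) auto
   have f1: "emeasure ?s {x<..} < top"
    unfolding es[OF borel_open[OF open_greaterThan]] using s by (intro le_less_trans[OF emeasure_mono sfin[OF x]]) auto
   have "{x<..M} \<inter> {M<..} = {}" by auto
   then have f2: "emeasure ?s {M<..} = 0" by (simp add: es)
   obtain g where g: "g \<in> borelfun" and N: "(\<integral>\<^sup>+y\<in>{x<..}. g y epowr p \<partial>?s) \<le> 1"
    and X: "Xu m p u ?s x epowr ((p - m) / p) \<le> c * (\<integral>\<^sup>+y\<in>{x<..}. copson ?s g y epowr m \<partial>u)"
    using MT[OF du ds' _ f1 f2] ufin[OF x] by blast
   let ?g = "\<lambda>y. g y * indicator {x<..M} y"
   have g': "?g \<in> borelfun" using g by measurable
   have p0: "0 < p" using p by simp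
   have mg: "(\<lambda>y. g y epowr p * indicator {x<..} y) \<in> borelfun" using g by measurable
   have N': "(powint p s ?g) \<le> 1"
   proof -
    have "(powint p s ?g) = (\<integral>\<^sup>+y\<in>{x<..M}. (g y epowr p * indicator {x<..} y) \<partial>s)"
     using p0 by (intro nn_integral_cong) (auto split: split_indicator)
    also have "\<dots> = (\<integral>\<^sup>+y\<in>{x<..}. g y epowr p \<partial>?s)"
     by (rule nn_integral_restr[OF s _ mg, symmetric]) simp
    finally show ?thesis using N by simp
   qed
   have cop: "copson ?s g y = copson s ?g y" for y by (rule copson_restr[OF s _ g]) simp
   have xs: "{..x} \<in> sets w" unfolding w by simp
   have "w {..x} * Xu m p u ?s x epowr (a * (p - m) / p) = w {..x} * (Xu m p u ?s x epowr ((p - m) / p)) epowr a"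
    by (simp add: epowr_epowr mult.commute)
   also have "\<dots> \<le> w {..x} * (c * iterK m u s ?g x) epowr a"
    using X a unfolding cop iterK_def by (intro mult_left_mono epowr_mono) auto
   also have "\<dots> = c epowr a * (\<integral>\<^sup>+y. iterK m u s ?g x epowr a * indicator {..x} y \<partial>w)"
    unfolding nn_integral_cmult_indicator[OF xs] epowr_mult[OF less_imp_le[OF a]] by (simp only: mult_ac)
   also have "\<dots> \<le> c epowr a * (\<integral>\<^sup>+y. iterK m u s ?g y epowr a \<partial>w)"
   proof (rule mult_left_mono[OF nn_integral_mono])
    fix y
    show "iterK m u s ?g x epowr a * indicator {..x} y \<le> iterK m u s ?g y epowr a"
     using a by (auto split: split_indicator intro!: epowr_mono iterK_antimono)
   qed simp
   also have "\<dots> \<le> c epowr a * (D * 1 epowr (a * m / p))"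
   proof (rule mult_left_mono)
    have "(\<integral>\<^sup>+y. iterK m u s ?g y epowr a \<partial>w) \<le> D * (powint p s ?g) epowr (a * m / p)"
     using C g' unfolding Cineq_def by blast
    also have "\<dots> \<le> D * 1 epowr (a * m / p)"
     using a m p0 by (intro mult_left_mono epowr_mono N') auto
    finally show "(\<integral>\<^sup>+y. iterK m u s ?g y epowr a \<partial>w) \<le> D * 1 epowr (a * m / p)" .
   qed simp
   finally show ?thesis by simp
  qed
  show "w {..x} * Xu m p u s x epowr (a * (p - m) / p) \<le> c epowr a * D"
  \<comment> \<open>With infinite mass to the left, u vanishes to the right and the local norm is 0.
    Otherwise w {..x} is divided out, so that the limit in M can be taken on the local norm
    alone.\<close>
  proof (cases "w {..x} = top")
   case True
   then have "u {x<..} = 0" by (rule head_infinite[OF x])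
   then have "{x<..} \<in> null_sets u" using u by auto
   then have "AE y in u. y \<notin> {x<..}" by (rule AE_not_in)
   then have "AE y in u. u {x<..y} epowr (m / (p - m)) * s {y<..} epowr (m * (p - 1) / (p - m)) * indicator {x<..} y = 0"
    by eventually_elim auto
   then have "Xu m p u s x = (\<integral>\<^sup>+y. 0 \<partial>u)" unfolding Xu_def by (rule nn_integral_cong_AE)
   then show ?thesis using th by simp
  next
   case False
   let ?W = "w {..x}"
   have W: "?W \<noteq> 0" using wpos[OF x] by auto
   have Wi: "?W * (1 / ?W) = 1" using W False by (simp add: ennreal_times_divide ennreal_divide_self less_top)
   have "Xu m p u (restr s {x<..M}) x \<le> (c epowr a * D * (1 / ?W)) epowr (1 / (a * (p - m) / p))" for M
   proof -
    have "(1 / ?W) * (?W * Xu m p u (restr s {x<..M}) x epowr (a * (p - m) / p)) \<le> (1 / ?W) * (c epowr a * D)"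
     by (intro mult_left_mono main) simp
    also have "(1 / ?W) * (c epowr a * D) = c epowr a * D * (1 / ?W)" by (rule mult.commute)
    also have "(1 / ?W) * (?W * Xu m p u (restr s {x<..M}) x epowr (a * (p - m) / p)) =
      ?W * (1 / ?W) * Xu m p u (restr s {x<..M}) x epowr (a * (p - m) / p)" by (simp only: mult_ac)
    finally have "Xu m p u (restr s {x<..M}) x epowr (a * (p - m) / p) \<le> c epowr a * D * (1 / ?W)"
     unfolding Wi by simp
    then show ?thesis using epowr_le_swap[OF th] by blast
   qed
   then have "Xu m p u s x \<le> (c epowr a * D * (1 / ?W)) epowr (1 / (a * (p - m) / p))"
    by (rule Xu_SUP[OF u s m p])
   then have "Xu m p u s x epowr (a * (p - m) / p) \<le> c epowr a * D * (1 / ?W)"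
    using epowr_le_swap[OF th] by blast
   then have "?W * Xu m p u s x epowr (a * (p - m) / p) \<le> ?W * (c epowr a * D * (1 / ?W))"
    by (rule mult_left_mono) simp
   also have "\<dots> = ?W * (1 / ?W) * (c epowr a * D)" by (simp only: mult_ac)
   finally show ?thesis unfolding Wi by simp
  qed
 qed
 qed
qed

section \<open>Lower bounds by A2 and A3 on a grid\<close>

lemma lower_grid_A2A3:
 assumes a: "0 < a" and m: "0 < m" and p: "1 < p" "a * m < p"
 shows "\<exists>c<top. \<forall>u w s t D. copson_grid u w s a t --> Cineq a m p u w s D -->
  (\<integral>\<^sup>+x\<in>{..t 0}. (w {..x} epowr (a * m / (p - a * m)) *
    Usup (a * (a * m / (p - a * m) + 1)) (a * m * (p - 1) / (p - a * m)) u s x) \<partial>w) \<le> c * D epowr (p / (p - a * m)) \<and>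
  (\<integral>\<^sup>+x\<in>{..t 0}. (Phi a u w x epowr (a * m / (p - a * m)) *
    Usup a (a * m * (p - 1) / (p - a * m)) u s x) \<partial>w) \<le> c * D epowr (p / (p - a * m))"
proof -
 define q where "q = a * m"
 have q: "0 < q" "q < p" using a m p by (auto simp: q_def)
 define e where "e = q / (p - q)"
 define \<kappa> where "\<kappa> = q * (p - 1) / (p - q)"
 have e: "0 \<le> e" "0 \<le> \<kappa>" using q p by (auto simp: e_def \<kappa>_def)
 have ae: "0 < a * (e + 1)" "0 \<le> a * (e + 1)" using a e by (auto intro!: mult_pos_pos)
 show ?thesis
 proof (rule ex_finiteE[OF cellsup_sums[OF a m p, folded q_def, folded e_def, folded \<kappa>_def]], goal_cases)
 case (1 c1)
 note c1 = 1(1) and cs = 1(2)[rule_format (no_asm)]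
 show ?thesis
 proof (rule ex_finiteE[OF Usup_le_cells[OF ae(1) e(2)]], goal_cases)
 case (1 c2)
 note c2 = 1(1) and us2 = 1(2)[rule_format (no_asm)]
 show ?thesis
 proof (rule ex_finiteE[OF Usup_le_cells[OF a e(2)]], goal_cases)
 case (1 c3)
 note c3 = 1(1) and us3 = 1(2)[rule_format (no_asm)]
 show ?thesis
 proof (rule ex_finiteE[OF Phi_le_beta[OF a]], goal_cases)
 case (1 c4)
 note c4 = 1(1) and ph = 1(2)[rule_format (no_asm)]
 \<comment> \<open>The middle factor is the constant of the geometric convolution with decay 1/2 and
   growth 3/2, so of ratio 3/4.\<close>
 define K2 where "K2 = c2 * (ennreal (1 / (1 - 1/2 * (3/2))) * c1)"
 define K3 where "K3 = c3 * (ennreal (1 / (1 - 1/2 * (3/2))) * c1)"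
 define H where "H = 2 epowr e * ((2 epowr a * c4) epowr e * K3 + (2 epowr a * 2) epowr e * K2)"
 have K2: "K2 < top" unfolding K2_def by (intro mult_less_top_ennreal c1 c2) simp
 have K3: "K3 < top" unfolding K3_def by (intro mult_less_top_ennreal c1 c3) simp
 have H: "H < top" unfolding H_def using a e
  by (intro mult_less_top_ennreal add_less_top_ennreal epowr_less_top c4 K2 K3) auto
 show ?thesis
  unfolding q_def[symmetric] e_def[symmetric] \<kappa>_def[symmetric]
 proof (intro exI[of _ "2 epowr e * K2 + H"] conjI allI impI)
  show "2 epowr e * K2 + H < top" by (intro add_less_top_ennreal mult_less_top_ennreal K2 H) auto
  fix u w s t D assume G: "copson_grid u w s a t" and C: "Cineq a m p u w s D"
  interpret copson_grid u w s a t by (rule G)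
  let ?D = "D epowr (p / (p - q))"
  have half: "W (Suc n) \<le> ennreal (1/2) * W n" for n using W_Suc_half[of n] by simp
  have half': "W (Suc n) epowr (e + 1) \<le> ennreal (1/2) * W n epowr (e + 1)" for n
  proof -
   have "W (Suc n) \<le> W n" using w t_dec[of n] by (intro emeasure_mono) auto
   then have "W (Suc n) epowr e \<le> W n epowr e" using e by (intro epowr_mono) auto
   then have "W (Suc n) epowr e * W (Suc n) \<le> W n epowr e * (ennreal (1/2) * W n)"
    by (intro mult_mono half) auto
   then show ?thesis using e by (simp add: epowr_add mult_ac)
  qed
  have S2: "(\<Sum>n. W n epowr (e + 1) * Usup (a * (e + 1)) \<kappa> u s (t n)) \<le> K2 * ?D"
  proof -
   have "(\<Sum>n. W n epowr (e + 1) * Usup (a * (e + 1)) \<kappa> u s (t n))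
    \<le> (\<Sum>n. c2 * (W n epowr (e + 1) * (\<Sum>j\<le>n. ennreal ((3/2) ^ (n - j)) * cellsup (a * (e + 1)) \<kappa> j)))"
   proof (intro suminf_le summableI)
    fix n
    have "W n epowr (e + 1) * Usup (a * (e + 1)) \<kappa> u s (t n) \<le> W n epowr (e + 1) * (c2 * (\<Sum>j\<le>n. ennreal ((3/2) ^ (n - j)) * cellsup (a * (e + 1)) \<kappa> j))"
     by (intro mult_left_mono us2[OF G]) simp
    then show "W n epowr (e + 1) * Usup (a * (e + 1)) \<kappa> u s (t n) \<le> c2 * (W n epowr (e + 1) * (\<Sum>j\<le>n. ennreal ((3/2) ^ (n - j)) * cellsup (a * (e + 1)) \<kappa> j))"
     by (simp only: mult.left_commute)
   qed
   also have "\<dots> = c2 * (\<Sum>n. W n epowr (e + 1) * (\<Sum>j\<le>n. ennreal ((3/2) ^ (n - j)) * cellsup (a * (e + 1)) \<kappa> j))"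
    by (rule ennreal_suminf_cmult)
   also have "\<dots> \<le> c2 * (ennreal (1 / (1 - 1/2 * (3/2))) * (\<Sum>n. W n epowr (e + 1) * cellsup (a * (e + 1)) \<kappa> n))"
    by (intro mult_left_mono suminf_geometric_convolution half') auto
   also have "\<dots> \<le> c2 * (ennreal (1 / (1 - 1/2 * (3/2))) * (c1 * ?D))"
    by (intro mult_left_mono cs[OF G C, THEN conjunct1]) auto
   finally show ?thesis by (simp only: K2_def mult.assoc)
  qed
  have S3: "(\<Sum>n. W n * (beta {..t n} epowr e * Usup a \<kappa> u s (t n))) \<le> K3 * ?D"
  proof -
   have "(\<Sum>n. W n * (beta {..t n} epowr e * Usup a \<kappa> u s (t n)))
    \<le> (\<Sum>n. c3 * (W n * (\<Sum>j\<le>n. ennreal ((3/2) ^ (n - j)) * (beta {..t j} epowr e * cellsup a \<kappa> j))))"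
   proof (intro suminf_le summableI)
    fix n
    have "beta {..t n} epowr e * Usup a \<kappa> u s (t n) \<le>
      beta {..t n} epowr e * (c3 * (\<Sum>j\<le>n. ennreal ((3/2) ^ (n - j)) * cellsup a \<kappa> j))"
     by (intro mult_left_mono us3[OF G]) simp
    also have "\<dots> = c3 * (\<Sum>j\<le>n. ennreal ((3/2) ^ (n - j)) * (beta {..t n} epowr e * cellsup a \<kappa> j))"
     by (simp only: sum_distrib_left mult_ac)
    also have "\<dots> \<le> c3 * (\<Sum>j\<le>n. ennreal ((3/2) ^ (n - j)) * (beta {..t j} epowr e * cellsup a \<kappa> j))"
     using e t_antimono sets_beta by (intro mult_left_mono sum_mono mult_right_mono epowr_mono emeasure_mono) auto
    finally have "W n * (beta {..t n} epowr e * Usup a \<kappa> u s (t n)) \<le>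
      W n * (c3 * (\<Sum>j\<le>n. ennreal ((3/2) ^ (n - j)) * (beta {..t j} epowr e * cellsup a \<kappa> j)))"
     by (rule mult_left_mono) simp
    then show "W n * (beta {..t n} epowr e * Usup a \<kappa> u s (t n)) \<le>
      c3 * (W n * (\<Sum>j\<le>n. ennreal ((3/2) ^ (n - j)) * (beta {..t j} epowr e * cellsup a \<kappa> j)))"
     by (simp only: mult.left_commute)
   qed
   also have "\<dots> = c3 * (\<Sum>n. W n * (\<Sum>j\<le>n. ennreal ((3/2) ^ (n - j)) * (beta {..t j} epowr e * cellsup a \<kappa> j)))"
    by (rule ennreal_suminf_cmult)
   also have "\<dots> \<le> c3 * (ennreal (1 / (1 - 1/2 * (3/2))) * (\<Sum>n. W n * (beta {..t n} epowr e * cellsup a \<kappa> n)))"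
    by (intro mult_left_mono suminf_geometric_convolution half) auto
   also have "\<dots> \<le> c3 * (ennreal (1 / (1 - 1/2 * (3/2))) * (c1 * ?D))"
    by (intro mult_left_mono cs[OF G C, THEN conjunct2]) auto
   finally show ?thesis by (simp only: K3_def mult.assoc)
  qed
  have S2': "(\<Sum>n. W (Suc n) * (W (Suc n) epowr e * Usup (a * (e + 1)) \<kappa> u s (t (Suc n)))) \<le> K2 * ?D"
  proof -
   have "(\<Sum>n. W (Suc n) * (W (Suc n) epowr e * Usup (a * (e + 1)) \<kappa> u s (t (Suc n)))) =
     (\<Sum>n. W (Suc n) epowr (e + 1) * Usup (a * (e + 1)) \<kappa> u s (t (Suc n)))"
    using e by (intro suminf_cong) (simp add: epowr_add mult_ac)
   also have "\<dots> \<le> (\<Sum>n. W n epowr (e + 1) * Usup (a * (e + 1)) \<kappa> u s (t n))"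
    unfolding suminf_Suc_ennreal[of "\<lambda>n. W n epowr (e + 1) * Usup (a * (e + 1)) \<kappa> u s (t n)"] by simp
   finally show ?thesis using S2 by (rule order.trans)
  qed
  have S3': "(\<Sum>n. W (Suc n) * (beta {..t (Suc n)} epowr e * Usup a \<kappa> u s (t (Suc n)))) \<le> K3 * ?D"
  proof (rule order.trans[OF _ S3])
   show "(\<Sum>n. W (Suc n) * (beta {..t (Suc n)} epowr e * Usup a \<kappa> u s (t (Suc n))))
    \<le> (\<Sum>n. W n * (beta {..t n} epowr e * Usup a \<kappa> u s (t n)))"
    unfolding suminf_Suc_ennreal[of "\<lambda>n. W n * (beta {..t n} epowr e * Usup a \<kappa> u s (t n))"] by simp
  qed
  have Wx: "w {..x} \<le> 2 * W (Suc n)" if "x \<in> grid_cell t (Suc n)" for x n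
   unfolding Whalf[of n, symmetric] using that w by (intro emeasure_mono) auto
  have "(\<integral>\<^sup>+x\<in>{..t 0}. (w {..x} epowr e * Usup (a * (e + 1)) \<kappa> u s x) \<partial>w)
    \<le> (\<Sum>n. W (Suc n) * (2 epowr e * (W (Suc n) epowr e * Usup (a * (e + 1)) \<kappa> u s (t (Suc n)))))"
  proof (rule upper_sum)
   fix n x assume x: "x \<in> grid_cell t (Suc n)"
   have "w {..x} epowr e \<le> (2 * W (Suc n)) epowr e" using e by (intro epowr_mono Wx x) auto
   also have "\<dots> = 2 epowr e * W (Suc n) epowr e" using e by (intro epowr_mult) auto
   finally have 1: "w {..x} epowr e \<le> 2 epowr e * W (Suc n) epowr e" .
   have 2: "Usup (a * (e + 1)) \<kappa> u s x \<le> Usup (a * (e + 1)) \<kappa> u s (t (Suc n))"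
    using x by (intro Usup_antimono[OF u ae(2)]) auto
   have "w {..x} epowr e * Usup (a * (e + 1)) \<kappa> u s x \<le>
     2 epowr e * W (Suc n) epowr e * Usup (a * (e + 1)) \<kappa> u s (t (Suc n))"
    by (intro mult_mono 1 2) auto
   then show "w {..x} epowr e * Usup (a * (e + 1)) \<kappa> u s x \<le>
     2 epowr e * (W (Suc n) epowr e * Usup (a * (e + 1)) \<kappa> u s (t (Suc n)))" by (simp only: mult.assoc)
  qed
  also have "\<dots> = (\<Sum>n. 2 epowr e * (W (Suc n) * (W (Suc n) epowr e * Usup (a * (e + 1)) \<kappa> u s (t (Suc n)))))"
   by (simp only: mult.left_commute)
  also have "\<dots> = 2 epowr e * (\<Sum>n. W (Suc n) * (W (Suc n) epowr e * Usup (a * (e + 1)) \<kappa> u s (t (Suc n))))"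
   by (rule ennreal_suminf_cmult)
  also have "\<dots> \<le> 2 epowr e * (K2 * ?D)" by (intro mult_left_mono S2') simp
  also have "\<dots> \<le> (2 epowr e * K2 + H) * ?D" by (simp add: distrib_right mult.assoc)
  finally show "(\<integral>\<^sup>+x\<in>{..t 0}. (w {..x} epowr e * Usup (a * (e + 1)) \<kappa> u s x) \<partial>w) \<le> (2 epowr e * K2 + H) * ?D" .
  let ?Y = "\<lambda>n. beta {..t (Suc n)} epowr e * Usup a \<kappa> u s (t (Suc n))"
  let ?Z = "\<lambda>n. W (Suc n) epowr e * Usup (a * (e + 1)) \<kappa> u s (t (Suc n))"
  have "(\<integral>\<^sup>+x\<in>{..t 0}. (Phi a u w x epowr e * Usup a \<kappa> u s x) \<partial>w)
    \<le> (\<Sum>n. W (Suc n) * (2 epowr e * ((2 epowr a * c4) epowr e * ?Y n + (2 epowr a * 2) epowr e * ?Z n)))"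
  proof (rule upper_sum)
   fix n x assume x: "x \<in> grid_cell t (Suc n)"
   then have tx: "t (Suc n) \<le> x" by auto
   let ?u = "u {t (Suc n)<..x}"
   have "Phi a u w x \<le> 2 epowr a * (Phi a u w (t (Suc n)) + w {..x} * ?u epowr a)"
    by (rule Phi_step[OF tx])
   also have "\<dots> \<le> 2 epowr a * (c4 * beta {..t (Suc n)} + 2 * W (Suc n) * ?u epowr a)"
    by (intro mult_left_mono add_mono mult_right_mono ph[OF G] Wx x) auto
   also have "\<dots> = 2 epowr a * c4 * beta {..t (Suc n)} + 2 epowr a * 2 * (W (Suc n) * ?u epowr a)"
    by (simp only: distrib_left mult.assoc)
   finally have "Phi a u w x epowr e \<le> (2 epowr a * c4 * beta {..t (Suc n)} + 2 epowr a * 2 * (W (Suc n) * ?u epowr a)) epowr e"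
    using e by (intro epowr_mono) auto
   also have "\<dots> \<le> 2 epowr e * ((2 epowr a * c4 * beta {..t (Suc n)}) epowr e + (2 epowr a * 2 * (W (Suc n) * ?u epowr a)) epowr e)"
    using e by (intro epowr_add_le) auto
   also have "(2 epowr a * c4 * beta {..t (Suc n)}) epowr e = (2 epowr a * c4) epowr e * beta {..t (Suc n)} epowr e"
    using e by (intro epowr_mult) auto
   also have "(2 epowr a * 2 * (W (Suc n) * ?u epowr a)) epowr e = (2 epowr a * 2) epowr e * (W (Suc n) epowr e * ?u epowr (a * e))"
   proof -
    have "(2 epowr a * 2 * (W (Suc n) * ?u epowr a)) epowr e = (2 epowr a * 2) epowr e * (W (Suc n) * ?u epowr a) epowr e"
     using e by (intro epowr_mult) auto
    also have "(W (Suc n) * ?u epowr a) epowr e = W (Suc n) epowr e * (?u epowr a) epowr e"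
     using e by (intro epowr_mult) auto
    finally show ?thesis by (simp only: epowr_epowr)
   qed
   finally have P: "Phi a u w x epowr e \<le> 2 epowr e * ((2 epowr a * c4) epowr e * beta {..t (Suc n)} epowr e +
     (2 epowr a * 2) epowr e * (W (Suc n) epowr e * ?u epowr (a * e)))" .
   have U1: "Usup a \<kappa> u s x \<le> Usup a \<kappa> u s (t (Suc n))" using a by (intro Usup_antimono[OF u _ tx]) auto
   \<comment> \<open>Inside the cell Phi exceeds the node value by w-mass times u(t (n + 1),x]^a.
     Its e-th power merges with the supremum at x into the supremum at the node with exponent a (e +
     1): this part of A3 is controlled by A2.\<close>
   have U2: "?u epowr (a * e) * Usup a \<kappa> u s x \<le> Usup (a * (e + 1)) \<kappa> u s (t (Suc n))"
    unfolding Usup_def[of a] SUP_mult_left_ennreal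
   proof (rule SUP_least)
    fix z assume z: "z \<in> {x<..}"
    let ?v = "u {t (Suc n)<..z}"
    have "?u epowr (a * e) * u {x<..z} epowr a \<le> ?v epowr (a * e) * ?v epowr a"
     using a e z tx u by (intro mult_mono epowr_mono emeasure_mono) auto
    also have "\<dots> = ?v epowr (a * (e + 1))"
     using a e epowr_add[of "a * e" a ?v] by (simp add: distrib_left)
    finally have "?u epowr (a * e) * u {x<..z} epowr a * s {z<..} epowr \<kappa> \<le> ?v epowr (a * (e + 1)) * s {z<..} epowr \<kappa>"
     by (rule mult_right_mono) simp
    also have "\<dots> \<le> Usup (a * (e + 1)) \<kappa> u s (t (Suc n))" using z tx by (intro Usup_upper) auto
    finally show "?u epowr (a * e) * (u {x<..z} epowr a * s {z<..} epowr \<kappa>) \<le> Usup (a * (e + 1)) \<kappa> u s (t (Suc n))"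
     by (simp only: mult.assoc)
   qed
   have "Phi a u w x epowr e * Usup a \<kappa> u s x \<le> 2 epowr e * ((2 epowr a * c4) epowr e * beta {..t (Suc n)} epowr e +
     (2 epowr a * 2) epowr e * (W (Suc n) epowr e * ?u epowr (a * e))) * Usup a \<kappa> u s x"
    by (rule mult_right_mono[OF P]) simp
   also have "\<dots> = 2 epowr e * ((2 epowr a * c4) epowr e * (beta {..t (Suc n)} epowr e * Usup a \<kappa> u s x) +
     (2 epowr a * 2) epowr e * (W (Suc n) epowr e * (?u epowr (a * e) * Usup a \<kappa> u s x)))"
    by (simp only: distrib_right mult.assoc)
   also have "\<dots> \<le> 2 epowr e * ((2 epowr a * c4) epowr e * ?Y n + (2 epowr a * 2) epowr e * ?Z n)"
    by (intro mult_left_mono add_mono U1 U2) auto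
   finally show "Phi a u w x epowr e * Usup a \<kappa> u s x \<le> 2 epowr e * ((2 epowr a * c4) epowr e * ?Y n + (2 epowr a * 2) epowr e * ?Z n)" .
  qed
  also have "\<dots> = (\<Sum>n. 2 epowr e * ((2 epowr a * c4) epowr e * (W (Suc n) * ?Y n) + (2 epowr a * 2) epowr e * (W (Suc n) * ?Z n)))"
   by (simp only: distrib_left mult.left_commute[of "W (Suc _)"])
  also have "\<dots> = 2 epowr e * ((2 epowr a * c4) epowr e * (\<Sum>n. W (Suc n) * ?Y n) + (2 epowr a * 2) epowr e * (\<Sum>n. W (Suc n) * ?Z n))"
   unfolding ennreal_suminf_cmult suminf_add_ennreal ..
  also have "\<dots> \<le> 2 epowr e * ((2 epowr a * c4) epowr e * (K3 * ?D) + (2 epowr a * 2) epowr e * (K2 * ?D))"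
   by (intro mult_left_mono add_mono S3' S2') auto
  also have "\<dots> = H * ?D" by (simp only: H_def distrib_left distrib_right mult.assoc)
  also have "\<dots> \<le> (2 epowr e * K2 + H) * ?D" by (intro mult_right_mono) auto
  finally show "(\<integral>\<^sup>+x\<in>{..t 0}. (Phi a u w x epowr e * Usup a \<kappa> u s x) \<partial>w) \<le> (2 epowr e * K2 + H) * ?D" .
 qed
 qed
 qed
 qed
 qed
qed

lemma Usup_zero:
 assumes "emeasure u {x<..} = 0" "0 < b" "sets u = sets borel"
 shows "Usup b k u s x = 0"
proof -
 have "emeasure u {x<..z} = 0" for z
 proof -
  have "{x<..z} \<subseteq> {x<..}" by auto
  then have "emeasure u {x<..z} \<le> emeasure u {x<..}" using assms(3) by (intro emeasure_mono) auto
  then show ?thesis using assms(1) by simp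
 qed
 then show ?thesis unfolding Usup_def using assms(2) by simp
qed

lemma Xu_zero:
 assumes "emeasure u {x<..} = 0" "sets u = sets borel"
 shows "Xu m p u s x = 0"
proof -
 have "{x<..} \<in> null_sets u" using assms by auto
 then have "AE y in u. y \<notin> {x<..}" by (rule AE_not_in)
 then have "AE y in u. emeasure u {x<..y} epowr (m / (p - m)) * emeasure s {y<..} epowr (m * (p - 1) / (p - m)) * indicator {x<..} y = 0"
  by eventually_elim auto
 then have "Xu m p u s x = (\<integral>\<^sup>+y. 0 \<partial>u)" unfolding Xu_def by (rule nn_integral_cong_AE)
 then show ?thesis by simp
qed

section \<open>Decomposition of the local norms over cells and the lower bound by A5_star\<close>

context copson_grid
begin

text \<open>The s-mass to the right of the n-th cell; nothing lies beyond cell 0.\<close>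

definition tail_end :: "nat => ennreal" where
 "tail_end n = (case n of 0 => 0 | Suc k => s {t k<..})"

abbreviation ucell :: "nat => real measure" where "ucell n \<equiv> restr u (grid_cell t n)"
abbreviation scell :: "nat => real measure" where "scell n \<equiv> restr s (grid_cell t n)"

lemma tail_end_split: "x \<in> grid_cell t n ==> s {x<..} = (scell n) {x<..} + tail_end n"
proof (cases n)
 case 0
 assume "x \<in> grid_cell t n"
 then have c: "grid_cell t n \<inter> {x<..} = {x<..}" using 0 by auto
 have "(scell n) {x<..} = s (grid_cell t n \<inter> {x<..})" by (rule restr_cell(2)) simp_all
 then show ?thesis unfolding c using 0 by (simp add: tail_end_def)
next
 case (Suc k)
 assume x: "x \<in> grid_cell t n"
 have c: "grid_cell t n \<inter> {x<..} = {x<..t k}" using x Suc by auto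
 have "(scell n) {x<..} = s {x<..t k}" unfolding c[symmetric] by (rule restr_cell(2)) simp_all
 moreover have "s {x<..t k} + s {t k<..} = s ({x<..t k} \<union> {t k<..})"
  using s by (intro plus_emeasure) auto
 moreover have "{x<..t k} \<union> {t k<..} = {x<..}" using x Suc by auto
 ultimately show ?thesis using Suc by (simp add: tail_end_def)
qed

lemma ucell_head: "x \<in> grid_cell t n ==> (ucell n) {t n<..x} = u {t n<..x}"
proof -
 assume "x \<in> grid_cell t n"
 then have "grid_cell t n \<inter> {t n<..x} = {t n<..x}" by (cases n) auto
 then show ?thesis by (simp add: restr_cell(2))
qed

text \<open>Inside a cell the full tail of s is the tail within the cell plus the mass T beyond it.
  The claim separates the two: a purely local integral and a boundary term in T.\<close>

lemma cell_Xs_le: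
 assumes m: "0 < m" "m < p" and p: "1 < p"
 shows "(\<integral>\<^sup>+x\<in>grid_cell t n. (u {t n<..x} epowr (p / (p - m)) * s {x<..} epowr (p * (m - 1) / (p - m))) \<partial>s)
  \<le> (1 + 2 epowr (p * (m - 1) / (p - m))) * (Xs m p (ucell n) (scell n) (t n)
   + u (grid_cell t n) epowr (p / (p - m)) * tail_end n epowr (m * (p - 1) / (p - m)))"
proof -
 define \<alpha> where "\<alpha> = p / (p - m)"
 define e where "e = p * (m - 1) / (p - m)"
 have \<alpha>: "0 \<le> \<alpha>" using m p by (simp add: \<alpha>_def)
 have e1: "m * (p - 1) / (p - m) = e + 1" using m by (simp add: e_def field_simps)
 let ?J = "grid_cell t n" and ?T = "tail_end n"
 let ?U = "\<lambda>x. u {t n<..x}" and ?sl = "\<lambda>x. (scell n) {x<..}"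
 have ss: "sets (scell n) = sets borel" by (rule restr_cell(1)) simp
 have [measurable]: "?U \<in> borelfun" "?sl \<in> borelfun"
  by (rule measurable_Ioc[OF u], rule measurable_tail[OF ss])
 have XsE: "Xs m p (ucell n) (scell n) (t n) = (\<integral>\<^sup>+x\<in>?J. (?U x epowr \<alpha> * ?sl x epowr e) \<partial>s)"
 proof -
  have us: "sets (ucell n) = sets borel" by (rule restr_cell(1)) simp
  have m1: "(\<lambda>x. (ucell n) {t n<..x} epowr \<alpha> * ?sl x epowr e * indicator {t n<..} x) \<in> borelfun"
   using measurable_Ioc[OF us, of "t n"] by measurable
  have "Xs m p (ucell n) (scell n) (t n) = (\<integral>\<^sup>+x\<in>?J. ((ucell n) {t n<..x} epowr \<alpha> * ?sl x epowr e * indicator {t n<..} x) \<partial>s)"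
   unfolding Xs_def \<alpha>_def[symmetric] e_def[symmetric] by (rule restr_cell(3)[OF _ m1]) simp
  also have "\<dots> = (\<integral>\<^sup>+x\<in>?J. (?U x epowr \<alpha> * ?sl x epowr e) \<partial>s)"
  proof (intro nn_integral_cong)
   fix x
   show "(ucell n) {t n<..x} epowr \<alpha> * ?sl x epowr e * indicator {t n<..} x * indicator ?J x = ?U x epowr \<alpha> * ?sl x epowr e * indicator ?J x"
    using grid_cell_subset[of t n] ucell_head[of x n] by (cases "x \<in> ?J") auto
  qed
  finally show ?thesis .
 qed
 have c1: "X \<le> (1 + 2 epowr e) * X" "2 epowr e * X \<le> (1 + 2 epowr e) * X" for X :: ennreal
  using mult_right_mono[of 1 "1 + 2 epowr e" X] mult_right_mono[of "2 epowr e" "1 + 2 epowr e" X] by auto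
 show ?thesis
  unfolding \<alpha>_def[symmetric] e_def[symmetric] e1
 \<comment> \<open>For a negative exponent the full tail, being larger, only helps. For e \<ge> 0
   the tail is at most twice the larger of its two parts, and the cell is divided
   accordingly.\<close>
 proof (cases "e < 0")
  case True
  have "(\<integral>\<^sup>+x\<in>?J. (?U x epowr \<alpha> * s {x<..} epowr e) \<partial>s) \<le> Xs m p (ucell n) (scell n) (t n)"
   unfolding XsE
  proof (intro nn_integral_mono)
   fix x
   have "s {x<..} epowr e \<le> ?sl x epowr e" if "x \<in> ?J"
    using True tail_end_split[OF that] by (intro epowr_antimono) auto
   then show "?U x epowr \<alpha> * s {x<..} epowr e * indicator ?J x \<le> ?U x epowr \<alpha> * ?sl x epowr e * indicator ?J x"
    by (cases "x \<in> ?J") (auto intro!: mult_left_mono)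
  qed
  also have "\<dots> \<le> Xs m p (ucell n) (scell n) (t n) + u ?J epowr \<alpha> * ?T epowr (e + 1)" by simp
  finally show "(\<integral>\<^sup>+x\<in>?J. (?U x epowr \<alpha> * s {x<..} epowr e) \<partial>s) \<le>
    (1 + 2 epowr e) * (Xs m p (ucell n) (scell n) (t n) + u ?J epowr \<alpha> * ?T epowr (e + 1))"
   using c1(1) by (rule order.trans)
 next
  case False
  let ?I = "\<lambda>x. indicator {x. ?sl x \<le> ?T} x :: ennreal"
  have lvl: "{x. ?sl x \<le> ?T} \<in> sets borel" by measurable
  have m1: "(\<lambda>x. ?U x epowr \<alpha> * ?sl x epowr e * indicator ?J x) \<in> borel_measurable s"
   by (rule measurable_borel_like[OF s]) measurable
  have m2: "(\<lambda>x. u ?J epowr \<alpha> * ?T epowr e * indicator (?J \<inter> {x. ?sl x \<le> ?T}) x) \<in> borel_measurable s"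
   by (rule measurable_borel_like[OF s]) measurable
  have m3: "(\<lambda>x. ?U x epowr \<alpha> * ?sl x epowr e * indicator ?J x + u ?J epowr \<alpha> * ?T epowr e * indicator (?J \<inter> {x. ?sl x \<le> ?T}) x) \<in> borel_measurable s"
   by (rule borel_measurable_add[OF m1 m2])
  have Js: "?J \<inter> {x. ?sl x \<le> ?T} \<in> sets s" unfolding s by (rule sets.Int[OF grid_cell_borel lvl])
  have "(\<integral>\<^sup>+x\<in>?J. (?U x epowr \<alpha> * s {x<..} epowr e) \<partial>s) \<le>
    (\<integral>\<^sup>+x. 2 epowr e * (?U x epowr \<alpha> * ?sl x epowr e * indicator ?J x + u ?J epowr \<alpha> * ?T epowr e * indicator (?J \<inter> {x. ?sl x \<le> ?T}) x) \<partial>s)"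
  proof (intro nn_integral_mono)
   fix x
   show "?U x epowr \<alpha> * s {x<..} epowr e * indicator ?J x \<le>
     2 epowr e * (?U x epowr \<alpha> * ?sl x epowr e * indicator ?J x + u ?J epowr \<alpha> * ?T epowr e * indicator (?J \<inter> {x. ?sl x \<le> ?T}) x)"
   proof (cases "x \<in> ?J")
    case x: True
    have "{t n<..x} \<subseteq> ?J" using x by (cases n) auto
    then have UJ: "?U x epowr \<alpha> \<le> u ?J epowr \<alpha>" using u \<alpha> by (intro epowr_mono emeasure_mono) auto
    show ?thesis
    proof (cases "?sl x \<le> ?T")
     case le: True
     have "s {x<..} \<le> 2 * ?T" unfolding tail_end_split[OF x] mult_2 by (rule add_right_mono[OF le])
     then have "s {x<..} epowr e \<le> (2 * ?T) epowr e" using False by (intro epowr_mono) auto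
     also have "\<dots> = 2 epowr e * ?T epowr e" using False by (intro epowr_mult) auto
     finally have "?U x epowr \<alpha> * s {x<..} epowr e \<le> u ?J epowr \<alpha> * (2 epowr e * ?T epowr e)"
      by (intro mult_mono UJ) auto
     also have "\<dots> = 2 epowr e * (u ?J epowr \<alpha> * ?T epowr e)" by (simp only: mult_ac)
     also have "\<dots> \<le> 2 epowr e * (?U x epowr \<alpha> * ?sl x epowr e + u ?J epowr \<alpha> * ?T epowr e)"
      by (intro mult_left_mono) auto
     finally show ?thesis using x le by simp
    next
     case gt: False
     have "s {x<..} \<le> 2 * ?sl x" unfolding tail_end_split[OF x] mult_2 using gt by (intro add_left_mono) auto
     then have "s {x<..} epowr e \<le> (2 * ?sl x) epowr e" using False by (intro epowr_mono) auto
     also have "\<dots> = 2 epowr e * ?sl x epowr e" using False by (intro epowr_mult) auto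
     finally have "?U x epowr \<alpha> * s {x<..} epowr e \<le> ?U x epowr \<alpha> * (2 epowr e * ?sl x epowr e)"
      by (rule mult_left_mono) simp
     also have "\<dots> = 2 epowr e * (?U x epowr \<alpha> * ?sl x epowr e)" by (simp only: mult_ac)
     finally show ?thesis using x gt by simp
    qed
   qed simp
  qed
  also have "\<dots> = 2 epowr e * (Xs m p (ucell n) (scell n) (t n) + u ?J epowr \<alpha> * ?T epowr e * s (?J \<inter> {x. ?sl x \<le> ?T}))"
   unfolding nn_integral_cmult[OF m3] nn_integral_add[OF m1 m2] nn_integral_cmult_indicator[OF Js] XsE ..
  also have "\<dots> \<le> 2 epowr e * (Xs m p (ucell n) (scell n) (t n) + u ?J epowr \<alpha> * ?T epowr e * ?T)"
  proof (intro mult_left_mono add_left_mono)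
   \<comment> \<open>The level bound: where the tail inside the cell is at most T, the s-mass is at
     most T as well. The mass of the whole cell may be far larger and would spoil the boundary
     term.\<close>
   have dsc: "diffuse (scell n)" by (rule diffuse_restr[OF ds grid_cell_borel])
   have "s (?J \<inter> {x. ?sl x \<le> ?T}) = (scell n) {x. ?sl x \<le> ?T}"
    by (rule restr_cell(2)[symmetric]) (use lvl in auto)
   also have "\<dots> \<le> ?T" using emeasure_tail_level[OF ss, of ?T] unfolding diffuse_ctail[OF dsc] .
   finally show "s (?J \<inter> {x. ?sl x \<le> ?T}) \<le> ?T" .
  qed auto
  also have "\<dots> = 2 epowr e * (Xs m p (ucell n) (scell n) (t n) + u ?J epowr \<alpha> * ?T epowr (e + 1))"
   using False by (simp add: epowr_add mult.assoc)
  finally show "(\<integral>\<^sup>+x\<in>?J. (?U x epowr \<alpha> * s {x<..} epowr e) \<partial>s) \<le>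
    (1 + 2 epowr e) * (Xs m p (ucell n) (scell n) (t n) + u ?J epowr \<alpha> * ?T epowr (e + 1))"
   using c1(2) by (rule order.trans)
 qed
qed

text \<open>The boundary term is the value of the supremum in \<open>cellsup\<close> at the right
  endpoint of the cell.\<close>

lemma cell_tail_bound:
 assumes b: "0 < b" and k: "0 < k"
 shows "u (grid_cell t n) epowr b * tail_end n epowr k \<le> cellsup b k n"
proof (cases n)
 case 0
 then show ?thesis using k by (simp add: tail_end_def)
next
 case (Suc i)
 have "t i \<in> grid_cell t n" using Suc t_dec by auto
 then have "u {t n<..t i} epowr b * s {t i<..} epowr k \<le> cellsup b k n"
  unfolding cellsup_def by (rule SUP_upper)
 then show ?thesis using Suc by (simp add: tail_end_def)
qed

end

text \<open>The u-mass of (t n,x] is split over the cells. The part from cell j is integrated over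
  that cell, which is \<open>cell_Xs_le\<close>, and over everything beyond, where it is constant
  and \<open>tail_power\<close> gives the boundary term again. Any \<theta> > 1 is allowed, to be
  adapted to the exponent under which the sum is used.\<close>

lemma Xs_le_cells:
 assumes m: "0 < m" "m < p" and p: "1 < p" and \<theta>: "1 < \<theta>"
 shows "\<exists>c<top. \<forall>u w s a t n. copson_grid u w s a t --> Xs m p u s (t n) \<le> c * (\<Sum>j\<le>n. ennreal (\<theta> ^ (n - j)) *
  (Xs m p (restr u (grid_cell t j)) (restr s (grid_cell t j)) (t j) +
   u (grid_cell t j) epowr (p / (p - m)) * copson_grid.tail_end s t j epowr (m * (p - 1) / (p - m))))"
proof -
 define \<alpha> where "\<alpha> = p / (p - m)"
 define e where "e = p * (m - 1) / (p - m)"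
 have \<alpha>: "0 < \<alpha>" using m p by (simp add: \<alpha>_def)
 have e1: "m * (p - 1) / (p - m) = e + 1" using m by (simp add: e_def field_simps)
 have "0 < m * (p - 1) / (p - m)" using m p by simp
 then have e: "-1 < e" using e1 by linarith
 have "\<exists>c<top. \<forall>x n. (\<Sum>j\<le>n. ennreal (1 ^ (n - j)) * x j) epowr \<alpha>
  \<le> c * (\<Sum>j\<le>n. ennreal (\<theta> ^ (n - j)) * x j epowr \<alpha>)"
  by (rule sum_epowr_geometric) (use \<alpha> \<theta> in simp_all)
 then obtain c1 where c1: "c1 < top" and geo: "\<And>x n. (\<Sum>j\<le>n. ennreal (1 ^ (n - j)) * x j) epowr \<alpha>
  \<le> c1 * (\<Sum>j\<le>n. ennreal (\<theta> ^ (n - j)) * x j epowr \<alpha>)" by blast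
 show ?thesis
 proof (rule ex_finiteE[OF tail_power[OF e]], goal_cases)
 case (1 c2)
 note c2 = 1(1) and tl = 1(2)[rule_format (no_asm)]
 define K where "K = 1 + 2 epowr e + c2"
 have K: "K < top" unfolding K_def by (intro add_less_top_ennreal c2) auto
 show ?thesis
  unfolding \<alpha>_def[symmetric] e1
 proof (intro exI[of _ "c1 * K"] conjI allI impI)
  show "c1 * K < top" by (rule mult_less_top_ennreal[OF c1 K])
  fix u w s a t n assume "copson_grid u w s a t"
  then interpret copson_grid u w s a t .
  let ?V = "\<lambda>x. s {x<..}"
  define Y where "Y = (\<lambda>j. Xs m p (ucell j) (scell j) (t j) + u (grid_cell t j) epowr \<alpha> * tail_end j epowr (e + 1))"
  have [measurable]: "?V \<in> borelfun" by (rule measurable_tail[OF s])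
  have mj: "(\<lambda>x. u (grid_cell t j \<inter> {..x})) \<in> borelfun" for j
   by (rule borel_measurable_mono_ennreal) (rule monoI, rule emeasure_mono, auto simp: u)
  note [measurable] = mj
  have part: "(\<integral>\<^sup>+x\<in>{t n<..}. (u (grid_cell t j \<inter> {..x}) epowr \<alpha> * ?V x epowr e) \<partial>s) \<le> K * Y j" for j
  proof -
   let ?J = "grid_cell t j"
   define F1 where "F1 = (\<lambda>x. u {t j<..x} epowr \<alpha> * ?V x epowr e * indicator ?J x)"
   \<comment> \<open>The half-line beyond cell j, empty for the unbounded cell.\<close>
   define B where "B = (case j of 0 => {} | Suc i => {t i<..})"
   have Bb: "B \<in> sets borel" unfolding B_def by (cases j) auto
   define F2 where "F2 = (\<lambda>x. u ?J epowr \<alpha> * (?V x epowr e * indicator B x))"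
   have m0: "(\<lambda>x. ?V x epowr e * indicator B x) \<in> borel_measurable s"
    by (rule measurable_borel_like[OF s]) (use Bb in measurable)
   have m1: "F1 \<in> borel_measurable s" unfolding F1_def
    by (rule measurable_borel_like[OF s]) (use measurable_Ioc[OF u, of "t j"] in measurable)
   have m2: "F2 \<in> borel_measurable s" unfolding F2_def
    by (rule measurable_borel_like[OF s]) (use Bb in measurable)
   have "(\<integral>\<^sup>+x\<in>{t n<..}. (u (?J \<inter> {..x}) epowr \<alpha> * ?V x epowr e) \<partial>s) \<le> (\<integral>\<^sup>+x. F1 x + F2 x \<partial>s)"
   proof (intro nn_integral_mono)
    fix x
    consider "x \<le> t j" | "x \<in> ?J" | i where "j = Suc i" "t i < x" by (cases j) fastforce+
    then have "u (?J \<inter> {..x}) epowr \<alpha> * ?V x epowr e \<le> F1 x + F2 x"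
    proof cases
     case 1
     then have E: "?J \<inter> {..x} = {}" using grid_cell_subset[of t j] by auto
     show ?thesis unfolding E using \<alpha> by simp
    next
     case 2
     have E: "?J \<inter> {..x} = {t j<..x}" using 2 by (cases j) auto
     show ?thesis unfolding E F1_def using 2 by simp
    next
     case 3
     have "u (?J \<inter> {..x}) epowr \<alpha> \<le> u ?J epowr \<alpha>"
      using u \<alpha> by (intro epowr_mono emeasure_mono) auto
     then have "u (?J \<inter> {..x}) epowr \<alpha> * ?V x epowr e \<le> u ?J epowr \<alpha> * ?V x epowr e"
      by (rule mult_right_mono) simp
     also have "\<dots> = F2 x" using 3 by (simp add: F2_def B_def)
     also have "\<dots> \<le> F1 x + F2 x" by simp
     finally show ?thesis .
    qed
    then show "u (?J \<inter> {..x}) epowr \<alpha> * ?V x epowr e * indicator {t n<..} x \<le> F1 x + F2 x"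
     by (auto split: split_indicator)
   qed
   also have "\<dots> = (\<integral>\<^sup>+x. F1 x \<partial>s) + (\<integral>\<^sup>+x. F2 x \<partial>s)" by (rule nn_integral_add[OF m1 m2])
   also have "\<dots> \<le> (1 + 2 epowr e) * Y j + c2 * Y j"
   proof (rule add_mono)
    show "(\<integral>\<^sup>+x. F1 x \<partial>s) \<le> (1 + 2 epowr e) * Y j"
     using cell_Xs_le[OF m p, of j] unfolding F1_def Y_def \<alpha>_def[symmetric] e_def[symmetric] e1 .
    have "(\<integral>\<^sup>+x. F2 x \<partial>s) = u ?J epowr \<alpha> * (\<integral>\<^sup>+x\<in>B. ?V x epowr e \<partial>s)"
     unfolding F2_def by (rule nn_integral_cmult[OF m0])
    also have "\<dots> \<le> u ?J epowr \<alpha> * (c2 * tail_end j epowr (e + 1))"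
    proof (rule mult_left_mono)
     show "(\<integral>\<^sup>+x\<in>B. ?V x epowr e \<partial>s) \<le> c2 * tail_end j epowr (e + 1)"
     proof (cases j)
      case 0
      then show ?thesis by (simp add: B_def)
     next
      case (Suc i)
      then show ?thesis using tl[OF ds sfin[OF t_pos], THEN conjunct1, of i] by (simp add: B_def tail_end_def)
     qed
    qed simp
    also have "\<dots> = c2 * (u ?J epowr \<alpha> * tail_end j epowr (e + 1))" by (simp only: mult_ac)
    also have "\<dots> \<le> c2 * Y j" unfolding Y_def by (intro mult_left_mono) auto
    finally show "(\<integral>\<^sup>+x. F2 x \<partial>s) \<le> c2 * Y j" .
   qed
   also have "\<dots> = K * Y j" by (simp only: K_def distrib_right)
   finally show ?thesis .
  qed
  have ms: "(\<lambda>x. u (grid_cell t j \<inter> {..x}) epowr \<alpha> * ?V x epowr e * indicator {t n<..} x) \<in> borel_measurable s" for j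
   by (rule measurable_borel_like[OF s]) measurable
  have ms': "(\<lambda>x. ennreal (\<theta> ^ (n - j)) * (u (grid_cell t j \<inter> {..x}) epowr \<alpha> * ?V x epowr e * indicator {t n<..} x)) \<in> borel_measurable s" for j
   by (rule measurable_borel_like[OF s]) measurable
  have ms'': "(\<lambda>x. \<Sum>j\<le>n. ennreal (\<theta> ^ (n - j)) * (u (grid_cell t j \<inter> {..x}) epowr \<alpha> * ?V x epowr e * indicator {t n<..} x)) \<in> borel_measurable s"
   by (rule borel_measurable_sum[OF ms'])
  have "Xs m p u s (t n) \<le> (\<integral>\<^sup>+x. c1 * (\<Sum>j\<le>n. ennreal (\<theta> ^ (n - j)) * (u (grid_cell t j \<inter> {..x}) epowr \<alpha> * ?V x epowr e * indicator {t n<..} x)) \<partial>s)"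
   unfolding Xs_def \<alpha>_def[symmetric] e_def[symmetric]
  proof (intro nn_integral_mono)
   fix x
   have "u {t n<..x} epowr \<alpha> \<le> c1 * (\<Sum>j\<le>n. ennreal (\<theta> ^ (n - j)) * u (grid_cell t j \<inter> {..x}) epowr \<alpha>)"
    using geo[where n = n and x = "\<lambda>j. u (grid_cell t j \<inter> {..x})"] unfolding tail_decomp by simp
   then have "u {t n<..x} epowr \<alpha> * (?V x epowr e * indicator {t n<..} x) \<le>
     c1 * (\<Sum>j\<le>n. ennreal (\<theta> ^ (n - j)) * u (grid_cell t j \<inter> {..x}) epowr \<alpha>) * (?V x epowr e * indicator {t n<..} x)"
    by (rule mult_right_mono) simp
   then show "u {t n<..x} epowr \<alpha> * ?V x epowr e * indicator {t n<..} x \<le>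
     c1 * (\<Sum>j\<le>n. ennreal (\<theta> ^ (n - j)) * (u (grid_cell t j \<inter> {..x}) epowr \<alpha> * ?V x epowr e * indicator {t n<..} x))"
    by (simp only: sum_distrib_right mult.assoc)
  qed
  also have "\<dots> = c1 * (\<Sum>j\<le>n. ennreal (\<theta> ^ (n - j)) * (\<integral>\<^sup>+x\<in>{t n<..}. (u (grid_cell t j \<inter> {..x}) epowr \<alpha> * ?V x epowr e) \<partial>s))"
   unfolding nn_integral_cmult[OF ms''] nn_integral_sum[OF ms'] nn_integral_cmult[OF ms] ..
  also have "\<dots> \<le> c1 * (\<Sum>j\<le>n. ennreal (\<theta> ^ (n - j)) * (K * Y j))"
   by (intro mult_left_mono sum_mono part) auto
  also have "\<dots> = c1 * K * (\<Sum>j\<le>n. ennreal (\<theta> ^ (n - j)) * Y j)"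
   by (simp only: sum_distrib_left mult_ac)
  finally show "Xs m p u s (t n) \<le> c1 * K * (\<Sum>j\<le>n. ennreal (\<theta> ^ (n - j)) *
    (Xs m p (ucell j) (scell j) (t j) + u (grid_cell t j) epowr \<alpha> * tail_end j epowr (e + 1)))"
   unfolding Y_def .
 qed
 qed
qed

text \<open>Each bounded cell has its own Maz'ya test function; free multiples of these are
  superposed and \<open>suminf_duality\<close> recovers the power p / (p - q) of the coefficients.
  On a bounded cell the restricted s vanishes beyond the right endpoint, as the test function
  requires. The index of W comes from the series in \<open>iterK_sum_le\<close> at the node t (k +
  1).\<close>

lemma local_dual:
 assumes a: "0 < a" and m: "0 < m" "m < p" and p: "1 < p" "a * m < p"
 shows "\<exists>c<top. \<forall>u w s t D. copson_grid u w s a t --> Cineq a m p u w s D -->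
  (\<Sum>k. (w {..t (Suc (Suc k))} * Xu m p (restr u (grid_cell t (Suc k))) (restr s (grid_cell t (Suc k))) (t (Suc k)) epowr (a * (p - m) / p))
    epowr (p / (p - a * m))) \<le> c * D epowr (p / (p - a * m))"
proof -
 define q where "q = a * m"
 have q: "0 < q" "q < p" using a m p by (auto simp: q_def)
 have p0: "0 < p" using p by simp
 show ?thesis
 proof (rule ex_finiteE[OF Mazya_test_function[OF m p(1)]], goal_cases)
 case (1 c)
 note c = 1(1) and MT = 1(2)[rule_format (no_asm)]
 show ?thesis
  unfolding q_def[symmetric]
 proof (intro exI[of _ "(c epowr a) epowr (p / (p - q))"] conjI allI impI)
  show "(c epowr a) epowr (p / (p - q)) < top" using a q p by (intro epowr_less_top c) auto
  fix u w s t D assume G: "copson_grid u w s a t" and C: "Cineq a m p u w s D"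
  interpret copson_grid u w s a t by (rule G)
  have "\<exists>g\<in>borel_measurable borel. (\<integral>\<^sup>+x\<in>{t (Suc k)<..}. g x epowr p \<partial>scell (Suc k)) \<le> 1 \<and>
   Xu m p (ucell (Suc k)) (scell (Suc k)) (t (Suc k)) epowr ((p - m) / p) \<le> c * (\<integral>\<^sup>+x\<in>{t (Suc k)<..}. copson (scell (Suc k)) g x epowr m \<partial>ucell (Suc k))" for k
  proof (rule MT)
   show "diffuse (ucell (Suc k))" by (rule diffuse_restr[OF du grid_cell_borel])
   show "diffuse (scell (Suc k))" by (rule diffuse_restr[OF ds grid_cell_borel])
   show "\<forall>x. (ucell (Suc k)) {t (Suc k)<..x} < top"
   proof
    fix x
    have "(ucell (Suc k)) {t (Suc k)<..x} \<le> (ucell (Suc k)) {t (Suc k)..x}"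
     using u by (intro emeasure_mono) auto
    also have "\<dots> < top" by (rule le_less_trans[OF restr_u_le ufin[OF t_pos]])
    finally show "(ucell (Suc k)) {t (Suc k)<..x} < top" .
   qed
   show "(scell (Suc k)) {t (Suc k)<..} < top" by (rule le_less_trans[OF restr_s_le sfin[OF t_pos]])
   have "grid_cell t (Suc k) \<inter> {t k<..} = {}" by auto
   then show "(scell (Suc k)) {t k<..} = 0" by (subst restr_cell(2)) auto
  qed
  then have "\<exists>g. \<forall>k. g k \<in> borelfun \<and> (\<integral>\<^sup>+x\<in>{t (Suc k)<..}. g k x epowr p \<partial>scell (Suc k)) \<le> 1 \<and>
   Xu m p (ucell (Suc k)) (scell (Suc k)) (t (Suc k)) epowr ((p - m) / p) \<le> c * (\<integral>\<^sup>+x\<in>{t (Suc k)<..}. copson (scell (Suc k)) (g k) x epowr m \<partial>ucell (Suc k))"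
   by (intro choice) blast
  then obtain g where "\<forall>k. g k \<in> borelfun \<and> (\<integral>\<^sup>+x\<in>{t (Suc k)<..}. g k x epowr p \<partial>scell (Suc k)) \<le> 1 \<and>
   Xu m p (ucell (Suc k)) (scell (Suc k)) (t (Suc k)) epowr ((p - m) / p) \<le> c * (\<integral>\<^sup>+x\<in>{t (Suc k)<..}. copson (scell (Suc k)) (g k) x epowr m \<partial>ucell (Suc k))" ..
  then have g: "\<And>k. g k \<in> borelfun" and gN: "\<And>k. (\<integral>\<^sup>+x\<in>{t (Suc k)<..}. g k x epowr p \<partial>scell (Suc k)) \<le> 1"
   and gX: "\<And>k. Xu m p (ucell (Suc k)) (scell (Suc k)) (t (Suc k)) epowr ((p - m) / p) \<le> c * (\<integral>\<^sup>+x\<in>{t (Suc k)<..}. copson (scell (Suc k)) (g k) x epowr m \<partial>ucell (Suc k))"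
   by simp_all
  let ?X = "\<lambda>k. Xu m p (ucell (Suc k)) (scell (Suc k)) (t (Suc k))"
  have "(\<Sum>k. (W (Suc (Suc k)) * ?X k epowr (a * (p - m) / p)) epowr (p / (p - q))) \<le> (c epowr a * D) epowr (p / (p - q))"
  proof (rule suminf_duality[OF q])
   fix l :: "nat => ennreal"
   \<comment> \<open>The supports are disjoint, so p-th powers add, while on its own cell the Copson
     integral of h is at least l k times that of g k.\<close>
   define h where "h = (\<lambda>x. \<Sum>k. l k * (g k x) * indicator (grid_cell t (Suc k)) x)"
   note [measurable] = g
   have h: "h \<in> borelfun" unfolding h_def by measurable
   have hN: "(powint p s h) \<le> (\<Sum>k. l k epowr p)"
   proof -
    have mk: "(\<lambda>x. g k x epowr p * indicator (grid_cell t (Suc k)) x) \<in> borel_measurable s" for k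
     by (rule measurable_borel_like[OF s]) measurable
    have mk': "(\<lambda>x. l k epowr p * (g k x epowr p * indicator (grid_cell t (Suc k)) x)) \<in> borel_measurable s" for k
     by (rule measurable_borel_like[OF s]) measurable
    have "(powint p s h) = (\<integral>\<^sup>+x. (\<Sum>k. l k epowr p * (g k x epowr p * indicator (grid_cell t (Suc k)) x)) \<partial>s)"
    proof (intro nn_integral_cong)
     fix x
     show "h x epowr p = (\<Sum>k. l k epowr p * (g k x epowr p * indicator (grid_cell t (Suc k)) x))"
     proof (cases "\<exists>j. x \<in> grid_cell t (Suc j)")
      case True
      then obtain j where j: "x \<in> grid_cell t (Suc j)" by blast
      have 1: "h x = l j * g j x" unfolding h_def by (rule sum_cells[OF j, of "\<lambda>k. l k * g k x"])
      have 2: "(\<Sum>k. l k epowr p * (g k x epowr p * indicator (grid_cell t (Suc k)) x)) = l j epowr p * g j x epowr p"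
       using sum_cells[OF j, of "\<lambda>k. l k epowr p * g k x epowr p"] by (simp only: mult.assoc)
      show ?thesis unfolding 1 2 using p0 by (intro epowr_mult) auto
     next
      case False
      then have "h x = 0" by (simp add: h_def del: grid_cell_simps)
      moreover have "(\<Sum>k. l k epowr p * (g k x epowr p * indicator (grid_cell t (Suc k)) x)) = 0"
       using False by (simp del: grid_cell_simps)
      ultimately show ?thesis using p0 by simp
     qed
    qed
    also have "\<dots> = (\<Sum>k. l k epowr p * (\<integral>\<^sup>+x\<in>grid_cell t (Suc k). g k x epowr p \<partial>s))"
     unfolding nn_integral_suminf[OF mk'] nn_integral_cmult[OF mk] ..
    also have "\<dots> \<le> (\<Sum>k. l k epowr p * 1)"
     using gN unfolding cell_norm_restr[OF g] by (intro suminf_le summableI mult_left_mono) auto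
    finally show ?thesis by simp
   qed
   have hK: "l k epowr m * (\<integral>\<^sup>+x\<in>{t (Suc k)<..}. copson (scell (Suc k)) (g k) x epowr m \<partial>ucell (Suc k)) \<le> iterK m u s h (t (Suc k))" for k
   proof -
    let ?c = "copson (scell (Suc k)) (g k)"
    have mc [measurable]: "?c \<in> borelfun" by (rule measurable_copson)
    have cop: "l k * ?c x \<le> copson s h x" for x
    proof -
     have mg: "(\<lambda>y. g k y * indicator (grid_cell t (Suc k)) y * indicator {x<..} y) \<in> borel_measurable s"
      by (rule measurable_borel_like[OF s]) measurable
     have "l k * ?c x = l k * copson s (\<lambda>y. g k y * indicator (grid_cell t (Suc k)) y) x"
      by (simp only: copson_restr[OF s grid_cell_borel g])
     also have "\<dots> = (\<integral>\<^sup>+y. l k * (g k y * indicator (grid_cell t (Suc k)) y * indicator {x<..} y) \<partial>s)"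
      unfolding copson_def by (rule nn_integral_cmult[OF mg, symmetric])
     also have "\<dots> \<le> copson s h x"
      unfolding copson_def
     proof (intro nn_integral_mono)
      fix y
      have "l k * g k y * indicator (grid_cell t (Suc k)) y \<le> h y"
       unfolding h_def by (rule le_suminf_term)
      then have "l k * g k y * indicator (grid_cell t (Suc k)) y * indicator {x<..} y \<le> h y * indicator {x<..} y"
       by (rule mult_right_mono) simp
      then show "l k * (g k y * indicator (grid_cell t (Suc k)) y * indicator {x<..} y) \<le> h y * indicator {x<..} y"
       by (simp only: mult.assoc)
     qed
     finally show ?thesis .
    qed
    have m1: "(\<lambda>x. ?c x epowr m * indicator {t (Suc k)<..} x) \<in> borelfun" by measurable
    have m2: "(\<lambda>x. ?c x epowr m * indicator {t (Suc k)<..} x * indicator (grid_cell t (Suc k)) x) \<in> borel_measurable u"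
     by (rule measurable_borel_like[OF u]) measurable
    have "l k epowr m * (\<integral>\<^sup>+x\<in>{t (Suc k)<..}. ?c x epowr m \<partial>ucell (Suc k)) =
      l k epowr m * (\<integral>\<^sup>+x\<in>grid_cell t (Suc k). (?c x epowr m * indicator {t (Suc k)<..} x) \<partial>u)"
     by (subst restr_cell(3)[OF _ m1]) auto
    also have "\<dots> = (\<integral>\<^sup>+x. l k epowr m * (?c x epowr m * indicator {t (Suc k)<..} x * indicator (grid_cell t (Suc k)) x) \<partial>u)"
     by (rule nn_integral_cmult[OF m2, symmetric])
    also have "\<dots> \<le> iterK m u s h (t (Suc k))"
     unfolding iterK_def
    proof (intro nn_integral_mono)
     fix x
     have "(l k * ?c x) epowr m \<le> copson s h x epowr m" using m by (intro epowr_mono cop) auto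
     then have "l k epowr m * ?c x epowr m \<le> copson s h x epowr m" using m by (simp add: epowr_mult)
     then show "l k epowr m * (?c x epowr m * indicator {t (Suc k)<..} x * indicator (grid_cell t (Suc k)) x) \<le> copson s h x epowr m * indicator {t (Suc k)<..} x"
      by (auto split: split_indicator)
    qed
    finally show ?thesis .
   qed
   have "(\<Sum>k. W (Suc (Suc k)) * ?X k epowr (a * (p - m) / p) * l k epowr q) \<le> (\<Sum>k. c epowr a * (W (Suc (Suc k)) * iterK m u s h (t (Suc k)) epowr a))"
   proof (intro suminf_le summableI)
    fix k
    let ?I = "\<integral>\<^sup>+x\<in>{t (Suc k)<..}. copson (scell (Suc k)) (g k) x epowr m \<partial>ucell (Suc k)"
    have "l k epowr m * ?X k epowr ((p - m) / p) \<le> l k epowr m * (c * ?I)"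
     by (intro mult_left_mono gX) simp
    also have "\<dots> = c * (l k epowr m * ?I)" by (simp only: mult_ac)
    also have "\<dots> \<le> c * iterK m u s h (t (Suc k))" by (intro mult_left_mono hK) simp
    finally have "(l k epowr m * ?X k epowr ((p - m) / p)) epowr a \<le> (c * iterK m u s h (t (Suc k))) epowr a"
     using a by (intro epowr_mono) auto
    then have "?X k epowr (a * (p - m) / p) * l k epowr q \<le> c epowr a * iterK m u s h (t (Suc k)) epowr a"
     using a by (simp add: epowr_mult epowr_epowr q_def mult.commute)
    then have "W (Suc (Suc k)) * (?X k epowr (a * (p - m) / p) * l k epowr q) \<le> W (Suc (Suc k)) * (c epowr a * iterK m u s h (t (Suc k)) epowr a)"
     by (rule mult_left_mono) simp
    then show "W (Suc (Suc k)) * ?X k epowr (a * (p - m) / p) * l k epowr q \<le> c epowr a * (W (Suc (Suc k)) * iterK m u s h (t (Suc k)) epowr a)"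
     by (simp only: mult_ac)
   qed
   also have "\<dots> = c epowr a * (\<Sum>k. W (Suc (Suc k)) * iterK m u s h (t (Suc k)) epowr a)" by (rule ennreal_suminf_cmult)
   also have "\<dots> \<le> c epowr a * (D * (\<Sum>k. l k epowr p) epowr (q / p))"
   proof (rule mult_left_mono)
    have "(\<Sum>k. W (Suc (Suc k)) * iterK m u s h (t (Suc k)) epowr a) \<le> (\<Sum>k. W (Suc k) * iterK m u s h (t k) epowr a)"
     unfolding suminf_Suc_ennreal[of "\<lambda>k. W (Suc k) * iterK m u s h (t k) epowr a"] by simp
    also have "\<dots> \<le> (\<integral>\<^sup>+x. iterK m u s h x epowr a \<partial>w)" using a by (intro iterK_sum_le) simp
    also have "\<dots> \<le> D * (powint p s h) epowr (q / p)"
     using C h unfolding Cineq_def q_def by blast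
    also have "\<dots> \<le> D * (\<Sum>k. l k epowr p) epowr (q / p)"
     using q p by (intro mult_left_mono epowr_mono hN) auto
    finally show "(\<Sum>k. W (Suc (Suc k)) * iterK m u s h (t (Suc k)) epowr a) \<le> D * (\<Sum>k. l k epowr p) epowr (q / p)" .
   qed simp
   finally show "(\<Sum>k. W (Suc (Suc k)) * ?X k epowr (a * (p - m) / p) * l k epowr q) \<le> c epowr a * D * (\<Sum>k. l k epowr p) epowr (q / p)"
    by (simp only: mult.assoc)
  qed
  also have "\<dots> = (c epowr a) epowr (p / (p - q)) * D epowr (p / (p - q))"
   using q p by (intro epowr_mult) auto
  finally show "(\<Sum>k. (W (Suc (Suc k)) * ?X k epowr (a * (p - m) / p)) epowr (p / (p - q))) \<le> (c epowr a) epowr (p / (p - q)) * D epowr (p / (p - q))" .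
 qed
 qed
qed

lemma (in copson_grid) W_epowr_half:
 assumes e: "0 \<le> e" shows "W (Suc n) epowr (e + 1) \<le> ennreal (1/2) * W n epowr (e + 1)"
proof -
 have half: "W (Suc n) \<le> ennreal (1/2) * W n" using W_Suc_half[of n] by simp
 have "W (Suc n) \<le> W n" using w t_dec[of n] by (intro emeasure_mono) auto
 then have "W (Suc n) epowr e \<le> W n epowr e" using e by (intro epowr_mono) auto
 then have "W (Suc n) epowr e * W (Suc n) \<le> W n epowr e * (ennreal (1/2) * W n)"
  by (intro mult_mono half) auto
 then show ?thesis using e by (simp add: epowr_add mult_ac)
qed

lemma (in copson_grid) Xu_cell_le:
 assumes m: "0 < m" "m < p" and p: "1 < p"
 shows "Xu m p (ucell n) (scell n) (t n) \<le> Xu m p u s (t n)"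
proof -
 have us: "sets (ucell n) = sets borel" and ss: "sets (scell n) = sets borel" by (rule restr_cell(1), simp)+
 let ?f = "\<lambda>x. (ucell n) {t n<..x} epowr (m / (p - m)) * (scell n) {x<..} epowr (m * (p - 1) / (p - m)) * indicator {t n<..} x"
 have mf: "?f \<in> borelfun"
  using measurable_Ioc[OF us, of "t n"] measurable_tail[OF ss] by measurable
 have "Xu m p (ucell n) (scell n) (t n) = (\<integral>\<^sup>+x\<in>grid_cell t n. ?f x \<partial>u)"
  unfolding Xu_def by (rule restr_cell(3)[OF _ mf]) simp
 also have "\<dots> \<le> Xu m p u s (t n)"
  unfolding Xu_def
 proof (intro nn_integral_mono)
  fix x
  have "(ucell n) {t n<..x} \<le> (ucell n) {t n..x}" using u by (intro emeasure_mono) auto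
  then have 1: "(ucell n) {t n<..x} \<le> u {t n<..x}" using restr_u_le by (rule order.trans)
  have "(ucell n) {t n<..x} epowr (m / (p - m)) * (scell n) {x<..} epowr (m * (p - 1) / (p - m))
   \<le> u {t n<..x} epowr (m / (p - m)) * s {x<..} epowr (m * (p - 1) / (p - m))"
   using m p by (intro mult_mono epowr_mono 1 restr_s_le) auto
  then show "?f x * indicator (grid_cell t n) x \<le> u {t n<..x} epowr (m / (p - m)) * s {x<..} epowr (m * (p - 1) / (p - m)) * indicator {t n<..} x"
   by (auto split: split_indicator)
 qed
 finally show ?thesis .
qed

text \<open>The bounded cells come from \<open>local_dual\<close>, at the price of one more halving
  of W.\<close>

lemma Xu_cells_sum:
 assumes a: "0 < a" and m: "0 < m" "m < p" and p: "1 < p" "a * m < p"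
 shows "\<exists>c<top. \<forall>u w s t D. copson_setting u w s a --> copson_grid u w s a t --> Cineq a m p u w s D -->
  (\<Sum>n. w {..t n} epowr (a * m / (p - a * m) + 1) *
   Xu m p (restr u (grid_cell t n)) (restr s (grid_cell t n)) (t n) epowr (a * (p - m) / (p - a * m))) \<le> c * D epowr (p / (p - a * m))"
proof -
 define q where "q = a * m"
 have q: "0 < q" "q < p" using a m p by (auto simp: q_def)
 define e where "e = q / (p - q)"
 define \<gamma> where "\<gamma> = a * (p - m) / (p - q)"
 have e: "0 \<le> e" using q by (simp add: e_def)
 have e1: "p / (p - q) = e + 1" using q by (simp add: e_def field_simps)
 have \<gamma>: "a * (p - m) / p * (p / (p - q)) = \<gamma>" using p q by (simp add: \<gamma>_def)
 show ?thesis
 proof (rule ex_finiteE[OF lower_A4[OF a m p(1)]], goal_cases)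
 case (1 c4)
 note c4 = 1(1) and A4 = 1(2)[rule_format (no_asm)]
 show ?thesis
 proof (rule ex_finiteE[OF local_dual[OF a m p, folded q_def]], goal_cases)
 case (1 c5)
 note c5 = 1(1) and ld = 1(2)[rule_format (no_asm)]
 show ?thesis
  unfolding q_def[symmetric] unfolding e_def[symmetric] \<gamma>_def[symmetric]
 proof (intro exI[of _ "c4 epowr (p / (p - q)) + 2 epowr (e + 1) * c5"] conjI allI impI)
  show "c4 epowr (p / (p - q)) + 2 epowr (e + 1) * c5 < top"
   using q p e by (intro add_less_top_ennreal mult_less_top_ennreal epowr_less_top c4 c5) auto
  fix u w s t D assume S: "copson_setting u w s a" and G: "copson_grid u w s a t" and C: "Cineq a m p u w s D"
  interpret copson_grid u w s a t by (rule G)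
  let ?X = "\<lambda>n. Xu m p (ucell n) (scell n) (t n)" and ?D = "D epowr (p / (p - q))"
  have comb: "(V * X epowr (a * (p - m) / p)) epowr (p / (p - q)) = V epowr (e + 1) * X epowr \<gamma>" for V X
  proof -
   have "0 \<le> p / (p - q)" and g: "a * (p - m) / p * (p / (p - q)) = \<gamma>" using q p by (auto simp: \<gamma>_def)
   then show ?thesis by (simp only: epowr_mult epowr_epowr g) (simp only: e1)
  qed
  \<comment> \<open>Cell 0 is unbounded and escapes \<open>local_dual\<close>; a single term is
    covered by the supremum bound of \<open>lower_A4\<close>.\<close>
  have 0: "W 0 epowr (e + 1) * ?X 0 epowr \<gamma> \<le> c4 epowr (p / (p - q)) * ?D"
  proof -
   have "(W 0 * ?X 0 epowr (a * (p - m) / p)) epowr (p / (p - q)) \<le> (W 0 * Xu m p u s (t 0) epowr (a * (p - m) / p)) epowr (p / (p - q))"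
    using a m p q by (intro epowr_mono mult_left_mono Xu_cell_le) auto
   also have "\<dots> \<le> (c4 * D) epowr (p / (p - q))"
    using q p by (intro epowr_mono A4[OF S C t_pos]) auto
   also have "\<dots> = c4 epowr (p / (p - q)) * ?D" using q p by (intro epowr_mult) auto
   finally show ?thesis unfolding comb .
  qed
  have "(\<Sum>n. W (Suc n) epowr (e + 1) * ?X (Suc n) epowr \<gamma>) = (\<Sum>n. 2 epowr (e + 1) * (W (Suc (Suc n)) epowr (e + 1) * ?X (Suc n) epowr \<gamma>))"
  proof (intro suminf_cong)
   fix n
   have "W (Suc n) epowr (e + 1) = 2 epowr (e + 1) * W (Suc (Suc n)) epowr (e + 1)"
    unfolding Whalf[of "Suc n"] using e by (intro epowr_mult) auto
   then show "W (Suc n) epowr (e + 1) * ?X (Suc n) epowr \<gamma> = 2 epowr (e + 1) * (W (Suc (Suc n)) epowr (e + 1) * ?X (Suc n) epowr \<gamma>)"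
    by (simp only: mult.assoc)
  qed
  also have "\<dots> = 2 epowr (e + 1) * (\<Sum>n. W (Suc (Suc n)) epowr (e + 1) * ?X (Suc n) epowr \<gamma>)" by (rule ennreal_suminf_cmult)
  also have "\<dots> \<le> 2 epowr (e + 1) * (c5 * ?D)"
   by (intro mult_left_mono) (use ld[OF G C] in \<open>unfold comb, simp_all\<close>)
  finally have Sc: "(\<Sum>n. W (Suc n) epowr (e + 1) * ?X (Suc n) epowr \<gamma>) \<le> 2 epowr (e + 1) * (c5 * ?D)" .
  have "(\<Sum>n. W n epowr (e + 1) * ?X n epowr \<gamma>) = W 0 epowr (e + 1) * ?X 0 epowr \<gamma> + (\<Sum>n. W (Suc n) epowr (e + 1) * ?X (Suc n) epowr \<gamma>)"
   by (rule suminf_Suc_ennreal)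
  also have "\<dots> \<le> c4 epowr (p / (p - q)) * ?D + 2 epowr (e + 1) * (c5 * ?D)" by (intro add_mono 0 Sc)
  also have "\<dots> = (c4 epowr (p / (p - q)) + 2 epowr (e + 1) * c5) * ?D" by (simp only: distrib_right mult.assoc)
  finally show "(\<Sum>n. W n epowr (e + 1) * ?X n epowr \<gamma>) \<le> (c4 epowr (p / (p - q)) + 2 epowr (e + 1) * c5) * ?D" .
 qed
 qed
 qed
qed

text \<open>The decomposition over cells is available for \<open>Xs\<close>, the test functions for
  \<open>Xu\<close>; the equivalence of the two is therefore used once for the full tail and once on
  each cell. The boundary terms are absorbed by the first sum in \<open>cellsup_sums\<close>, the
  one that also gives A2.\<close>

lemma lower_grid_A5:
 assumes a: "0 < a" and m: "0 < m" "m < p" and p: "1 < p" "a * m < p"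
 shows "\<exists>c<top. \<forall>u w s t D. copson_setting u w s a --> copson_grid u w s a t --> Cineq a m p u w s D -->
  (\<integral>\<^sup>+x\<in>{..t 0}. (w {..x} epowr (a * m / (p - a * m)) * Xu m p u s x epowr (a * (p - m) / (p - a * m))) \<partial>w)
   \<le> c * D epowr (p / (p - a * m))"
proof -
 define q where "q = a * m"
 have q: "0 < q" "q < p" using a m p by (auto simp: q_def)
 define e where "e = q / (p - q)"
 define \<gamma> where "\<gamma> = a * (p - m) / (p - q)"
 define \<kappa> where "\<kappa> = q * (p - 1) / (p - q)"
 have e: "0 \<le> e" using q by (simp add: e_def)
 have e1: "p / (p - q) = e + 1" using q by (simp add: e_def field_simps)
 have \<gamma>: "0 < \<gamma>" using a m q by (simp add: \<gamma>_def)
 have \<kappa>: "0 < \<kappa>" using q p by (simp add: \<kappa>_def)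
 have ae: "0 < a * (e + 1)" using a e by (intro mult_pos_pos) auto
 have x1: "p / (p - m) * \<gamma> = a * (e + 1)" using m unfolding e1[symmetric] by (simp add: \<gamma>_def)
 have x2: "m * (p - 1) / (p - m) * \<gamma> = \<kappa>" using m by (simp add: \<gamma>_def \<kappa>_def q_def)
 \<comment> \<open>Chosen so that \<theta>^\<gamma> is the square root of 2: above 1, as
   \<open>Xs_le_cells\<close> demands, and below the threshold 2 set by the decay of W.\<close>
 define \<theta> :: real where "\<theta> = 2 powr (1 / (2 * \<gamma>))"
 have \<theta>1: "1 < \<theta>" unfolding \<theta>_def using \<gamma> by (intro gr_one_powr) auto
 have "\<theta> powr \<gamma> = 2 powr (1 / 2)" unfolding \<theta>_def powr_powr using \<gamma> by simp
 also have "\<dots> < 2 powr 1" by (intro powr_less_mono) auto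
 finally have \<theta>: "1 / 2 * \<theta> powr \<gamma> < 1" by simp
 have "\<exists>c<top. \<forall>\<omega> x. (\<forall>n. \<omega> (Suc n) \<le> ennreal (1/2) * \<omega> n) -->
   (\<Sum>n. \<omega> n * (\<Sum>j\<le>n. ennreal (\<theta> ^ (n - j)) * x j) epowr \<gamma>) \<le> c * (\<Sum>n. \<omega> n * x n epowr \<gamma>)"
  by (rule suminf_geometric_epowr) (use \<gamma> \<theta> \<theta>1 in simp_all)
 then obtain c1 where c1: "c1 < top" and geo: "\<And>\<omega> x. (\<forall>n. \<omega> (Suc n) \<le> ennreal (1/2) * \<omega> n) ==>
   (\<Sum>n. \<omega> n * (\<Sum>j\<le>n. ennreal (\<theta> ^ (n - j)) * x j) epowr \<gamma>) \<le> c1 * (\<Sum>n. \<omega> n * x n epowr \<gamma>)" by blast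
 show ?thesis
 proof (rule ex_finiteE[OF Xs_Xu_equiv[OF m p(1)]], goal_cases)
 case (1 c2)
 note c2 = 1(1) and eqv = 1(2)[rule_format (no_asm)]
 show ?thesis
 proof (rule ex_finiteE[OF Xs_le_cells[OF m p(1) \<theta>1]], goal_cases)
 case (1 c3)
 note c3 = 1(1) and dec = 1(2)[rule_format (no_asm)]
 show ?thesis
 proof (rule ex_finiteE[OF cellsup_sums[OF a m(1) p, folded q_def, folded e_def, folded \<kappa>_def]], goal_cases)
 case (1 c4)
 note c4 = 1(1) and cs = 1(2)[rule_format (no_asm)]
 show ?thesis
 proof (rule ex_finiteE[OF Xu_cells_sum[OF a m p, folded q_def, folded e_def, folded \<gamma>_def]], goal_cases)
 case (1 c5)
 note c5 = 1(1) and xc = 1(2)[rule_format (no_asm)]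
 define K where "K = 2 epowr e * ((c2 * c3) epowr \<gamma> * (c1 * (2 epowr \<gamma> * (c2 epowr \<gamma> * c5 + c4))))"
 show ?thesis
  unfolding q_def[symmetric] unfolding e_def[symmetric] \<gamma>_def[symmetric]
 proof (intro exI[of _ K] conjI allI impI)
  show "K < top" unfolding K_def using e \<gamma>
   by (intro add_less_top_ennreal mult_less_top_ennreal epowr_less_top c1 c2 c3 c4 c5) auto
  fix u w s t D assume S: "copson_setting u w s a" and G: "copson_grid u w s a t" and C: "Cineq a m p u w s D"
  interpret copson_grid u w s a t by (rule G)
  let ?D = "D epowr (p / (p - q))"
  define Y where "Y = (\<lambda>j. Xs m p (ucell j) (scell j) (t j) + u (grid_cell t j) epowr (p / (p - m)) * tail_end j epowr (m * (p - 1) / (p - m)))"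
  have Xn: "Xu m p u s (t n) \<le> c2 * c3 * (\<Sum>j\<le>n. ennreal (\<theta> ^ (n - j)) * Y j)" for n
  proof -
   have "Xu m p u s (t n) \<le> c2 * Xs m p u s (t n)"
    using eqv[OF du ds _ sfin[OF t_pos], of n] ufin[OF t_pos] by blast
   also have "\<dots> \<le> c2 * (c3 * (\<Sum>j\<le>n. ennreal (\<theta> ^ (n - j)) * Y j))"
    unfolding Y_def by (intro mult_left_mono dec[OF G]) simp
   finally show ?thesis by (simp only: mult.assoc)
  qed
  have Yn: "Y n epowr \<gamma> \<le> 2 epowr \<gamma> * (c2 epowr \<gamma> * Xu m p (ucell n) (scell n) (t n) epowr \<gamma> + cellsup (a * (e + 1)) \<kappa> n)" for n
  proof -
   let ?X = "Xu m p (ucell n) (scell n) (t n)"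
   have dX: "Xs m p (ucell n) (scell n) (t n) \<le> c2 * ?X"
   proof (rule eqv[THEN conjunct1])
    show "diffuse (ucell n)" by (rule diffuse_restr[OF du grid_cell_borel])
    show "diffuse (scell n)" by (rule diffuse_restr[OF ds grid_cell_borel])
    show "\<forall>x. (ucell n) {t n<..x} < top"
    proof
     fix x
     have "(ucell n) {t n<..x} \<le> (ucell n) {t n..x}" using u by (intro emeasure_mono) auto
     also have "\<dots> < top" by (rule le_less_trans[OF restr_u_le ufin[OF t_pos]])
     finally show "(ucell n) {t n<..x} < top" .
    qed
    show "(scell n) {t n<..} < top" by (rule le_less_trans[OF restr_s_le sfin[OF t_pos]])
   qed
   have "Y n epowr \<gamma> \<le> 2 epowr \<gamma> * (Xs m p (ucell n) (scell n) (t n) epowr \<gamma> +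
     (u (grid_cell t n) epowr (p / (p - m)) * tail_end n epowr (m * (p - 1) / (p - m))) epowr \<gamma>)"
    unfolding Y_def using \<gamma> by (intro epowr_add_le) auto
   also have "(u (grid_cell t n) epowr (p / (p - m)) * tail_end n epowr (m * (p - 1) / (p - m))) epowr \<gamma>
     = u (grid_cell t n) epowr (a * (e + 1)) * tail_end n epowr \<kappa>"
    unfolding epowr_mult[OF less_imp_le[OF \<gamma>]] epowr_epowr x1 x2 ..
   also have "2 epowr \<gamma> * (Xs m p (ucell n) (scell n) (t n) epowr \<gamma> + u (grid_cell t n) epowr (a * (e + 1)) * tail_end n epowr \<kappa>)
     \<le> 2 epowr \<gamma> * ((c2 * ?X) epowr \<gamma> + cellsup (a * (e + 1)) \<kappa> n)"
    using \<gamma> by (intro mult_left_mono add_mono epowr_mono dX cell_tail_bound ae \<kappa>) auto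
   also have "(c2 * ?X) epowr \<gamma> = c2 epowr \<gamma> * ?X epowr \<gamma>" using \<gamma> by (intro epowr_mult) auto
   finally show ?thesis .
  qed
  have main: "(\<Sum>n. W n epowr (e + 1) * Xu m p u s (t n) epowr \<gamma>) \<le>
    (c2 * c3) epowr \<gamma> * (c1 * (2 epowr \<gamma> * (c2 epowr \<gamma> * c5 + c4))) * ?D"
  proof -
   have "(\<Sum>n. W n epowr (e + 1) * Xu m p u s (t n) epowr \<gamma>) \<le>
     (\<Sum>n. (c2 * c3) epowr \<gamma> * (W n epowr (e + 1) * (\<Sum>j\<le>n. ennreal (\<theta> ^ (n - j)) * Y j) epowr \<gamma>))"
   proof (intro suminf_le summableI)
    fix n
    have "Xu m p u s (t n) epowr \<gamma> \<le> (c2 * c3 * (\<Sum>j\<le>n. ennreal (\<theta> ^ (n - j)) * Y j)) epowr \<gamma>"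
     using \<gamma> by (intro epowr_mono Xn) auto
    also have "\<dots> = (c2 * c3) epowr \<gamma> * (\<Sum>j\<le>n. ennreal (\<theta> ^ (n - j)) * Y j) epowr \<gamma>"
     using \<gamma> by (intro epowr_mult) auto
    finally have "W n epowr (e + 1) * Xu m p u s (t n) epowr \<gamma> \<le>
      W n epowr (e + 1) * ((c2 * c3) epowr \<gamma> * (\<Sum>j\<le>n. ennreal (\<theta> ^ (n - j)) * Y j) epowr \<gamma>)"
     by (rule mult_left_mono) simp
    then show "W n epowr (e + 1) * Xu m p u s (t n) epowr \<gamma> \<le>
      (c2 * c3) epowr \<gamma> * (W n epowr (e + 1) * (\<Sum>j\<le>n. ennreal (\<theta> ^ (n - j)) * Y j) epowr \<gamma>)"
     by (simp only: mult.left_commute)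
   qed
   also have "\<dots> = (c2 * c3) epowr \<gamma> * (\<Sum>n. W n epowr (e + 1) * (\<Sum>j\<le>n. ennreal (\<theta> ^ (n - j)) * Y j) epowr \<gamma>)"
    by (rule ennreal_suminf_cmult)
   also have "\<dots> \<le> (c2 * c3) epowr \<gamma> * (c1 * (\<Sum>n. W n epowr (e + 1) * Y n epowr \<gamma>))"
    using W_epowr_half[OF e] by (intro mult_left_mono geo allI) auto
   also have "\<dots> \<le> (c2 * c3) epowr \<gamma> * (c1 * (2 epowr \<gamma> * (c2 epowr \<gamma> * (c5 * ?D) + c4 * ?D)))"
   proof (intro mult_left_mono)
    have "(\<Sum>n. W n epowr (e + 1) * Y n epowr \<gamma>) \<le> (\<Sum>n. 2 epowr \<gamma> * (c2 epowr \<gamma> * (W n epowr (e + 1) * Xu m p (ucell n) (scell n) (t n) epowr \<gamma>)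
      + W n epowr (e + 1) * cellsup (a * (e + 1)) \<kappa> n))"
    proof (intro suminf_le summableI)
     fix n
     have "W n epowr (e + 1) * Y n epowr \<gamma> \<le> W n epowr (e + 1) * (2 epowr \<gamma> * (c2 epowr \<gamma> * Xu m p (ucell n) (scell n) (t n) epowr \<gamma> + cellsup (a * (e + 1)) \<kappa> n))"
      by (intro mult_left_mono Yn) simp
     then show "W n epowr (e + 1) * Y n epowr \<gamma> \<le> 2 epowr \<gamma> * (c2 epowr \<gamma> * (W n epowr (e + 1) * Xu m p (ucell n) (scell n) (t n) epowr \<gamma>)
      + W n epowr (e + 1) * cellsup (a * (e + 1)) \<kappa> n)"
      by (simp only: distrib_left mult.left_commute[of "W n epowr (e + 1)"])
    qed
    also have "\<dots> = 2 epowr \<gamma> * (c2 epowr \<gamma> * (\<Sum>n. W n epowr (e + 1) * Xu m p (ucell n) (scell n) (t n) epowr \<gamma>)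
      + (\<Sum>n. W n epowr (e + 1) * cellsup (a * (e + 1)) \<kappa> n))"
     unfolding ennreal_suminf_cmult suminf_add_ennreal ..
    also have "\<dots> \<le> 2 epowr \<gamma> * (c2 epowr \<gamma> * (c5 * ?D) + c4 * ?D)"
     by (intro mult_left_mono add_mono xc[OF S G C] cs[OF G C, THEN conjunct1]) auto
    finally show "(\<Sum>n. W n epowr (e + 1) * Y n epowr \<gamma>) \<le> 2 epowr \<gamma> * (c2 epowr \<gamma> * (c5 * ?D) + c4 * ?D)" .
   qed auto
   also have "\<dots> = (c2 * c3) epowr \<gamma> * (c1 * (2 epowr \<gamma> * (c2 epowr \<gamma> * c5 + c4))) * ?D"
    by (simp only: distrib_left distrib_right mult.assoc)
   finally show ?thesis .
  qed
  have "(\<integral>\<^sup>+x\<in>{..t 0}. (w {..x} epowr e * Xu m p u s x epowr \<gamma>) \<partial>w) \<le>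
    (\<Sum>n. W (Suc n) * (2 epowr e * (W (Suc n) epowr e * Xu m p u s (t (Suc n)) epowr \<gamma>)))"
  proof (rule upper_sum)
   fix n x assume x: "x \<in> grid_cell t (Suc n)"
   have "w {..x} \<le> 2 * W (Suc n)" unfolding Whalf[of n, symmetric] using x w by (intro emeasure_mono) auto
   then have "w {..x} epowr e \<le> (2 * W (Suc n)) epowr e" using e by (intro epowr_mono) auto
   also have "\<dots> = 2 epowr e * W (Suc n) epowr e" using e by (intro epowr_mult) auto
   finally have 1: "w {..x} epowr e \<le> 2 epowr e * W (Suc n) epowr e" .
   have 2: "Xu m p u s x epowr \<gamma> \<le> Xu m p u s (t (Suc n)) epowr \<gamma>"
    using x \<gamma> by (intro epowr_mono Xu_antimono[OF u m]) auto
   have "w {..x} epowr e * Xu m p u s x epowr \<gamma> \<le> 2 epowr e * W (Suc n) epowr e * Xu m p u s (t (Suc n)) epowr \<gamma>"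
    by (intro mult_mono 1 2) auto
   then show "w {..x} epowr e * Xu m p u s x epowr \<gamma> \<le> 2 epowr e * (W (Suc n) epowr e * Xu m p u s (t (Suc n)) epowr \<gamma>)"
    by (simp only: mult.assoc)
  qed
  also have "\<dots> = (\<Sum>n. 2 epowr e * (W (Suc n) epowr (e + 1) * Xu m p u s (t (Suc n)) epowr \<gamma>))"
   using e by (intro suminf_cong) (simp add: epowr_add mult_ac)
  also have "\<dots> = 2 epowr e * (\<Sum>n. W (Suc n) epowr (e + 1) * Xu m p u s (t (Suc n)) epowr \<gamma>)" by (rule ennreal_suminf_cmult)
  also have "\<dots> \<le> 2 epowr e * (\<Sum>n. W n epowr (e + 1) * Xu m p u s (t n) epowr \<gamma>)"
   unfolding suminf_Suc_ennreal[of "\<lambda>n. W n epowr (e + 1) * Xu m p u s (t n) epowr \<gamma>"] by (intro mult_left_mono) auto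
  also have "\<dots> \<le> 2 epowr e * ((c2 * c3) epowr \<gamma> * (c1 * (2 epowr \<gamma> * (c2 epowr \<gamma> * c5 + c4))) * ?D)"
   by (intro mult_left_mono main) simp
  also have "\<dots> = K * ?D" by (simp only: K_def mult.assoc)
  finally show "(\<integral>\<^sup>+x\<in>{..t 0}. (w {..x} epowr e * Xu m p u s x epowr \<gamma>) \<partial>w) \<le> K * ?D" .
 qed
 qed
 qed
 qed
 qed
qed

context copson_setting
begin

lemma measurable_head_w: "(\<lambda>x. w {..x} epowr e) \<in> borelfun"
 by (rule borel_measurable_epowr[OF measurable_head[OF w]])

lemma measurable_Phi': "(\<lambda>x. Phi a u w x epowr e) \<in> borelfun"
 by (rule borel_measurable_epowr, rule borel_measurable_mono_ennreal)
  (rule monoI, rule Phi_mono[OF u], use a0 in auto)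

lemma measurable_Usup': "0 \<le> b ==> Usup b k u s \<in> borelfun"
 by (rule borel_measurable_antimono_ennreal) (rule antimonoI, rule Usup_antimono[OF u])

lemma measurable_Xu': "0 < m ==> m < p ==> (\<lambda>x. Xu m p u s x epowr e) \<in> borelfun"
 by (rule borel_measurable_epowr, rule borel_measurable_antimono_ennreal)
  (rule antimonoI, rule Xu_antimono[OF u])

end

section \<open>Lower bounds on the half-line, and the upper bound for m < p, q < p\<close>

lemma lower_A2A3:
 assumes a: "0 < a" and m: "0 < m" and p: "1 < p" "a * m < p"
 shows "\<exists>c<top. \<forall>u w s D. copson_setting u w s a --> Cineq a m p u w s D -->
  head_Usup_int (a * (p / (p - a * m))) (a * m / (p - a * m)) (a * m * (p - 1) / (p - a * m)) u w s
   \<le> c * D epowr (p / (p - a * m)) \<and>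
  Phi_Usup_int a (a * m / (p - a * m)) (a * m * (p - 1) / (p - a * m)) u w s
   \<le> c * D epowr (p / (p - a * m))"
proof -
 have e: "a * m / (p - a * m) + 1 = p / (p - a * m)" using p by (simp add: field_simps)
 have ap: "0 < a * (p / (p - a * m))" using a p by simp
 show ?thesis
 proof (rule ex_finiteE[OF lower_grid_A2A3[OF a m p, unfolded e]], goal_cases)
 case (1 c)
 note c = 1(1) and L = 1(2)[rule_format (no_asm)]
 show ?thesis
 proof (intro exI[of _ c] conjI[OF c] allI impI)
  fix u w s D assume S: "copson_setting u w s a" and C: "Cineq a m p u w s D"
  interpret copson_setting u w s a by (rule S)
  show "head_Usup_int (a * (p / (p - a * m))) (a * m / (p - a * m)) (a * m * (p - 1) / (p - a * m)) u w s
   \<le> c * D epowr (p / (p - a * m)) \<and>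
  Phi_Usup_int a (a * m / (p - a * m)) (a * m * (p - 1) / (p - a * m)) u w s
   \<le> c * D epowr (p / (p - a * m))"
  proof (rule conjI)
   show "head_Usup_int (a * (p / (p - a * m))) (a * m / (p - a * m)) (a * m * (p - 1) / (p - a * m)) u w s
    \<le> c * D epowr (p / (p - a * m))"
   proof (rule integral_le_by_grids)
    show "(\<lambda>x. w {..x} epowr (a * m / (p - a * m)) * Usup (a * (p / (p - a * m))) (a * m * (p - 1) / (p - a * m)) u s x) \<in> borelfun"
     using ap by (intro borel_measurable_times_ennreal measurable_head_w measurable_Usup' less_imp_le)
   qed (simp_all only: L[OF _ C, THEN conjunct1] Usup_zero[OF _ ap u] mult_zero_right)
   show "Phi_Usup_int a (a * m / (p - a * m)) (a * m * (p - 1) / (p - a * m)) u w s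
    \<le> c * D epowr (p / (p - a * m))"
   proof (rule integral_le_by_grids)
    show "(\<lambda>x. Phi a u w x epowr (a * m / (p - a * m)) * Usup a (a * m * (p - 1) / (p - a * m)) u s x) \<in> borelfun"
     using a by (intro borel_measurable_times_ennreal measurable_Phi' measurable_Usup' less_imp_le)
   qed (simp_all only: L[OF _ C, THEN conjunct2] Usup_zero[OF _ a u] mult_zero_right)
  qed
 qed
 qed
qed

lemma lower_A5:
 assumes a: "0 < a" and m: "0 < m" "m < p" and p: "1 < p" "a * m < p"
 shows "\<exists>c<top. \<forall>u w s D. copson_setting u w s a --> Cineq a m p u w s D -->
  (\<integral>\<^sup>+x. w {..x} epowr (a * m / (p - a * m)) * Xu m p u s x epowr (a * (p - m) / (p - a * m)) \<partial>w)
   \<le> c * D epowr (p / (p - a * m))"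
proof -
 have g: "0 < a * (p - m) / (p - a * m)" using a m p by simp
 show ?thesis
 proof (rule ex_finiteE[OF lower_grid_A5[OF a m p]], goal_cases)
 case (1 c)
 note c = 1(1) and L = 1(2)[rule_format (no_asm)]
 show ?thesis
 proof (intro exI[of _ c] conjI[OF c] allI impI)
  fix u w s D assume S: "copson_setting u w s a" and C: "Cineq a m p u w s D"
  interpret copson_setting u w s a by (rule S)
  show "(\<integral>\<^sup>+x. w {..x} epowr (a * m / (p - a * m)) * Xu m p u s x epowr (a * (p - m) / (p - a * m)) \<partial>w)
   \<le> c * D epowr (p / (p - a * m))"
  proof (rule integral_le_by_grids)
   show "(\<lambda>x. w {..x} epowr (a * m / (p - a * m)) * Xu m p u s x epowr (a * (p - m) / (p - a * m))) \<in> borelfun"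
    by (intro borel_measurable_times_ennreal measurable_head_w measurable_Xu' m)
  qed (simp_all only: L[OF S _ C] Xu_zero[OF _ u] zero_epowr[OF g] mult_zero_right)
 qed
 qed
qed

text \<open>Local and discrete series as before. The discrete one produces A3 and A2, and A2 is
  replaced by A5_star through \<open>Usup_le_Xu\<close>; that lemma needs finite u-mass on bounded
  intervals away from 0, hence only points x > 0 are used.\<close>

lemma upper_d:
 assumes a: "0 < a" and m: "0 < m" "m < p" and p: "1 < p" "a * m < p"
 shows "\<exists>c<top. \<forall>u w s g. copson_setting u w s a --> g \<in> borelfun --> (powint p s g) < top -->
  iterK_int a m u w s g \<le> c * (
   (Phi_Usup_int a (a * m / (p - a * m)) (a * m * (p - 1) / (p - a * m)) u w s +
   (\<integral>\<^sup>+x. w {..x} epowr (a * m / (p - a * m)) * Xu m p u s x epowr (a * (p - m) / (p - a * m)) \<partial>w)) epowr ((p - a * m) / p)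
   * powint p s g epowr (a * m / p))"
proof -
 define \<gamma> where "\<gamma> = a * (p - m) / (p - a * m)"
 have \<gamma>: "0 < \<gamma>" using a m p by (simp add: \<gamma>_def)
 have x1: "p / (p - m) * \<gamma> = a * (p / (p - a * m))" using m by (simp add: \<gamma>_def)
 have x2: "m * (p - 1) / (p - m) * \<gamma> = a * m * (p - 1) / (p - a * m)" using m by (simp add: \<gamma>_def)
 have x3: "(p - m) / p * (a * (p / (p - a * m))) = \<gamma>" using p by (simp add: \<gamma>_def)
 have th: "0 < (p - a * m) / p" using p by simp
 show ?thesis
 proof (rule ex_finiteE[OF local_norm_lt[OF m p(1)]], goal_cases)
 case (1 c1)
 note c1 = 1(1) and loc = 1(2)[rule_format (no_asm)]
 show ?thesis
 proof (rule ex_finiteE[OF Usup_le_Xu[OF m p(1) \<gamma>, unfolded x1 x2]], goal_cases)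
 case (1 c2)
 note c2 = 1(1) and UX = 1(2)[rule_format (no_asm)]
 show ?thesis
 proof (rule ex_finiteE[OF grid_upper_lt[OF a m(1) p c1]], goal_cases)
 case (1 c)
 note c = 1(1) and U = 1(2)[rule_format (no_asm)]
 show ?thesis
  unfolding \<gamma>_def[symmetric]
 proof (intro exI[of _ "c * (1 + c2) epowr ((p - a * m) / p)"] conjI allI impI)
  show "c * (1 + c2) epowr ((p - a * m) / p) < top"
   using th by (intro mult_less_top_ennreal epowr_less_top add_less_top_ennreal c c2) auto
  fix u w s and g :: "real => ennreal"
  assume S: "copson_setting u w s a" and g: "g \<in> borelfun" and N: "(powint p s g) < top"
  interpret copson_setting u w s a by (rule S)
  let ?A3 = "\<integral>\<^sup>+x. Phi a u w x epowr (a * m / (p - a * m)) * Usup a (a * m * (p - 1) / (p - a * m)) u s x \<partial>w"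
  let ?A2 = "\<integral>\<^sup>+x. w {..x} epowr (a * m / (p - a * m)) * Usup (a * (p / (p - a * m))) (a * m * (p - 1) / (p - a * m)) u s x \<partial>w"
  let ?A5 = "\<integral>\<^sup>+x. w {..x} epowr (a * m / (p - a * m)) * Xu m p u s x epowr \<gamma> \<partial>w"
  let ?N = "powint p s g epowr (a * m / p)"
  have m5: "(\<lambda>x. w {..x} epowr (a * m / (p - a * m)) * Xu m p u s x epowr \<gamma>) \<in> borel_measurable w"
   by (rule measurable_borel_like[OF w]) (intro borel_measurable_times_ennreal measurable_head_w measurable_Xu' m)
  have A2: "?A2 \<le> c2 * ?A5"
  proof -
   have null: "AE x in w. x \<notin> {..0}" using w w0 by (intro AE_not_in) auto
   have "?A2 \<le> (\<integral>\<^sup>+x. c2 * (w {..x} epowr (a * m / (p - a * m)) * Xu m p u s x epowr \<gamma>) \<partial>w)"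
   proof (rule nn_integral_mono_AE, use null in eventually_elim)
    fix x :: real assume "x \<notin> {..0}"
    then have "\<forall>z. u {x<..z} < top" using ufin by auto
    then have "w {..x} epowr (a * m / (p - a * m)) * Usup (a * (p / (p - a * m))) (a * m * (p - 1) / (p - a * m)) u s x
     \<le> w {..x} epowr (a * m / (p - a * m)) * (c2 * Xu m p u s x epowr \<gamma>)"
     by (intro mult_left_mono UX du s) auto
    then show "w {..x} epowr (a * m / (p - a * m)) * Usup (a * (p / (p - a * m))) (a * m * (p - 1) / (p - a * m)) u s x
     \<le> c2 * (w {..x} epowr (a * m / (p - a * m)) * Xu m p u s x epowr \<gamma>)"
     by (simp only: mult.left_commute)
   qed
   also have "\<dots> = c2 * ?A5" by (rule nn_integral_cmult[OF m5])
   finally show ?thesis .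
  qed
  have b1: "?A3 + ?A2 \<le> (1 + c2) * (?A3 + ?A5)"
  proof -
   have "?A3 + ?A2 \<le> ?A3 + c2 * ?A5" by (intro add_left_mono A2)
   also have "\<dots> \<le> (?A3 + ?A5) + c2 * (?A3 + ?A5)" by (intro add_mono mult_left_mono) auto
   finally show ?thesis by (simp only: distrib_right mult_1)
  qed
  have b2: "?A5 \<le> (1 + c2) * (?A3 + ?A5)"
  proof -
   have "?A5 \<le> (?A3 + ?A5) + c2 * (?A3 + ?A5)" by (simp add: add.assoc add_increasing)
   then show ?thesis by (simp only: distrib_right mult_1)
  qed
  show "iterK_int a m u w s g \<le> c * (1 + c2) epowr ((p - a * m) / p) * ((?A3 + ?A5) epowr ((p - a * m) / p) * ?N)"
  proof (rule iterK_integral_le[OF m(1)])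
   fix t assume G: "copson_grid u w s a t"
   have "iterK_int_upto (t 0) a m u w s g \<le> c * (((1 + c2) * (?A3 + ?A5)) epowr ((p - a * m) / p) * ?N)"
   proof (rule U[OF G g N b1, of "\<lambda>x. Xu m p u s x epowr ((p - m) / p)"])
    show "\<forall>n. copson_grid.local_norm u s t m g n \<le> c1 * ((\<integral>\<^sup>+y\<in>grid_cell t n. g y epowr p \<partial>s) epowr (m / p) * Xu m p u s (t n) epowr ((p - m) / p))"
     using loc[OF G g N] by blast
    show "antimono (\<lambda>x. Xu m p u s x epowr ((p - m) / p))"
     using m p by (intro antimonoI epowr_mono Xu_antimono[OF u m]) auto
    show "(\<integral>\<^sup>+x. w {..x} epowr (a * m / (p - a * m)) * (Xu m p u s x epowr ((p - m) / p)) epowr (a * (p / (p - a * m))) \<partial>w) \<le> (1 + c2) * (?A3 + ?A5)"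
     unfolding epowr_epowr x3 by (rule b2)
   qed
   also have "\<dots> = c * (1 + c2) epowr ((p - a * m) / p) * ((?A3 + ?A5) epowr ((p - a * m) / p) * ?N)"
    unfolding epowr_mult[OF less_imp_le[OF th]] by (simp only: mult.assoc)
   finally show "iterK_int_upto (t 0) a m u w s g \<le> c * (1 + c2) epowr ((p - a * m) / p) * ((?A3 + ?A5) epowr ((p - a * m) / p) * ?N)" .
  qed
 qed
 qed
 qed
 qed
qed

section \<open>Weights as measures\<close>

text \<open>A weight is only Lebesgue measurable; the push-forward under the identity restricts f dx
  to the Borel sets, where heads and tails are measured. The indicator discards the values of f
  outside (0,\<infinity>).\<close>

definition wmeas :: "(real => ennreal) => real measure" where
 "wmeas f = distr (density lebesgue (\<lambda>x. f x * indicator {0<..} x)) borel (\<lambda>x. x)"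

lemma sets_wmeas [simp, measurable_cong]: "sets (wmeas f) = sets borel"
 by (simp add: wmeas_def)

lemma Mplus_iff: "f \<in> Mplus \<longleftrightarrow> (\<lambda>x. f x * indicator {0<..} x) \<in> borel_measurable lebesgue"
 unfolding Mplus_def by (rule borel_measurable_restrict_space_iff_ennreal) simp

lemma nn_integral_wmeas:
 assumes f: "f \<in> Mplus" and g: "g \<in> borelfun"
 shows "(\<integral>\<^sup>+x. g x \<partial>wmeas f) = (\<integral>\<^sup>+x\<in>{0<..}. g x * f x \<partial>lebesgue)"
proof -
 have id: "(\<lambda>x. x) \<in> lebesgue \<rightarrow>\<^sub>M borel" by (simp add: measurable_completion)
 have g': "g \<in> borel_measurable lebesgue" using g by (simp add: measurable_completion)
 have "(\<integral>\<^sup>+x. g x \<partial>wmeas f) = (\<integral>\<^sup>+x. g x \<partial>density lebesgue (\<lambda>x. f x * indicator {0<..} x))"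
  unfolding wmeas_def using id g by (intro nn_integral_distr) (auto cong: measurable_cong_sets)
 also have "\<dots> = (\<integral>\<^sup>+x. f x * indicator {0<..} x * g x \<partial>lebesgue)"
  using f g' unfolding Mplus_iff by (intro nn_integral_density) auto
 finally show ?thesis by (simp add: mult_ac)
qed

lemma AE_lebesgue_neq: "AE x in lebesgue. x \<noteq> (b::real)"
 using AE_not_in[of "{b}" lebesgue] by simp

text \<open>The integrals of the statement are over open intervals, those of the measure-theoretic
  part over half-open ones; the endpoint b is a null set.\<close>

lemma integ_wmeas_Ioc:
 assumes f: "f \<in> Mplus" and g: "g \<in> borelfun" and a: "0 \<le> a"
  and G: "\<And>x. a < x ==> x < b ==> G x = g x * f x"
 shows "integ G a b = (\<integral>\<^sup>+x\<in>{a<..b}. g x \<partial>wmeas f)"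
proof -
 have "(\<integral>\<^sup>+x\<in>{a<..b}. g x \<partial>wmeas f) = (\<integral>\<^sup>+x\<in>{0<..}. g x * indicator {a<..b} x * f x \<partial>lebesgue)"
  using g by (intro nn_integral_wmeas f) auto
 also have "\<dots> = integ G a b"
  unfolding integ_def
  by (rule nn_integral_cong_AE, use AE_lebesgue_neq[of b] in eventually_elim)
   (use a G in \<open>auto split: split_indicator simp: mult.commute\<close>)
 finally show ?thesis ..
qed

lemma integ_tail_wmeas:
 assumes f: "f \<in> Mplus" and g: "g \<in> borelfun" and a: "0 \<le> a"
  and G: "\<And>x. a < x ==> G x = g x * f x"
 shows "integ_tail G a = (\<integral>\<^sup>+x\<in>{a<..}. g x \<partial>wmeas f)"
proof -
 have "(\<integral>\<^sup>+x\<in>{a<..}. g x \<partial>wmeas f) = (\<integral>\<^sup>+x\<in>{0<..}. g x * indicator {a<..} x * f x \<partial>lebesgue)"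
  using g by (intro nn_integral_wmeas f) auto
 also have "\<dots> = integ_tail G a"
  unfolding integ_tail_def
  by (rule nn_integral_cong) (use a G in \<open>auto split: split_indicator simp: mult.commute\<close>)
 finally show ?thesis ..
qed

lemma emeasure_wmeas_atMost_0: assumes "f \<in> Mplus" shows "(wmeas f) {..0} = 0"
proof -
 have "(wmeas f) {..0} = (\<integral>\<^sup>+x. indicator {..0} x \<partial>wmeas f)" by simp
 also have "\<dots> = (\<integral>\<^sup>+x\<in>{0<..}. indicator {..0} x * f x \<partial>lebesgue)"
  by (intro nn_integral_wmeas assms) auto
 also have "\<dots> = (\<integral>\<^sup>+x. 0 \<partial>(lebesgue :: real measure))"
  by (rule nn_integral_cong) (auto split: split_indicator)
 finally show ?thesis by simp
qed

lemma AE_wmeas_pos: assumes "f \<in> Mplus" shows "AE x in wmeas f. 0 < x"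
proof -
 have "{..0} \<in> null_sets (wmeas f)" using emeasure_wmeas_atMost_0[OF assms] by auto
 then have "AE x in wmeas f. x \<notin> {..0}" by (rule AE_not_in)
 then show ?thesis by eventually_elim auto
qed

lemma integ_tail_wmeas_0:
 assumes f: "f \<in> Mplus" and g: "g \<in> borelfun"
  and G: "\<And>x. 0 < x ==> G x = g x * f x"
 shows "integ_tail G 0 = (\<integral>\<^sup>+x. g x \<partial>wmeas f)"
proof -
 have "integ_tail G 0 = (\<integral>\<^sup>+x\<in>{0<..}. g x \<partial>wmeas f)" by (rule integ_tail_wmeas[OF f g order_refl G])
 also have "\<dots> = (\<integral>\<^sup>+x. g x \<partial>wmeas f)"
  by (rule nn_integral_cong_AE, use AE_wmeas_pos[OF f] in eventually_elim) auto
 finally show ?thesis .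
qed

lemma integ_wmeas_atMost:
 assumes f: "f \<in> Mplus" and g: "g \<in> borelfun"
  and G: "\<And>x. 0 < x ==> x < b ==> G x = g x * f x"
 shows "integ G 0 b = (\<integral>\<^sup>+x\<in>{..b}. g x \<partial>wmeas f)"
proof -
 have "integ G 0 b = (\<integral>\<^sup>+x\<in>{0<..b}. g x \<partial>wmeas f)" by (rule integ_wmeas_Ioc[OF f g order_refl G])
 also have "\<dots> = (\<integral>\<^sup>+x\<in>{..b}. g x \<partial>wmeas f)"
  by (rule nn_integral_cong_AE, use AE_wmeas_pos[OF f] in eventually_elim) (auto split: split_indicator)
 finally show ?thesis .
qed

lemma integ_eq_emeasure: "f \<in> Mplus ==> 0 < a ==> integ f a b = (wmeas f) {a<..b}"
 using integ_wmeas_Ioc[of f "\<lambda>_. 1" a b f] by simp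

lemma integ_0_eq_emeasure: "f \<in> Mplus ==> integ f 0 b = (wmeas f) {..b}"
 using integ_wmeas_atMost[of f "\<lambda>_. 1" b f] by simp

lemma integ_tail_eq_emeasure: "f \<in> Mplus ==> 0 \<le> a ==> integ_tail f a = (wmeas f) {a<..}"
 using integ_tail_wmeas[of f "\<lambda>_. 1" a f] by simp

lemma diffuse_wmeas: assumes "f \<in> Mplus" shows "diffuse (wmeas f)"
 unfolding diffuse_def
proof (intro conjI allI)
 fix b
 have "(wmeas f) {b} = (\<integral>\<^sup>+x. indicator {b} x \<partial>wmeas f)" by simp
 also have "\<dots> = (\<integral>\<^sup>+x\<in>{0<..}. indicator {b} x * f x \<partial>lebesgue)"
  by (intro nn_integral_wmeas assms) auto
 also have "\<dots> = (\<integral>\<^sup>+x. 0 \<partial>(lebesgue :: real measure))"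
  by (rule nn_integral_cong_AE, use AE_lebesgue_neq[of b] in eventually_elim) auto
 finally show "(wmeas f) {b} = 0" by simp
qed simp

lemma weight_triplesD:
 assumes "(u, w, v) \<in> weight_triples m q"
 shows "u \<in> Mplus" "w \<in> Mplus" "v \<in> Mplus" "admissible m q u w"
 using assms by (auto simp: weight_triples_def weight_def)

lemma vdual_Mplus: assumes "v \<in> Mplus" shows "vdual p v \<in> Mplus"
proof -
 have "v \<in> borel_measurable (lebesgue_on {0<..})" using assms by (simp add: Mplus_def)
 then show ?thesis unfolding Mplus_def vdual_def by measurable
qed

lemma Mplus_times: "f \<in> Mplus ==> g \<in> Mplus ==> (\<lambda>x. f x * g x) \<in> Mplus"
 unfolding Mplus_def by measurable

lemma Mplus_borel: assumes "g \<in> borelfun" shows "g \<in> Mplus"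
proof -
 have "g \<in> borel_measurable lebesgue" using assms by (simp add: measurable_completion)
 then show ?thesis unfolding Mplus_def by (rule measurable_restrict_space1)
qed

section \<open>The quantities of the statement expressed through the three measures\<close>

locale weights =
 fixes p q m :: real and u w v :: "real => ennreal"
 assumes p: "1 < p" and q: "0 < q" and m: "0 < m" and tr: "(u, w, v) \<in> weight_triples m q"
begin

abbreviation "U \<equiv> wmeas u"
abbreviation "Wt \<equiv> wmeas w"
abbreviation "S \<equiv> wmeas (vdual p v)"

lemmas Mp = weight_triplesD(1-3)[OF tr] vdual_Mplus[OF weight_triplesD(3)[OF tr]]

lemma measurable_Ioc_epowr: "(\<lambda>s. U {s<..t} epowr e) \<in> borelfun"
 by (rule borel_measurable_epowr[OF measurable_Ioc']) simp

lemma integ_Phi: "integ (\<lambda>s. integ u s t epowr (q / m) * w s) 0 t = Phi (q / m) U Wt t"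
 unfolding Phi_def
 by (rule integ_wmeas_atMost[OF Mp(2) measurable_Ioc_epowr]) (simp add: integ_eq_emeasure Mp)

lemma integ_Phi': "integ (\<lambda>s. w s * integ u s t epowr (q / m)) 0 t = Phi (q / m) U Wt t"
 unfolding integ_Phi[symmetric] by (simp only: mult.commute)

lemma Phi_pos: "0 < t ==> 0 < Phi (q / m) U Wt t"
 and Phi_fin: "0 < t ==> Phi (q / m) U Wt t < top"
 using weight_triplesD(4)[OF tr] q
 by (auto simp: admissible_def integ_Phi zero_less_iff_neq_zero epowr_eq_0_iff less_top[symmetric] epowr_eq_top_iff)

lemma Phi_meas: "Phi (q / m) U Wt \<in> borelfun"
 by (rule borel_measurable_mono_ennreal) (rule monoI, rule Phi_mono, use q m in auto)

text \<open>If u had infinite mass on (x,y], then so on (z,y] for every z \<le> x. Finiteness of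
  Phi(y) would force w {..x} = 0, and then Phi(x) = 0 contradicts admissibility.\<close>

lemma U_finite: assumes "0 < x" shows "U {x<..y} < top"
proof (rule ccontr)
 assume "\<not> U {x<..y} < top"
 then have top: "U {x<..y} = top" using less_top by blast
 then have xy: "x < y" by (cases "x < y") auto
 have hs: "{..x} \<in> sets Wt" by simp
 have "Wt {..x} * top \<le> Phi (q / m) U Wt y"
 proof -
  have "top * Wt {..x} = (\<integral>\<^sup>+z. top * indicator {..x} z \<partial>Wt)"
   by (rule nn_integral_cmult_indicator[OF hs, symmetric])
  also have "\<dots> \<le> Phi (q / m) U Wt y"
   unfolding Phi_def
  proof (intro nn_integral_mono)
   fix z
   have "U {z<..y} = top" if "z \<le> x"
   proof -
    have "{x<..y} \<subseteq> {z<..y}" using that by auto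
    then show ?thesis using emeasure_mono[of "{x<..y}" "{z<..y}" U] top by (simp add: top_unique)
   qed
   then show "top * indicator {..x} z \<le> U {z<..y} epowr (q / m) * indicator {..y} z"
    using xy q m by (auto split: split_indicator)
  qed
  finally show ?thesis by (simp only: mult.commute)
 qed
 then have W0: "Wt {..x} = 0" using Phi_fin[of y] assms xy
  by (auto simp: ennreal_mult_top top_unique split: if_splits)
 have "Phi (q / m) U Wt x = (\<integral>\<^sup>+z. 0 \<partial>Wt)"
  unfolding Phi_def
 proof (rule nn_integral_cong_AE)
  have "{..x} \<in> null_sets Wt" using W0 by auto
  then have "AE z in Wt. z \<notin> {..x}" by (rule AE_not_in)
  then show "AE z in Wt. U {z<..x} epowr (q / m) * indicator {..x} z = 0" by eventually_elim auto
 qed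
 then show False using Phi_pos[OF assms] by simp
qed

lemma tail_finite_iff: "tail_finite p v \<longleftrightarrow> (\<forall>t>0. S {t<..} < top)"
 by (auto simp: tail_finite_def integ_tail_eq_emeasure Mp)

lemma setting: assumes "tail_finite p v" shows "copson_setting U Wt S (q / m)"
 using assms q m unfolding tail_finite_iff
 by unfold_locales (auto intro!: diffuse_wmeas Mp U_finite Phi_fin Phi_pos emeasure_wmeas_atMost_0)

lemma exps: "q / m * m = q" "1 / conj_exp p = (p - 1) / p" "1 - conj_exp p = - (1 / (p - 1))"
 using p m by (auto simp: conj_exp_def field_simps)

text \<open>B1 and B4 are q-th powers: of A1, and of A4 or A4_star for X = \<open>Xs\<close> or X =
  \<open>Xu\<close>. The integrals B2, B3 and B5 are r-th powers, r = p q / (p - q), of A2, A3, and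
  A5 or A5_star.\<close>

definition B1 where "B1 = (SUP t\<in>{0<..}. Phi (q / m) U Wt t * S {t<..} epowr (q * (p - 1) / p))"

definition B4 where "B4 X = (SUP t\<in>{0<..}. Wt {..t} * X t epowr (q / m * (p - m) / p))"

definition B5 where "B5 X = (\<integral>\<^sup>+t. Wt {..t} epowr (q / (p - q)) * X t epowr (q / m * (p - m) / (p - q)) \<partial>Wt)"

definition B2 where "B2 = (\<integral>\<^sup>+t. Wt {..t} epowr (q / (p - q)) * Usup (q / m * (p / (p - q))) (q * (p - 1) / (p - q)) U S t \<partial>Wt)"

definition B3 where "B3 = (\<integral>\<^sup>+t. Phi (q / m) U Wt t epowr (q / (p - q)) * Usup (q / m) (q * (p - 1) / (p - q)) U S t \<partial>Wt)"

lemma A1_eq: "A1 p q m u w v epowr q = B1"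
proof -
 have "(Phi (q / m) U Wt t epowr (1 / q) * S {t<..} epowr ((p - 1) / p)) epowr q =
  Phi (q / m) U Wt t * S {t<..} epowr (q * (p - 1) / p)" for t
  using q by (simp add: epowr_mult epowr_epowr mult.commute)
 then show ?thesis
  unfolding A1_def B1_def integ_Phi' using q
  by (simp add: epowr_SUP exps integ_tail_eq_emeasure Mp cong: SUP_cong_simp)
qed

lemma A4_gen:
 assumes mp: "m < p" and X: "\<And>t. 0 < t ==> F t = X t"
 shows "(SUP t\<in>{0<..}. integ w 0 t epowr (1 / q) * F t epowr ((p - m) / (p * m))) epowr q = B4 X"
proof -
 have e: "(p - m) / (p * m) * q = q / m * (p - m) / p" using p m by (simp add: field_simps)
 then have "(integ w 0 t epowr (1 / q) * F t epowr ((p - m) / (p * m))) epowr q =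
  Wt {..t} * X t epowr (q / m * (p - m) / p)" if "0 < t" for t
  using q unfolding epowr_mult[OF less_imp_le[OF q]] epowr_epowr e X[OF that] by (simp add: integ_0_eq_emeasure Mp)
 then show ?thesis using q by (simp add: epowr_SUP B4_def cong: SUP_cong_simp)
qed

lemma measurable_Xs_term:
 "(\<lambda>x. U {t<..x} epowr c * S {x<..} epowr d) \<in> borelfun"
 by (intro borel_measurable_times_ennreal borel_measurable_epowr measurable_Ioc measurable_tail) auto

lemma integ_tail_Xs: "0 < t ==> integ_tail (\<lambda>s. integ u t s epowr (p / (p - m)) *
  integ_tail (vdual p v) s epowr (p * (m - 1) / (p - m)) * vdual p v s) t = Xs m p U S t"
 unfolding Xs_def
 by (rule integ_tail_wmeas[OF Mp(4) measurable_Xs_term]) (auto simp: integ_eq_emeasure integ_tail_eq_emeasure Mp)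

lemma integ_tail_Xu: "0 < t ==> integ_tail (\<lambda>s. integ u t s epowr (m / (p - m)) * u s *
  integ_tail (vdual p v) s epowr (m * (p - 1) / (p - m))) t = Xu m p U S t"
 unfolding Xu_def
 by (rule integ_tail_wmeas[OF Mp(1) measurable_Xs_term]) (auto simp: integ_eq_emeasure integ_tail_eq_emeasure Mp mult_ac)

lemma A4_eq: "m < p ==> A4 p q m u w v epowr q = B4 (Xs m p U S)"
 and A4_star_eq: "m < p ==> A4_star p q m u w v epowr q = B4 (Xu m p U S)"
 unfolding A4_def A4_star_def by (simp_all add: A4_gen integ_tail_Xs integ_tail_Xu)

lemma rexp: "q < p ==> p * q / (p - q) / p = q / (p - q)" "q < p ==> p * q / (p - q) / m = q / m * (p / (p - q))"
 "q < p ==> p * q / (p - q) / conj_exp p = q * (p - 1) / (p - q)" "q < p ==> 1 / (p * q / (p - q)) * q = (p - q) / p"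
 "q < p ==> q * (p - m) / (m * (p - q)) = q / m * (p - m) / (p - q)"
 using p q m by (auto simp: conj_exp_def field_simps)

lemma measurable_W_epowr: "(\<lambda>t. Wt {..t} epowr e) \<in> borelfun"
 by (rule borel_measurable_epowr[OF measurable_head]) simp

lemma integ_A:
 assumes "F \<in> borelfun" "X \<in> borelfun" "\<And>t. 0 < t ==> F' t = F t" "\<And>t. 0 < t ==> X' t = X t"
 shows "integ_tail (\<lambda>t. F' t * w t * X' t) 0 = (\<integral>\<^sup>+t. F t * X t \<partial>Wt)"
 by (rule integ_tail_wmeas_0[OF Mp(2)]) (use assms in \<open>auto simp: mult_ac\<close>)

lemma measurable_Usup': "0 \<le> b ==> Usup b k U S \<in> borelfun"
 by (rule borel_measurable_antimono_ennreal) (rule antimonoI, rule Usup_antimono, auto)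

lemma A2_eq: assumes qp: "q < p" shows "A2 p q m u w v epowr q = B2 epowr ((p - q) / p)"
 unfolding A2_def Let_def epowr_epowr rexp[OF qp] B2_def
 by (subst integ_A[OF measurable_W_epowr[of "q / (p - q)"] measurable_Usup'[of "q / m * (p / (p - q))" "q * (p - 1) / (p - q)"]])
   (use p q m qp in \<open>auto simp: Usup_def integ_eq_emeasure integ_0_eq_emeasure integ_tail_eq_emeasure Mp\<close>)

lemma A3_eq: assumes qp: "q < p" shows "A3 p q m u w v epowr q = B3 epowr ((p - q) / p)"
 unfolding A3_def Let_def epowr_epowr rexp[OF qp] B3_def integ_Phi'
 by (subst integ_A[OF borel_measurable_epowr[OF Phi_meas, of "q / (p - q)"] measurable_Usup'[of "q / m" "q * (p - 1) / (p - q)"]])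
   (use p q m qp in \<open>auto simp: Usup_def integ_eq_emeasure integ_0_eq_emeasure integ_tail_eq_emeasure Mp\<close>)

lemma Xs_antimono: assumes "m < p" "x \<le> y" shows "Xs m p U S y \<le> Xs m p U S x"
 unfolding Xs_def
 by (intro nn_integral_mono) (use assms p in \<open>auto split: split_indicator intro!: mult_right_mono epowr_mono emeasure_mono\<close>)

lemma measurable_X: "m < p ==> Xs m p U S \<in> borelfun" "m < p ==> Xu m p U S \<in> borelfun"
 by (rule borel_measurable_antimono_ennreal, rule antimonoI, erule (1) Xs_antimono)
   (rule borel_measurable_antimono_ennreal, rule antimonoI, rule Xu_antimono, use m in auto)

lemma A5_eq: assumes "m < p" and qp: "q < p" shows "A5 p q m u w v epowr q = B5 (Xs m p U S) epowr ((p - q) / p)"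
 unfolding A5_def Let_def epowr_epowr rexp[OF qp] B5_def
 by (subst integ_A[OF measurable_W_epowr[of "q / (p - q)"] borel_measurable_epowr[OF measurable_X(1), of "q / m * (p - m) / (p - q)"]])
   (use assms in \<open>auto simp: integ_tail_Xs integ_0_eq_emeasure Mp\<close>)

lemma A5_star_eq: assumes "m < p" and qp: "q < p" shows "A5_star p q m u w v epowr q = B5 (Xu m p U S) epowr ((p - q) / p)"
 unfolding A5_star_def Let_def epowr_epowr rexp[OF qp] B5_def
 by (subst integ_A[OF measurable_W_epowr[of "q / (p - q)"] borel_measurable_epowr[OF measurable_X(2), of "q / m * (p - m) / (p - q)"]])
   (use assms in \<open>auto simp: integ_tail_Xu integ_0_eq_emeasure Mp\<close>)

end

section \<open>The dual weight and the substitution h = g v^(1 - p')\<close>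

lemma vdual_exp: "1 < p ==> 1 - conj_exp p = - (1 / (p - 1))"
 by (simp add: conj_exp_def field_simps)

lemma vdual_eq_0_iff: "1 < p ==> vdual p v x = 0 \<longleftrightarrow> v x = top"
 unfolding vdual_def vdual_exp by (cases "v x" rule: ennreal_pos_cases) (auto simp: ennreal_epowr_pos epowr_def)

lemma vdual_eq_top_iff: "1 < p ==> vdual p v x = top \<longleftrightarrow> v x = 0"
 unfolding vdual_def vdual_exp by (cases "v x" rule: ennreal_pos_cases) (auto simp: ennreal_epowr_pos epowr_def)

lemma vdual_power:
 assumes "1 < p" "v x \<noteq> 0" "v x \<noteq> top" shows "vdual p v x epowr (p - 1) * v x = 1"
proof -
 have e: "(1 - conj_exp p) * (p - 1) = -1" using assms by (simp add: vdual_exp)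
 have "(v x epowr (-1)) * (v x epowr 1) = 1" by (subst epowr_add'[symmetric]) (use assms in auto)
 then show ?thesis unfolding vdual_def epowr_epowr e by simp
qed

text \<open>For 0 < v < top this is (v^(1 - p'))^(p - 1) v = 1. For v = 0 the left side is 0, and v
  = top makes the dual weight 0 and hence h = 0.\<close>

lemma vdual_power_le:
 assumes "1 < p" "h \<le> vdual p v x" shows "h epowr p * v x \<le> h"
proof -
 consider "v x = 0" | "v x = top" | "v x \<noteq> 0" "v x \<noteq> top" by blast
 then show ?thesis
 proof cases
  case 2
  then have "h = 0" using assms vdual_eq_0_iff[OF assms(1), of v x] by simp
  then show ?thesis using assms by simp
 next
  case 3
  have "h epowr p = h * h epowr (p - 1)" using epowr_add[of 1 "p - 1" h] assms by simp
  then have "h epowr p * v x = h * (h epowr (p - 1) * v x)" by (simp only: mult.assoc)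
  also have "\<dots> \<le> h * (vdual p v x epowr (p - 1) * v x)"
   using assms by (intro mult_left_mono mult_right_mono epowr_mono) auto
  finally show ?thesis unfolding vdual_power[where v = v, OF assms(1) 3] by simp
 qed simp
qed

lemma vdual_test_le:
 assumes "1 < p" shows "(g * vdual p v x) epowr p * v x \<le> g epowr p * vdual p v x"
proof -
 have "(g * vdual p v x) epowr p * v x = g epowr p * (vdual p v x epowr p * v x)"
  using assms by (simp add: epowr_mult mult.assoc)
 also have "\<dots> \<le> g epowr p * vdual p v x" using assms by (intro mult_left_mono vdual_power_le) auto
 finally show ?thesis .
qed

text \<open>Where the dual weight vanishes, v is infinite, and finiteness of h^p v forces h = 0; the
  convention 0 / 0 = 0 then makes the quotient recover h there too.\<close>

lemma vdual_quotient:
 assumes p: "1 < p" and fin: "vdual p v x \<noteq> top" "h epowr p * v x \<noteq> top"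
 shows "h / vdual p v x * vdual p v x = h" "(h / vdual p v x) epowr p * vdual p v x \<le> h epowr p * v x"
proof -
 let ?s = "vdual p v x"
 have *: "h / ?s * ?s = h \<and> (h / ?s) epowr p * ?s \<le> h epowr p * v x"
 proof (cases "?s = 0")
  case True
  then have "v x = top" using vdual_eq_0_iff[OF p, of v x] by simp
  then have "h epowr p = 0" using fin(2) by (auto simp: ennreal_mult_top split: if_splits)
  then have "h = 0" using p by (simp add: epowr_eq_0_iff)
  then show ?thesis using p by simp
 next
  case False
  then have v: "v x \<noteq> 0" "v x \<noteq> top" using vdual_eq_0_iff[OF p, of v x] vdual_eq_top_iff[OF p, of v x] fin by auto
  have 1: "h / ?s * ?s = h" using False fin by (simp add: ennreal_divide_times ennreal_divide_self less_top zero_less_iff_neq_zero)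
  have s: "?s * (?s epowr (p - 1) * v x) = ?s epowr p * v x"
   using epowr_add[of 1 "p - 1" ?s] p by (simp add: mult.assoc)
  have "(h / ?s) epowr p * ?s = (h / ?s) epowr p * (?s * (?s epowr (p - 1) * v x))"
   unfolding vdual_power[where v = v, OF p v] by simp
  also have "\<dots> = (h / ?s * ?s) epowr p * v x" unfolding s using p by (simp add: epowr_mult mult.assoc)
  finally show ?thesis unfolding 1 by simp
 qed
 then show "h / ?s * ?s = h" "(h / ?s) epowr p * ?s \<le> h epowr p * v x" by auto
qed

context weights
begin

lemma lhs_norm_power:
 assumes H: "H \<in> borelfun" and hH: "\<And>s. 0 < s ==> integ_tail h s = H s"
 shows "lhs_norm m q u w h epowr q = (\<integral>\<^sup>+t. (\<integral>\<^sup>+s\<in>{t<..}. H s epowr m \<partial>U) epowr (q / m) \<partial>Wt)"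
proof -
 have i: "integ_tail (\<lambda>s. integ_tail h s epowr m * u s) t = (\<integral>\<^sup>+s\<in>{t<..}. H s epowr m \<partial>U)" if "0 < t" for t
  by (rule integ_tail_wmeas[OF Mp(1) borel_measurable_epowr[OF H]]) (use that hH in auto)
 have "(\<lambda>t. \<integral>\<^sup>+s\<in>{t<..}. H s epowr m \<partial>U) \<in> borelfun"
  by (rule borel_measurable_antimono_ennreal)
    (intro antimonoI nn_integral_mono, auto split: split_indicator)
 then have "integ_tail (\<lambda>t. integ_tail (\<lambda>s. integ_tail h s epowr m * u s) t epowr (q / m) * w t) 0 =
  (\<integral>\<^sup>+t. (\<integral>\<^sup>+s\<in>{t<..}. H s epowr m \<partial>U) epowr (q / m) \<partial>Wt)"
  by (intro integ_tail_wmeas_0[OF Mp(2)] borel_measurable_epowr) (auto simp: i)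
 then show ?thesis unfolding lhs_norm_def epowr_epowr using q by simp
qed

lemma rhs_norm_power: "rhs_norm p v h epowr q = integ_tail (\<lambda>t. h t epowr p * v t) 0 epowr (q / p)"
 by (simp add: rhs_norm_def epowr_epowr)

text \<open>Left of t the integral of h is at least its value at t. Stated for h itself and without
  finiteness of s, since it serves the case of infinite tails.\<close>

lemma lhs_norm_ge:
 assumes t: "0 < t"
 shows "Phi (q / m) U Wt t * integ_tail h t epowr q \<le> lhs_norm m q u w h epowr q"
proof -
 let ?H = "integ_tail h"
 have anti: "antimono ?H"
  unfolding integ_tail_def by (intro antimonoI nn_integral_mono) (auto split: split_indicator)
 have H: "?H \<in> borelfun" by (rule borel_measurable_antimono_ennreal[OF anti])
 have "Phi (q / m) U Wt t * ?H t epowr q = (\<integral>\<^sup>+y. U {y<..t} epowr (q / m) * indicator {..t} y * ?H t epowr q \<partial>Wt)"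
  unfolding Phi_def
  by (rule nn_integral_multc[symmetric], rule measurable_borel_like)
   (auto intro!: borel_measurable_times_ennreal measurable_Ioc_epowr)
 also have "\<dots> \<le> (\<integral>\<^sup>+y. (\<integral>\<^sup>+s\<in>{y<..}. ?H s epowr m \<partial>U) epowr (q / m) \<partial>Wt)"
 proof (intro nn_integral_mono)
  fix y
  have yt: "{y<..t} \<in> sets U" by simp
  have "U {y<..t} * ?H t epowr m = (\<integral>\<^sup>+s. ?H t epowr m * indicator {y<..t} s \<partial>U)"
   unfolding nn_integral_cmult_indicator[OF yt] by (rule mult.commute)
  also have "\<dots> \<le> (\<integral>\<^sup>+s\<in>{y<..}. ?H s epowr m \<partial>U)"
   by (intro nn_integral_mono) (use m antimonoD[OF anti] in \<open>auto split: split_indicator intro!: epowr_mono\<close>)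
  finally have "(U {y<..t} * ?H t epowr m) epowr (q / m) \<le> (\<integral>\<^sup>+s\<in>{y<..}. ?H s epowr m \<partial>U) epowr (q / m)"
   using q m by (intro epowr_mono) auto
  then show "U {y<..t} epowr (q / m) * indicator {..t} y * ?H t epowr q \<le> (\<integral>\<^sup>+s\<in>{y<..}. ?H s epowr m \<partial>U) epowr (q / m)"
   using q m by (auto simp: epowr_mult epowr_epowr split: split_indicator)
 qed
 also have "\<dots> = lhs_norm m q u w h epowr q" by (rule lhs_norm_power[OF H refl, symmetric])
 finally show ?thesis .
qed

lemma lhs_le_rhs:
 assumes "C_opt p q m u w v < c" "h \<in> Mplus" shows "lhs_norm m q u w h epowr q \<le> c epowr q * rhs_norm p v h epowr q"
proof -
 obtain d where d: "\<forall>h\<in>Mplus. lhs_norm m q u w h \<le> d * rhs_norm p v h" "d < c"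
  using assms(1) unfolding C_opt_eq_Inf Inf_less_iff by auto
 have "lhs_norm m q u w h \<le> d * rhs_norm p v h" using d assms(2) by blast
 also have "\<dots> \<le> c * rhs_norm p v h" using d(2) by (intro mult_right_mono) auto
 finally have "lhs_norm m q u w h epowr q \<le> (c * rhs_norm p v h) epowr q" using q by (intro epowr_mono) auto
 then show ?thesis using q by (simp add: epowr_mult)
qed

lemma copson_wmeas: "g \<in> borelfun ==> 0 < s ==> integ_tail (\<lambda>x. g x * vdual p v x) s = copson S g s"
 unfolding copson_def by (rule integ_tail_wmeas[OF Mp(4)]) auto

text \<open>The test function g v^(1 - p') has weighted norm at most the norm of g with respect to
  s. Equality may fail where v = 0, since there the dual weight is infinite while the factor v gives
  0.\<close>

lemma Cineq_C_opt:
 assumes "C_opt p q m u w v < c" shows "Cineq (q / m) m p U Wt S (c epowr q)"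
 unfolding Cineq_def
proof (intro ballI)
 fix g :: "real => ennreal" assume g: "g \<in> borelfun"
 let ?h = "\<lambda>x. g x * vdual p v x"
 have h: "?h \<in> Mplus" by (intro Mplus_times Mplus_borel g Mp)
 have "(\<integral>\<^sup>+x. iterK m U S g x epowr (q / m) \<partial>Wt) = lhs_norm m q u w ?h epowr q"
  unfolding iterK_def by (rule lhs_norm_power[OF measurable_copson copson_wmeas[OF g], symmetric])
 also have "\<dots> \<le> c epowr q * rhs_norm p v ?h epowr q" by (rule lhs_le_rhs[OF assms h])
 also have "\<dots> \<le> c epowr q * (powint p S g) epowr (q / p)"
 proof -
  have "integ_tail (\<lambda>t. ?h t epowr p * v t) 0 \<le> integ_tail (\<lambda>t. g t epowr p * vdual p v t) 0"
   unfolding integ_tail_def by (intro nn_integral_mono mult_right_mono vdual_test_le p) simp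
  also have "\<dots> = (powint p S g)"
   by (rule integ_tail_wmeas_0[OF Mp(4) borel_measurable_epowr[OF g]]) simp
  finally show ?thesis unfolding rhs_norm_power using p q by (intro mult_left_mono epowr_mono) auto
 qed
 finally show "(\<integral>\<^sup>+x. iterK m U S g x epowr (q / m) \<partial>Wt) \<le> c epowr q * (powint p S g) epowr (q / m * m / p)"
  unfolding exps .
qed

text \<open>An integrable function is finite almost everywhere; countably many tails exhaust
  (0,\<infinity>).\<close>

lemma AE_vdual_finite:
 assumes tf: "tail_finite p v" shows "AE x in lebesgue. 0 < x --> vdual p v x \<noteq> top"
proof -
 have "AE x in lebesgue. 1 / real (Suc n) < x --> vdual p v x \<noteq> top" for n
 proof -
  let ?f = "\<lambda>x. vdual p v x * indicator {1 / real (Suc n)<..} x"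
  have eq: "?f = (\<lambda>x. (vdual p v x * indicator {0<..} x) * indicator {1 / real (Suc n)<..} x)"
   by (auto split: split_indicator simp: fun_eq_iff less_trans[of 0 "1 / real (Suc n)"])
  have "(\<lambda>x. vdual p v x * indicator {0<..} x) \<in> borel_measurable lebesgue" using Mp(4) by (simp add: Mplus_iff)
  then have f: "?f \<in> borel_measurable lebesgue"
   unfolding eq by (rule borel_measurable_times_ennreal) (rule borel_measurable_indicator, simp)
  have "integral\<^sup>N lebesgue ?f < top" using tf unfolding tail_finite_def integ_tail_def by simp
  then have "AE x in lebesgue. ?f x \<noteq> \<infinity>" by (intro nn_integral_noteq_infinite f) auto
  then show ?thesis by eventually_elim auto
 qed
 then have "AE x in lebesgue. \<forall>n. 1 / real (Suc n) < x --> vdual p v x \<noteq> top" unfolding AE_all_countable by blast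
 then show ?thesis
 proof eventually_elim
  case (elim x)
  show ?case
  proof
   assume "0 < x"
   then obtain n where "1 / real (Suc n) < x" using nat_approx_posE by blast
   then show "vdual p v x \<noteq> top" using elim by blast
  qed
 qed
qed

lemma C_opt_le:
 assumes tf: "tail_finite p v"
  and le: "\<And>g. g \<in> borelfun ==> (powint p S g) < top ==>
   (\<integral>\<^sup>+x. iterK m U S g x epowr (q / m) \<partial>Wt) \<le> D * (powint p S g) epowr (q / p)"
 shows "C_opt p q m u w v \<le> D epowr (1 / q)"
 unfolding C_opt_def
proof (intro SUP_least)
 fix h assume h: "h \<in> Mplus"
 let ?R = "integ_tail (\<lambda>t. h t epowr p * v t) 0"
 show "lhs_norm m q u w h / rhs_norm p v h \<le> D epowr (1 / q)"
 \<comment> \<open>An infinite denominator makes the quotient 0.\<close>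
 proof (cases "?R = top")
  case True
  then show ?thesis using p by (simp add: rhs_norm_def)
 next
  case False
  have m1: "(\<lambda>x. h x epowr p * v x) \<in> Mplus"
   using h Mp(3) unfolding Mplus_def by measurable
  have "AE x in lebesgue. h x epowr p * v x * indicator {0<..} x \<noteq> \<infinity>"
   using m1 False unfolding Mplus_iff integ_tail_def by (intro nn_integral_noteq_infinite) auto
  then have fin: "AE x in lebesgue. 0 < x --> h x epowr p * v x \<noteq> top" by eventually_elim auto
  let ?f = "\<lambda>x. h x / vdual p v x * indicator {0<..} x"
  have "(\<lambda>x. h x / vdual p v x) \<in> Mplus" using h Mp(4) unfolding Mplus_def by measurable
  then have "?f \<in> borel_measurable lebesgue" unfolding Mplus_iff .
  \<comment> \<open>The quotient of h by the dual weight is Lebesgue measurable only; an almost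
    everywhere equal Borel function takes its place.\<close>
  then obtain g where g: "g \<in> borelfun" and "AE x in lborel. ?f x = g x"
   using completion_ex_borel_measurable[of ?f lborel] by auto
  then have fg: "AE x in lebesgue. ?f x = g x" by (intro AE_completion)
  have ae: "AE x in lebesgue. 0 < x --> g x * vdual p v x = h x \<and> g x epowr p * vdual p v x \<le> h x epowr p * v x"
   using fg fin AE_vdual_finite[OF tf]
  proof eventually_elim
   case (elim x)
   show ?case
   proof
    assume x: "0 < x"
    then have "g x = h x / vdual p v x" "vdual p v x \<noteq> top" "h x epowr p * v x \<noteq> top" using elim by auto
    then show "g x * vdual p v x = h x \<and> g x epowr p * vdual p v x \<le> h x epowr p * v x"
     using vdual_quotient[OF p] by metis
   qed
  qed
  have cop: "integ_tail h s = copson S g s" if s: "0 < s" for s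
   unfolding copson_wmeas[OF g s, symmetric] integ_tail_def
   by (rule nn_integral_cong_AE, use ae in eventually_elim) (use s in \<open>auto split: split_indicator\<close>)
  have "(powint p S g) = integ_tail (\<lambda>y. g y epowr p * vdual p v y) 0"
   by (rule integ_tail_wmeas_0[OF Mp(4) borel_measurable_epowr[OF g], symmetric]) simp
  also have "\<dots> \<le> ?R"
   unfolding integ_tail_def
   by (rule nn_integral_mono_AE, use ae in eventually_elim) (auto split: split_indicator)
  finally have N: "(powint p S g) \<le> ?R" .
  then have N': "(powint p S g) < top" using False less_top order_le_less_trans by blast
  have "lhs_norm m q u w h epowr q = (\<integral>\<^sup>+x. iterK m U S g x epowr (q / m) \<partial>Wt)"
   unfolding iterK_def by (rule lhs_norm_power[OF measurable_copson cop])
  also have "\<dots> \<le> D * (powint p S g) epowr (q / p)" by (rule le[OF g N'])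
  also have "\<dots> \<le> D * ?R epowr (q / p)" using p q N by (intro mult_left_mono epowr_mono) auto
  also have "\<dots> = (D epowr (1 / q) * rhs_norm p v h) epowr q"
   unfolding epowr_mult[OF less_imp_le[OF q]] rhs_norm_power epowr_epowr using q by simp
  finally have le': "lhs_norm m q u w h \<le> D epowr (1 / q) * rhs_norm p v h" using q by (simp add: epowr_le_iff)
  have "lhs_norm m q u w h / rhs_norm p v h \<le> (D epowr (1 / q) * rhs_norm p v h) / rhs_norm p v h"
   by (rule divide_right_mono_ennreal[OF le'])
  also have "\<dots> \<le> D epowr (1 / q)"
  proof (cases "rhs_norm p v h = 0 \<or> rhs_norm p v h = top")
   case True then show ?thesis by auto
  next
   case False then show ?thesis by (simp add: ennreal_mult_divide_eq)
  qed
  finally show ?thesis .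
 qed
qed

end

section \<open>Infinite tails of the dual weight\<close>

context weights
begin

lemma W_pos: assumes "0 < x" shows "0 < Wt {..x}"
proof (rule ccontr)
 assume "\<not> 0 < Wt {..x}"
 then have "{..x} \<in> null_sets Wt" by auto
 then have "AE z in Wt. z \<notin> {..x}" by (rule AE_not_in)
 then have "AE z in Wt. U {z<..x} epowr (q / m) * indicator {..x} z = 0" by eventually_elim auto
 then have "Phi (q / m) U Wt x = (\<integral>\<^sup>+z. 0 \<partial>Wt)" unfolding Phi_def by (rule nn_integral_cong_AE)
 then show False using Phi_pos[OF assms] by simp
qed

text \<open>Phi(t0) is the w-integral of u(t,t0]^a and is positive; F dominates infinity times that
  integrand.\<close>

lemma Phi_weighted_top:
 assumes t0: "0 < t0" and F: "\<And>t. 0 < t ==> 0 < U {t<..t0} ==> F t = top"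
 shows "(\<integral>\<^sup>+t. F t \<partial>Wt) = top"
proof -
 have "top * Phi (q / m) U Wt t0 = (\<integral>\<^sup>+t. top * (U {t<..t0} epowr (q / m) * indicator {..t0} t) \<partial>Wt)"
  unfolding Phi_def
  by (rule nn_integral_cmult[symmetric], rule measurable_borel_like)
   (auto intro!: borel_measurable_times_ennreal measurable_Ioc_epowr)
 also have "\<dots> \<le> (\<integral>\<^sup>+t. F t \<partial>Wt)"
 proof (rule nn_integral_mono_AE, use AE_wmeas_pos[OF Mp(2)] in eventually_elim)
  fix t :: real assume "0 < t"
  then show "top * (U {t<..t0} epowr (q / m) * indicator {..t0} t) \<le> F t"
   using F[of t] q m by (cases "U {t<..t0} = 0") (auto simp: zero_less_iff_neq_zero)
 qed
 finally show ?thesis using Phi_pos[OF t0] by (simp add: ennreal_top_mult top_unique zero_less_iff_neq_zero)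
qed

lemma ex_U_pos: assumes "0 < t0" obtains t where "0 < t" "t < t0" "0 < U {t<..t0}"
proof -
 have "\<exists>t>0. 0 < U {t<..t0}"
  using Phi_weighted_top[OF assms, of "\<lambda>_. 0"] by auto
 then obtain t where t: "0 < t" "0 < U {t<..t0}" by blast
 moreover have "t < t0" using t(2) by (cases "t < t0") auto
 ultimately show thesis using that by blast
qed

context
 fixes t0 assumes t0: "0 < t0" and St0: "S {t0<..} = top"
begin

lemma B1_top: "B1 = top"
proof -
 have "Phi (q / m) U Wt t0 * S {t0<..} epowr (q * (p - 1) / p) \<le> B1"
  unfolding B1_def using t0 by (intro SUP_upper) auto
 then show ?thesis using St0 p q Phi_pos[OF t0] by (simp add: ennreal_mult_top top_unique zero_less_iff_neq_zero)
qed

lemma B3_top: assumes "q < p" shows "B3 = top"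
 unfolding B3_def
proof (rule Phi_weighted_top[OF t0])
 fix t assume t: "0 < t" "0 < U {t<..t0}"
 then have tt: "t < t0" by (cases "t < t0") auto
 have "U {t<..t0} epowr (q / m) * S {t0<..} epowr (q * (p - 1) / (p - q)) \<le> Usup (q / m) (q * (p - 1) / (p - q)) U S t"
  unfolding Usup_def using tt by (intro SUP_upper) auto
 moreover have "0 < U {t<..t0} epowr (q / m)" using t q m by (intro epowr_pos) auto
 ultimately have "Usup (q / m) (q * (p - 1) / (p - q)) U S t = top"
  using St0 p q assms by (simp add: ennreal_mult_top top_unique zero_less_iff_neq_zero)
 moreover have "0 < Phi (q / m) U Wt t epowr (q / (p - q))" using t q assms by (intro epowr_pos Phi_pos) auto
 ultimately show "Phi (q / m) U Wt t epowr (q / (p - q)) * Usup (q / m) (q * (p - 1) / (p - q)) U S t = top"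
  by (simp add: ennreal_mult_top)
qed

text \<open>The set where the tail of s is at most 1 has s-mass at most 1, so infinite mass remains
  where the tail exceeds 1 and its power, nonnegative as m \<ge> 1, is at least 1. For m < 1 an
  infinite tail raised to a negative power is 0, and the conclusion can fail.\<close>

lemma Xs_top:
 assumes mp: "1 \<le> m" "m < p" and t: "0 < t" "0 < U {t<..t0}" shows "Xs m p U S t = top"
proof -
 have tt: "t < t0" using t by (cases "t < t0") auto
 let ?e = "p * (m - 1) / (p - m)" and ?d = "p / (p - m)"
 let ?L = "{x. S {x..} \<le> 1}"
 have e: "0 \<le> ?e" "0 \<le> ?d" using mp p by auto
 have L: "?L \<in> sets borel" using measurable_ctail[of S] by measurable
 have "top \<le> S (?L \<union> ({t0<..} - ?L))" unfolding St0[symmetric] using L by (intro emeasure_mono) auto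
 also have "\<dots> \<le> S ?L + S ({t0<..} - ?L)" using L by (intro emeasure_subadditive) auto
 also have "\<dots> \<le> 1 + S ({t0<..} - ?L)" by (intro add_right_mono emeasure_tail_level) simp
 finally have big: "S ({t0<..} - ?L) = top" by (simp add: top_unique ennreal_add_eq_top)
 have ms: "{t0<..} - ?L \<in> sets S" using L by simp
 have "U {t<..t0} epowr ?d * top = (\<integral>\<^sup>+x. U {t<..t0} epowr ?d * indicator ({t0<..} - ?L) x \<partial>S)"
  unfolding nn_integral_cmult_indicator[OF ms] big ..
 also have "\<dots> \<le> Xs m p U S t"
  unfolding Xs_def
 proof (intro nn_integral_mono)
  fix x
  show "U {t<..t0} epowr ?d * indicator ({t0<..} - ?L) x \<le>
   U {t<..x} epowr ?d * S {x<..} epowr ?e * indicator {t<..} x"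
  proof (cases "x \<in> {t0<..} - ?L")
   case True
   then have x: "t0 < x" "1 \<le> S {x<..}" by (auto simp: diffuse_ctail[OF diffuse_wmeas[OF Mp(4)]])
   have "U {t<..t0} epowr ?d * 1 \<le> U {t<..x} epowr ?d * S {x<..} epowr ?e"
   proof (intro mult_mono epowr_mono emeasure_mono e)
    show "1 \<le> S {x<..} epowr ?e" using epowr_mono[OF e(1) x(2)] by simp
   qed (use x in auto)
   then show ?thesis using True x tt by simp
  qed simp
 qed
 finally show ?thesis using epowr_pos[OF t(2) e(2)] by (simp add: ennreal_mult_top top_unique zero_less_iff_neq_zero)
qed

text \<open>Up to t0 the tail of s is infinite with a positive exponent, and the integral of the
  u-factor over (t,t0] is positive by \<open>head_power\<close>.\<close>

lemma Xu_top:
 assumes mp: "m < p" and t: "0 < t" "0 < U {t<..t0}" shows "Xu m p U S t = top"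
proof -
 let ?a = "m / (p - m)"
 have a: "-1 < ?a" using m mp less_trans[of "-1" 0 ?a] by simp
 obtain c where c: "U {t<..t0} epowr (?a + 1) \<le> c * (\<integral>\<^sup>+x\<in>{t<..t0}. U {t<..x} epowr ?a \<partial>U)"
  using head_power[OF a] diffuse_wmeas[OF Mp(1)] U_finite[OF t(1), of t0] by blast
 have "0 < U {t<..t0} epowr (?a + 1)" using t a by (intro epowr_pos) auto
 then have I: "(\<integral>\<^sup>+x\<in>{t<..t0}. U {t<..x} epowr ?a \<partial>U) \<noteq> 0" using c by auto
 have "(\<integral>\<^sup>+x\<in>{t<..t0}. U {t<..x} epowr ?a \<partial>U) * top = (\<integral>\<^sup>+x. U {t<..x} epowr ?a * indicator {t<..t0} x * top \<partial>U)"
  by (rule nn_integral_multc[symmetric], rule measurable_borel_like)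
   (auto intro!: borel_measurable_times_ennreal borel_measurable_epowr measurable_Ioc)
 also have "\<dots> \<le> Xu m p U S t"
  unfolding Xu_def
 proof (intro nn_integral_mono)
  fix x
  have "S {x<..} = top" if "x \<le> t0"
  proof -
   have "{t0<..} \<subseteq> {x<..}" using that by auto
   then show ?thesis using emeasure_mono[of "{t0<..}" "{x<..}" S] St0 by (simp add: top_unique)
  qed
  then show "U {t<..x} epowr ?a * indicator {t<..t0} x * top \<le>
   U {t<..x} epowr ?a * S {x<..} epowr (m * (p - 1) / (p - m)) * indicator {t<..} x"
   using m mp p by (auto split: split_indicator)
 qed
 finally show ?thesis using I by (simp add: ennreal_mult_top top_unique zero_less_iff_neq_zero)
qed

lemma B4_top:
 assumes mp: "m < p" and X: "\<And>t. 0 < t ==> 0 < U {t<..t0} ==> X t = top" shows "B4 X = top"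
proof -
 obtain t where t: "0 < t" "0 < U {t<..t0}" using ex_U_pos[OF t0] by blast
 have "Wt {..t} * X t epowr (q / m * (p - m) / p) \<le> B4 X"
  unfolding B4_def using t by (intro SUP_upper) auto
 then show ?thesis using X[OF t] W_pos[OF t(1)] mp p q m by (simp add: ennreal_mult_top top_unique zero_less_iff_neq_zero)
qed

lemma B5_top:
 assumes mp: "m < p" "q < p" and X: "\<And>t. 0 < t ==> 0 < U {t<..t0} ==> X t = top" shows "B5 X = top"
 unfolding B5_def
proof (rule Phi_weighted_top[OF t0])
 fix t assume t: "0 < t" "0 < U {t<..t0}"
 have "0 < Wt {..t} epowr (q / (p - q))" using mp q by (intro epowr_pos W_pos t) auto
 then show "Wt {..t} epowr (q / (p - q)) * X t epowr (q / m * (p - m) / (p - q)) = top"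
  using X[OF t] mp p q m by (simp add: ennreal_mult_top)
qed

text \<open>The dual weight beyond t0 is truncated in height and length to have finite integral I n.
  The denominator is then at most I n^(1 / p), while the numerator is at least Phi(t0)^(1 / q) I n;
  a finite constant would bound I n^((p - 1) / p), but I n tends to infinity.\<close>

lemma C_opt_top: "C_opt p q m u w v = top"
proof (rule ccontr)
 assume "C_opt p q m u w v \<noteq> top"
 then obtain c where c: "C_opt p q m u w v < c" "c < top" using dense less_top by blast
 let ?T = "\<lambda>x. vdual p v x * indicator {t0<..} x"
 define h where "h n x = min (vdual p v x) (of_nat n) * indicator {t0<..<real n} x" for n :: nat and x
 have Mh: "h n \<in> Mplus" for n
 proof -
  have "(\<lambda>x. min (vdual p v x) (of_nat n)) \<in> Mplus" using Mp(4) unfolding Mplus_def by measurable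
  moreover have "(\<lambda>x. indicator {t0<..<real n} x) \<in> Mplus" by (rule Mplus_borel) simp
  ultimately show ?thesis unfolding h_def by (rule Mplus_times)
 qed
 define I where "I n = integ_tail (h n) t0" for n
 have I_eq: "I n = (\<integral>\<^sup>+x. h n x \<partial>lebesgue)" for n
  unfolding I_def integ_tail_def h_def by (intro nn_integral_cong) (auto split: split_indicator)
 have "I n \<le> (\<integral>\<^sup>+x. of_nat n * indicator {t0<..<real n} x \<partial>lebesgue)" for n
  unfolding I_eq h_def by (intro nn_integral_mono) (auto split: split_indicator)
 also have "\<dots> n < top" for n
 proof -
  have "lborel {t0<..<real n} < top" by (rule emeasure_bounded_finite[simplified]) simp
  then show ?thesis
   by (subst nn_integral_cmult_indicator) (auto intro!: mult_less_top_ennreal simp: of_nat_less_top)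
 qed
 finally have Ifin: "I n < top" for n .
 have step: "Phi (q / m) U Wt t0 * I n epowr (q * (p - 1) / p) \<le> c epowr q" for n
 proof -
  have "integ_tail (\<lambda>x. h n x epowr p * v x) 0 \<le> I n"
   unfolding integ_tail_def I_eq
  proof (intro nn_integral_mono)
   fix x
   have "h n x \<le> vdual p v x" by (auto simp: h_def split: split_indicator)
   then show "h n x epowr p * v x * indicator {0<..} x \<le> h n x"
    using vdual_power_le[where v = v and x = x, OF p] by (auto split: split_indicator)
  qed
  then have "c epowr q * integ_tail (\<lambda>x. h n x epowr p * v x) 0 epowr (q / p) \<le> c epowr q * I n epowr (q / p)"
   using p q by (intro mult_left_mono epowr_mono) auto
  with order.trans[OF lhs_norm_ge[OF t0] lhs_le_rhs[OF c(1) Mh]]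
  have le: "Phi (q / m) U Wt t0 * I n epowr q \<le> c epowr q * I n epowr (q / p)"
   unfolding rhs_norm_power I_def[symmetric] by (rule order.trans)
  show ?thesis
  proof (cases "I n = 0")
   case True then show ?thesis using p q by simp
  next
   case False
   have I0: "I n epowr (q / p) \<noteq> 0" "I n epowr (q / p) \<noteq> top"
    using False Ifin[of n] p q by (auto simp: epowr_eq_0_iff epowr_eq_top_iff)
   have "q = q / p + q * (p - 1) / p" using p by (simp add: field_simps)
   then have "I n epowr q = I n epowr (q / p) * I n epowr (q * (p - 1) / p)"
    using epowr_add[of "q / p" "q * (p - 1) / p" "I n"] p q by simp
   then have "I n epowr (q / p) * (Phi (q / m) U Wt t0 * I n epowr (q * (p - 1) / p)) \<le> I n epowr (q / p) * c epowr q"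
    using le by (simp only: mult_ac)
   then show ?thesis unfolding ennreal_mult_le_mult_iff[OF I0] .
  qed
 qed
 have "top = (\<integral>\<^sup>+x. ?T x \<partial>lebesgue)"
  using St0 t0 integ_tail_eq_emeasure[OF Mp(4), of t0] by (simp add: integ_tail_def)
 also have "\<dots> \<le> (\<integral>\<^sup>+x. (SUP n. h n x) \<partial>lebesgue)"
 proof (rule nn_integral_mono, rule dense_le)
  fix x y assume y: "y < ?T x"
  then have x: "t0 < x" "y < vdual p v x" by (cases "t0 < x"; simp)+
  have "y < top" using x(2) by (rule order.strict_trans2) simp
  then obtain n1 where n1: "y < of_nat n1" using ennreal_Ex_less_of_nat by blast
  obtain n2 where n2: "x < real n2" using reals_Archimedean2 by blast
  have "y < of_nat (max n1 n2)" using n1 by (rule order.strict_trans2) simp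
  then have "y \<le> h (max n1 n2) x" using x n2 by (auto simp: h_def)
  also have "\<dots> \<le> (SUP n. h n x)" by (rule SUP_upper) simp
  finally show "y \<le> (SUP n. h n x)" .
 qed
 also have "\<dots> = (SUP n. I n)"
  unfolding I_eq
 proof (rule nn_integral_monotone_convergence_SUP)
  show "incseq h"
  proof (intro incseq_SucI le_funI)
   fix n x
   have "min (vdual p v x) (of_nat n) \<le> min (vdual p v x) (of_nat (Suc n))"
    by (intro min.mono order_refl of_nat_mono) simp
   then show "h n x \<le> h (Suc n) x"
    unfolding h_def by (rule mult_mono) (auto split: split_indicator)
  qed
  show "h n \<in> borel_measurable lebesgue" for n
  proof -
   have "(\<lambda>x. h n x * indicator {0<..} x) = h n" using t0 by (auto simp: h_def fun_eq_iff split: split_indicator)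
   then show ?thesis using Mh[of n] by (simp add: Mplus_iff)
  qed
 qed
 finally have sup: "(SUP n. I n) = top" by (simp add: top_unique)
 have "top = Phi (q / m) U Wt t0 * (SUP n. I n) epowr (q * (p - 1) / p)"
  unfolding sup using Phi_pos[OF t0] p q by (simp add: ennreal_mult_top zero_less_iff_neq_zero)
 also have "\<dots> = (SUP n. Phi (q / m) U Wt t0 * I n epowr (q * (p - 1) / p))"
  using p q by (simp add: epowr_SUP SUP_mult_left_ennreal)
 also have "\<dots> \<le> c epowr q" by (intro SUP_least step)
 finally show False using epowr_less_top[of q c] q c(2) by (simp add: top_unique)
qed

end

lemma not_tail_finiteE: assumes "\<not> tail_finite p v" obtains t0 where "0 < t0" "S {t0<..} = top"
 using assms unfolding tail_finite_iff using less_top by blast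

end

section \<open>The characterisations\<close>

lemma epowr_root_le: "0 < q ==> x epowr q \<le> K * y epowr q ==> x \<le> K epowr (1 / q) * y"
 by (subst (asm) epowr_le_swap) (simp_all add: epowr_mult epowr_inverse)

lemma epowr_sum_le: "0 \<le> q ==> x epowr q + y epowr q \<le> 2 * (x + y) epowr q"
 unfolding mult_2 by (intro add_mono epowr_mono) auto

lemma lesssim_onI:
 assumes c: "c < top" and le: "\<And>u w v. (u, w, v) \<in> T ==> A u w v \<le> c * B u w v"
 shows "lesssim_on T (\<lambda>(u, w, v). A u w v) (\<lambda>(u, w, v). B u w v)"
 unfolding lesssim_on_def
\<comment> \<open>The added 1 makes the constant positive even for c = 0.\<close>
proof (intro exI[of _ "enn2real c + 1"] conjI ballI)
 have "c \<le> ennreal (enn2real c + 1)" using c by (cases c) (auto intro!: ennreal_leI)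
 then have "c * B u w v \<le> ennreal (enn2real c + 1) * B u w v" for u w v by (rule mult_right_mono) simp
 then have "A u w v \<le> ennreal (enn2real c + 1) * B u w v" if "(u, w, v) \<in> T" for u w v
  using le[OF that] by (rule order.trans[rotated])
 then show "(case x of (u, w, v) => A u w v) \<le> ennreal (enn2real c + 1) * (case x of (u, w, v) => B u w v)"
  if "x \<in> T" for x using that by (cases x) simp
qed (simp add: add_nonneg_pos)

lemma lesssim_on_trans: "lesssim_on T A B ==> lesssim_on T B C ==> lesssim_on T A C"
 unfolding lesssim_on_def
proof (elim exE conjE)
 fix c d :: real assume *: "0 < c" "\<forall>x\<in>T. A x \<le> ennreal c * B x" "0 < d" "\<forall>x\<in>T. B x \<le> ennreal d * C x"
 show "\<exists>c. 0 < c \<and> (\<forall>x\<in>T. A x \<le> ennreal c * C x)"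
 proof (intro exI[of _ "c * d"] conjI ballI)
  fix x assume x: "x \<in> T"
  have "A x \<le> ennreal c * B x" using * x by blast
  also have "\<dots> \<le> ennreal c * (ennreal d * C x)" using * x by (intro mult_left_mono) auto
  finally show "A x \<le> ennreal (c * d) * C x" using * by (simp add: ennreal_mult mult.assoc)
 qed (use * in simp)
qed

lemma approx_on_trans: "approx_on T A B ==> approx_on T B C ==> approx_on T A C"
 unfolding approx_on_def using lesssim_on_trans by blast

lemma approx_on_sym: "approx_on T A B ==> approx_on T B A"
 unfolding approx_on_def by blast

context weights
begin

text \<open>Finite and infinite tails of s under one constant. For infinite tails A = top, and the
  summand 1 prevents the product from collapsing to 0 * top = 0.\<close>

lemma C_opt_upper:
 assumes le: "\<And>g. tail_finite p v ==> g \<in> borelfun ==> (powint p S g) < top ==>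
   (\<integral>\<^sup>+x. iterK m U S g x epowr (q / m) \<partial>Wt) \<le> c * (B * (powint p S g) epowr (q / p))"
  and B: "B \<le> k * A epowr q" and A: "\<not> tail_finite p v ==> A = top"
 shows "C_opt p q m u w v \<le> ((c * k) epowr (1 / q) + 1) * A"
proof (cases "tail_finite p v")
 case True
 have "C_opt p q m u w v \<le> (c * B) epowr (1 / q)"
  by (rule C_opt_le[OF True]) (use le[OF True] in \<open>simp only: mult.assoc\<close>)
 also have "\<dots> \<le> (c * (k * A epowr q)) epowr (1 / q)" using q B by (intro epowr_mono mult_left_mono) auto
 also have "\<dots> = (c * k) epowr (1 / q) * A" using q by (simp add: epowr_mult epowr_inverse mult.assoc)
 also have "\<dots> \<le> ((c * k) epowr (1 / q) + 1) * A" by (intro mult_right_mono) auto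
 finally show ?thesis .
next
 case False
 then show ?thesis using A by (simp add: ennreal_mult_top)
qed

text \<open>The inequality is available for every c above the optimal constant, and density passes
  to the limit after division by the nonzero constant K. With an infinite tail the optimal constant
  is infinite, and the summand 1 keeps the product infinite.\<close>

lemma C_opt_lower:
 assumes le: "\<And>D. tail_finite p v ==> Cineq (q / m) m p U Wt S D ==> A epowr q \<le> k * D" and k: "k < top"
 shows "A \<le> (k epowr (1 / q) + 1) * C_opt p q m u w v"
proof (cases "tail_finite p v")
 case True
 let ?K = "k epowr (1 / q) + 1"
 have K: "?K \<noteq> 0" "?K \<noteq> top" using epowr_less_top[of "1 / q" k] k q by auto
 have "A / ?K \<le> C_opt p q m u w v"
 proof (rule dense_ge)
  fix c assume c: "C_opt p q m u w v < c"
  have "A epowr q \<le> k * c epowr q" by (rule le[OF True Cineq_C_opt[OF c]])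
  then have "A \<le> k epowr (1 / q) * c" by (rule epowr_root_le[OF q])
  also have "\<dots> \<le> c * ?K" unfolding mult.commute[of c] by (intro mult_right_mono) auto
  finally have "A / ?K \<le> c * ?K / ?K" by (rule divide_right_mono_ennreal)
  then show "A / ?K \<le> c" using K by (simp add: ennreal_mult_divide_eq)
 qed
 then have "A / ?K * ?K \<le> C_opt p q m u w v * ?K" by (rule mult_right_mono) simp
 moreover have "A / ?K * ?K = A" using K by (simp add: ennreal_divide_times ennreal_divide_self less_top zero_less_iff_neq_zero)
 ultimately show ?thesis by (simp only: mult.commute)
next
 case False
 then obtain t0 where "0 < t0" "S {t0<..} = top" by (rule not_tail_finiteE)
 then have "C_opt p q m u w v = top" by (rule C_opt_top)
 then show ?thesis by (simp add: ennreal_mult_top)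
qed

lemma A_top:
 assumes "\<not> tail_finite p v"
 shows "A1 p q m u w v = top" "q < p ==> A3 p q m u w v = top"
  "m < p ==> A4_star p q m u w v = top" "1 \<le> m ==> m < p ==> A4 p q m u w v = top"
  "m < p ==> q < p ==> A5_star p q m u w v = top" "1 \<le> m ==> m < p ==> q < p ==> A5 p q m u w v = top"
proof -
 obtain t0 where t0: "0 < t0" "S {t0<..} = top" using assms by (rule not_tail_finiteE)
 have *: "x = top" if "x epowr q = top" for x using that q by (simp add: epowr_eq_top_iff)
 show "A1 p q m u w v = top" by (rule *) (simp add: A1_eq B1_top[OF t0])
 show "A3 p q m u w v = top" if "q < p"
  by (rule *) (use that p in \<open>simp add: A3_eq B3_top[OF t0]\<close>)
 show "A4_star p q m u w v = top" if "m < p"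
  by (rule *) (simp add: A4_star_eq that B4_top[OF t0 that Xu_top[OF t0 that]])
 show "A4 p q m u w v = top" if "1 \<le> m" "m < p"
  by (rule *) (simp add: A4_eq that B4_top[OF t0 that(2) Xs_top[OF t0 that]])
 show "A5_star p q m u w v = top" if "m < p" "q < p"
  by (rule *) (use p that in \<open>simp add: A5_star_eq B5_top[OF t0 that Xu_top[OF t0 that(1)]]\<close>)
 show "A5 p q m u w v = top" if "1 \<le> m" "m < p" "q < p"
  by (rule *) (use p that in \<open>simp add: A5_eq B5_top[OF t0 that(2,3) Xs_top[OF t0 that(1,2)]]\<close>)
qed

lemma B4_mono:
 assumes mp: "m < p" and XY: "\<And>t. 0 < t ==> X t \<le> c * Y t"
 shows "B4 X \<le> c epowr (q / m * (p - m) / p) * B4 Y"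
 unfolding B4_def[of X]
proof (rule SUP_least)
 let ?g = "q / m * (p - m) / p"
 have g: "0 \<le> ?g" using mp p q m by simp
 fix t :: real assume t: "t \<in> {0<..}"
 have "Wt {..t} * X t epowr ?g \<le> Wt {..t} * (c * Y t) epowr ?g"
  using t by (intro mult_left_mono epowr_mono g XY) auto
 also have "\<dots> = c epowr ?g * (Wt {..t} * Y t epowr ?g)" unfolding epowr_mult[OF g] by (simp only: mult_ac)
 also have "\<dots> \<le> c epowr ?g * B4 Y" unfolding B4_def by (intro mult_left_mono SUP_upper t) simp
 finally show "Wt {..t} * X t epowr ?g \<le> c epowr ?g * B4 Y" .
qed

lemma B5_mono:
 assumes mp: "m < p" "q < p" and XY: "\<And>t. 0 < t ==> X t \<le> c * Y t" and Y: "Y \<in> borelfun"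
 shows "B5 X \<le> c epowr (q / m * (p - m) / (p - q)) * B5 Y"
proof -
 let ?g = "q / m * (p - m) / (p - q)" and ?W = "\<lambda>t. Wt {..t} epowr (q / (p - q))"
 have g: "0 \<le> ?g" using mp p q m by simp
 have "B5 X \<le> (\<integral>\<^sup>+t. c epowr ?g * (?W t * Y t epowr ?g) \<partial>Wt)"
  unfolding B5_def
 proof (rule nn_integral_mono_AE, use AE_wmeas_pos[OF Mp(2)] in eventually_elim)
  fix t :: real assume "0 < t"
  then have "?W t * X t epowr ?g \<le> ?W t * (c * Y t) epowr ?g" by (intro mult_left_mono epowr_mono g XY) auto
  then show "?W t * X t epowr ?g \<le> c epowr ?g * (?W t * Y t epowr ?g)" unfolding epowr_mult[OF g] by (simp only: mult_ac)
 qed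
 also have "\<dots> = c epowr ?g * B5 Y"
  unfolding B5_def
  by (rule nn_integral_cmult, rule measurable_borel_like)
    (auto intro!: borel_measurable_times_ennreal measurable_W_epowr borel_measurable_epowr Y)
 finally show ?thesis .
qed

end

section \<open>Comparison of the starred and unstarred quantities\<close>

lemma weightsI: "1 < p ==> 0 < q ==> 0 < m ==> (u, w, v) \<in> weight_triples m q ==> weights p q m u w v"
 by unfold_locales

lemma A45_star_equiv:
 assumes pqm: "1 < p" "0 < q" "0 < m" and mp: "m < p"
 shows "\<exists>c<top. \<forall>u w v. (u, w, v) \<in> weight_triples m q --> tail_finite p v -->
  (A4 p q m u w v \<le> c * A4_star p q m u w v \<and> A4_star p q m u w v \<le> c * A4 p q m u w v) \<and>
  (q < p --> A5 p q m u w v \<le> c * A5_star p q m u w v \<and> A5_star p q m u w v \<le> c * A5 p q m u w v)"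
proof -
 show ?thesis
 proof (rule ex_finiteE[OF Xs_Xu_equiv[OF pqm(3) mp pqm(1)]], goal_cases)
 case (1 c)
 note c = 1(1) and eq = 1(2)[rule_format (no_asm)]
 define K4 where "K4 = (c epowr (q / m * (p - m) / p)) epowr (1 / q)"
 define K5 where "K5 = ((c epowr (q / m * (p - m) / (p - q))) epowr ((p - q) / p)) epowr (1 / q)"
 have K4: "K4 < top" unfolding K4_def using pqm mp by (intro epowr_less_top c) auto
 have K5: "K5 < top" if "q < p" unfolding K5_def using pqm mp that by (intro epowr_less_top c) auto
 define K where "K = K4 + (if q < p then K5 else 0)"
 have up: "x \<le> K * y" if "x \<le> K4 * y" for x y
  using that by (rule order.trans) (auto simp: K_def intro!: mult_right_mono)
 have up5: "x \<le> K * y" if "q < p" "x \<le> K5 * y" for x y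
  using that(2) by (rule order.trans) (auto simp: K_def that intro!: mult_right_mono)
 show ?thesis
 proof (intro exI[of _ K] conjI[where P = "K < top"] allI impI)
  show "K < top" unfolding K_def using K4 K5 by auto
  fix u w v assume tr: "(u, w, v) \<in> weight_triples m q" and tf: "tail_finite p v"
  interpret weights p q m u w v using pqm tr by (rule weightsI)
  have X: "Xs m p U S t \<le> c * Xu m p U S t" "Xu m p U S t \<le> c * Xs m p U S t" if t: "0 < t" for t
  proof -
   have "\<forall>x. U {t<..x} < top" by (intro allI U_finite t)
   moreover have "S {t<..} < top" using tf t unfolding tail_finite_iff by blast
   ultimately have "Xs m p U S t \<le> c * Xu m p U S t \<and> Xu m p U S t \<le> c * Xs m p U S t"
    by (rule eq[OF diffuse_wmeas[OF Mp(1)] diffuse_wmeas[OF Mp(4)]])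
   then show "Xs m p U S t \<le> c * Xu m p U S t" "Xu m p U S t \<le> c * Xs m p U S t" by simp_all
  qed
  have 4: "A4 p q m u w v \<le> K4 * A4_star p q m u w v" "A4_star p q m u w v \<le> K4 * A4 p q m u w v"
   unfolding K4_def
   by (rule epowr_root_le[OF q], unfold A4_eq[OF mp] A4_star_eq[OF mp], rule B4_mono[OF mp], erule X)+
  have 5: "A5 p q m u w v \<le> K5 * A5_star p q m u w v" "A5_star p q m u w v \<le> K5 * A5 p q m u w v" if qp: "q < p"
  proof -
   have th: "0 \<le> (p - q) / p" using qp p by simp
   show "A5 p q m u w v \<le> K5 * A5_star p q m u w v"
    unfolding K5_def
    by (rule epowr_root_le[OF q], unfold A5_eq[OF mp qp] A5_star_eq[OF mp qp] epowr_mult[OF th, symmetric])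
     (intro epowr_mono th B5_mono mp qp X measurable_X)
   show "A5_star p q m u w v \<le> K5 * A5 p q m u w v"
    unfolding K5_def
    by (rule epowr_root_le[OF q], unfold A5_eq[OF mp qp] A5_star_eq[OF mp qp] epowr_mult[OF th, symmetric])
     (intro epowr_mono th B5_mono mp qp X measurable_X)
  qed
  show "(A4 p q m u w v \<le> K * A4_star p q m u w v \<and> A4_star p q m u w v \<le> K * A4 p q m u w v) \<and>
   (q < p --> A5 p q m u w v \<le> K * A5_star p q m u w v \<and> A5_star p q m u w v \<le> K * A5 p q m u w v)"
   using up[OF 4(1)] up[OF 4(2)] up5[OF _ 5(1)] up5[OF _ 5(2)] by blast
 qed
 qed
qed

text \<open>Here P is finiteness of the tails and x is A1 or A3, which is infinite otherwise: inside
  the sums the two forms are comparable without any condition on m.\<close>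

lemma sum_le_scaled:
 fixes x y z c :: ennreal
 assumes "P ==> y \<le> c * z" "\<not> P ==> x = top" shows "x + y \<le> (1 + c) * (x + z)"
proof (cases P)
 case True
 have "x + y \<le> 1 * (x + z) + c * (x + z)"
  using assms(1)[OF True] by (intro add_mono order.trans[OF assms(1)[OF True]] mult_left_mono) auto
 then show ?thesis by (simp only: distrib_right)
qed (simp add: assms(2) ennreal_mult_top)

lemma le_scaled:
 fixes y z c :: ennreal
 assumes "P ==> y \<le> c * z" "\<not> P ==> z = top" shows "y \<le> (1 + c) * z"
proof (cases P)
 case True
 show ?thesis by (rule order.trans[OF assms(1)[OF True]]) (intro mult_right_mono, auto)
qed (simp add: assms(2) ennreal_mult_top)

text \<open>With finite tails all four claims follow from the equivalence of \<open>Xs\<close> and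
  \<open>Xu\<close>. With infinite tails the sums are infinite through A1 or A3, whereas A4 and A5
  alone are infinite by \<open>Xs_top\<close>, where m \<ge> 1 is used.\<close>

lemma star_approx:
 assumes pqm: "1 < p" "0 < q" "0 < m" and mp: "m < p"
 shows "approx_on (weight_triples m q) (\<lambda>(u, w, v). A1 p q m u w v + A4 p q m u w v)
   (\<lambda>(u, w, v). A1 p q m u w v + A4_star p q m u w v)"
  "approx_on {(u, w, v) \<in> weight_triples m q. 1 \<le> m \<or> tail_finite p v}
   (\<lambda>(u, w, v). A4 p q m u w v) (\<lambda>(u, w, v). A4_star p q m u w v)"
  "q < p ==> approx_on (weight_triples m q) (\<lambda>(u, w, v). A3 p q m u w v + A5 p q m u w v)
   (\<lambda>(u, w, v). A3 p q m u w v + A5_star p q m u w v)"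
  "q < p ==> approx_on {(u, w, v) \<in> weight_triples m q. (1 \<le> m \<and> 1 < q) \<or> tail_finite p v}
   (\<lambda>(u, w, v). A5 p q m u w v) (\<lambda>(u, w, v). A5_star p q m u w v)"
proof -
 obtain c where c: "c < top" and eq: "\<And>u w v. (u, w, v) \<in> weight_triples m q ==> tail_finite p v ==>
  (A4 p q m u w v \<le> c * A4_star p q m u w v \<and> A4_star p q m u w v \<le> c * A4 p q m u w v) \<and>
  (q < p --> A5 p q m u w v \<le> c * A5_star p q m u w v \<and> A5_star p q m u w v \<le> c * A5 p q m u w v)"
  using A45_star_equiv[OF assms] by blast
 have c1: "1 + c < top" using c by simp
 note top = weights.A_top[OF weightsI[OF pqm]]
 show "approx_on (weight_triples m q) (\<lambda>(u, w, v). A1 p q m u w v + A4 p q m u w v)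
   (\<lambda>(u, w, v). A1 p q m u w v + A4_star p q m u w v)"
  unfolding approx_on_def
 proof (intro conjI lesssim_onI[OF c1])
  fix u w v assume tr: "(u, w, v) \<in> weight_triples m q"
  show "A1 p q m u w v + A4 p q m u w v \<le> (1 + c) * (A1 p q m u w v + A4_star p q m u w v)"
   "A1 p q m u w v + A4_star p q m u w v \<le> (1 + c) * (A1 p q m u w v + A4 p q m u w v)"
   by (rule sum_le_scaled[where P = "tail_finite p v"]; use eq[OF tr] top(1)[OF tr] in blast)+
 qed
 show "approx_on {(u, w, v) \<in> weight_triples m q. 1 \<le> m \<or> tail_finite p v}
   (\<lambda>(u, w, v). A4 p q m u w v) (\<lambda>(u, w, v). A4_star p q m u w v)"
  unfolding approx_on_def
 proof (intro conjI lesssim_onI[OF c1])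
  fix u w v assume "(u, w, v) \<in> {(u, w, v) \<in> weight_triples m q. 1 \<le> m \<or> tail_finite p v}"
  then have tr: "(u, w, v) \<in> weight_triples m q" "1 \<le> m \<or> tail_finite p v" by auto
  show "A4 p q m u w v \<le> (1 + c) * A4_star p q m u w v" "A4_star p q m u w v \<le> (1 + c) * A4 p q m u w v"
   by (rule le_scaled[where P = "tail_finite p v"]; use eq[OF tr(1)] top(3,4)[OF tr(1)] tr(2) mp in blast)+
 qed
 assume qp: "q < p"
 show "approx_on (weight_triples m q) (\<lambda>(u, w, v). A3 p q m u w v + A5 p q m u w v)
   (\<lambda>(u, w, v). A3 p q m u w v + A5_star p q m u w v)"
  unfolding approx_on_def
 proof (intro conjI lesssim_onI[OF c1])
  fix u w v assume tr: "(u, w, v) \<in> weight_triples m q"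
  show "A3 p q m u w v + A5 p q m u w v \<le> (1 + c) * (A3 p q m u w v + A5_star p q m u w v)"
   "A3 p q m u w v + A5_star p q m u w v \<le> (1 + c) * (A3 p q m u w v + A5 p q m u w v)"
   by (rule sum_le_scaled[where P = "tail_finite p v"]; use eq[OF tr] top(2)[OF tr] qp in blast)+
 qed
 show "approx_on {(u, w, v) \<in> weight_triples m q. (1 \<le> m \<and> 1 < q) \<or> tail_finite p v}
   (\<lambda>(u, w, v). A5 p q m u w v) (\<lambda>(u, w, v). A5_star p q m u w v)"
  unfolding approx_on_def
 proof (intro conjI lesssim_onI[OF c1])
  fix u w v assume "(u, w, v) \<in> {(u, w, v) \<in> weight_triples m q. (1 \<le> m \<and> 1 < q) \<or> tail_finite p v}"
  then have tr: "(u, w, v) \<in> weight_triples m q" "1 \<le> m \<or> tail_finite p v" by auto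
  show "A5 p q m u w v \<le> (1 + c) * A5_star p q m u w v" "A5_star p q m u w v \<le> (1 + c) * A5 p q m u w v"
   by (rule le_scaled[where P = "tail_finite p v"]; use eq[OF tr(1)] top(5,6)[OF tr(1)] tr(2) mp qp in blast)+
 qed
qed

lemma qm_cancel: "0 < m ==> q / m * m = (q :: real)"
 by simp

lemma A1_lesssim:
 assumes pqm: "1 < p" "0 < q" "0 < m"
 shows "\<exists>c<top. \<forall>u w v. (u, w, v) \<in> weight_triples m q --> A1 p q m u w v \<le> c * C_opt p q m u w v"
proof (intro exI[of _ "1 epowr (1 / q) + 1"] conjI allI impI)
 fix u w v assume "(u, w, v) \<in> weight_triples m q"
 with pqm interpret weights p q m u w v by (rule weightsI)
 have a: "0 < q / m" using pqm by simp
 show "A1 p q m u w v \<le> (1 epowr (1 / q) + 1) * C_opt p q m u w v"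
 proof (rule C_opt_lower)
  fix D assume tf: "tail_finite p v" and C: "Cineq (q / m) m p U Wt S D"
  show "A1 p q m u w v epowr q \<le> 1 * D"
   unfolding A1_eq B1_def mult_1
   by (rule SUP_least) (use lower_A1[OF a m p setting[OF tf] C] in \<open>simp only: exps greaterThan_iff\<close>)
 qed simp
qed simp

lemma A23_lesssim:
 assumes pqm: "1 < p" "0 < q" "0 < m" and qp: "q < p"
 shows "\<exists>c<top. \<forall>u w v. (u, w, v) \<in> weight_triples m q -->
  A2 p q m u w v \<le> c * C_opt p q m u w v \<and> A3 p q m u w v \<le> c * C_opt p q m u w v"
proof -
 let ?th = "(p - q) / p"
 have a: "0 < q / m" "q / m * m < p" using pqm qp by auto
 have th: "0 \<le> ?th" "p / (p - q) * ?th = 1" using pqm qp by auto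
 show ?thesis
 proof (rule ex_finiteE[OF lower_A2A3[OF a(1) pqm(3,1) a(2), unfolded qm_cancel[OF pqm(3)]]], goal_cases)
 case (1 c)
 note c = 1(1) and L = 1(2)[rule_format (no_asm)]
 have pw: "B epowr ?th \<le> c epowr ?th * D" if "B \<le> c * D epowr (p / (p - q))" for B D
  using epowr_mono[OF th(1) that] unfolding epowr_mult[OF th(1)] epowr_epowr th(2) by simp
 show ?thesis
 proof (intro exI[of _ "(c epowr ?th) epowr (1 / q) + 1"] conjI[where Q = "All _"] allI impI)
  have cth: "c epowr ?th < top" by (rule epowr_less_top[OF th(1) c])
  then show "(c epowr ?th) epowr (1 / q) + 1 < top" using epowr_less_top[of "1 / q" "c epowr ?th"] pqm by simp
  fix u w v assume "(u, w, v) \<in> weight_triples m q"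
  with pqm interpret weights p q m u w v by (rule weightsI)
  show "A2 p q m u w v \<le> ((c epowr ?th) epowr (1 / q) + 1) * C_opt p q m u w v \<and>
   A3 p q m u w v \<le> ((c epowr ?th) epowr (1 / q) + 1) * C_opt p q m u w v"
   by (intro conjI C_opt_lower cth)
    (unfold A2_eq[OF qp] A3_eq[OF qp] B2_def B3_def, rule pw[OF L[OF setting, THEN conjunct1]], assumption+,
     rule pw[OF L[OF setting, THEN conjunct2]], assumption+)
 qed
 qed
qed

lemma case_a:
 assumes pqm: "1 < p" "0 < q" "0 < m" and pm: "p \<le> m" "p \<le> q"
 shows "approx_on (weight_triples m q) (\<lambda>(u, w, v). C_opt p q m u w v) (\<lambda>(u, w, v). A1 p q m u w v)"
 unfolding approx_on_def
proof (rule conjI)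
 have a: "0 < q / m" "p \<le> q / m * m" using pqm pm by auto
 show "lesssim_on (weight_triples m q) (\<lambda>(u, w, v). C_opt p q m u w v) (\<lambda>(u, w, v). A1 p q m u w v)"
 proof (rule ex_finiteE[OF upper_a[OF a(1) pqm(3,1) a(2) pm(1), unfolded qm_cancel[OF pqm(3)]]], goal_cases)
 case (1 c)
 note c = 1(1) and U = 1(2)[rule_format (no_asm)]
 show ?case
 proof (rule lesssim_onI)
  show "(c * 1) epowr (1 / q) + 1 < top" using pqm c by (intro add_less_top_ennreal epowr_less_top) auto
  fix u w v assume "(u, w, v) \<in> weight_triples m q"
  with pqm interpret weights p q m u w v by (rule weightsI)
  have B: "\<forall>x>0. Phi (q / m) U Wt x * S {x<..} epowr (q * (p - 1) / p) \<le> B1"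
   unfolding B1_def by (intro allI impI SUP_upper) simp
  show "C_opt p q m u w v \<le> ((c * 1) epowr (1 / q) + 1) * A1 p q m u w v"
  proof (rule C_opt_upper[OF U[OF setting _ _ B]])
   show "B1 \<le> 1 * A1 p q m u w v epowr q" by (simp add: A1_eq)
  qed (auto simp: A_top)
 qed
 qed
 show "lesssim_on (weight_triples m q) (\<lambda>(u, w, v). A1 p q m u w v) (\<lambda>(u, w, v). C_opt p q m u w v)"
  using A1_lesssim[OF pqm] by (elim exE conjE) (rule lesssim_onI, blast+)
qed

text \<open>The upper bounds produce a power of a sum of r-th powers, the statement has a sum of the
  quantities themselves; the two differ by a constant.\<close>

lemma sum_theta_le:
 assumes "q < p" "0 < q" and "x epowr q = b epowr ((p - q) / p)" "y epowr q = c epowr ((p - q) / p)"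
 shows "(b + c) epowr ((p - q) / p) \<le> (2 epowr ((p - q) / p) * 2) * (x + y) epowr q"
proof -
 have "(b + c) epowr ((p - q) / p) \<le> 2 epowr ((p - q) / p) * (x epowr q + y epowr q)"
  unfolding assms(3,4) using assms(1,2) by (intro epowr_add_le) auto
 also have "\<dots> \<le> 2 epowr ((p - q) / p) * (2 * (x + y) epowr q)"
  using assms(2) by (intro mult_left_mono epowr_sum_le) auto
 finally show ?thesis by (simp only: mult.assoc)
qed

lemma case_b:
 assumes pqm: "1 < p" "0 < q" "0 < m" and pm: "p \<le> m" "q < p"
 shows "approx_on (weight_triples m q) (\<lambda>(u, w, v). C_opt p q m u w v) (\<lambda>(u, w, v). A2 p q m u w v + A3 p q m u w v)"
 unfolding approx_on_def
proof (rule conjI)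
 have a: "0 < q / m" "q / m * m < p" using pqm pm by auto
 let ?th = "(p - q) / p"
 show "lesssim_on (weight_triples m q) (\<lambda>(u, w, v). C_opt p q m u w v) (\<lambda>(u, w, v). A2 p q m u w v + A3 p q m u w v)"
 proof (rule ex_finiteE[OF upper_b[OF a(1) pqm(3,1) a(2) pm(1), unfolded qm_cancel[OF pqm(3)]]], goal_cases)
 case (1 c)
 note c = 1(1) and U = 1(2)[rule_format (no_asm)]
 show ?case
 proof (rule lesssim_onI)
  show "(c * (2 epowr ?th * 2)) epowr (1 / q) + 1 < top"
   using pqm pm by (intro add_less_top_ennreal epowr_less_top mult_less_top_ennreal c) auto
  fix u w v assume "(u, w, v) \<in> weight_triples m q"
  with pqm interpret weights p q m u w v by (rule weightsI)
  show "C_opt p q m u w v \<le> ((c * (2 epowr ?th * 2)) epowr (1 / q) + 1) * (A2 p q m u w v + A3 p q m u w v)"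
  proof (rule C_opt_upper[OF U[OF setting, folded B2_def B3_def]])
   show "(B3 + B2) epowr ?th \<le> 2 epowr ?th * 2 * (A2 p q m u w v + A3 p q m u w v) epowr q"
    unfolding add.commute[of "A2 p q m u w v"] by (rule sum_theta_le) (use pm q in \<open>auto simp: A2_eq A3_eq\<close>)
  qed (auto simp: A_top pm)
 qed
 qed
 obtain d where d: "d < top" "\<And>u w v. (u, w, v) \<in> weight_triples m q ==>
  A2 p q m u w v \<le> d * C_opt p q m u w v \<and> A3 p q m u w v \<le> d * C_opt p q m u w v"
  using A23_lesssim[OF pqm pm(2)] by blast
 show "lesssim_on (weight_triples m q) (\<lambda>(u, w, v). A2 p q m u w v + A3 p q m u w v) (\<lambda>(u, w, v). C_opt p q m u w v)"
  by (rule lesssim_onI[of "d + d"]) (use d in \<open>auto simp: distrib_right intro!: add_mono\<close>)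
qed

lemma case_c:
 assumes pqm: "1 < p" "0 < q" "0 < m" and mp: "m < p" "p \<le> q"
 shows "approx_on (weight_triples m q) (\<lambda>(u, w, v). C_opt p q m u w v) (\<lambda>(u, w, v). A1 p q m u w v + A4_star p q m u w v)"
 unfolding approx_on_def
proof (rule conjI)
 have a: "0 < q / m" "p \<le> q / m * m" using pqm mp by auto
 show "lesssim_on (weight_triples m q) (\<lambda>(u, w, v). C_opt p q m u w v) (\<lambda>(u, w, v). A1 p q m u w v + A4_star p q m u w v)"
 proof (rule ex_finiteE[OF upper_c[OF a(1) pqm(3) mp(1) pqm(1) a(2), unfolded qm_cancel[OF pqm(3)]]], goal_cases)
 case (1 c)
 note c = 1(1) and U = 1(2)[rule_format (no_asm)]
 show ?case
 proof (rule lesssim_onI)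
  show "(c * 2) epowr (1 / q) + 1 < top" using pqm by (intro add_less_top_ennreal epowr_less_top mult_less_top_ennreal c) auto
  fix u w v assume "(u, w, v) \<in> weight_triples m q"
  with pqm interpret weights p q m u w v by (rule weightsI)
  have "Phi (q / m) U Wt x * S {x<..} epowr (q * (p - 1) / p) \<le> B1" if "0 < x" for x
   unfolding B1_def by (rule SUP_upper) (use that in simp)
  then have B: "\<forall>x>0. Phi (q / m) U Wt x * S {x<..} epowr (q * (p - 1) / p) \<le> B1 + B4 (Xu m p U S)"
   by (intro allI impI add_increasing2) auto
  have "Wt {..x} * Xu m p U S x epowr (q / m * (p - m) / p) \<le> B4 (Xu m p U S)" if "0 < x" for x
   unfolding B4_def by (rule SUP_upper) (use that in simp)
  then have B': "\<forall>x>0. Wt {..x} * Xu m p U S x epowr (q / m * (p - m) / p) \<le> B1 + B4 (Xu m p U S)"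
   by (intro allI impI add_increasing) auto
  show "C_opt p q m u w v \<le> ((c * 2) epowr (1 / q) + 1) * (A1 p q m u w v + A4_star p q m u w v)"
  proof (rule C_opt_upper[OF U[OF setting _ _ B B']])
   show "B1 + B4 (Xu m p U S) \<le> 2 * (A1 p q m u w v + A4_star p q m u w v) epowr q"
    unfolding A1_eq[symmetric] A4_star_eq[OF mp(1), symmetric] using q by (intro epowr_sum_le) simp
  qed (auto simp: A_top)
 qed
 qed
 obtain c1 where c1: "c1 < top" "\<And>u w v. (u, w, v) \<in> weight_triples m q ==> A1 p q m u w v \<le> c1 * C_opt p q m u w v"
  using A1_lesssim[OF pqm] by blast
 obtain c2 where c2: "c2 < top" and L: "\<And>u w s D x. copson_setting u w s (q / m) ==> Cineq (q / m) m p u w s D ==> 0 < x ==>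
  w {..x} * Xu m p u s x epowr (q / m * (p - m) / p) \<le> c2 * D"
  using lower_A4[OF a(1) pqm(3) mp(1) pqm(1)] by blast
 have "c2 epowr (1 / q) < top" using pqm by (intro epowr_less_top c2) simp
 then have k: "c1 + (c2 epowr (1 / q) + 1) < top" using c1 by simp
 show "lesssim_on (weight_triples m q) (\<lambda>(u, w, v). A1 p q m u w v + A4_star p q m u w v) (\<lambda>(u, w, v). C_opt p q m u w v)"
 proof (rule lesssim_onI[OF k])
  fix u w v assume tr: "(u, w, v) \<in> weight_triples m q"
  with pqm interpret weights p q m u w v by (rule weightsI)
  have "A4_star p q m u w v \<le> (c2 epowr (1 / q) + 1) * C_opt p q m u w v"
  proof (rule C_opt_lower[OF _ c2])
   fix D assume tf: "tail_finite p v" and C: "Cineq (q / m) m p U Wt S D"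
   show "A4_star p q m u w v epowr q \<le> c2 * D"
    unfolding A4_star_eq[OF mp(1)] B4_def by (rule SUP_least) (use L[OF setting[OF tf] C] in simp)
  qed
  then show "A1 p q m u w v + A4_star p q m u w v \<le> (c1 + (c2 epowr (1 / q) + 1)) * C_opt p q m u w v"
   unfolding distrib_right[of c1] by (intro add_mono c1(2)[OF tr])
 qed
qed

lemma case_d:
 assumes pqm: "1 < p" "0 < q" "0 < m" and mp: "m < p" "q < p"
 shows "approx_on (weight_triples m q) (\<lambda>(u, w, v). C_opt p q m u w v) (\<lambda>(u, w, v). A3 p q m u w v + A5_star p q m u w v)"
 unfolding approx_on_def
proof (rule conjI)
 have a: "0 < q / m" "q / m * m < p" using pqm mp by auto
 let ?th = "(p - q) / p"
 have th: "0 \<le> ?th" "p / (p - q) * ?th = 1" using pqm mp by auto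
 show "lesssim_on (weight_triples m q) (\<lambda>(u, w, v). C_opt p q m u w v) (\<lambda>(u, w, v). A3 p q m u w v + A5_star p q m u w v)"
 proof (rule ex_finiteE[OF upper_d[OF a(1) pqm(3) mp(1) pqm(1) a(2), unfolded qm_cancel[OF pqm(3)]]], goal_cases)
 case (1 c)
 note c = 1(1) and U = 1(2)[rule_format (no_asm)]
 show ?case
 proof (rule lesssim_onI)
  show "(c * (2 epowr ?th * 2)) epowr (1 / q) + 1 < top"
   using pqm mp by (intro add_less_top_ennreal epowr_less_top mult_less_top_ennreal c) auto
  fix u w v assume "(u, w, v) \<in> weight_triples m q"
  with pqm interpret weights p q m u w v by (rule weightsI)
  show "C_opt p q m u w v \<le> ((c * (2 epowr ?th * 2)) epowr (1 / q) + 1) * (A3 p q m u w v + A5_star p q m u w v)"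
  proof (rule C_opt_upper[OF U[OF setting, folded B3_def B5_def[of "Xu m p U S"]]])
   show "(B3 + B5 (Xu m p U S)) epowr ?th \<le> 2 epowr ?th * 2 * (A3 p q m u w v + A5_star p q m u w v) epowr q"
    by (rule sum_theta_le) (use mp q in \<open>auto simp: A5_star_eq A3_eq\<close>)
  qed (auto simp: A_top mp)
 qed
 qed
 obtain c1 where c1: "c1 < top" "\<And>u w v. (u, w, v) \<in> weight_triples m q ==> A3 p q m u w v \<le> c1 * C_opt p q m u w v"
  using A23_lesssim[OF pqm mp(2)] by blast
 obtain c2 where c2: "c2 < top" and L: "\<And>u w s D. copson_setting u w s (q / m) ==> Cineq (q / m) m p u w s D ==>
  (\<integral>\<^sup>+x. w {..x} epowr (q / (p - q)) * Xu m p u s x epowr (q / m * (p - m) / (p - q)) \<partial>w) \<le> c2 * D epowr (p / (p - q))"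
  using lower_A5[OF a(1) pqm(3) mp(1) pqm(1) a(2)] unfolding qm_cancel[OF pqm(3)] by blast
 have c2': "c2 epowr ?th < top" by (rule epowr_less_top[OF th(1) c2])
 have "(c2 epowr ?th) epowr (1 / q) < top" using pqm by (intro epowr_less_top[OF _ c2']) simp
 then have k: "c1 + ((c2 epowr ?th) epowr (1 / q) + 1) < top" using c1 by simp
 show "lesssim_on (weight_triples m q) (\<lambda>(u, w, v). A3 p q m u w v + A5_star p q m u w v) (\<lambda>(u, w, v). C_opt p q m u w v)"
 proof (rule lesssim_onI[OF k])
  fix u w v assume tr: "(u, w, v) \<in> weight_triples m q"
  with pqm interpret weights p q m u w v by (rule weightsI)
  have "A5_star p q m u w v \<le> ((c2 epowr ?th) epowr (1 / q) + 1) * C_opt p q m u w v"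
  proof (rule C_opt_lower[OF _ c2'])
   fix D assume tf: "tail_finite p v" and C: "Cineq (q / m) m p U Wt S D"
   have "A5_star p q m u w v epowr q \<le> (c2 * D epowr (p / (p - q))) epowr ?th"
    unfolding A5_star_eq[OF mp] B5_def by (intro epowr_mono th L[OF setting[OF tf] C])
   then show "A5_star p q m u w v epowr q \<le> c2 epowr ?th * D"
    unfolding epowr_mult[OF th(1)] epowr_epowr th(2) by simp
  qed
  then show "A3 p q m u w v + A5_star p q m u w v \<le> (c1 + ((c2 epowr ?th) epowr (1 / q) + 1)) * C_opt p q m u w v"
   unfolding distrib_right[of c1] by (intro add_mono c1(2)[OF tr])
 qed
qed

theorem theorem1p1:
  fixes p q m :: real
  assumes "1 < p" and "0 < q" and "0 < m"
  shows
    "(p \<le> m \<and> p \<le> q \<longrightarrow>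
        approx_on (weight_triples m q)
          (\<lambda>(u, w, v). C_opt p q m u w v)
          (\<lambda>(u, w, v). A1 p q m u w v))
     \<and>
     (p \<le> m \<and> q < p \<longrightarrow>
        approx_on (weight_triples m q)
          (\<lambda>(u, w, v). C_opt p q m u w v)
          (\<lambda>(u, w, v). A2 p q m u w v + A3 p q m u w v))
     \<and>
     (m < p \<and> p \<le> q \<longrightarrow>
        approx_on (weight_triples m q)
          (\<lambda>(u, w, v). C_opt p q m u w v)
          (\<lambda>(u, w, v). A1 p q m u w v + A4 p q m u w v)
        \<and>
        approx_on (weight_triples m q)
          (\<lambda>(u, w, v). A1 p q m u w v + A4 p q m u w v)
          (\<lambda>(u, w, v). A1 p q m u w v + A4_star p q m u w v)
        \<and>
        approx_on {(u, w, v) \<in> weight_triples m q. 1 \<le> m \<or> tail_finite p v}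
          (\<lambda>(u, w, v). A4 p q m u w v)
          (\<lambda>(u, w, v). A4_star p q m u w v))
     \<and>
     (m < p \<and> q < p \<longrightarrow>
        approx_on (weight_triples m q)
          (\<lambda>(u, w, v). C_opt p q m u w v)
          (\<lambda>(u, w, v). A3 p q m u w v + A5 p q m u w v)
        \<and>
        approx_on (weight_triples m q)
          (\<lambda>(u, w, v). A3 p q m u w v + A5 p q m u w v)
          (\<lambda>(u, w, v). A3 p q m u w v + A5_star p q m u w v)
        \<and>
        approx_on {(u, w, v) \<in> weight_triples m q. (1 \<le> m \<and> 1 < q) \<or> tail_finite p v}
          (\<lambda>(u, w, v). A5 p q m u w v)
          (\<lambda>(u, w, v). A5_star p q m u w v))"
proof (intro conjI impI; (elim conjE)?)
  assume "m < p" "p \<le> q"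
  note star = star_approx(1,2)[OF assms \<open>m < p\<close>]
  show "approx_on (weight_triples m q) (\<lambda>(u, w, v). C_opt p q m u w v) (\<lambda>(u, w, v). A1 p q m u w v + A4 p q m u w v)"
    by (rule approx_on_trans[OF case_c approx_on_sym[OF star(1)]]) fact+
  show "approx_on (weight_triples m q) (\<lambda>(u, w, v). A1 p q m u w v + A4 p q m u w v)
    (\<lambda>(u, w, v). A1 p q m u w v + A4_star p q m u w v)" by (fact star(1))
  show "approx_on {(u, w, v) \<in> weight_triples m q. 1 \<le> m \<or> tail_finite p v}
    (\<lambda>(u, w, v). A4 p q m u w v) (\<lambda>(u, w, v). A4_star p q m u w v)" by (fact star(2))
next
  assume "m < p" "q < p"
  note star = star_approx(3,4)[OF assms \<open>m < p\<close> \<open>q < p\<close>]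
  show "approx_on (weight_triples m q) (\<lambda>(u, w, v). C_opt p q m u w v) (\<lambda>(u, w, v). A3 p q m u w v + A5 p q m u w v)"
    by (rule approx_on_trans[OF case_d approx_on_sym[OF star(1)]]) fact+
  show "approx_on (weight_triples m q) (\<lambda>(u, w, v). A3 p q m u w v + A5 p q m u w v)
    (\<lambda>(u, w, v). A3 p q m u w v + A5_star p q m u w v)" by (fact star(1))
  show "approx_on {(u, w, v) \<in> weight_triples m q. (1 \<le> m \<and> 1 < q) \<or> tail_finite p v}
    (\<lambda>(u, w, v). A5 p q m u w v) (\<lambda>(u, w, v). A5_star p q m u w v)" by (fact star(2))
qed (rule case_a[OF assms] case_b[OF assms], assumption+)+

end
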